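(* Let $(t^{(n)})_n$ be a sequence of cycle types, $t^{(n)}$ being of size $n$, such that $t_1^{(n)}=o(\sqrt n)$ and $2t_2^{(n)}=np_2+o(n)$ as $n\to\infty$, for some $p_2\in[0,1]$. For each $n$, let $\tau_n$ be a uniformly random $t^{(n)}$-cyclic permutation. Then for any integer $r\ge1$, we have the following (joint) convergence in distribution: $$\left(\frac{X_\pi(\tau_n)-\binom nr\frac1{r!}}{n^{r-1/2}}\right)_{\pi\in\mathfrak{S}_r}\underset{n\to\infty}{\longrightarrow}\mathcal{N}(0,\Sigma^{p_2}),$$ where for any $\pi,\rho\in\mathfrak{S}_r$, if $U,V$ are i.i.d. uniform random variables on $[0,1]$: $$((r-1)!)^2\,\Sigma_{\pi,\rho}^{p_2}=\mathrm{Cov}[\psi_\pi(U,V),\psi_\rho(U,V)]+p_2\,\mathrm{Cov}[\psi_\pi(U,V),\psi_\rho(V,U)].$$ The matrix $\Sigma^{p_2}$ has rank $(r-1)^2$ for any $p_2<1$, and rank $r(r-1)/2$ for $p_2=1$. Moreover, $\Sigma_{\pi,\pi}^{p_2}>0$ for any $p_2\in[0,1]$ and any $\pi\in\mathfrak{S}_r$ with $r\ge2$.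
   Context: $[n]=\{1,\dots,n\}$ and $\mathfrak{S}_r$ is the set of permutations of $[r]$. A cycle type of size $n$ is a sequence $t=(t_1,\dots,t_n)$ of nonnegative integers with $\sum_{p=1}^n p\,t_p=n$; a permutation of $[n]$ is $t$-cyclic if it has exactly $t_p$ cycles of length $p$ for every $p$ (fixed points are $1$-cycles). For $\tau\in\mathfrak{S}_n$ and $\pi\in\mathfrak{S}_r$, $X_\pi(\tau)$ is the number of subsets $\{i_1<\dots<i_r\}$ of $[n]$ such that for all $j,k\in[r]$, $\pi(j)>\pi(k)\iff\tau(i_j)>\tau(i_k)$. For a set of $r$ points in the plane with pairwise distinct x-coordinates and pairwise distinct y-coordinates, $\mathrm{Perm}$ of this set is the permutation $\tau\in\mathfrak{S}_r$ such that $\tau(i)=j$ when the $i$-th point from the left is the $j$-th point from the bottom. For $\pi\in\mathfrak{S}_r$ and $z\in[0,1]^2$, $\psi_\pi(z):=\mathbf{P}(\mathrm{Perm}(\{\hat Z_1,\dots,\hat Z_{r-1},z\})=\pi)$, where $\hat Z_1,\dots,\hat Z_{r-1}$ are i.i.d. uniform on $[0,1]^2$. *)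

theory Defs
  imports
    "HOL-Probability.Probability"
    "HOL-Library.Landau_Symbols"
    "HOL-Library.Function_Algebras"
    "HOL-Combinatorics.Combinatorics"
begin

abbreviation perms :: "nat \<Rightarrow> (nat \<Rightarrow> nat) set"
  where "perms r \<equiv> {\<pi>. \<pi> permutes {1..r}}"

subsection \<open>Cycle types and patterns\<close>

text \<open>A sequence \<open>(t\<^sub>1, \<dots>, t\<^sub>n)\<close> is a function on the naturals of which only the values
  at \<open>1, \<dots>, n\<close> are used.\<close>

definition is_cycle_type :: "nat \<Rightarrow> (nat \<Rightarrow> nat) \<Rightarrow> bool"
  where "is_cycle_type n t \<longleftrightarrow> (\<Sum>p=1..n. p * t p) = n"

definition num_cycles :: "nat \<Rightarrow> (nat \<Rightarrow> nat) \<Rightarrow> nat \<Rightarrow> nat"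
  where "num_cycles n \<tau> p = card {C. C \<subseteq> {1..n} \<and> cyclic_on \<tau> C \<and> card C = p}"

definition t_cyclic :: "nat \<Rightarrow> (nat \<Rightarrow> nat) \<Rightarrow> (nat \<Rightarrow> nat) set"
  where "t_cyclic n t = {\<tau> \<in> perms n. \<forall>p\<in>{1..n}. num_cycles n \<tau> p = t p}"

text \<open>The element \<open>i\<^sub>j\<close> of a set \<open>{i\<^sub>1 < \<dots> < i\<^sub>r}\<close>, with \<open>j\<close> counted from 1.\<close>

definition nth_elem :: "nat set \<Rightarrow> nat \<Rightarrow> nat"
  where "nth_elem I j = sorted_list_of_set I ! (j - 1)"

definition pattern_count :: "nat \<Rightarrow> nat \<Rightarrow> (nat \<Rightarrow> nat) \<Rightarrow> (nat \<Rightarrow> nat) \<Rightarrow> nat"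
  where "pattern_count n r \<pi> \<tau> =
    card {I. I \<subseteq> {1..n} \<and> card I = r \<and>
      (\<forall>j\<in>{1..r}. \<forall>k\<in>{1..r}. \<pi> j > \<pi> k \<longleftrightarrow> \<tau> (nth_elem I j) > \<tau> (nth_elem I k))}"

subsection \<open>Permutations of planar point sets\<close>

definition x_rank :: "(real \<times> real) set \<Rightarrow> real \<times> real \<Rightarrow> nat"
  where "x_rank A z = card {w \<in> A. fst w \<le> fst z}"

definition y_rank :: "(real \<times> real) set \<Rightarrow> real \<times> real \<Rightarrow> nat"
  where "y_rank A z = card {w \<in> A. snd w \<le> snd z}"

text \<open>Only meaningful for a finite set with pairwise distinct x- and y-coordinates.\<close>

definition Perm :: "(real \<times> real) set \<Rightarrow> nat \<Rightarrow> nat"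
  where "Perm A i =
    (if i \<in> {1..card A} then THE j. \<exists>z\<in>A. x_rank A z = i \<and> y_rank A z = j else i)"

definition unif01 :: "real measure"
  where "unif01 = uniform_measure lborel {0..1}"

definition unif_square :: "(real \<times> real) measure"
  where "unif_square = unif01 \<Otimes>\<^sub>M unif01"

text \<open>The samples \<open>Z\<^sub>1, \<dots>, Z\<^sub>r\<^sub>-\<^sub>1\<close> for which \<open>Perm\<close> is not meaningful form a null set.\<close>

definition psi :: "nat \<Rightarrow> (nat \<Rightarrow> nat) \<Rightarrow> real \<times> real \<Rightarrow> real"
  where "psi r \<pi> z =
    (let P = PiM {1..<r} (\<lambda>_. unif_square)
     in measure P {Z \<in> space P. Perm (insert z (Z ` {1..<r})) = \<pi>})"

subsection \<open>The covariance matrix\<close>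

definition covariance :: "'a measure \<Rightarrow> ('a \<Rightarrow> real) \<Rightarrow> ('a \<Rightarrow> real) \<Rightarrow> real"
  where "covariance M X Y =
    (\<integral>\<omega>. (X \<omega> - (\<integral>\<omega>'. X \<omega>' \<partial>M)) * (Y \<omega> - (\<integral>\<omega>'. Y \<omega>' \<partial>M)) \<partial>M)"

definition cov_matrix :: "nat \<Rightarrow> real \<Rightarrow> (nat \<Rightarrow> nat) \<Rightarrow> (nat \<Rightarrow> nat) \<Rightarrow> real"
  where "cov_matrix r p2 \<pi> \<rho> =
    (covariance unif_square (\<lambda>(u, v). psi r \<pi> (u, v)) (\<lambda>(u, v). psi r \<rho> (u, v))
     + p2 * covariance unif_square (\<lambda>(u, v). psi r \<pi> (u, v)) (\<lambda>(u, v). psi r \<rho> (v, u)))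
    / (fact (r - 1))\<^sup>2"

text \<open>The rank of a matrix with rows and columns indexed by a finite set: the dimension of the
  span of its columns, which are vectors in \<open>'i \<Rightarrow> real\<close> vanishing outside \<open>I\<close>.\<close>

definition matrix_rank :: "'i set \<Rightarrow> ('i \<Rightarrow> 'i \<Rightarrow> real) \<Rightarrow> nat"
  where "matrix_rank I A =
    vector_space.dim (\<lambda>(c::real) (v::'i \<Rightarrow> real) i. c * v i)
      ((\<lambda>j i. if i \<in> I then A i j else 0) ` I)"

subsection \<open>Gaussian vectors and convergence in distribution\<close>

text \<open>Vectors indexed by a finite set \<open>I\<close> are extensional functions, that is, points of
  \<open>PiM I (\<lambda>_. borel)\<close>.  Covariance matrices may be singular, so Gaussian vectors
  are characterised by their linear forms being normal, possibly with variance zero.\<close>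

definition normal_law :: "real \<Rightarrow> real \<Rightarrow> real measure"
  where "normal_law \<mu> \<sigma> =
    (if \<sigma> = 0 then return borel \<mu> else density lborel (normal_density \<mu> \<sigma>))"

definition is_multivariate_normal ::
    "'i set \<Rightarrow> ('i \<Rightarrow> real) \<Rightarrow> ('i \<Rightarrow> 'i \<Rightarrow> real) \<Rightarrow> ('i \<Rightarrow> real) measure \<Rightarrow> bool"
  where "is_multivariate_normal I m A N \<longleftrightarrow>
    prob_space N \<and> sets N = sets (PiM I (\<lambda>_. borel)) \<and>
    (\<forall>a. \<exists>\<mu> \<sigma>. \<sigma> \<ge> 0 \<and> distr N borel (\<lambda>x. \<Sum>i\<in>I. a i * x i) = normal_law \<mu> \<sigma>) \<and>
    (\<forall>i\<in>I. (\<integral>x. x i \<partial>N) = m i) \<and>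
    (\<forall>i\<in>I. \<forall>j\<in>I. covariance N (\<lambda>x. x i) (\<lambda>x. x j) = A i j)"

definition weak_conv_vec ::
    "'i set \<Rightarrow> (nat \<Rightarrow> ('i \<Rightarrow> real) measure) \<Rightarrow> ('i \<Rightarrow> real) measure \<Rightarrow> bool"
  where "weak_conv_vec I M N \<longleftrightarrow>
    (\<forall>f :: ('i \<Rightarrow> real) \<Rightarrow> real.
      continuous_map (product_topology (\<lambda>_. euclideanreal) I) euclideanreal f \<longrightarrow>
      bounded (f ` (\<Pi>\<^sub>E i\<in>I. UNIV)) \<longrightarrow>
      (\<lambda>n. \<integral>x. f x \<partial>M n) \<longlonglongrightarrow> (\<integral>x. f x \<partial>N))"

definition normalized_counts :: "nat \<Rightarrow> nat \<Rightarrow> (nat \<Rightarrow> nat) \<Rightarrow> (nat \<Rightarrow> nat) \<Rightarrow> real"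
  where "normalized_counts r n \<tau> =
    (\<lambda>\<pi>\<in>perms r. (real (pattern_count n r \<pi> \<tau>) - real (n choose r) * (1 / fact r))
                   / real n powr (real r - 1 / 2))"

text \<open>The law of the normalized pattern counts of a uniformly random \<open>t\<close>-cyclic permutation
  of \<open>[n]\<close>.\<close>

definition counts_law :: "nat \<Rightarrow> nat \<Rightarrow> (nat \<Rightarrow> nat) \<Rightarrow> ((nat \<Rightarrow> nat) \<Rightarrow> real) measure"
  where "counts_law r n t =
    distr (measure_pmf (pmf_of_set (t_cyclic n t))) (PiM (perms r) (\<lambda>_. borel))
      (normalized_counts r n)"

end

theory Submission imports Defs begin

text \<open>Let \<open>U\<^sub>1, \<dots>, U\<^sub>n\<close> be i.i.d. uniform on \<open>[0, 1]\<close>.  Conjugating a fixed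
  \<open>t\<close>-cyclic permutation \<open>\<tau>\<close> by the ranks of the \<open>U\<^sub>i\<close> yields a uniformly random \<open>t\<close>-cyclic permutation,
  whose pattern counts are those of the points \<open>(U\<^sub>i, U\<^bsub>\<tau> i\<^esub>)\<close>.  Up to \<open>o(n\<^bsup>r-1/2\<^esup>)\<close> in \<open>L\<^sup>1\<close>, the
  centred count of \<open>\<pi>\<close> equals its first-order projection, which is \<open>n\<^bsup>r-1\<^esup> / (r-1)!\<close> times the sum of
  \<open>g(U\<^sub>i, U\<^bsub>\<tau> i\<^esub>)\<close> over \<open>i\<close>, where \<open>g = \<psi>\<^sub>\<pi> - 1/r!\<close>.  Both marginals of \<open>g\<close> vanish, so two terms of
  this sum correlate only if they are equal or belong to the same 2-cycle: hence the two summands of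
  \<open>\<Sigma>\<close>.  The dependence between the terms has range at most 2 along the cycles, so a Stein-type
  differential inequality for the characteristic function gives the Gaussian limit, and the vector
  version follows by the Cramer-Wold device.  Finally \<open>\<psi>\<^sub>\<pi>\<close> is, up to a factor, the sum over \<open>k\<close> of products of
  Bernstein polynomials of index \<open>k\<close> and \<open>\<pi> k\<close>.  Since the Bernstein polynomials form a partition of unity,
  centring leaves a tensor square of dimension \<open>(r-1)\<^sup>2\<close>; for \<open>p\<^sub>2 = 1\<close> the covariance only sees its
  symmetric part, of dimension \<open>r(r-1)/2\<close>.\<close>

subsection \<open>A Cramer-Wold criterion for weak convergence\<close>

text \<open>Every estimate is proved for one fixed \<open>\<tau>\<close> with i.i.d. labels, and its
  bound depends only on n, the number of fixed points and the number of points on 2-cycles. It is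
  therefore uniform over the conjugacy class, and averaging over \<open>\<tau>\<close> costs
  nothing. This is why explicit bounds for characteristic functions are used. The obstacle is the
  dependence between the points. An r-set behaves like r independent points of the square only if it
  is disjoint from its image under \<open>\<tau>\<close>. Up to (t_1 + 1) n^(r-1) sets fail this and
  are bounded without any cancellation; they are negligible against n^(r-1/2) because t_1 = o(sqrt
  n). For the other sets, the remainder after projection is orthogonal to every function that sees
  at most one of its points, so that only about n^(2r-2) of the n^(2r) covariances survive. For the
  ranks, the covariance matrix is read as the Gram matrix of a nonnegative form on kernels: a kernel
  orthogonal to all the others is orthogonal to itself, and it remains to find where the form
  vanishes.\<close>

inductive trig :: "'i set \<Rightarrow> (('i \<Rightarrow> real) \<Rightarrow> real) \<Rightarrow> bool" for I where
  trig_cos: "trig I (\<lambda>x. cos (\<Sum>i\<in>I. s i * x i))"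
| trig_sin: "trig I (\<lambda>x. sin (\<Sum>i\<in>I. s i * x i))"
| trig_add: "trig I f \<Longrightarrow> trig I g \<Longrightarrow> trig I (\<lambda>x. f x + g x)"
| trig_scale: "trig I f \<Longrightarrow> trig I (\<lambda>x. c * f x)"

lemma trig_const: "trig I (\<lambda>_. c)"
  using trig_scale[OF trig_cos[of I "\<lambda>_. 0"], of c] by simp

lemma trig_diff:
  assumes "trig I f" "trig I g" shows "trig I (\<lambda>x. f x - g x)"
  using trig_add[OF assms(1) trig_scale[OF assms(2), of "-1"]] by simp

lemma trig_coordinate:
  assumes "finite I" "i \<in> I" shows "trig I (\<lambda>x. sin (c * x i))"
proof -
  have "(\<Sum>j\<in>I. (if j = i then c else 0) * x j) = c * x i" for x :: "'a \<Rightarrow> real"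
    using assms by (simp add: if_distrib[of "\<lambda>t. t * _"] sum.delta' cong: if_cong)
  then show ?thesis using trig_sin[of I "\<lambda>j. if j = i then c else 0"] by simp
qed

lemma trig_mult_cos:
  assumes "trig I g" shows "trig I (\<lambda>x. cos (\<Sum>i\<in>I. s i * x i) * g x)"
  using assms
proof induction
  case (trig_cos t)
  have "cos (\<Sum>i\<in>I. s i * x i) * cos (\<Sum>i\<in>I. t i * x i)
    = (1/2) * (cos (\<Sum>i\<in>I. (s i - t i) * x i) + cos (\<Sum>i\<in>I. (s i + t i) * x i))" for x
    by (simp add: left_diff_distrib distrib_right sum.distrib sum_subtractf cos_times_cos)
  then show ?case by (simp only:) (intro trig.intros)
next
  case (trig_sin t)
  have "cos (\<Sum>i\<in>I. s i * x i) * sin (\<Sum>i\<in>I. t i * x i)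
    = (1/2) * (sin (\<Sum>i\<in>I. (s i + t i) * x i) - sin (\<Sum>i\<in>I. (s i - t i) * x i))" for x
    by (simp add: left_diff_distrib distrib_right sum.distrib sum_subtractf cos_times_sin)
  then show ?case by (simp only:) (intro trig.intros trig_diff)
next
  case (trig_add f g) then show ?case by (simp add: distrib_left) (intro trig.intros)
next
  case (trig_scale f c) then show ?case using trig.trig_scale[of I _ c] by (simp add: mult.left_commute)
qed

lemma trig_mult_sin:
  assumes "trig I g" shows "trig I (\<lambda>x. sin (\<Sum>i\<in>I. s i * x i) * g x)"
  using assms
proof induction
  case (trig_cos t)
  have "sin (\<Sum>i\<in>I. s i * x i) * cos (\<Sum>i\<in>I. t i * x i)
    = (1/2) * (sin (\<Sum>i\<in>I. (s i + t i) * x i) + sin (\<Sum>i\<in>I. (s i - t i) * x i))" for x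
    by (simp add: left_diff_distrib distrib_right sum.distrib sum_subtractf sin_times_cos)
  then show ?case by (simp only:) (intro trig.intros)
next
  case (trig_sin t)
  have "sin (\<Sum>i\<in>I. s i * x i) * sin (\<Sum>i\<in>I. t i * x i)
    = (1/2) * (cos (\<Sum>i\<in>I. (s i - t i) * x i) - cos (\<Sum>i\<in>I. (s i + t i) * x i))" for x
    by (simp add: left_diff_distrib distrib_right sum.distrib sum_subtractf sin_times_sin)
  then show ?case by (simp only:) (intro trig.intros trig_diff)
next
  case (trig_add f g) then show ?case by (simp add: distrib_left) (intro trig.intros)
next
  case (trig_scale f c) then show ?case using trig.trig_scale[of I _ c] by (simp add: mult.left_commute)
qed

text \<open>Sums and scalar multiples are built into \<open>trig\<close> so that limits of integrals
  extend from sines and cosines by linearity alone; products come from the product-to-sum formulas.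
  Together they make \<open>trig\<close> an algebra, as Stone-Weierstrass requires.\<close>

lemma trig_mult:
  assumes "trig I f" "trig I g" shows "trig I (\<lambda>x. f x * g x)"
  using assms(1)
proof induction
  case (trig_cos s) show ?case by (rule trig_mult_cos[OF assms(2)])
next
  case (trig_sin s) show ?case by (rule trig_mult_sin[OF assms(2)])
next
  case (trig_add f h) then show ?case by (simp add: distrib_right) (intro trig.intros)
next
  case (trig_scale f c) then show ?case using trig.trig_scale[of I _ c] by (simp add: mult.assoc)
qed

lemma trig_measurable:
  assumes "trig I f" shows "f \<in> borel_measurable (PiM I (\<lambda>_. borel))"
  using assms
proof induction
  case (trig_cos s) show ?case by measurable
next
  case (trig_sin s) show ?case by measurable
next
  case (trig_add f g) note [measurable] = trig_add.IH show ?case by measurable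
next
  case (trig_scale f c) note [measurable] = trig_scale.IH show ?case by measurable
qed

lemma trig_bounded:
  assumes "trig I f" shows "\<exists>B. \<forall>x. \<bar>f x\<bar> \<le> B"
  using assms
proof induction
  case (trig_add f g)
  then obtain A B where "\<And>x. \<bar>f x\<bar> \<le> A" "\<And>x. \<bar>g x\<bar> \<le> B" by blast
  then have "\<bar>f x + g x\<bar> \<le> A + B" for x by (meson abs_triangle_ineq add_mono order_trans)
  then show ?case by blast
next
  case (trig_scale f c)
  then obtain A where "\<And>x. \<bar>f x\<bar> \<le> A" by blast
  then have "\<bar>c * f x\<bar> \<le> \<bar>c\<bar> * A" for x by (simp add: abs_mult mult_left_mono)
  then show ?case by blast
qed (auto intro: exI[of _ 1])

lemma trig_limit:
  assumes M: "\<And>n. prob_space (M n)" "\<And>n. sets (M n) = sets (PiM I (\<lambda>_. borel))"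
    and N: "prob_space N" "sets N = sets (PiM I (\<lambda>_. borel))"
    and c: "\<And>s. (\<lambda>n. \<integral>x. cos (\<Sum>i\<in>I. s i * x i) \<partial>M n) \<longlonglongrightarrow> (\<integral>x. cos (\<Sum>i\<in>I. s i * x i) \<partial>N)"
    and s: "\<And>s. (\<lambda>n. \<integral>x. sin (\<Sum>i\<in>I. s i * x i) \<partial>M n) \<longlonglongrightarrow> (\<integral>x. sin (\<Sum>i\<in>I. s i * x i) \<partial>N)"
    and f: "trig I f"
  shows "(\<lambda>n. \<integral>x. f x \<partial>M n) \<longlonglongrightarrow> (\<integral>x. f x \<partial>N)"
proof -
  have int: "integrable Q g"
    if Q: "prob_space Q" "sets Q = sets (PiM I (\<lambda>_. borel :: real measure))" "trig I g" for Q g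
  proof -
    interpret prob_space Q by (rule Q)
    obtain B where "\<And>x. \<bar>g x\<bar> \<le> B" using trig_bounded[OF Q(3)] by blast
    then show ?thesis
      using trig_measurable[OF Q(3)] measurable_cong_sets[OF Q(2) refl]
      by (intro integrable_const_bound[where B = B]) auto
  qed
  show ?thesis using f
  proof induction
    case (trig_add f g)
    then show ?case using int M N by (simp add: tendsto_add)
  next
    case (trig_scale f c)
    then show ?case by (simp add: tendsto_mult_left)
  qed (use c s in auto)
qed

text \<open>Substituting y = sin (x / c) in every coordinate maps the cube of half-side
  \<open>L\<close> bijectively onto a cube with sides [-1, 1] and turns \<open>f\<close> into a
  continuous function on a compact set, where polynomials in y are trigonometric in x. As the sine
  sends every real into [-1, 1], the approximant is bounded by \<open>B + e\<close> on the whole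
  space and not only on the cube.\<close>

lemma trig_approximation:
  fixes f :: "('i \<Rightarrow> real) \<Rightarrow> real"
  assumes fin: "finite I"
    and cont: "continuous_map (product_topology (\<lambda>_. euclideanreal) I) euclideanreal f"
    and bound: "\<And>x. x \<in> (\<Pi>\<^sub>E i\<in>I. UNIV) \<Longrightarrow> \<bar>f x\<bar> \<le> B" and L: "L > 0" and e: "e > 0"
  obtains p where "trig I p" "\<And>x. \<bar>p x\<bar> \<le> B + e"
    "\<And>x. x \<in> (\<Pi>\<^sub>E i\<in>I. UNIV) \<Longrightarrow> (\<And>i. i \<in> I \<Longrightarrow> \<bar>x i\<bar> \<le> L) \<Longrightarrow> \<bar>f x - p x\<bar> \<le> e"
proof -
  \<comment> \<open>With this scale \<open>L / c = pi / 2\<close>, so that \<open>arcsin\<close>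
    inverts \<open>sin\<close> on the whole cube.\<close>
  define c where "c = 2 * L / pi"
  have c: "c > 0" using L by (simp add: c_def)
  obtain u where u: "bij_betw u I {0..<card I}" using ex_bij_betw_finite_nat[OF fin] by blast
  define w where "w = the_inv_into I u"
  have uw: "w k \<in> I" "u (w k) = k" if "k < card I" for k
    using bij_betwE[OF bij_betw_the_inv_into[OF u]] f_the_inv_into_f_bij_betw[OF u, of k] that
    by (auto simp: w_def)
  have wu: "u i < card I" "w (u i) = i" if "i \<in> I" for i
    using bij_betwE[OF u] the_inv_into_f_f[of u I i] u that by (auto simp: w_def bij_betw_def)
  \<comment> \<open>The index set is numbered because Stone-Weierstrass is only available on metric spaces.\<close>
  define S where "S = (\<Pi>\<^sub>E k\<in>(UNIV :: nat set). if k < card I then {-1..1::real} else {undefined})"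
  define sn where "sn x = (\<lambda>k. if k < card I then sin ((1/c) * x (w k)) else undefined)" for x :: "'i \<Rightarrow> real"
  define asn where "asn y = (\<lambda>i\<in>I. c * arcsin (y (u i)))" for y :: "nat \<Rightarrow> real"
  define R where "R = {g. continuous_on S g \<and> trig I (\<lambda>x. g (sn x))}"
  have sn_S: "sn x \<in> S" for x by (auto simp: sn_def S_def)
  have "compactin (product_topology (\<lambda>_. euclidean) UNIV) S"
    unfolding S_def by (subst compactin_PiE) auto
  then have "compact S" unfolding euclidean_product_topology compactin_euclidean_iff .
  have "function_ring_on R S"
  proof
    fix x y assume xy: "x \<in> S" "y \<in> S" "x \<noteq> y"
    then obtain i where i: "x i \<noteq> y i" by auto
    \<comment> \<open>Coordinates beyond \<open>card I\<close> are frozen to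
      \<open>undefined\<close> in \<open>S\<close>, which keeps it compact and leaves only genuine
      coordinates to separate points.\<close>
    have "i < card I"
    proof (rule ccontr)
      assume "\<not> i < card I"
      with xy have "x i = undefined" "y i = undefined" by (auto simp: S_def PiE_iff split: if_splits)
      with i show False by simp
    qed
    moreover from this have "trig I (\<lambda>x. sin ((1/c) * x (w i)))" using uw by (intro trig_coordinate fin) auto
    ultimately have iR: "(\<lambda>y. y i) \<in> R"
      by (auto simp: R_def sn_def intro: continuous_on_product_coordinates[THEN continuous_on_subset])
    show "\<exists>f\<in>R. f x \<noteq> f y" by (rule bexI[OF _ iR]) (rule i)
  qed (use \<open>compact S\<close> in \<open>simp_all add: R_def continuous_on_add continuous_on_mult trig_add trig_mult trig_const\<close>)
  then interpret function_ring_on R S .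
  have "continuous_on S (\<lambda>y. f (asn y))"
  proof -
    have "continuous_map (top_of_set S) (product_topology (\<lambda>_. euclideanreal) I) asn"
      unfolding continuous_map_componentwise
    proof (intro conjI ballI)
      show "asn ` topspace (top_of_set S) \<subseteq> extensional I" by (auto simp: asn_def)
      fix i assume i: "i \<in> I"
      have "y (u i) \<in> {-1..1}" if "y \<in> S" for y
        using that wu[OF i] by (auto simp: S_def PiE_iff dest: spec[of _ "u i"])
      then have "continuous_on S (\<lambda>y. c * arcsin (y (u i)))"
        by (intro continuous_intros continuous_on_product_coordinates[THEN continuous_on_subset]) auto
      then show "continuous_map (top_of_set S) euclideanreal (\<lambda>x. asn x i)"
        using i by (simp add: asn_def)
    qed
    from continuous_map_compose[OF this cont] show ?thesis by (simp add: comp_def)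
  qed
  from Stone_Weierstrass_basic[OF this e]
  obtain g where g: "g \<in> R" "\<And>y. y \<in> S \<Longrightarrow> \<bar>f (asn y) - g y\<bar> < e" by blast
  show thesis
  proof (rule that[of "\<lambda>x. g (sn x)"])
    show "trig I (\<lambda>x. g (sn x))" using g by (simp add: R_def)
    fix x
    have "\<bar>f (asn (sn x))\<bar> \<le> B" by (intro bound) (auto simp: asn_def)
    with g(2)[OF sn_S, of x] show "\<bar>g (sn x)\<bar> \<le> B + e" by linarith
  next
    fix x :: "'i \<Rightarrow> real" assume x: "x \<in> (\<Pi>\<^sub>E i\<in>I. UNIV)" "\<And>i. i \<in> I \<Longrightarrow> \<bar>x i\<bar> \<le> L"
    have "c * arcsin (sin ((1/c) * x i)) = x i" if "i \<in> I" for i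
    proof -
      have "\<bar>(1/c) * x i\<bar> \<le> (1/c) * L"
        using x(2)[OF that] c by (simp add: abs_mult divide_right_mono)
      also have "\<dots> = pi / 2" using L by (simp add: c_def)
      finally have "- (pi / 2) \<le> (1/c) * x i" "(1/c) * x i \<le> pi / 2" by linarith+
      then have "arcsin (sin ((1/c) * x i)) = (1/c) * x i" by (rule arcsin_sin)
      then show ?thesis using c by simp
    qed
    then have "asn (sn x) = x"
      using x(1) by (auto simp: asn_def sn_def fun_eq_iff PiE_iff extensional_def wu)
    then show "\<bar>f x - g (sn x)\<bar> \<le> e" using g(2)[OF sn_S, of x] by simp
  qed
qed

text \<open>A pointwise limit of trigonometric functions: the approximants on the cubes of half-side
  m + 1, with error 1 / (m + 1), converge at every point since it lies in all but finitely many
  cubes.\<close>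

lemma continuous_map_product_measurable:
  fixes f :: "('i \<Rightarrow> real) \<Rightarrow> real"
  assumes fin: "finite I"
    and cont: "continuous_map (product_topology (\<lambda>_. euclideanreal) I) euclideanreal f"
    and bound: "\<And>x. x \<in> (\<Pi>\<^sub>E i\<in>I. UNIV) \<Longrightarrow> \<bar>f x\<bar> \<le> B"
  shows "f \<in> borel_measurable (PiM I (\<lambda>_. borel))"
proof -
  have "\<exists>p. trig I p \<and> (\<forall>x\<in>(\<Pi>\<^sub>E i\<in>I. UNIV). (\<forall>i\<in>I. \<bar>x i\<bar> \<le> real (Suc m)) \<longrightarrow> \<bar>f x - p x\<bar> \<le> 1 / real (Suc m))" for m
    by (rule trig_approximation[OF fin cont bound, of "real (Suc m)" "1 / real (Suc m)"]) auto
  then obtain p where p: "\<And>m. trig I (p m)"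
    "\<And>m x. x \<in> (\<Pi>\<^sub>E i\<in>I. UNIV) \<Longrightarrow> (\<forall>i\<in>I. \<bar>x i\<bar> \<le> real (Suc m)) \<Longrightarrow> \<bar>f x - p m x\<bar> \<le> 1 / real (Suc m)"
    by metis
  show ?thesis
  proof (rule borel_measurable_LIMSEQ_real)
    show "p m \<in> borel_measurable (PiM I (\<lambda>_. borel))" for m by (rule trig_measurable[OF p(1)])
    fix x :: "'i \<Rightarrow> real" assume "x \<in> space (PiM I (\<lambda>_. borel))"
    then have x: "x \<in> (\<Pi>\<^sub>E i\<in>I. UNIV)" by (simp add: space_PiM)
    obtain m0 where m0: "(\<Sum>i\<in>I. \<bar>x i\<bar>) \<le> real m0" using real_arch_simple by blast
    have "\<bar>p m x - f x\<bar> \<le> 1 / real (Suc m)" if "m \<ge> m0" for m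
    proof -
      have "\<bar>x i\<bar> \<le> real (Suc m)" if "i \<in> I" for i
        using member_le_sum[of i I "\<lambda>i. \<bar>x i\<bar>"] that fin m0 \<open>m \<ge> m0\<close> by simp
      with p(2)[OF x] show ?thesis by (simp add: abs_minus_commute)
    qed
    then have "eventually (\<lambda>m. norm (p m x - f x) \<le> 1 / real (Suc m)) sequentially"
      by (auto simp: eventually_sequentially)
    then have "(\<lambda>m. p m x - f x) \<longlonglongrightarrow> 0"
      by (rule Lim_null_comparison) (rule LIMSEQ_Suc[OF lim_1_over_n])
    then show "(\<lambda>m. p m x) \<longlonglongrightarrow> f x" by (rule LIM_zero_cancel)
  qed
qed

text \<open>Splits the expectation at the exceptional set \<open>A\<close>, where only the bounds
  \<open>B\<close> and \<open>C\<close> are available.\<close>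

lemma expectation_diff_bound:
  assumes "prob_space Q" and f[measurable]: "f \<in> borel_measurable Q" and p[measurable]: "p \<in> borel_measurable Q"
    and A: "A \<in> sets Q"
    and fb: "\<And>x. x \<in> space Q \<Longrightarrow> \<bar>f x\<bar> \<le> B" and pb: "\<And>x. \<bar>p x\<bar> \<le> (C::real)"
    and fp: "\<And>x. x \<in> space Q - A \<Longrightarrow> \<bar>f x - p x\<bar> \<le> e" and e: "e \<ge> 0"
  shows "\<bar>(\<integral>x. f x \<partial>Q) - (\<integral>x. p x \<partial>Q)\<bar> \<le> e + (B + C) * measure Q A"
proof -
  interpret prob_space Q by fact
  note [measurable] = A
  have i: "integrable Q f" "integrable Q p"
    by (rule integrable_const_bound[where B = B], use fb in auto)
       (rule integrable_const_bound[where B = C], use pb in auto)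
  have "0 \<le> B + C"
    using fb pb not_empty by (metis abs_ge_zero add_nonneg_nonneg ex_in_conv order_trans)
  have "\<bar>(\<integral>x. f x \<partial>Q) - (\<integral>x. p x \<partial>Q)\<bar> = \<bar>\<integral>x. f x - p x \<partial>Q\<bar>" using i by simp
  also have "\<dots> \<le> (\<integral>x. \<bar>f x - p x\<bar> \<partial>Q)" by (rule integral_abs_bound)
  also have "\<dots> \<le> (\<integral>x. e + (B + C) * indicator A x \<partial>Q)"
  proof (rule integral_mono)
    show "integrable Q (\<lambda>x. \<bar>f x - p x\<bar>)" using i by auto
    show "integrable Q (\<lambda>x. e + (B + C) * indicator A x)"
      by (intro Bochner_Integration.integrable_add integrable_mult_right integrable_real_indicator integrable_const A) (simp add: emeasure_eq_measure)
    fix x assume x: "x \<in> space Q"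
    show "\<bar>f x - p x\<bar> \<le> e + (B + C) * indicator A x"
      using fb[OF x] pb[of x] fp[of x] x e \<open>0 \<le> B + C\<close> by (cases "x \<in> A") auto
  qed
  also have "\<dots> = e + (B + C) * measure Q A"
  proof -
    have "integrable Q (\<lambda>x. (B + C) * indicator A x)"
      by (intro integrable_mult_right integrable_real_indicator A) (simp add: emeasure_eq_measure)
    then show ?thesis
      using sets.sets_into_space[OF A] by (simp add: prob_space Int_absorb2)
  qed
  finally show ?thesis .
qed

text \<open>One trigonometric approximant replaces \<open>f\<close> under both laws: inside a large
  cube the error is uniform, outside it is at most \<open>2 * B + e\<close>, and tightness makes the
  mass there small.\<close>

theorem weak_conv_vec_trig:
  fixes M :: "nat \<Rightarrow> ('i \<Rightarrow> real) measure"
  assumes fin: "finite I"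
    and M: "\<And>n. prob_space (M n)" "\<And>n. sets (M n) = sets (PiM I (\<lambda>_. borel))"
    and N: "prob_space N" "sets N = sets (PiM I (\<lambda>_. borel))"
    and c: "\<And>s. (\<lambda>n. \<integral>x. cos (\<Sum>i\<in>I. s i * x i) \<partial>M n) \<longlonglongrightarrow> (\<integral>x. cos (\<Sum>i\<in>I. s i * x i) \<partial>N)"
    and s: "\<And>s. (\<lambda>n. \<integral>x. sin (\<Sum>i\<in>I. s i * x i) \<partial>M n) \<longlonglongrightarrow> (\<integral>x. sin (\<Sum>i\<in>I. s i * x i) \<partial>N)"
    and tight: "\<And>e. e > 0 \<Longrightarrow> \<exists>L>0. \<forall>\<^sub>F n in sequentially. measure (M n) {x \<in> space (M n). \<exists>i\<in>I. L < \<bar>x i\<bar>} \<le> e"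
    and tightN: "\<And>e. e > 0 \<Longrightarrow> \<exists>L>0. measure N {x \<in> space N. \<exists>i\<in>I. L < \<bar>x i\<bar>} \<le> e"
  shows "weak_conv_vec I M N"
  unfolding weak_conv_vec_def
proof (intro allI impI)
  fix f :: "('i \<Rightarrow> real) \<Rightarrow> real"
  assume cont: "continuous_map (product_topology (\<lambda>_. euclideanreal) I) euclideanreal f"
    and bdd: "bounded (f ` (\<Pi>\<^sub>E i\<in>I. UNIV))"
  obtain B where B: "B > 0" "\<And>x. x \<in> (\<Pi>\<^sub>E i\<in>I. UNIV) \<Longrightarrow> \<bar>f x\<bar> \<le> B"
    using bdd unfolding bounded_pos by auto
  define out where "out Q L = {x \<in> space Q. \<exists>i\<in>I. L < \<bar>x i\<bar>}" for Q :: "('i \<Rightarrow> real) measure" and L :: real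
  have sp: "space Q = (\<Pi>\<^sub>E i\<in>I. UNIV)" if "sets Q = sets (PiM I (\<lambda>_. borel :: real measure))" for Q
    using sets_eq_imp_space_eq[OF that] by (simp add: space_PiM)
  have fm: "f \<in> borel_measurable (PiM I (\<lambda>_. borel))"
    by (rule continuous_map_product_measurable[OF fin cont B(2)])
  have key: "\<bar>(\<integral>x. f x \<partial>Q) - (\<integral>x. p x \<partial>Q)\<bar> \<le> e + (B + (B + e)) * measure Q (out Q L')"
    if Q: "prob_space Q" "sets Q = sets (PiM I (\<lambda>_. borel))" and e: "e > 0" and L: "L' \<le> L"
      and p: "trig I p" "\<And>x. \<bar>p x\<bar> \<le> B + e"
        "\<And>x. x \<in> (\<Pi>\<^sub>E i\<in>I. UNIV) \<Longrightarrow> (\<And>i. i \<in> I \<Longrightarrow> \<bar>x i\<bar> \<le> L) \<Longrightarrow> \<bar>f x - p x\<bar> \<le> e" for Q p e L L'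
  proof (rule expectation_diff_bound)
    note meas = measurable_cong_sets[OF Q(2) refl]
    show "f \<in> borel_measurable Q" "p \<in> borel_measurable Q"
      using fm trig_measurable[OF p(1)] meas by auto
    have "{x \<in> space (PiM I (\<lambda>_. borel)). \<exists>i\<in>I. L' < \<bar>x i\<bar>} \<in> sets (PiM I (\<lambda>_. borel :: real measure))"
    proof (rule sets.sets_Collect_finite_Ex[OF _ fin])
      fix i assume "i \<in> I"
      then have [measurable]: "(\<lambda>x. x i) \<in> borel_measurable (PiM I (\<lambda>_. borel :: real measure))"
        by (rule measurable_component_singleton)
      show "{x \<in> space (PiM I (\<lambda>_. borel)). L' < \<bar>x i\<bar>} \<in> sets (PiM I (\<lambda>_. borel :: real measure))"
        by measurable
    qed
    then show "out Q L' \<in> sets Q"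
      using Q(2) sets_eq_imp_space_eq[OF Q(2)] by (simp add: out_def)
    fix x assume "x \<in> space Q - out Q L'"
    then show "\<bar>f x - p x\<bar> \<le> e"
      using L by (intro p(3)) (auto simp: out_def sp[OF Q(2)] not_less intro: order_trans)
  qed (use Q p e B sp in auto)
  show "(\<lambda>n. \<integral>x. f x \<partial>M n) \<longlonglongrightarrow> (\<integral>x. f x \<partial>N)"
  proof (rule LIMSEQ_I)
    fix r :: real assume r: "r > 0"
    \<comment> \<open>With this choice \<open>e + (2 * B + e) * e\<close> is at most
      \<open>2 * (B + 1) * e\<close>, hence at most a quarter of \<open>r\<close>, which leaves room
      for two replacements and the trigonometric limit.\<close>
    define e where "e = min 1 (r / (8 * (B + 1)))"
    have e: "e > 0" "e \<le> 1" using r B by (auto simp: e_def)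
    have e_r: "e + (B + (B + e)) * e \<le> r / 4"
    proof -
      have "e + (B + (B + e)) * e \<le> e * (2 * (B + 1))" using e B by (simp add: algebra_simps)
      also have "\<dots> \<le> r / (8 * (B + 1)) * (2 * (B + 1))" using B by (intro mult_right_mono) (auto simp: e_def)
      also have "\<dots> = r / 4" using B by (simp add: field_simps)
      finally show ?thesis .
    qed
    obtain L1 where L1: "L1 > 0" "\<forall>\<^sub>F n in sequentially. measure (M n) (out (M n) L1) \<le> e"
      using tight[OF e(1)] unfolding out_def by blast
    obtain L2 where L2: "L2 > 0" "measure N (out N L2) \<le> e"
      using tightN[OF e(1)] unfolding out_def by blast
    \<comment> \<open>The approximant belongs to the larger cube, so that a single \<open>p\<close>
      serves the tail sets of both laws.\<close>
    define L where "L = max L1 L2"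
    have L: "L > 0" "L1 \<le> L" "L2 \<le> L" using L1 by (auto simp: L_def)
    obtain p where p: "trig I p" "\<And>x. \<bar>p x\<bar> \<le> B + e"
      "\<And>x. x \<in> (\<Pi>\<^sub>E i\<in>I. UNIV) \<Longrightarrow> (\<And>i. i \<in> I \<Longrightarrow> \<bar>x i\<bar> \<le> L) \<Longrightarrow> \<bar>f x - p x\<bar> \<le> e"
      using trig_approximation[OF fin cont B(2) L(1) e(1)] by blast
    have small: "e + (B + (B + e)) * t \<le> r / 4" if "t \<le> e" for t
      using that e B e_r mult_left_mono[of t e "B + (B + e)"] by linarith
    have "(\<lambda>n. \<integral>x. p x \<partial>M n) \<longlonglongrightarrow> (\<integral>x. p x \<partial>N)" by (rule trig_limit[OF M N c s p(1)])
    then have "\<forall>\<^sub>F n in sequentially. \<bar>(\<integral>x. p x \<partial>M n) - (\<integral>x. p x \<partial>N)\<bar> < r / 4"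
      using r unfolding tendsto_iff dist_real_def by (meson divide_pos_pos zero_less_numeral)
    then have "\<forall>\<^sub>F n in sequentially. \<bar>(\<integral>x. f x \<partial>M n) - (\<integral>x. f x \<partial>N)\<bar> < r"
      using L1(2)
    proof eventually_elim
      case (elim n)
      have kM: "\<bar>(\<integral>x. f x \<partial>M n) - (\<integral>x. p x \<partial>M n)\<bar> \<le> r / 4"
        by (rule order_trans[OF key[OF M[of n] e(1) L(2) p(1,2)] small[OF elim(2)]]) (rule p(3))
      have kN: "\<bar>(\<integral>x. f x \<partial>N) - (\<integral>x. p x \<partial>N)\<bar> \<le> r / 4"
        by (rule order_trans[OF key[OF N e(1) L(3) p(1,2)] small[OF L2(2)]]) (rule p(3))
      show ?case using kM kN elim r by linarith
    qed
    then show "\<exists>no. \<forall>n\<ge>no. norm ((\<integral>x. f x \<partial>M n) - (\<integral>x. f x \<partial>N)) < r"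
      by (auto simp: eventually_sequentially)
  qed
qed

subsection \<open>Existence of Gaussian vectors\<close>

definition psd :: "'i set \<Rightarrow> ('i \<Rightarrow> 'i \<Rightarrow> real) \<Rightarrow> bool"
  where "psd I A \<longleftrightarrow> (\<forall>i\<in>I. \<forall>j\<in>I. A i j = A j i) \<and> (\<forall>c. 0 \<le> (\<Sum>i\<in>I. \<Sum>j\<in>I. c i * c j * A i j))"

lemma quadratic_form_insert:
  assumes "finite F" "x \<notin> F" and sym: "\<And>j. j \<in> F \<Longrightarrow> A j x = A x j"
  shows "(\<Sum>i\<in>insert x F. \<Sum>j\<in>insert x F. c i * c j * A i j)
    = (c x)\<^sup>2 * A x x + 2 * c x * (\<Sum>j\<in>F. c j * A x j) + (\<Sum>i\<in>F. \<Sum>j\<in>F. c i * c j * (A i j :: real))"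
proof -
  have "(\<Sum>i\<in>F. c i * c x * A i x) = c x * (\<Sum>j\<in>F. c j * A x j)"
    unfolding sum_distrib_left by (intro sum.cong refl) (simp add: sym)
  moreover have "(\<Sum>j\<in>F. c x * c j * A x j) = c x * (\<Sum>j\<in>F. c j * A x j)"
    unfolding sum_distrib_left by (intro sum.cong refl) simp
  ultimately show ?thesis
    using assms(1,2) by (simp add: sum.distrib power2_eq_square)
qed

text \<open>The Cholesky factorization, by taking the Schur complement of one entry.\<close>

lemma psd_factorization:
  assumes "finite I" "psd I A"
  shows "\<exists>B. \<forall>i\<in>I. \<forall>j\<in>I. A i j = (\<Sum>k\<in>I. B i k * (B j k :: real))"
  using assms
proof (induction I arbitrary: A rule: finite_induct)
  case (insert x F)
  define s where "s = A x x"
  have sym: "A i j = A j i" if "i \<in> insert x F" "j \<in> insert x F" for i j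
    using insert.prems that by (auto simp: psd_def)
  have symx: "A j x = A x j" if "j \<in> F" for j using sym that by blast
  have form: "0 \<le> (c x)\<^sup>2 * s + 2 * c x * (\<Sum>j\<in>F. c j * A x j) + (\<Sum>i\<in>F. \<Sum>j\<in>F. c i * c j * A i j)" for c
  proof -
    have "0 \<le> (\<Sum>i\<in>insert x F. \<Sum>j\<in>insert x F. c i * c j * A i j)"
      using insert.prems unfolding psd_def by blast
    also note quadratic_form_insert[where F = F and x = x and A = A and c = c, OF insert.hyps symx]
    finally show ?thesis unfolding s_def .
  qed
  have s0: "s \<ge> 0"
  proof -
    define c where "c i = (if i = x then 1 else 0 :: real)" for i
    have c: "c x = 1" "\<And>j. j \<in> F \<Longrightarrow> c j = 0" using insert.hyps by (auto simp: c_def)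
    show ?thesis using form[of c] by (simp add: c)
  qed
  have zero: "A x j = 0" if j: "j \<in> F" and "s = 0" for j
  proof (rule ccontr)
    assume ne: "A x j \<noteq> 0"
    \<comment> \<open>Test vector with value \<open>t\<close> at \<open>x\<close> and 1 at
      \<open>j\<close>: as \<open>s = 0\<close>, the form is affine in \<open>t\<close>, and this
      \<open>t\<close> gives it the value -1.\<close>
    define t where "t = - (A j j + 1) / (2 * A x j)"
    define c where "c i = (if i = x then t else if i = j then 1 else 0)" for i
    have xj: "x \<noteq> j" using j insert.hyps by auto
    have cF: "c i = (if i = j then 1 else 0)" if "i \<in> F" for i using that insert.hyps by (auto simp: c_def)
    have "(\<Sum>i\<in>F. c i * A x i) = A x j"
      using j insert.hyps by (simp add: cF if_distrib[of "\<lambda>t. t * _"] cong: if_cong)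
    moreover have "(\<Sum>i\<in>F. \<Sum>k\<in>F. c i * c k * A i k) = A j j"
    proof -
      have "(\<Sum>k\<in>F. c i * c k * A i k) = c i * A i j" if "i \<in> F" for i
      proof -
        have "(\<Sum>k\<in>F. c i * c k * A i k) = (\<Sum>k\<in>F. if k = j then c i * A i j else 0)"
          by (intro sum.cong refl) (auto simp: cF)
        then show ?thesis using j insert.hyps by simp
      qed
      then have "(\<Sum>i\<in>F. \<Sum>k\<in>F. c i * c k * A i k) = (\<Sum>i\<in>F. if i = j then A j j else 0)"
        by (intro sum.cong refl) (auto simp: cF)
      then show ?thesis using j insert.hyps by simp
    qed
    ultimately have "0 \<le> 2 * t * A x j + A j j" using form[of c] \<open>s = 0\<close> by (simp add: c_def)
    moreover have "2 * t * A x j = - (A j j + 1)" using ne by (simp add: t_def)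
    ultimately show False by simp
  qed
  \<comment> \<open>Schur complement of the entry \<open>s\<close>. If \<open>s = 0\<close>, the
    quotient is 0 by the convention for division, which is right because \<open>zero\<close> makes
    the row vanish.\<close>
  define A' where "A' i j = A i j - A i x * A x j / s" for i j
  have "psd F A'"
    unfolding psd_def
  proof (intro conjI ballI allI)
    fix i j assume "i \<in> F" "j \<in> F"
    then show "A' i j = A' j i" using sym by (simp add: A'_def mult.commute)
  next
    fix c :: "'a \<Rightarrow> real"
    define L where "L = (\<Sum>j\<in>F. c j * A x j)"
    \<comment> \<open>The value at \<open>x\<close> minimizes the form of \<open>A\<close> over all
      extensions of \<open>c\<close>, and the minimum is the form of \<open>A'\<close> at
      \<open>c\<close>.\<close>
    define d where "d i = (if i = x then - L / s else c i)" for i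
    have dF: "d i = c i" if "i \<in> F" for i using that insert.hyps by (auto simp: d_def)
    have "(\<Sum>i\<in>F. \<Sum>j\<in>F. c i * c j * A' i j) = (\<Sum>i\<in>F. \<Sum>j\<in>F. c i * c j * A i j) - L * L / s"
    proof -
      have "L * L / s = (\<Sum>i\<in>F. \<Sum>j\<in>F. c i * c j * (A i x * A x j / s))"
        unfolding L_def sum_product sum_divide_distrib using sym by (intro sum.cong refl) simp
      then show ?thesis by (simp add: A'_def right_diff_distrib sum_subtractf)
    qed
    also have "\<dots> = (d x)\<^sup>2 * s + 2 * d x * (\<Sum>j\<in>F. d j * A x j) + (\<Sum>i\<in>F. \<Sum>j\<in>F. d i * d j * A i j)"
    proof -
      have sums: "(\<Sum>j\<in>F. d j * A x j) = L" "(\<Sum>i\<in>F. \<Sum>j\<in>F. d i * d j * A i j) = (\<Sum>i\<in>F. \<Sum>j\<in>F. c i * c j * A i j)"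
        by (simp_all add: L_def dF)
      have dx: "d x = - L / s" by (simp add: d_def)
      show ?thesis unfolding sums dx by (cases "s = 0") (simp_all add: field_simps power2_eq_square)
    qed
    finally show "0 \<le> (\<Sum>i\<in>F. \<Sum>j\<in>F. c i * c j * A' i j)" using form[of d] by simp
  qed
  from insert.IH[OF this] obtain B' where B': "\<And>i j. i \<in> F \<Longrightarrow> j \<in> F \<Longrightarrow> A' i j = (\<Sum>k\<in>F. B' i k * B' j k)" by blast
  \<comment> \<open>The column of \<open>x\<close> is that of \<open>A\<close> scaled by
    \<open>sqrt s\<close>; it accounts for exactly what the Schur complement subtracts.\<close>
  define B where "B i k = (if k = x then A i x / sqrt s else if i = x then 0 else B' i k)" for i k
  have Bx: "B i x * B j x = A i x * A x j / s" if "j \<in> insert x F" for i j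
    using s0 sym[OF that, of x] by (simp add: B_def)
  have BF: "B i k = (if i = x then 0 else B' i k)" if "k \<in> F" for i k
    using that insert.hyps by (auto simp: B_def)
  show ?case
  proof (intro exI[of _ B] ballI)
    fix i j assume ij: "i \<in> insert x F" "j \<in> insert x F"
    have "(\<Sum>k\<in>insert x F. B i k * B j k) = A i x * A x j / s + (\<Sum>k\<in>F. B i k * B j k)"
      using insert.hyps Bx[OF ij(2)] by simp
    also have "\<dots> = A i j"
    proof (cases "i = x \<or> j = x")
      case True
      then have "(\<Sum>k\<in>F. B i k * B j k) = 0" by (intro sum.neutral) (auto simp: BF)
      moreover have "A i x * A x j / s = A i j"
        using True ij zero sym[OF ij] sym[OF ij(1), of x] by (cases "s = 0") (auto simp: s_def)
      ultimately show ?thesis by simp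
    next
      case False
      then have "i \<in> F" "j \<in> F" using ij by auto
      then have "(\<Sum>k\<in>F. B i k * B j k) = A' i j"
        using False by (simp add: B' BF)
      then show ?thesis by (simp add: A'_def)
    qed
    finally show "A i j = (\<Sum>k\<in>insert x F. B i k * B j k)" by simp
  qed
qed auto

section \<open>Centred normal laws on the line, the degenerate one included\<close>

lemma real_distribution_normal_law:
  assumes "\<sigma> \<ge> 0" shows "real_distribution (normal_law 0 \<sigma>)"
proof (cases "\<sigma> = 0")
  case True
  then show ?thesis
    by (auto simp: normal_law_def real_distribution_def real_distribution_axioms_def intro: prob_space_return)
next
  case False
  then show ?thesis using assms
    by (auto simp: normal_law_def real_distribution_def real_distribution_axioms_def intro: prob_space_normal_density)
qed

text \<open>Covers variance zero as well, so that characteristic functions need no case distinction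
  afterwards.\<close>

lemma normal_law_eq_distr:
  assumes "\<sigma> \<ge> 0" shows "normal_law 0 \<sigma> = distr std_normal_distribution borel (\<lambda>x. \<sigma> * x)"
proof (cases "\<sigma> = 0")
  case True
  interpret prob_space std_normal_distribution by (rule real_distribution.axioms(1)[OF real_dist_normal_dist])
  have "distr std_normal_distribution borel (\<lambda>x. 0) = return borel (0::real)"
    by (intro measure_eqI) (auto simp: emeasure_distr indicator_def emeasure_space_1[simplified])
  with True show ?thesis by (simp add: normal_law_def)
next
  case False
  interpret prob_space std_normal_distribution by (rule real_distribution.axioms(1)[OF real_dist_normal_dist])
  have s: "\<sigma> > 0" using assms False by simp
  have "distributed std_normal_distribution lborel (\<lambda>x. (\<sigma> * x - 0) / \<sigma>) std_normal_density"
  proof -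
    have "distr std_normal_distribution lborel (\<lambda>x. x) = std_normal_distribution"
      by (intro distr_id2) simp
    then show ?thesis using s by (auto simp: distributed_def)
  qed
  then have "distributed std_normal_distribution lborel (\<lambda>x. \<sigma> * x) (normal_density 0 \<sigma>)"
    using normal_standard_normal_convert[OF s, of "\<lambda>x. \<sigma> * x" 0] by simp
  then have "distr std_normal_distribution lborel (\<lambda>x. \<sigma> * x) = density lborel (normal_density 0 \<sigma>)"
    by (simp add: distributed_def)
  moreover have "distr std_normal_distribution lborel (\<lambda>x. \<sigma> * x) = distr std_normal_distribution borel (\<lambda>x. \<sigma> * x)"
    by (intro distr_cong) auto
  ultimately show ?thesis using False by (simp add: normal_law_def)
qed

lemma char_normal_law:
  assumes "\<sigma> \<ge> 0" shows "char (normal_law 0 \<sigma>) t = exp (- (t\<^sup>2 * \<sigma>\<^sup>2 / 2))"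
proof -
  have "char (normal_law 0 \<sigma>) t = (\<integral>x. iexp (t * (\<sigma> * x)) \<partial>std_normal_distribution)"
    unfolding normal_law_eq_distr[OF assms] char_def by (subst integral_distr) auto
  also have "\<dots> = char std_normal_distribution (t * \<sigma>)" by (simp add: char_def mult.assoc)
  also have "\<dots> = exp (- (t\<^sup>2 * \<sigma>\<^sup>2 / 2))" by (simp add: char_std_normal_distribution power_mult_distrib)
  finally show ?thesis .
qed

lemma std_normal_moments:
  "(\<integral>x. x \<partial>std_normal_distribution) = 0" "(\<integral>x. x\<^sup>2 \<partial>std_normal_distribution) = 1"
  using integral_std_normal_distribution_moment_odd[of 1] std_normal_distribution_even_moments[of 1]
  by (simp_all add: has_bochner_integral_iff)

text \<open>The image of independent standard normal coordinates under a matrix B with A = B B^T.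
  The Fourier integrals and square integrability are part of the conclusion because the limit
  theorem compares the former and derives tightness from the latter.\<close>

theorem multivariate_normal_exists:
  assumes fin: "finite I" and psd: "psd I A"
  obtains N where "is_multivariate_normal I (\<lambda>_. 0) A N"
    "\<And>s. (\<integral>x. cos (\<Sum>i\<in>I. s i * x i) \<partial>N) = exp (- ((\<Sum>i\<in>I. \<Sum>j\<in>I. s i * s j * A i j) / 2))"
    "\<And>s. (\<integral>x. sin (\<Sum>i\<in>I. s i * x i) \<partial>N) = 0"
    "\<And>i. i \<in> I \<Longrightarrow> integrable N (\<lambda>x. (x i)\<^sup>2)"
proof -
  obtain B where B: "\<And>i j. i \<in> I \<Longrightarrow> j \<in> I \<Longrightarrow> A i j = (\<Sum>k\<in>I. B i k * B j k)"
    using psd_factorization[OF fin psd] by blast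
  let ?G = "std_normal_distribution"
  define P where "P = PiM I (\<lambda>_. ?G)"
  define T where "T g = (\<lambda>i\<in>I. \<Sum>k\<in>I. B i k * (g k :: real))" for g
  define N where "N = distr P (PiM I (\<lambda>_. borel)) T"
  interpret G: prob_space ?G by (rule real_distribution.axioms(1)[OF real_dist_normal_dist])
  interpret PS: product_prob_space "\<lambda>_. ?G" I by standard
  have psP: "prob_space P" unfolding P_def by (rule prob_space_PiM) (rule G.prob_space_axioms)
  interpret P: prob_space P by (rule psP)
  have comp: "(\<lambda>g. g k) \<in> borel_measurable P" if "k \<in> I" for k
  proof -
    have "(\<lambda>g. g k) \<in> P \<rightarrow>\<^sub>M ?G" unfolding P_def by (rule measurable_component_singleton[OF that])
    then show ?thesis by simp
  qed
  have lin: "(\<lambda>g. \<Sum>k\<in>I. c k * g k) \<in> borel_measurable P" for c :: "'a \<Rightarrow> real"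
    by (intro borel_measurable_sum borel_measurable_times borel_measurable_const comp)
  have T: "T \<in> P \<rightarrow>\<^sub>M PiM I (\<lambda>_. borel)"
    unfolding T_def by (rule measurable_restrict) (rule lin)
  have psN: "prob_space N" unfolding N_def by (rule P.prob_space_distr[OF T])
  have int_prod: "integrable P (\<lambda>g. \<Prod>m\<in>I. f m (g m)) \<and> (\<integral>g. (\<Prod>m\<in>I. f m (g m)) \<partial>P) = (\<Prod>m\<in>I. \<integral>x. f m x \<partial>?G)"
    if "\<And>m. m \<in> I \<Longrightarrow> integrable ?G (f m)" for f :: "'a \<Rightarrow> real \<Rightarrow> 'c::{real_normed_field,banach,second_countable_topology}"
    unfolding P_def using PS.product_integral_prod[OF fin, of f] PS.product_integrable_prod[OF fin, of f] that by simp
  have mom: "integrable P (\<lambda>g. g k * g l) \<and> (\<integral>g. g k * g l \<partial>P) = (if k = l then 1 else 0)"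
    if kl: "k \<in> I" "l \<in> I" for k l
  proof -
    \<comment> \<open>A product over all coordinates whose value is \<open>g k * g l\<close>; for
      \<open>k = l\<close> the two factors meet in the same coordinate and give the square.\<close>
    define f where "f m x = (if m = k then x else 1) * (if m = l then x else 1 :: real)" for m x
    have fi: "f m = (if m = k \<and> m = l then (\<lambda>x. x ^ 2) else if m = k \<or> m = l then (\<lambda>x. x ^ 1) else (\<lambda>x. x ^ 0))" for m
      by (auto simp: f_def power2_eq_square)
    have "integrable ?G (f m)" for m
      unfolding fi using integrable_std_normal_distribution_moment by (simp only: split: if_split) blast
    from int_prod[of f, OF this]
    have "integrable P (\<lambda>g. \<Prod>m\<in>I. f m (g m))" "(\<integral>g. (\<Prod>m\<in>I. f m (g m)) \<partial>P) = (\<Prod>m\<in>I. \<integral>x. f m x \<partial>?G)" by auto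
    moreover have "(\<Prod>m\<in>I. f m (g m)) = g k * g l" for g
      using fin kl unfolding f_def prod.distrib by simp
    moreover have "(\<Prod>m\<in>I. \<integral>x. f m x \<partial>?G) = (if k = l then 1 else 0)"
    proof (cases "k = l")
      case True
      then have "(\<integral>x. f m x \<partial>?G) = 1" for m
        unfolding fi using std_normal_moments G.prob_space by simp
      with True show ?thesis by simp
    next
      case False
      then have "(\<integral>x. f k x \<partial>?G) = 0" unfolding fi using std_normal_moments by simp
      then have "(\<Prod>m\<in>I. \<integral>x. f m x \<partial>?G) = 0" using kl fin by (auto intro: prod_zero)
      with False show ?thesis by simp
    qed
    ultimately show ?thesis by simp
  qed
  have mean: "integrable P (\<lambda>g. g k) \<and> (\<integral>g. g k \<partial>P) = 0" if k: "k \<in> I" for k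
  proof -
    have d: "distr P ?G (\<lambda>g. g k) = ?G"
      unfolding P_def by (rule distr_PiM_component) (auto intro: G.prob_space_axioms k)
    have m: "(\<lambda>g. g k) \<in> P \<rightarrow>\<^sub>M ?G" unfolding P_def by (rule measurable_component_singleton[OF k])
    have "integrable ?G (\<lambda>x. x)" using integrable_std_normal_distribution_moment[of 1] by simp
    then have "integrable P (\<lambda>g. g k)"
      using integrable_distr_eq[OF m, of "\<lambda>x. x"] unfolding d by simp
    moreover have "(\<integral>g. g k \<partial>P) = 0"
      using integral_distr[OF m, of "\<lambda>x. x"] std_normal_moments unfolding d by simp
    ultimately show ?thesis by simp
  qed
  have charlin: "(\<integral>g. iexp (\<Sum>k\<in>I. c k * g k) \<partial>P) = exp (- ((\<Sum>k\<in>I. (c k)\<^sup>2) / 2))" for c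
  proof -
    have "iexp (\<Sum>k\<in>I. c k * g k) = (\<Prod>k\<in>I. iexp (c k * g k))" for g :: "'a \<Rightarrow> real"
      using fin by (simp add: sum_distrib_left exp_sum)
    then have "(\<integral>g. iexp (\<Sum>k\<in>I. c k * g k) \<partial>P) = (\<Prod>k\<in>I. \<integral>x. iexp (c k * x) \<partial>?G)"
      using int_prod[of "\<lambda>k x. iexp (c k * x)"] G.integrable_iexp by simp
    also have "\<dots> = (\<Prod>k\<in>I. complex_of_real (exp (- ((c k)\<^sup>2 / 2))))"
      using fun_cong[OF char_std_normal_distribution] by (intro prod.cong refl) (simp add: char_def)
    also have "\<dots> = complex_of_real (exp (\<Sum>k\<in>I. - ((c k)\<^sup>2 / 2)))"
      using fin by (simp only: exp_sum of_real_prod)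
    also have "(\<Sum>k\<in>I. - ((c k)\<^sup>2 / 2)) = - ((\<Sum>k\<in>I. (c k)\<^sup>2) / 2)"
      by (simp add: sum_negf sum_divide_distrib)
    finally show ?thesis .
  qed
  define co where "co a k = (\<Sum>i\<in>I. a i * B i k)" for a k
  have lin_T: "(\<Sum>i\<in>I. a i * T g i) = (\<Sum>k\<in>I. co a k * g k)" for a g
  proof -
    have "(\<Sum>i\<in>I. a i * T g i) = (\<Sum>i\<in>I. \<Sum>k\<in>I. a i * B i k * g k)"
      by (simp add: T_def sum_distrib_left mult.assoc)
    also have "\<dots> = (\<Sum>k\<in>I. \<Sum>i\<in>I. a i * B i k * g k)" by (rule sum.swap)
    finally show ?thesis by (simp add: co_def sum_distrib_right)
  qed
  have co_sq: "(\<Sum>k\<in>I. (co a k)\<^sup>2) = (\<Sum>i\<in>I. \<Sum>j\<in>I. a i * a j * A i j)" for a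
  proof -
    have "(\<Sum>k\<in>I. (co a k)\<^sup>2) = (\<Sum>k\<in>I. \<Sum>i\<in>I. \<Sum>j\<in>I. a i * a j * (B i k * B j k))"
      unfolding co_def power2_eq_square sum_product by (intro sum.cong refl) simp
    also have "\<dots> = (\<Sum>i\<in>I. \<Sum>k\<in>I. \<Sum>j\<in>I. a i * a j * (B i k * B j k))" by (rule sum.swap)
    also have "\<dots> = (\<Sum>i\<in>I. \<Sum>j\<in>I. \<Sum>k\<in>I. a i * a j * (B i k * B j k))"
      by (rule sum.cong[OF refl]) (rule sum.swap)
    also have "\<dots> = (\<Sum>i\<in>I. \<Sum>j\<in>I. a i * a j * A i j)"
      by (intro sum.cong refl) (simp add: B sum_distrib_left)
    finally show ?thesis .
  qed
  have linN: "(\<lambda>x. \<Sum>i\<in>I. a i * x i) \<in> borel_measurable (PiM I (\<lambda>_. borel))" for a :: "'a \<Rightarrow> real"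
    by (intro borel_measurable_sum borel_measurable_times borel_measurable_const measurable_component_singleton)
  have charN: "(\<integral>x. iexp (\<Sum>i\<in>I. a i * x i) \<partial>N) = exp (- ((\<Sum>i\<in>I. \<Sum>j\<in>I. a i * a j * A i j) / 2))" for a
  proof -
    have [measurable]: "(\<lambda>x. \<Sum>i\<in>I. a i * x i) \<in> borel_measurable (PiM I (\<lambda>_. borel))" by (rule linN)
    have "(\<integral>x. iexp (\<Sum>i\<in>I. a i * x i) \<partial>N) = (\<integral>g. iexp (\<Sum>i\<in>I. a i * T g i) \<partial>P)"
      unfolding N_def by (rule integral_distr[OF T]) measurable
    then show ?thesis unfolding lin_T charlin co_sq .
  qed
  \<comment> \<open>The standard deviation may be 0 here; equality of characteristic functions
    determines degenerate laws too.\<close>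
  have law: "distr N borel (\<lambda>x. \<Sum>i\<in>I. a i * x i) = normal_law 0 (sqrt (\<Sum>k\<in>I. (co a k)\<^sup>2))" for a
  proof (rule Levy_uniqueness)
    have nn: "(\<Sum>k\<in>I. (co a k)\<^sup>2) \<ge> 0" by (intro sum_nonneg) auto
    have mN: "(\<lambda>x. \<Sum>i\<in>I. a i * x i) \<in> borel_measurable N" for a :: "'a \<Rightarrow> real"
      using linN unfolding N_def by simp
    show "real_distribution (normal_law 0 (sqrt (\<Sum>k\<in>I. (co a k)\<^sup>2)))"
      by (rule real_distribution_normal_law) (simp add: nn)
    show "real_distribution (distr N borel (\<lambda>x. \<Sum>i\<in>I. a i * x i))"
      by (rule prob_space.real_distribution_distr[OF psN mN])
    show "char (distr N borel (\<lambda>x. \<Sum>i\<in>I. a i * x i)) = char (normal_law 0 (sqrt (\<Sum>k\<in>I. (co a k)\<^sup>2)))"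
    proof
      fix t
      have "char (distr N borel (\<lambda>x. \<Sum>i\<in>I. a i * x i)) t = (\<integral>x. iexp (t * (\<Sum>i\<in>I. a i * x i)) \<partial>N)"
        unfolding char_def by (rule integral_distr[OF mN]) simp
      also have "\<dots> = (\<integral>x. iexp (\<Sum>i\<in>I. (t * a i) * x i) \<partial>N)" by (simp add: sum_distrib_left mult.assoc)
      also have "\<dots> = exp (- ((\<Sum>i\<in>I. \<Sum>j\<in>I. (t * a i) * (t * a j) * A i j) / 2))" by (rule charN)
      also have "(\<Sum>i\<in>I. \<Sum>j\<in>I. (t * a i) * (t * a j) * A i j) = t\<^sup>2 * (\<Sum>k\<in>I. (co a k)\<^sup>2)"
        unfolding co_sq sum_distrib_left by (intro sum.cong refl) (simp add: power2_eq_square)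
      finally show "char (distr N borel (\<lambda>x. \<Sum>i\<in>I. a i * x i)) t = char (normal_law 0 (sqrt (\<Sum>k\<in>I. (co a k)\<^sup>2))) t"
        using nn by (simp add: char_normal_law)
    qed
  qed
  have Ti: "T g i = (\<Sum>k\<in>I. B i k * g k)" if "i \<in> I" for g i using that by (simp add: T_def)
  have prodexp: "T g i * T g j = (\<Sum>k\<in>I. \<Sum>l\<in>I. B i k * B j l * (g k * g l))" if "i \<in> I" "j \<in> I" for g i j
    unfolding Ti[OF that(1)] Ti[OF that(2)] sum_product by (intro sum.cong refl) simp
  have int2: "integrable P (\<lambda>g. T g i * T g j)" "(\<integral>g. T g i * T g j \<partial>P) = A i j" if ij: "i \<in> I" "j \<in> I" for i j
  proof -
    have i1: "integrable P (\<lambda>g. B i k * B j l * (g k * g l))" if "k \<in> I" "l \<in> I" for k l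
      using mom[OF that] by (intro integrable_mult_right) auto
    show "integrable P (\<lambda>g. T g i * T g j)"
      unfolding prodexp[OF ij] by (intro Bochner_Integration.integrable_sum i1)
    have "(\<integral>g. T g i * T g j \<partial>P) = (\<Sum>k\<in>I. \<Sum>l\<in>I. B i k * B j l * (\<integral>g. g k * g l \<partial>P))"
      unfolding prodexp[OF ij] using i1 by (simp add: Bochner_Integration.integral_sum Bochner_Integration.integrable_sum)
    also have "\<dots> = (\<Sum>k\<in>I. \<Sum>l\<in>I. if l = k then B i k * B j k else 0)"
      using mom by (intro sum.cong refl) auto
    also have "\<dots> = A i j" using fin ij by (simp add: B)
    finally show "(\<integral>g. T g i * T g j \<partial>P) = A i j" .
  qed
  have meanT: "(\<integral>g. T g i \<partial>P) = 0" if i: "i \<in> I" for i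
    unfolding Ti[OF i] using mean by (simp add: Bochner_Integration.integral_sum)
  have compN: "(\<lambda>x. x i) \<in> borel_measurable (PiM I (\<lambda>_. borel :: real measure))" if "i \<in> I" for i
    by (rule measurable_component_singleton[OF that])
  have meanN: "(\<integral>x. x i \<partial>N) = 0" if i: "i \<in> I" for i
    unfolding N_def by (subst integral_distr[OF T compN[OF i]]) (rule meanT[OF i])
  have covN: "covariance N (\<lambda>x. x i) (\<lambda>x. x j) = A i j" if ij: "i \<in> I" "j \<in> I" for i j
  proof -
    have "covariance N (\<lambda>x. x i) (\<lambda>x. x j) = (\<integral>x. x i * x j \<partial>N)"
      unfolding covariance_def meanN[OF ij(1)] meanN[OF ij(2)] by simp
    also have "\<dots> = (\<integral>g. T g i * T g j \<partial>P)"
      unfolding N_def by (rule integral_distr[OF T]) (intro borel_measurable_times compN ij)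
    finally show ?thesis using int2[OF ij] by simp
  qed
  show thesis
  proof (rule that[of N])
    show "is_multivariate_normal I (\<lambda>_. 0) A N"
      unfolding is_multivariate_normal_def
    proof (intro conjI allI ballI)
      show "prob_space N" by (rule psN)
      show "sets N = sets (PiM I (\<lambda>_. borel))" by (simp add: N_def)
      fix a
      show "\<exists>\<mu> \<sigma>. \<sigma> \<ge> 0 \<and> distr N borel (\<lambda>x. \<Sum>i\<in>I. a i * x i) = normal_law \<mu> \<sigma>"
        using law[of a] by (intro exI[of _ 0] exI[of _ "sqrt (\<Sum>k\<in>I. (co a k)\<^sup>2)"]) (simp add: sum_nonneg)
    qed (use meanN covN in auto)
    interpret N: prob_space N by (rule psN)
    fix s :: "'a \<Rightarrow> real"
    have i: "integrable N (\<lambda>x. iexp (\<Sum>i\<in>I. s i * x i))"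
      using linN[of s] by (intro N.integrable_iexp) (simp_all add: N_def del: of_real_sum)
    have ie: "iexp y = Complex (cos y) (sin y)" for y by (simp add: cis_conv_exp[symmetric] complex_eq_iff)
    show "(\<integral>x. cos (\<Sum>i\<in>I. s i * x i) \<partial>N) = exp (- ((\<Sum>i\<in>I. \<Sum>j\<in>I. s i * s j * A i j) / 2))"
      using integral_Re[OF i] unfolding charN by (simp only: ie complex.sel Re_complex_of_real)
    show "(\<integral>x. sin (\<Sum>i\<in>I. s i * x i) \<partial>N) = 0"
      using integral_Im[OF i] unfolding charN by (simp only: ie complex.sel Im_complex_of_real)
  next
    fix i assume i: "i \<in> I"
    show "integrable N (\<lambda>x. (x i)\<^sup>2)"
      unfolding N_def power2_eq_square
      by (subst integrable_distr_eq[OF T]) (intro borel_measurable_times compN i, rule int2[OF i i])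
  qed
qed

subsection \<open>A central limit theorem for locally dependent variables\<close>

lemma has_vector_derivative_quadratic:
  fixes f :: "real \<Rightarrow> 'b::real_normed_vector"
  assumes "\<And>y. norm (f y - f x - (y - x) *\<^sub>R d) \<le> K * (y - x)\<^sup>2"
  shows "(f has_vector_derivative d) (at x)"
  unfolding has_vector_derivative_def has_derivative_at_alt
proof (intro conjI allI impI)
  show "bounded_linear (\<lambda>t. t *\<^sub>R d)" by (rule bounded_linear_scaleR_left)
  fix e :: real assume e: "e > 0"
  define K' where "K' = \<bar>K\<bar> + 1"
  have K': "K' > 0" "K \<le> K'" by (auto simp: K'_def)
  show "\<exists>\<delta>>0. \<forall>y. norm (y - x) < \<delta> \<longrightarrow> norm (f y - f x - (y - x) *\<^sub>R d) \<le> e * norm (y - x)"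
  proof (intro exI[of _ "e / K'"] conjI allI impI)
    show "e / K' > 0" using e K' by simp
    fix y assume y: "norm (y - x) < e / K'"
    have "norm (f y - f x - (y - x) *\<^sub>R d) \<le> K' * (y - x)\<^sup>2"
      using assms[of y] mult_right_mono[OF K'(2), of "(y - x)\<^sup>2"] by simp
    also have "\<dots> = (K' * \<bar>y - x\<bar>) * \<bar>y - x\<bar>" by (simp add: power2_eq_square)
    also have "\<dots> \<le> e * \<bar>y - x\<bar>"
      using y K' by (intro mult_right_mono) (auto simp: pos_less_divide_eq mult.commute)
    finally show "norm (f y - f x - (y - x) *\<^sub>R d) \<le> e * norm (y - x)" by simp
  qed
qed

lemma vector_derivative_norm_bound:
  fixes f :: "real \<Rightarrow> 'b::real_normed_vector"
  assumes "\<And>x. \<bar>x\<bar> \<le> \<bar>s\<bar> \<Longrightarrow> (f has_vector_derivative f' x) (at x)" "\<And>x. \<bar>x\<bar> \<le> \<bar>s\<bar> \<Longrightarrow> norm (f' x) \<le> B"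
  shows "norm (f s - f 0) \<le> B * \<bar>s\<bar>"
proof -
  have "norm (f s - f 0) \<le> B * norm (s - 0)"
  proof (rule differentiable_bound[where S = "{- \<bar>s\<bar>..\<bar>s\<bar>}"])
    fix x assume "x \<in> {- \<bar>s\<bar>..\<bar>s\<bar>}"
    then have x: "\<bar>x\<bar> \<le> \<bar>s\<bar>" by (auto simp: abs_le_iff)
    show "(f has_derivative (\<lambda>t. t *\<^sub>R f' x)) (at x within {- \<bar>s\<bar>..\<bar>s\<bar>})"
      using assms(1)[OF x] unfolding has_vector_derivative_def by (rule has_derivative_at_withinI)
    show "onorm (\<lambda>t. t *\<^sub>R f' x) \<le> B"
      using assms(2)[OF x] by (intro onorm_le) (simp add: mult.commute[of B] mult_left_mono)
  qed auto
  then show ?thesis by simp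
qed

lemma iexp_diff_bound: "cmod (iexp x - iexp y) \<le> \<bar>x - y\<bar>"
proof -
  have "iexp x - iexp y = iexp y * (iexp (x - y) - 1)"
    by (simp add: right_diff_distrib flip: exp_add)
  then have "cmod (iexp x - iexp y) = cmod (iexp (x - y) - 1)" by (simp add: norm_mult)
  also have "\<dots> \<le> \<bar>x - y\<bar>" using iexp_approx1[of "x - y" 0] by simp
  finally show ?thesis .
qed

lemma iexp_taylor2: "cmod (iexp x - 1 - \<i> * x) \<le> x\<^sup>2 / 2"
proof -
  have "(\<Sum>k\<le>Suc 0. (\<i> * x) ^ k / fact k) = 1 + \<i> * x" by simp
  moreover have "\<bar>x\<bar> ^ Suc (Suc 0) / fact (Suc (Suc 0)) = x\<^sup>2 / 2" by (simp add: power2_eq_square)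
  ultimately show ?thesis using iexp_approx1[of x "Suc 0"] by (simp only: diff_diff_eq)
qed

context prob_space
begin

lemma norm_expectation_le:
  fixes f :: "'a \<Rightarrow> complex"
  assumes "f \<in> borel_measurable M" "\<And>x. cmod (f x) \<le> B"
  shows "cmod (expectation f) \<le> B"
proof -
  have i: "integrable M f" using assms by (intro integrable_const_bound[where B = B]) auto
  have "cmod (expectation f) \<le> expectation (\<lambda>x. cmod (f x))" by (rule integral_norm_bound)
  also have "\<dots> \<le> expectation (\<lambda>_. B)" using i assms by (intro integral_mono) auto
  finally show ?thesis by (simp add: prob_space)
qed

text \<open>Differentiation under the expectation: since \<open>W\<close> is bounded, the Taylor
  remainder of the exponential is quadratic in \<open>y - s\<close> uniformly on the probability
  space.\<close>

lemma char_fun_derivative: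
  assumes [measurable]: "W \<in> borel_measurable M" and W: "\<And>x. \<bar>W x\<bar> \<le> B"
  shows "((\<lambda>s. expectation (\<lambda>x. iexp (s * W x))) has_vector_derivative
    expectation (\<lambda>x. \<i> * W x * iexp (s * W x))) (at s)"
proof (rule has_vector_derivative_quadratic[where K = "B\<^sup>2 / 2"])
  fix y
  have i1: "integrable M (\<lambda>x. iexp (t * W x))" for t
    by (intro integrable_const_bound[where B = 1]) auto
  have i2: "integrable M (\<lambda>x. \<i> * W x * iexp (s * W x))"
    using W by (intro integrable_const_bound[where B = B]) (auto simp: norm_mult)
  have "expectation (\<lambda>x. iexp (y * W x)) - expectation (\<lambda>x. iexp (s * W x)) - (y - s) *\<^sub>R expectation (\<lambda>x. \<i> * W x * iexp (s * W x))
    = expectation (\<lambda>x. iexp (y * W x) - iexp (s * W x) - (y - s) *\<^sub>R (\<i> * W x * iexp (s * W x)))"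
    using i1 i2 by simp
  also have "cmod \<dots> \<le> B\<^sup>2 / 2 * (y - s)\<^sup>2"
  proof (rule norm_expectation_le)
    fix x
    have "iexp (y * W x) - iexp (s * W x) - (y - s) *\<^sub>R (\<i> * W x * iexp (s * W x))
      = iexp (s * W x) * (iexp ((y - s) * W x) - 1 - \<i> * ((y - s) * W x))"
      by (simp add: right_diff_distrib scaleR_conv_of_real flip: exp_add) (simp add: algebra_simps)
    then have "cmod (iexp (y * W x) - iexp (s * W x) - (y - s) *\<^sub>R (\<i> * W x * iexp (s * W x)))
      \<le> ((y - s) * W x)\<^sup>2 / 2"
      using iexp_taylor2[of "(y - s) * W x"] by (simp add: norm_mult)
    also have "\<dots> \<le> ((y - s) * B)\<^sup>2 / 2"
      using W[of x] by (simp add: power_mult_distrib mult_left_mono power2_le_iff_abs_le abs_le_square_iff[symmetric])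
    finally show "cmod (iexp (y * W x) - iexp (s * W x) - (y - s) *\<^sub>R (\<i> * W x * iexp (s * W x)))
      \<le> B\<^sup>2 / 2 * (y - s)\<^sup>2" by (simp add: power_mult_distrib mult.commute)
  qed measurable
  finally show "norm (expectation (\<lambda>x. iexp (y * W x)) - expectation (\<lambda>x. iexp (s * W x)) - (y - s) *\<^sub>R expectation (\<lambda>x. \<i> * W x * iexp (s * W x)))
    \<le> B\<^sup>2 / 2 * (y - s)\<^sup>2" .
qed

text \<open>The characteristic function \<open>\<phi>\<close> of the normalized sum satisfies \<open>\<phi>' s = - s v \<phi> s\<close> up to a
  small error: in \<open>E[X\<^sub>i exp(isW)]\<close> expand the exponential in the part of \<open>W\<close> that depends on \<open>X\<^sub>i\<close>.\<close>

theorem local_dependence_char_bound: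
  fixes X :: "'i \<Rightarrow> 'a \<Rightarrow> real"
  assumes fin: "finite V" and n: "n = real (card V)" "n > 0"
    and meas: "\<And>i. X i \<in> borel_measurable M" and C: "\<And>i x. \<bar>X i x\<bar> \<le> C"
    and N1: "\<And>i. i \<in> V \<Longrightarrow> N1 i \<subseteq> V \<and> real (card (N1 i)) \<le> D"
    and N2: "\<And>i. i \<in> V \<Longrightarrow> N2 i \<subseteq> V \<and> real (card (N2 i)) \<le> D"
    and ind1: "\<And>i s. i \<in> V \<Longrightarrow> expectation (\<lambda>x. X i x * iexp (s * (\<Sum>j\<in>V - N1 i. X j x))) = 0"
    and ind2: "\<And>i s. i \<in> V \<Longrightarrow>
      expectation (\<lambda>x. complex_of_real (X i x * (\<Sum>j\<in>N1 i. X j x)) * iexp (s * (\<Sum>j\<in>V - N2 i. X j x)))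
      = expectation (\<lambda>x. complex_of_real (X i x * (\<Sum>j\<in>N1 i. X j x))) * expectation (\<lambda>x. iexp (s * (\<Sum>j\<in>V - N2 i. X j x)))"
    and v: "v = (\<Sum>i\<in>V. expectation (\<lambda>x. X i x * (\<Sum>j\<in>N1 i. X j x))) / n"
  shows "cmod (expectation (\<lambda>x. iexp (s * ((\<Sum>i\<in>V. X i x) / sqrt n))) - complex_of_real (exp (- (s\<^sup>2 * v / 2))))
    \<le> 4 * D\<^sup>2 * C ^ 3 * exp (s\<^sup>2 * \<bar>v\<bar>) * \<bar>s\<bar> ^ 3 / sqrt n"
proof -
  define h where "h = 1 / sqrt n"
  have h: "h > 0" "h * h * n = 1" using n by (auto simp: h_def)
  have C0: "C \<ge> 0" using C abs_ge_zero order_trans by blast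
  have "V \<noteq> {}" using n by auto
  then obtain i0 where "i0 \<in> V" by blast
  then have D0: "D \<ge> 0" using N1[of i0] by (meson of_nat_0_le_iff order_trans)
  note [measurable] = meas
  have sum_bound: "\<bar>\<Sum>j\<in>A. X j x\<bar> \<le> D * C" if "real (card A) \<le> D" for A x
  proof -
    have "\<bar>\<Sum>j\<in>A. X j x\<bar> \<le> real (card A) * C"
      using sum_norm_bound[of A "\<lambda>j. X j x" C] C by simp
    also have "\<dots> \<le> D * C" using that C0 by (rule mult_right_mono)
    finally show ?thesis .
  qed
  define S where "S x = (\<Sum>i\<in>V. X i x)" for x
  define W where "W x = h * S x" for x
  have [measurable]: "S \<in> borel_measurable M" "W \<in> borel_measurable M" unfolding S_def W_def by measurable
  define \<phi> where "\<phi> s = expectation (\<lambda>x. iexp (s * W x))" for s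
  define \<phi>' where "\<phi>' s = expectation (\<lambda>x. \<i> * W x * iexp (s * W x))" for s
  have Sb: "\<bar>S x\<bar> \<le> n * C" for x
    using sum_norm_bound[of V "\<lambda>j. X j x" C] C n by (simp add: S_def)
  have Wb: "\<bar>W x\<bar> \<le> h * (n * C)" for x
    using Sb[of x] h by (simp add: W_def abs_mult mult_left_mono)
  have der: "(\<phi> has_vector_derivative \<phi>' s) (at s)" for s
    unfolding \<phi>_def \<phi>'_def by (rule char_fun_derivative[OF _ Wb]) measurable
  have \<phi>_le: "cmod (\<phi> s) \<le> 1" for s unfolding \<phi>_def by (rule norm_expectation_le) auto
  define c where "c i = expectation (\<lambda>x. X i x * (\<Sum>j\<in>N1 i. X j x))" for i
  \<comment> \<open>The factor 4 bounds 7/2 = 1/2 + 2 + 1, the constants of the three estimates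
    \<open>e1\<close>, \<open>e2\<close> and \<open>e3\<close> below.\<close>
  define err where "err s = 4 * D\<^sup>2 * C ^ 3 * (s * h)\<^sup>2" for s
  have step: "cmod (expectation (\<lambda>x. X i x * iexp (s * W x)) - \<i> * (s * h) * c i * \<phi> s) \<le> err s" if i: "i \<in> V" for i s
  proof -
    define t where "t = s * h"
    define R where "R x = (\<Sum>j\<in>N1 i. X j x)" for x
    define T where "T x = (\<Sum>j\<in>V - N1 i. X j x)" for x
    define Q where "Q x = (\<Sum>j\<in>N2 i. X j x)" for x
    define T2 where "T2 x = (\<Sum>j\<in>V - N2 i. X j x)" for x
    have [measurable]: "R \<in> borel_measurable M" "T \<in> borel_measurable M" "Q \<in> borel_measurable M" "T2 \<in> borel_measurable M"
      unfolding R_def T_def Q_def T2_def by measurable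
    have ST: "S x = T x + R x" "S x = T2 x + Q x" for x
      unfolding S_def T_def R_def T2_def Q_def using N1[OF i] N2[OF i] fin by (auto simp: sum.subset_diff)
    have Rb: "\<bar>R x\<bar> \<le> D * C" and Qb: "\<bar>Q x\<bar> \<le> D * C" for x
      unfolding R_def Q_def using N1[OF i] N2[OF i] by (auto intro: sum_bound)
    have XR: "\<bar>X i x * R x\<bar> \<le> C * (D * C)" for x
      using C[of i x] Rb[of x] C0 by (auto simp: abs_mult intro!: mult_mono)
    have W: "s * W x = t * T x + t * R x" "s * W x = t * T2 x + t * Q x" for x
      using arg_cong[OF ST(1)[of x], of "\<lambda>y. t * y"] arg_cong[OF ST(2)[of x], of "\<lambda>y. t * y"]
      by (simp_all only: W_def t_def distrib_left mult.assoc)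
    have dQ: "\<bar>t * Q x\<bar> \<le> \<bar>t\<bar> * (D * C)" and dR: "\<bar>t * R x\<bar> \<le> \<bar>t\<bar> * (D * C)" for x
      using Qb[of x] Rb[of x] by (auto simp: abs_mult intro!: mult_left_mono)
    let ?E = expectation
    have I1: "integrable M (\<lambda>x. X i x * iexp (g x))" if [measurable]: "g \<in> borel_measurable M" for g
      using C by (intro integrable_const_bound[where B = C]) (auto simp: norm_mult)
    have I2: "integrable M (\<lambda>x. complex_of_real (X i x * R x) * iexp (g x))" if [measurable]: "g \<in> borel_measurable M" for g
      using XR by (intro integrable_const_bound[where B = "C * (D * C)"]) (auto simp: norm_mult abs_mult)
    \<comment> \<open>By \<open>ind1\<close> the zeroth-order term vanishes, so the expansion of the
      exponential around \<open>T\<close> starts with the linear term in \<open>R\<close>.\<close>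
    have e1: "cmod (?E (\<lambda>x. X i x * iexp (s * W x)) - \<i> * t * ?E (\<lambda>x. complex_of_real (X i x * R x) * iexp (t * T x)))
      \<le> C * ((\<bar>t\<bar> * (D * C))\<^sup>2 / 2)"
    proof -
      have "?E (\<lambda>x. X i x * iexp (s * W x)) - \<i> * t * ?E (\<lambda>x. complex_of_real (X i x * R x) * iexp (t * T x))
        = ?E (\<lambda>x. X i x * iexp (s * W x)) - ?E (\<lambda>x. X i x * iexp (t * T x)) - ?E (\<lambda>x. \<i> * t * (complex_of_real (X i x * R x) * iexp (t * T x)))"
        using ind1[OF i, of t] unfolding T_def by simp
      also have "\<dots> = ?E (\<lambda>x. X i x * iexp (s * W x) - X i x * iexp (t * T x) - \<i> * t * (complex_of_real (X i x * R x) * iexp (t * T x)))"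
      proof -
        have J: "integrable M (\<lambda>x. X i x * iexp (s * W x))" "integrable M (\<lambda>x. X i x * iexp (t * T x))"
          by (intro I1; measurable)+
        have J3: "integrable M (\<lambda>x. \<i> * t * (complex_of_real (X i x * R x) * iexp (t * T x)))"
          by (intro integrable_mult_right I2) measurable
        show ?thesis
          unfolding Bochner_Integration.integral_diff[OF Bochner_Integration.integrable_diff[OF J] J3]
            Bochner_Integration.integral_diff[OF J] ..
      qed
      also have "cmod \<dots> \<le> C * ((\<bar>t\<bar> * (D * C))\<^sup>2 / 2)"
      proof (rule norm_expectation_le)
        fix x
        have "X i x * iexp (s * W x) - X i x * iexp (t * T x) - \<i> * t * (complex_of_real (X i x * R x) * iexp (t * T x))
          = X i x * (iexp (t * T x) * (iexp (t * R x) - 1 - \<i> * (t * R x)))"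
          unfolding W(1) by (simp add: distrib_left exp_add right_diff_distrib mult_ac)
        also have "cmod \<dots> \<le> C * ((t * R x)\<^sup>2 / 2)"
          unfolding norm_mult using C[of i x] C0 iexp_taylor2[of "t * R x"]
          by (intro mult_mono) (auto simp: norm_mult)
        also have "\<dots> \<le> C * ((\<bar>t\<bar> * (D * C))\<^sup>2 / 2)"
          using dR[of x] C0 D0 by (intro mult_left_mono divide_right_mono) (auto simp: abs_le_square_iff[symmetric] abs_mult)
        finally show "cmod (X i x * iexp (s * W x) - X i x * iexp (t * T x) - \<i> * t * (complex_of_real (X i x * R x) * iexp (t * T x)))
          \<le> C * ((\<bar>t\<bar> * (D * C))\<^sup>2 / 2)" .
      qed measurable
      finally show ?thesis .
    qed
    \<comment> \<open>The factor \<open>X i x * R x\<close> need not be independent of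
      \<open>T\<close>; exchanging \<open>T\<close> for \<open>T2\<close> makes \<open>ind2\<close>
      applicable.\<close>
    have e2: "cmod (?E (\<lambda>x. complex_of_real (X i x * R x) * iexp (t * T x)) - ?E (\<lambda>x. complex_of_real (X i x * R x) * iexp (t * T2 x)))
      \<le> C * (D * C) * (2 * (\<bar>t\<bar> * (D * C)))"
    proof -
      have "?E (\<lambda>x. complex_of_real (X i x * R x) * iexp (t * T x)) - ?E (\<lambda>x. complex_of_real (X i x * R x) * iexp (t * T2 x))
        = ?E (\<lambda>x. complex_of_real (X i x * R x) * iexp (t * T x) - complex_of_real (X i x * R x) * iexp (t * T2 x))"
        by (intro Bochner_Integration.integral_diff[symmetric] I2) measurable
      also have "cmod \<dots> \<le> C * (D * C) * (2 * (\<bar>t\<bar> * (D * C)))"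
      proof (rule norm_expectation_le)
        fix x
        have "cmod (iexp (t * T x) - iexp (t * T2 x)) \<le> \<bar>t * T x - t * T2 x\<bar>" by (rule iexp_diff_bound)
        also have "\<dots> \<le> 2 * (\<bar>t\<bar> * (D * C))" using W[of x] dQ[of x] dR[of x] by linarith
        finally have "cmod (complex_of_real (X i x * R x) * (iexp (t * T x) - iexp (t * T2 x))) \<le> C * (D * C) * (2 * (\<bar>t\<bar> * (D * C)))"
          unfolding norm_mult norm_of_real using XR[of x] C0 D0 by (intro mult_mono) auto
        then show "cmod (complex_of_real (X i x * R x) * iexp (t * T x) - complex_of_real (X i x * R x) * iexp (t * T2 x))
          \<le> C * (D * C) * (2 * (\<bar>t\<bar> * (D * C)))" by (simp only: right_diff_distrib)
      qed measurable
      finally show ?thesis .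
    qed
    \<comment> \<open>Factor by \<open>ind2\<close>, then restore the full sum inside the
      exponential to recover \<open>\<phi> s\<close>.\<close>
    have e3: "cmod (?E (\<lambda>x. complex_of_real (X i x * R x) * iexp (t * T2 x)) - c i * \<phi> s) \<le> C * (D * C) * (\<bar>t\<bar> * (D * C))"
    proof -
      have ci: "?E (\<lambda>x. complex_of_real (X i x * R x)) = c i" by (simp only: c_def R_def integral_complex_of_real)
      have cb: "cmod (c i) \<le> C * (D * C)" unfolding ci[symmetric] using XR by (intro norm_expectation_le) (auto simp only: norm_of_real, measurable)
      have "?E (\<lambda>x. complex_of_real (X i x * R x) * iexp (t * T2 x)) - c i * \<phi> s = c i * (?E (\<lambda>x. iexp (t * T2 x)) - \<phi> s)"
        using ind2[OF i, of t] unfolding R_def[symmetric] T2_def[symmetric] ci by (simp add: right_diff_distrib)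
      also have "cmod \<dots> \<le> C * (D * C) * (\<bar>t\<bar> * (D * C))"
        unfolding norm_mult
      proof (intro mult_mono cb)
        have "?E (\<lambda>x. iexp (t * T2 x)) - \<phi> s = ?E (\<lambda>x. iexp (t * T2 x) - iexp (s * W x))"
          unfolding \<phi>_def by (intro Bochner_Integration.integral_diff[symmetric] integrable_iexp) measurable
        also have "cmod \<dots> \<le> \<bar>t\<bar> * (D * C)"
        proof (rule norm_expectation_le)
          fix x
          have "cmod (iexp (t * T2 x) - iexp (s * W x)) \<le> \<bar>t * T2 x - s * W x\<bar>" by (rule iexp_diff_bound)
          also have "\<dots> \<le> \<bar>t\<bar> * (D * C)" using W(2)[of x] dQ[of x] by linarith
          finally show "cmod (iexp (t * T2 x) - iexp (s * W x)) \<le> \<bar>t\<bar> * (D * C)" .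
        qed measurable
        finally show "cmod (?E (\<lambda>x. iexp (t * T2 x)) - \<phi> s) \<le> \<bar>t\<bar> * (D * C)" .
      qed (use C0 D0 in auto)
      finally show ?thesis .
    qed
    let ?a = "?E (\<lambda>x. X i x * iexp (s * W x))" and ?b = "?E (\<lambda>x. complex_of_real (X i x * R x) * iexp (t * T x))"
      and ?c = "?E (\<lambda>x. complex_of_real (X i x * R x) * iexp (t * T2 x))"
    have "?a - \<i> * t * c i * \<phi> s = (?a - \<i> * t * ?b) + \<i> * t * ((?b - ?c) + (?c - c i * \<phi> s))"
      by (simp add: algebra_simps)
    also have "cmod \<dots> \<le> C * ((\<bar>t\<bar> * (D * C))\<^sup>2 / 2) + \<bar>t\<bar> * (C * (D * C) * (2 * (\<bar>t\<bar> * (D * C))) + C * (D * C) * (\<bar>t\<bar> * (D * C)))"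
    proof (rule norm_triangle_mono[OF e1])
      have "cmod ((?b - ?c) + (?c - c i * \<phi> s)) \<le> C * (D * C) * (2 * (\<bar>t\<bar> * (D * C))) + C * (D * C) * (\<bar>t\<bar> * (D * C))"
        by (rule norm_triangle_mono[OF e2 e3])
      then show "cmod (\<i> * t * ((?b - ?c) + (?c - c i * \<phi> s))) \<le> \<bar>t\<bar> * (C * (D * C) * (2 * (\<bar>t\<bar> * (D * C))) + C * (D * C) * (\<bar>t\<bar> * (D * C)))"
        by (simp add: norm_mult mult_left_mono)
    qed
    also have "\<dots> = 7 / 2 * (D\<^sup>2 * C ^ 3 * t\<^sup>2)"
      by (simp add: power2_eq_square power3_eq_cube algebra_simps)
    also have "\<dots> \<le> 4 * (D\<^sup>2 * C ^ 3 * t\<^sup>2)" using C0 D0 by (intro mult_right_mono) auto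
    finally show ?thesis by (simp add: err_def t_def mult.assoc)
  qed
  have ode: "cmod (\<phi>' s + s * v * \<phi> s) \<le> 4 * D\<^sup>2 * C ^ 3 * s\<^sup>2 * h" for s
  proof -
    have I1: "integrable M (\<lambda>x. X i x * iexp (s * W x))" for i
      using C by (intro integrable_const_bound[where B = C]) (auto simp: norm_mult)
    have "\<phi>' s = expectation (\<lambda>x. \<Sum>i\<in>V. \<i> * h * (X i x * iexp (s * W x)))"
      unfolding \<phi>'_def by (intro Bochner_Integration.integral_cong refl)
        (simp add: W_def S_def sum_distrib_left sum_distrib_right mult_ac)
    also have "\<dots> = (\<Sum>i\<in>V. \<i> * h * expectation (\<lambda>x. X i x * iexp (s * W x)))"
      by (subst Bochner_Integration.integral_sum, intro integrable_mult_right I1) simp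
    finally have "\<phi>' s = (\<Sum>i\<in>V. \<i> * h * expectation (\<lambda>x. X i x * iexp (s * W x)))" .
    moreover have "s * v * \<phi> s = - (\<Sum>i\<in>V. \<i> * h * (\<i> * (s * h) * c i * \<phi> s))"
    proof -
      have "h * h * (\<Sum>i\<in>V. c i) = v"
        unfolding v c_def[symmetric] using h n by (simp add: field_simps)
      then have "v = (\<Sum>i\<in>V. h * h * c i)" by (simp add: sum_distrib_left)
      then show ?thesis
        by (simp add: sum_distrib_left sum_distrib_right sum_negf[symmetric] mult_ac)
    qed
    ultimately have "\<phi>' s + s * v * \<phi> s = (\<Sum>i\<in>V. \<i> * h * (expectation (\<lambda>x. X i x * iexp (s * W x)) - \<i> * (s * h) * c i * \<phi> s))"
      by (simp add: right_diff_distrib sum_subtractf)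
    also have "cmod \<dots> \<le> (\<Sum>i\<in>V. h * err s)"
      using step h by (intro sum_norm_le) (simp add: norm_mult)
    also have "\<dots> = n * (h * err s)" using n by simp
    also have "\<dots> = 4 * D\<^sup>2 * C ^ 3 * s\<^sup>2 * h * (h * h * n)" by (simp add: err_def power2_eq_square mult_ac)
    finally show ?thesis using h by simp
  qed
  define K where "K = 4 * D\<^sup>2 * C ^ 3 * h"
  have K: "K \<ge> 0" using C0 h by (simp add: K_def)
  \<comment> \<open>Integrating factor: the derivative of
    \<open>\<phi> s * exp (s\<^sup>2 * v / 2)\<close> is the left side of \<open>ode\<close> times
    the exponential. The absolute value of \<open>v\<close> appears because its sign is left
    open.\<close>
  have "cmod (\<phi> s * exp (s\<^sup>2 * v / 2) - \<phi> 0 * exp (0\<^sup>2 * v / 2)) \<le> exp (s\<^sup>2 * \<bar>v\<bar> / 2) * (K * s\<^sup>2) * \<bar>s\<bar>"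
  proof (rule vector_derivative_norm_bound)
    fix x assume x: "\<bar>x\<bar> \<le> \<bar>s\<bar>"
    have "((\<lambda>s. exp (s\<^sup>2 * v / 2)) has_real_derivative (x * v) * exp (x\<^sup>2 * v / 2)) (at x)"
      by (auto intro!: derivative_eq_intros)
    then have "((\<lambda>s. complex_of_real (exp (s\<^sup>2 * v / 2))) has_vector_derivative complex_of_real ((x * v) * exp (x\<^sup>2 * v / 2))) (at x)"
      by (intro has_vector_derivative_of_real) (simp add: has_real_derivative_iff_has_vector_derivative)
    from has_vector_derivative_mult[OF der this]
    show "((\<lambda>s. \<phi> s * exp (s\<^sup>2 * v / 2)) has_vector_derivative (\<phi>' x + x * v * \<phi> x) * exp (x\<^sup>2 * v / 2)) (at x)"
      by (simp add: algebra_simps)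
    have x2: "x\<^sup>2 \<le> s\<^sup>2" using x by (simp add: abs_le_square_iff)
    have "cmod ((\<phi>' x + x * v * \<phi> x) * exp (x\<^sup>2 * v / 2)) \<le> (4 * D\<^sup>2 * C ^ 3 * x\<^sup>2 * h) * exp (x\<^sup>2 * v / 2)"
      unfolding norm_mult norm_of_real using ode[of x] by (simp add: mult_right_mono)
    also have "\<dots> = K * x\<^sup>2 * exp (x\<^sup>2 * v / 2)" by (simp add: K_def mult_ac)
    also have "\<dots> \<le> K * s\<^sup>2 * exp (s\<^sup>2 * \<bar>v\<bar> / 2)"
    proof (rule mult_mono)
      show "K * x\<^sup>2 \<le> K * s\<^sup>2" using x2 K by (rule mult_left_mono)
      have "x\<^sup>2 * v \<le> x\<^sup>2 * \<bar>v\<bar>" by (intro mult_left_mono) auto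
      also have "\<dots> \<le> s\<^sup>2 * \<bar>v\<bar>" using x2 by (intro mult_right_mono) auto
      finally have "x\<^sup>2 * v \<le> s\<^sup>2 * \<bar>v\<bar>" .
      then show "exp (x\<^sup>2 * v / 2) \<le> exp (s\<^sup>2 * \<bar>v\<bar> / 2)" by simp
    qed (use K in auto)
    finally show "cmod ((\<phi>' x + x * v * \<phi> x) * exp (x\<^sup>2 * v / 2)) \<le> exp (s\<^sup>2 * \<bar>v\<bar> / 2) * (K * s\<^sup>2)" by (simp add: mult_ac)
  qed
  moreover have "\<phi> 0 = 1" by (simp add: \<phi>_def prob_space)
  ultimately have "cmod (\<phi> s * exp (s\<^sup>2 * v / 2) - 1) \<le> exp (s\<^sup>2 * \<bar>v\<bar> / 2) * (K * s\<^sup>2) * \<bar>s\<bar>" by simp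
  \<comment> \<open>Undoing the integrating factor costs another factor bounded by the same
    exponential, whence the full \<open>exp (s\<^sup>2 * \<bar>v\<bar>)\<close> in the
    result.\<close>
  then have "exp (- (s\<^sup>2 * v / 2)) * cmod (\<phi> s * exp (s\<^sup>2 * v / 2) - 1)
    \<le> exp (s\<^sup>2 * \<bar>v\<bar> / 2) * (exp (s\<^sup>2 * \<bar>v\<bar> / 2) * (K * s\<^sup>2) * \<bar>s\<bar>)"
  proof (rule mult_mono[rotated])
    have "- (s\<^sup>2 * v) \<le> s\<^sup>2 * \<bar>v\<bar>" using mult_left_mono[of "-v" "\<bar>v\<bar>" "s\<^sup>2"] by simp
    then show "exp (- (s\<^sup>2 * v / 2)) \<le> exp (s\<^sup>2 * \<bar>v\<bar> / 2)" by simp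
  qed auto
  also have "\<dots> = K * exp (s\<^sup>2 * \<bar>v\<bar>) * \<bar>s\<bar> ^ 3"
  proof -
    have "exp (s\<^sup>2 * \<bar>v\<bar>) = exp (s\<^sup>2 * \<bar>v\<bar> / 2) * exp (s\<^sup>2 * \<bar>v\<bar> / 2)" by (simp flip: exp_add)
    then show ?thesis by (simp add: power3_eq_cube power2_eq_square mult_ac)
  qed
  also have "exp (- (s\<^sup>2 * v / 2)) * cmod (\<phi> s * exp (s\<^sup>2 * v / 2) - 1) = cmod (\<phi> s - complex_of_real (exp (- (s\<^sup>2 * v / 2))))"
  proof -
    have "complex_of_real (exp (- (s\<^sup>2 * v / 2))) * (\<phi> s * exp (s\<^sup>2 * v / 2) - 1) = \<phi> s - complex_of_real (exp (- (s\<^sup>2 * v / 2)))"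
      by (simp add: right_diff_distrib mult.left_commute[of _ "\<phi> s"] flip: of_real_mult exp_add)
    then show ?thesis by (metis norm_mult norm_of_real abs_exp_cancel)
  qed
  finally show ?thesis
    unfolding \<phi>_def W_def S_def K_def h_def by (simp add: mult_ac)
qed

end

subsection \<open>Permutations of a given cycle type\<close>

text \<open>Transports the shift modulo the cardinality along a numbering of
  \<open>C\<close>.\<close>

lemma ex_cyclic_permutation:
  assumes "finite C" "C \<noteq> {}"
  obtains c where "c permutes C" "cyclic_on c C"
proof -
  define k where "k = card C"
  have k: "k > 0" using assms by (simp add: k_def card_gt_0_iff)
  obtain h where h: "bij_betw h {0..<k} C" using ex_bij_betw_nat_finite[OF assms(1)] unfolding k_def by blast
  define f where "f i = Suc i mod k" for i
  have fn: "(f ^^ n) 0 = n mod k" for n by (induction n) (auto simp: f_def mod_Suc_eq)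
  have "orbit f 0 = {0..<k}"
  proof
    show "orbit f 0 \<subseteq> {0..<k}" using k by (auto simp: orbit_altdef fn)
    show "{0..<k} \<subseteq> orbit f 0"
    proof
      fix i assume "i \<in> {0..<k}"
      \<comment> \<open>An orbit consists of positive iterates; the extra round of \<open>k\<close>
        steps is what reaches 0 itself.\<close>
      then have "(f ^^ (i + k)) 0 = i" "0 < i + k" using k by (auto simp: fn)
      then show "i \<in> orbit f 0" unfolding orbit_altdef by (metis (mono_tags, lifting) mem_Collect_eq)
    qed
  qed
  then have cyc: "cyclic_on f {0..<k}" using k unfolding cyclic_on_def by (intro bexI[of _ 0]) auto
  have "inj_on f {0..<k}"
  proof (rule inj_onI)
    fix x y assume "x \<in> {0..<k}" "y \<in> {0..<k}" "f x = f y"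
    then show "x = y" by (auto simp: f_def mod_Suc split: if_splits)
  qed
  moreover have "f ` {0..<k} \<subseteq> {0..<k}" using k by (auto simp: f_def)
  ultimately have bf: "bij_betw f {0..<k} {0..<k}" by (auto simp: bij_betw_def endo_inj_surj)
  define g where "g = the_inv_into {0..<k} h"
  have gh: "g (h i) = i" if "i \<in> {0..<k}" for i
    unfolding g_def using h that by (intro the_inv_into_f_f) (auto simp: bij_betw_def)
  have bg: "bij_betw g C {0..<k}" unfolding g_def by (rule bij_betw_the_inv_into[OF h])
  define c where "c x = (if x \<in> C then h (f (g x)) else x)" for x
  have "bij_betw (h \<circ> (f \<circ> g)) C C" by (intro bij_betw_trans[OF bij_betw_trans[OF bg bf] h])
  then have "bij_betw c C C" by (rule bij_betw_cong[THEN iffD1, rotated]) (auto simp: c_def)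
  then have "c permutes C" by (rule bij_imp_permutes) (auto simp: c_def)
  moreover have "cyclic_on c (h ` {0..<k})"
  proof (rule cyclic_on_image[OF cyc])
    fix i assume i: "i \<in> {0..<k}"
    then have "h i \<in> C" using h by (auto simp: bij_betw_def)
    then show "c (h i) = h (f i)" using gh[OF i] by (simp add: c_def)
  qed
  then have "cyclic_on c C" using h by (simp add: bij_betw_def)
  ultimately show ?thesis by (rule that)
qed

text \<open>The ground set is a parameter because the existence proof below removes the points of
  one cycle at a time.\<close>

definition cycles :: "('a \<Rightarrow> 'a) \<Rightarrow> 'a set \<Rightarrow> nat \<Rightarrow> 'a set set"
  where "cycles \<tau> S p = {C. C \<subseteq> S \<and> cyclic_on \<tau> C \<and> card C = p}"

text \<open>Induction on the ground set: split off as many points as the length of one prescribed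
  cycle, permute them cyclically, and compose with a permutation of the rest. The purpose is that
  \<open>t_cyclic n t\<close> is nonempty, so that a uniform law on it makes sense.\<close>

lemma permutation_with_cycle_type:
  assumes "finite S" "(\<Sum>p=1..N. p * t p) = card S"
  shows "\<exists>\<tau>. \<tau> permutes S \<and> (\<forall>p\<in>{1..N}. card (cycles \<tau> S p) = t p)"
  using assms
proof (induction "card S" arbitrary: S t rule: less_induct)
  case less
  show ?case
  proof (cases "\<exists>p\<in>{1..N}. t p > 0")
    case False
    then have "card S = 0" using less.prems(2) by simp
    then have S: "S = {}" using less.prems(1) by simp
    have "cycles id S p = {}" for p unfolding S cycles_def by (auto simp: cyclic_on_alldef)
    then show ?thesis using False permutes_id[of S] by (intro exI[of _ id]) auto
  next
    case True
    then obtain p0 where p0: "p0 \<in> {1..N}" "t p0 > 0" by blast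
    define t' where "t' = t(p0 := t p0 - 1)"
    have sum: "(\<Sum>p=1..N. p * t p) = p0 + (\<Sum>p=1..N. p * t' p)"
    proof -
      have "(\<Sum>p=1..N. p * t p) = p0 * t p0 + (\<Sum>p\<in>{1..N} - {p0}. p * t p)"
        using p0(1) by (simp add: sum.remove)
      moreover have "(\<Sum>p=1..N. p * t' p) = p0 * (t p0 - 1) + (\<Sum>p\<in>{1..N} - {p0}. p * t p)"
        using p0(1) by (subst sum.remove[of _ p0]) (auto simp: t'_def intro!: sum.cong)
      moreover have "p0 * t p0 = p0 + p0 * (t p0 - 1)" using p0(2) by (cases "t p0") auto
      ultimately show ?thesis by linarith
    qed
    then have "p0 \<le> card S" using less.prems by simp
    then obtain C0 where C0: "C0 \<subseteq> S" "card C0 = p0" using obtain_subset_with_card_n by metis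
    have finC: "finite C0" using C0 less.prems finite_subset by blast
    have C0ne: "C0 \<noteq> {}" using C0 p0 by auto
    have cardD: "card (S - C0) = card S - p0" using C0 finC by (simp add: card_Diff_subset)
    have "\<exists>\<tau>'. \<tau>' permutes (S - C0) \<and> (\<forall>p\<in>{1..N}. card (cycles \<tau>' (S - C0) p) = t' p)"
    proof (rule less.hyps)
      show "card (S - C0) < card S" using cardD p0(1) \<open>p0 \<le> card S\<close> by simp
      show "finite (S - C0)" using less.prems(1) by simp
      show "(\<Sum>p=1..N. p * t' p) = card (S - C0)" using sum less.prems(2) cardD by linarith
    qed
    then obtain \<tau>' where \<tau>': "\<tau>' permutes (S - C0)" "\<And>p. p \<in> {1..N} \<Longrightarrow> card (cycles \<tau>' (S - C0) p) = t' p"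
      by blast
    obtain c where c: "c permutes C0" "cyclic_on c C0" using ex_cyclic_permutation[OF finC C0ne] .
    define \<tau> where "\<tau> = c \<circ> \<tau>'"
    have \<tau>_C0: "\<tau> x = c x" if "x \<in> C0" for x
      using that permutes_not_in[OF \<tau>'(1), of x] by (simp add: \<tau>_def)
    have \<tau>_out: "\<tau> x = \<tau>' x" if "x \<in> S - C0" for x
    proof -
      have "\<tau>' x \<in> S - C0" using permutes_in_image[OF \<tau>'(1)] that by blast
      then show ?thesis using permutes_not_in[OF c(1), of "\<tau>' x"] by (simp add: \<tau>_def)
    qed
    have perm: "\<tau> permutes S"
      unfolding \<tau>_def using permutes_subset[OF c(1) C0(1)] permutes_subset[OF \<tau>'(1), of S]
      by (intro permutes_compose) auto
    have cyc0: "cyclic_on \<tau> C0"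
      using cyclic_cong[of C0 \<tau> c] \<tau>_C0 c(2) by blast
    have cyc_out: "cyclic_on \<tau> C \<longleftrightarrow> cyclic_on \<tau>' C" if "C \<subseteq> S - C0" for C
      by (rule cyclic_cong) (use \<tau>_out that in auto)
    have split: "C = C0 \<or> C \<subseteq> S - C0" if "C \<subseteq> S" "cyclic_on \<tau> C" for C
    proof (cases "C \<inter> C0 = {}")
      case True then show ?thesis using that by auto
    next
      case False
      then obtain x where "x \<in> C" "x \<in> C0" by blast
      then have "C = orbit \<tau> x" "C0 = orbit \<tau> x"
        using orbit_cyclic_eq3[OF that(2)] orbit_cyclic_eq3[OF cyc0] by auto
      then show ?thesis by simp
    qed
    have cyc_eq: "cycles \<tau> S p = (if p = p0 then insert C0 (cycles \<tau>' (S - C0) p) else cycles \<tau>' (S - C0) p)" for p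
    proof -
      have mem: "C \<in> cycles \<tau> S p \<longleftrightarrow> C = C0 \<and> p = p0 \<or> C \<in> cycles \<tau>' (S - C0) p" for C
        unfolding cycles_def mem_Collect_eq using split[of C] cyc_out[of C] cyc0 C0 by blast
      show ?thesis
      proof (cases "p = p0")
        case True
        show ?thesis unfolding if_P[OF True] by (rule set_eqI) (unfold mem insert_iff, use True in blast)
      next
        case False
        show ?thesis unfolding if_not_P[OF False] by (rule set_eqI) (simp only: mem False simp_thms)
      qed
    qed
    have notin: "C0 \<notin> cycles \<tau>' (S - C0) p" for p
    proof
      assume "C0 \<in> cycles \<tau>' (S - C0) p"
      then have "C0 \<subseteq> S - C0" by (simp add: cycles_def)
      then show False using C0ne by blast
    qed
    have fin: "finite (cycles \<tau>' (S - C0) p)" for p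
    proof (rule finite_subset)
      show "cycles \<tau>' (S - C0) p \<subseteq> Pow (S - C0)" unfolding cycles_def by blast
      show "finite (Pow (S - C0))" using less.prems(1) by simp
    qed
    have "card (cycles \<tau> S p) = t p" if p: "p \<in> {1..N}" for p
    proof (cases "p = p0")
      case True
      have "card (cycles \<tau> S p) = Suc (card (cycles \<tau>' (S - C0) p))"
        unfolding cyc_eq[of p] if_P[OF True] by (rule card_insert_disjoint[OF fin notin])
      also have "\<dots> = Suc (t' p)" by (simp only: \<tau>'(2)[OF p])
      finally show ?thesis using True p0(2) by (simp add: t'_def)
    next
      case False
      have "card (cycles \<tau> S p) = t' p" unfolding cyc_eq[of p] if_not_P[OF False] by (rule \<tau>'(2)[OF p])
      then show ?thesis using False by (simp add: t'_def)
    qed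
    with perm show ?thesis by blast
  qed
qed

lemma num_cycles_eq: "num_cycles n \<tau> p = card (cycles \<tau> {1..n} p)"
  by (simp add: num_cycles_def cycles_def)

lemma t_cyclic_nonempty:
  assumes "is_cycle_type n t" shows "t_cyclic n t \<noteq> {}"
  using permutation_with_cycle_type[of "{1..n}" t n] assms
  unfolding is_cycle_type_def t_cyclic_def num_cycles_eq by auto

lemma finite_t_cyclic: "finite (t_cyclic n t)"
  by (rule finite_subset[of _ "perms n"]) (auto simp: t_cyclic_def intro: finite_permutations)

text \<open>Conjugation relabels: taking images under \<open>\<sigma>\<close> is a bijection between
  the cycles of the two permutations and preserves their lengths.\<close>

lemma num_cycles_conj:
  assumes s: "\<sigma> permutes {1..n}"
  shows "num_cycles n (\<sigma> \<circ> \<tau> \<circ> inv \<sigma>) p = num_cycles n \<tau> p"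
proof -
  have inj: "inj \<sigma>" by (rule permutes_inj[OF s])
  let ?A = "{C. C \<subseteq> {1..n} \<and> cyclic_on \<tau> C \<and> card C = p}"
  let ?B = "{C. C \<subseteq> {1..n} \<and> cyclic_on (\<sigma> \<circ> \<tau> \<circ> inv \<sigma>) C \<and> card C = p}"
  have "bij_betw (\<lambda>C. \<sigma> ` C) ?A ?B"
  proof (rule bij_betwI[where g = "\<lambda>C. inv \<sigma> ` C"])
    show "(\<lambda>C. \<sigma> ` C) \<in> ?A \<rightarrow> ?B"
    proof safe
      fix C x assume "C \<subseteq> {1..n}" "x \<in> C"
      then show "\<sigma> x \<in> {1..n}" using permutes_in_image[OF s] by blast
    next
      fix C assume "cyclic_on \<tau> C"
      then show "cyclic_on (\<sigma> \<circ> \<tau> \<circ> inv \<sigma>) (\<sigma> ` C)"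
        by (rule cyclic_on_image) (simp add: permutes_inverses(2)[OF s])
      show "card (\<sigma> ` C) = card C" using inj by (simp add: card_image inj_on_subset)
    qed
    show "(\<lambda>C. inv \<sigma> ` C) \<in> ?B \<rightarrow> ?A"
    proof safe
      fix C x assume "C \<subseteq> {1..n}" "x \<in> C"
      then show "inv \<sigma> x \<in> {1..n}" using permutes_in_image[OF permutes_inv[OF s]] by blast
    next
      fix C assume "cyclic_on (\<sigma> \<circ> \<tau> \<circ> inv \<sigma>) C"
      then show "cyclic_on \<tau> (inv \<sigma> ` C)"
        by (rule cyclic_on_image) (simp add: permutes_inverses(2)[OF s])
      show "card (inv \<sigma> ` C) = card C" using permutes_inj[OF permutes_inv[OF s]] by (simp add: card_image inj_on_subset)
    qed
  qed (simp_all add: image_image permutes_inverses[OF s])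
  then show ?thesis unfolding num_cycles_def by (rule bij_betw_same_card[symmetric])
qed

lemma conj_t_cyclic:
  assumes s: "\<sigma> permutes {1..n}" and t: "\<tau> \<in> t_cyclic n t"
  shows "\<sigma> \<circ> \<tau> \<circ> inv \<sigma> \<in> t_cyclic n t"
proof -
  have "\<tau> permutes {1..n}" using t by (simp add: t_cyclic_def)
  then have "\<sigma> \<circ> (\<tau> \<circ> inv \<sigma>) permutes {1..n}"
    by (intro permutes_compose permutes_inv s)
  then show ?thesis using t num_cycles_conj[OF s] by (simp add: t_cyclic_def comp_assoc)
qed

text \<open>Conjugation by \<open>\<sigma>\<close> permutes the class, with conjugation by
  \<open>inv \<sigma>\<close> as its inverse. This invariance is what lets random labels
  enter.\<close>

lemma sum_t_cyclic_conj:
  assumes s: "\<sigma> permutes {1..n}"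
  shows "(\<Sum>\<tau>\<in>t_cyclic n t. f (\<sigma> \<circ> \<tau> \<circ> inv \<sigma>)) = (\<Sum>\<tau>\<in>t_cyclic n t. f \<tau>)"
proof (rule sum.reindex_bij_witness[of _ "\<lambda>\<tau>. inv \<sigma> \<circ> \<tau> \<circ> \<sigma>" "\<lambda>\<tau>. \<sigma> \<circ> \<tau> \<circ> inv \<sigma>"])
  fix \<tau> assume t: "\<tau> \<in> t_cyclic n t"
  show "\<sigma> \<circ> \<tau> \<circ> inv \<sigma> \<in> t_cyclic n t" by (rule conj_t_cyclic[OF s t])
  have "inv \<sigma> \<circ> \<tau> \<circ> inv (inv \<sigma>) \<in> t_cyclic n t" by (rule conj_t_cyclic[OF permutes_inv[OF s] t])
  then show "inv \<sigma> \<circ> \<tau> \<circ> \<sigma> \<in> t_cyclic n t" by (simp add: permutes_inv_inv[OF s])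
qed (simp_all add: fun_eq_iff permutes_inverses[OF s])

lemma card_fixed_points:
  assumes "\<tau> \<in> t_cyclic n t" "n \<ge> 1"
  shows "card {i \<in> {1..n}. \<tau> i = i} = t 1"
proof -
  have "cycles \<tau> {1..n} 1 = (\<lambda>i. {i}) ` {i \<in> {1..n}. \<tau> i = i}"
  proof safe
    fix C assume C: "C \<in> cycles \<tau> {1..n} 1"
    then have "card C = 1" by (simp add: cycles_def)
    then obtain x where x: "C = {x}" by (rule card_1_singletonE)
    then have "orbit \<tau> x = {x}" using C orbit_cyclic_eq3[of \<tau> C x] by (simp add: cycles_def)
    then show "C \<in> (\<lambda>i. {i}) ` {i \<in> {1..n}. \<tau> i = i}"
      using x C by (auto simp: cycles_def orbit_eq_singleton_iff)
  next
    fix i assume "i \<in> {1..n}" "\<tau> i = i"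
    then show "{i} \<in> cycles \<tau> {1..n} 1"
      using orbit_eq_singleton_iff[of \<tau> i] by (auto simp: cycles_def intro: cyclic_on_singleI)
  qed
  then have "bij_betw (\<lambda>i. {i}) {i \<in> {1..n}. \<tau> i = i} (cycles \<tau> {1..n} 1)"
    by (simp add: bij_betw_def)
  then have "card {i \<in> {1..n}. \<tau> i = i} = card (cycles \<tau> {1..n} 1)" by (rule bij_betw_same_card)
  also have "\<dots> = t 1" using assms unfolding t_cyclic_def num_cycles_eq by auto
  finally show ?thesis .
qed

text \<open>The points counted form the disjoint union of the two-element cycles. The bound on
  \<open>n\<close> matters because \<open>t_cyclic\<close> prescribes the number of cycles only for
  lengths up to \<open>n\<close>.\<close>

lemma card_two_cycle_points:
  assumes t: "\<tau> \<in> t_cyclic n t" and n: "n \<ge> 2"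
  shows "card {i \<in> {1..n}. \<tau> i \<noteq> i \<and> \<tau> (\<tau> i) = i} = 2 * t 2"
proof -
  have perm: "\<tau> permutes {1..n}" using t by (simp add: t_cyclic_def)
  let ?C = "cycles \<tau> {1..n} 2"
  have orb: "orbit \<tau> x = {x, \<tau> x}" if "\<tau> (\<tau> x) = x" for x
  proof
    show "orbit \<tau> x \<subseteq> {x, \<tau> x}"
    proof
      fix y assume "y \<in> orbit \<tau> x" then show "y \<in> {x, \<tau> x}" by induction (use that in auto)
    qed
    have "\<tau> x \<in> orbit \<tau> x" by (rule orbit.base)
    then have "\<tau> (\<tau> x) \<in> orbit \<tau> x" by (rule orbit.step)
    then show "{x, \<tau> x} \<subseteq> orbit \<tau> x" using that orbit.base[of \<tau> x] by simp
  qed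
  have un: "\<Union>?C = {i \<in> {1..n}. \<tau> i \<noteq> i \<and> \<tau> (\<tau> i) = i}"
  proof safe
    fix i C assume C: "C \<in> ?C" and i: "i \<in> C"
    then have cyc: "cyclic_on \<tau> C" "card C = 2" "C \<subseteq> {1..n}" by (auto simp: cycles_def)
    show "i \<in> {1..n}" using cyc i by auto
    have Ci: "C = orbit \<tau> i" using orbit_cyclic_eq3[OF cyc(1) i] by simp
    show ne: False if "\<tau> i = i" using that cyc Ci orbit_eq_singleton_iff[of \<tau> i] by simp
    have ne': "\<tau> i \<noteq> i" using ne by blast
    have in_C: "\<tau> i \<in> C" "\<tau> (\<tau> i) \<in> C" using cyclic_on_inI[OF cyc(1)] i by auto
    have "C = {i, \<tau> i}"
      using in_C i ne' cyc(2) by (intro card_subset_eq[symmetric] finite_cyclic_on[OF cyc(1)]) auto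
    moreover have "\<tau> (\<tau> i) \<noteq> \<tau> i" using ne injD[OF permutes_inj[OF perm], of "\<tau> i" i] by auto
    ultimately show "\<tau> (\<tau> i) = i" using in_C by auto
  next
    fix i assume i: "i \<in> {1..n}" "\<tau> i \<noteq> i" "\<tau> (\<tau> i) = i"
    have "\<tau> i \<in> {1..n}" using permutes_in_image[OF perm] i by blast
    then have "{i, \<tau> i} \<in> ?C"
      using i orb[OF i(3)] by (auto simp: cycles_def cyclic_on_def)
    then show "i \<in> \<Union>?C" by blast
  qed
  have "2 * card ?C = card (\<Union>?C)"
  proof (rule card_partition)
    show "finite ?C" by (rule finite_subset[of _ "Pow {1..n}"]) (auto simp: cycles_def)
    show "finite (\<Union>?C)" unfolding un by simp
    show "card c = 2" if "c \<in> ?C" for c using that by (simp add: cycles_def)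
    fix c1 c2 assume c: "c1 \<in> ?C" "c2 \<in> ?C" "c1 \<noteq> c2"
    show "c1 \<inter> c2 = {}"
    proof (rule equals0I)
      fix x assume "x \<in> c1 \<inter> c2"
      then have "c1 = orbit \<tau> x" "c2 = orbit \<tau> x"
        using c orbit_cyclic_eq3[of \<tau> c1 x] orbit_cyclic_eq3[of \<tau> c2 x] by (simp_all add: cycles_def)
      with c show False by simp
    qed
  qed
  moreover have "card ?C = t 2" using t n unfolding t_cyclic_def num_cycles_eq by auto
  ultimately show ?thesis unfolding un by simp
qed

subsection \<open>Integration over finite products of real probability spaces\<close>

text \<open>Bounded everywhere, and measurable for the Borel product rather than for a particular
  product measure: the class does not depend on the laws of the coordinates, is closed under the
  operations used later, and yields integrability at once.\<close>

definition bmeas :: "'i set \<Rightarrow> (('i \<Rightarrow> real) \<Rightarrow> 'b::{real_normed_field, banach, second_countable_topology}) \<Rightarrow> bool"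
  where "bmeas V f \<longleftrightarrow> f \<in> borel_measurable (PiM V (\<lambda>_. borel)) \<and> (\<exists>B. \<forall>w. norm (f w) \<le> B)"

lemma bmeas_const [intro, simp]: "bmeas V (\<lambda>_. c)"
  by (auto simp: bmeas_def)

lemma bmeas_mult [intro]:
  assumes "bmeas V f" "bmeas V g" shows "bmeas V (\<lambda>w. f w * g w)"
proof -
  obtain A B where *: "\<And>w. norm (f w) \<le> A" "\<And>w. norm (g w) \<le> B"
    using assms by (auto simp: bmeas_def)
  then have "0 \<le> A" by (meson norm_ge_zero order_trans)
  with * have "norm (f w * g w) \<le> A * B" for w
    by (auto simp: norm_mult intro!: mult_mono)
  with assms show ?thesis by (auto simp: bmeas_def)
qed

lemma bmeas_add [intro]:
  assumes "bmeas V f" "bmeas V g" shows "bmeas V (\<lambda>w. f w + g w)"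
proof -
  obtain A B where *: "\<And>w. norm (f w) \<le> A" "\<And>w. norm (g w) \<le> B"
    using assms by (auto simp: bmeas_def)
  then have "norm (f w + g w) \<le> A + B" for w
    by (meson add_mono norm_triangle_le)
  with assms show ?thesis by (auto simp: bmeas_def)
qed

lemma bmeas_minus [intro]:
  assumes "bmeas V f" shows "bmeas V (\<lambda>w. - f w)"
  using assms by (auto simp: bmeas_def)

lemma bmeas_diff [intro]:
  assumes "bmeas V f" "bmeas V g" shows "bmeas V (\<lambda>w. f w - g w)"
  using bmeas_add[OF assms(1) bmeas_minus[OF assms(2)]] by simp

lemma bmeas_sum [intro]:
  assumes "\<And>i. i \<in> I \<Longrightarrow> bmeas V (f i)" shows "bmeas V (\<lambda>w. \<Sum>i\<in>I. f i w)"
  using assms by (induction I rule: infinite_finite_induct) auto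

lemma bmeas_prod [intro]:
  assumes "\<And>i. i \<in> I \<Longrightarrow> bmeas V (f i)" shows "bmeas V (\<lambda>w. \<Prod>i\<in>I. f i w)"
  using assms by (induction I rule: infinite_finite_induct) auto

lemma bmeas_power [intro]:
  assumes "bmeas V f" shows "bmeas V (\<lambda>w. f w ^ n)"
  using assms by (induction n) auto

lemma bmeas_abs [intro]:
  assumes "bmeas V (f :: _ \<Rightarrow> real)" shows "bmeas V (\<lambda>w. \<bar>f w\<bar>)"
  using assms by (auto simp: bmeas_def)

lemma bmeas_compose:
  fixes h :: "real \<Rightarrow> 'b::{real_normed_field, banach, second_countable_topology}"
  assumes "f \<in> borel_measurable (PiM V (\<lambda>_. borel))" "h \<in> borel_measurable borel"
    and "\<And>x. norm (h x) \<le> B"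
  shows "bmeas V (\<lambda>w. h (f w))"
  using assms by (auto simp: bmeas_def)

lemma bmeas_measurable [dest]: "bmeas V f \<Longrightarrow> f \<in> borel_measurable (PiM V (\<lambda>_. borel))"
  by (auto simp: bmeas_def)

lemma bmeas_iexp [intro]: "bmeas V f \<Longrightarrow> bmeas V (\<lambda>w. iexp (f w))"
  by (auto simp: bmeas_def intro!: exI[of _ 1])

lemma bmeas_of_real [intro]: "bmeas V f \<Longrightarrow> bmeas V (\<lambda>w. complex_of_real (f w))"
  by (auto simp: bmeas_def)

definition free_of :: "'i \<Rightarrow> (('i \<Rightarrow> real) \<Rightarrow> 'b) \<Rightarrow> bool"
  where "free_of x f \<longleftrightarrow> (\<forall>w y. f (w(x := y)) = f w)"

text \<open>Pointwise counterpart of being measurable with respect to the coordinates in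
  \<open>A\<close>; \<open>free_of x\<close> is the case where \<open>A\<close> is the complement of
  \<open>x\<close>.\<close>

definition dep :: "'i set \<Rightarrow> (('i \<Rightarrow> real) \<Rightarrow> 'b) \<Rightarrow> bool"
  where "dep A f \<longleftrightarrow> (\<forall>w w'. (\<forall>i\<in>A. w i = w' i) \<longrightarrow> f w = f w')"

lemma dep_free_of: "dep A f \<Longrightarrow> x \<notin> A \<Longrightarrow> free_of x f"
  by (auto simp: dep_def free_of_def)

lemma dep_mono: "dep A f \<Longrightarrow> A \<subseteq> B \<Longrightarrow> dep B f"
  by (auto simp: dep_def)

text \<open>The factors may differ from one another, so that Dirac masses can be mixed with uniform
  laws.\<close>

locale real_product = finite_product_prob_space M V for M :: "'i \<Rightarrow> real measure" and V +
  assumes sets_M: "\<And>i. sets (M i) = sets borel"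
begin

lemmas finite_V = finite_index

lemma sets_PiM_borel: "sets (PiM V M) = sets (PiM V (\<lambda>_. borel))"
  by (intro sets_PiM_cong) (auto simp: sets_M)

lemma space_M: "space (M i) = UNIV"
  using sets_eq_imp_space_eq[OF sets_M] by simp

lemma bmeas_borel: "bmeas V f \<Longrightarrow> f \<in> borel_measurable (PiM V M)"
  by (auto simp: bmeas_def cong: measurable_cong_sets[OF sets_PiM_borel refl])

lemma bmeas_integrable:
  assumes "bmeas V f" shows "integrable (PiM V M) f"
proof -
  obtain B where "\<And>w. norm (f w) \<le> B" using assms by (auto simp: bmeas_def)
  then show ?thesis
    by (intro P.integrable_const_bound[where B = B]) (auto simp: bmeas_borel[OF assms])
qed

text \<open>The outer integral stays over the full product although its integrand has lost the
  coordinate \<open>x\<close>. The index set never changes, and coordinates can be integrated out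
  one after another.\<close>

lemma integral_coordinate:
  assumes f: "bmeas V f" and x: "x \<in> V"
  shows "(\<integral>w. f w \<partial>PiM V M) = (\<integral>w. (\<integral>y. f (w(x := y)) \<partial>M x) \<partial>PiM V M)"
proof -
  let ?V = "V - {x}"
  have V: "insert x ?V = V" using x by auto
  have fin: "finite ?V" using finite_V by auto
  let ?g = "\<lambda>w. (\<integral>y. f (w(x := y)) \<partial>M x)"
  have "(\<integral>w. f w \<partial>PiM V M) = (\<integral>w. ?g w \<partial>PiM ?V M)"
    using product_integral_insert[of ?V x f, unfolded V] bmeas_integrable[OF f] fin by blast
  also have "\<dots> = (\<integral>w. ?g w \<partial>distr (PiM V M) (PiM ?V M) (\<lambda>w. restrict w ?V))"
    using distr_PiM_restrict_finite[of ?V] fin by simp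
  also have "\<dots> = (\<integral>w. ?g (restrict w ?V) \<partial>PiM V M)"
  proof (rule integral_distr)
    show "(\<lambda>w. restrict w ?V) \<in> PiM V M \<rightarrow>\<^sub>M PiM ?V M"
      by (rule measurable_restrict_subset) auto
    interpret M: prob_space "M x" by (rule M.prob_space_axioms)
    have "(\<lambda>(w, y). w(x := y)) \<in> PiM ?V M \<Otimes>\<^sub>M M x \<rightarrow>\<^sub>M PiM (insert x ?V) M"
      by (rule measurable_add_dim)
    from measurable_comp[OF this[unfolded V] bmeas_borel[OF f]]
    have "(\<lambda>(w, y). f (w(x := y))) \<in> borel_measurable (PiM ?V M \<Otimes>\<^sub>M M x)"
      by (simp add: comp_def case_prod_beta)
    then show "?g \<in> borel_measurable (PiM ?V M)"
      by measurable
  qed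
  also have "\<dots> = (\<integral>w. ?g w \<partial>PiM V M)"
  proof (rule Bochner_Integration.integral_cong[OF refl])
    fix w assume "w \<in> space (PiM V M)"
    \<comment> \<open>Restriction changes a point of the product only at \<open>x\<close>, where the
      update overwrites it.\<close>
    then have "(restrict w ?V)(x := y) = w(x := y)" for y
      by (auto simp: space_PiM fun_eq_iff PiE_def extensional_def)
    then show "?g (restrict w ?V) = ?g w" by simp
  qed
  finally show ?thesis .
qed

lemma integral_one_coordinate:
  assumes "bmeas V f" "x \<in> V" "\<And>w. (\<integral>y. f (w(x := y)) \<partial>M x) = g w"
  shows "(\<integral>w. f w \<partial>PiM V M) = (\<integral>w. g w \<partial>PiM V M)"
  using integral_coordinate[OF assms(1,2)] assms(3) by simp

text \<open>Independence of functions of disjoint sets of coordinates, by Fubini for the splitting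
  of \<open>V\<close> into its part in \<open>A\<close> and the rest.\<close>

lemma integral_mult_dep:
  fixes f g :: "('i \<Rightarrow> real) \<Rightarrow> 'b::{real_normed_field, banach, second_countable_topology}"
  assumes f: "bmeas V f" and g: "bmeas V g" and df: "dep A f" and dg: "dep B g" and AB: "A \<inter> B = {}"
  shows "(\<integral>w. f w * g w \<partial>PiM V M) = (\<integral>w. f w \<partial>PiM V M) * (\<integral>w. g w \<partial>PiM V M)"
proof -
  let ?A = "V \<inter> A" and ?B = "V - A"
  have V: "?A \<union> ?B = V" and fin: "finite ?A" "finite ?B" and disj: "?A \<inter> ?B = {}"
    using finite_V by auto
  \<comment> \<open>Filler values: \<open>f\<close> does not see the coordinates outside
    \<open>A\<close>, nor \<open>g\<close> those in \<open>A\<close>.\<close>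
  define z where "z = restrict (\<lambda>_. 0 :: real) V"
  define f' where "f' x = f (merge ?A ?B (x, restrict z ?B))" for x
  define g' where "g' y = g (merge ?A ?B (restrict z ?A, y))" for y
  have fold: "(\<integral>w. h w \<partial>PiM V M) = (\<integral>x. (\<integral>y. h (merge ?A ?B (x, y)) \<partial>PiM ?B M) \<partial>PiM ?A M)"
    if "bmeas V h" for h :: "('i \<Rightarrow> real) \<Rightarrow> 'b"
    using product_integral_fold[of ?A ?B h] fin disj bmeas_integrable[OF that] by (simp add: V)
  have f': "f (merge ?A ?B (x, y)) = f' x" if "x \<in> space (PiM ?A M)" "y \<in> space (PiM ?B M)" for x y
    unfolding f'_def
  proof (rule df[unfolded dep_def, rule_format])
    fix i assume "i \<in> A"
    then show "merge ?A ?B (x, y) i = merge ?A ?B (x, restrict z ?B) i"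
      by (cases "i \<in> V") (auto simp: merge_def)
  qed
  have g': "g (merge ?A ?B (x, y)) = g' y" if "x \<in> space (PiM ?A M)" "y \<in> space (PiM ?B M)" for x y
    unfolding g'_def
  proof (rule dg[unfolded dep_def, rule_format])
    fix i assume "i \<in> B"
    then show "merge ?A ?B (x, y) i = merge ?A ?B (restrict z ?A, y) i"
      using AB by (cases "i \<in> V") (auto simp: merge_def)
  qed
  interpret PA: prob_space "PiM ?A M" by (rule prob_space_PiM) (rule M.prob_space_axioms)
  interpret PB: prob_space "PiM ?B M" by (rule prob_space_PiM) (rule M.prob_space_axioms)
  have Ef: "(\<integral>w. f w \<partial>PiM V M) = (\<integral>x. f' x \<partial>PiM ?A M)"
    unfolding fold[OF f] by (intro Bochner_Integration.integral_cong refl)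
      (simp add: f' PB.prob_space cong: Bochner_Integration.integral_cong)
  have "(\<integral>w. g w \<partial>PiM V M) = (\<integral>x. (\<integral>y. g' y \<partial>PiM ?B M) \<partial>PiM ?A M)"
    unfolding fold[OF g] by (intro Bochner_Integration.integral_cong refl) (simp add: g')
  then have Eg: "(\<integral>w. g w \<partial>PiM V M) = (\<integral>y. g' y \<partial>PiM ?B M)"
    by (simp add: PA.prob_space)
  have "(\<integral>w. f w * g w \<partial>PiM V M) = (\<integral>x. (\<integral>y. f' x * g' y \<partial>PiM ?B M) \<partial>PiM ?A M)"
    unfolding fold[OF bmeas_mult[OF f g]]
    by (intro Bochner_Integration.integral_cong refl) (simp add: f' g')
  then show ?thesis unfolding Ef Eg by simp
qed

end

section \<open>The uniform law on the unit interval\<close>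

lemma integral_unif01:
  fixes f :: "real \<Rightarrow> 'b::{banach, second_countable_topology}"
  assumes [measurable]: "f \<in> borel_measurable borel"
  shows "(\<integral>x. f x \<partial>unif01) = (\<integral>x. indicator {0..1} x *\<^sub>R f x \<partial>lborel)"
proof -
  have "unif01 = density lborel (\<lambda>x. ennreal (indicator {0..1} x))"
    unfolding unif01_def uniform_measure_def by (intro arg_cong[of _ _ "density lborel"])
      (auto simp: fun_eq_iff indicator_def divide_ennreal_def)
  moreover have "integral\<^sup>L (density lborel (\<lambda>x. ennreal (indicator {0..1} x))) f
      = (\<integral>x. indicator {0..1} x *\<^sub>R f x \<partial>lborel)"
    by (rule integral_density) auto
  ultimately show ?thesis by simp
qed

lemma sets_unif01 [simp, measurable_cong]: "sets unif01 = sets borel"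
  by (simp add: unif01_def)

lemma space_unif01 [simp]: "space unif01 = UNIV"
  by (simp add: unif01_def)

lemma prob_space_unif01: "prob_space unif01"
  unfolding unif01_def by (rule prob_space_uniform_measure) auto

text \<open>Makes polynomials bounded on the whole line without changing them on the support of the
  uniform law.\<close>

definition clamp01 :: "real \<Rightarrow> real"
  where "clamp01 x = max 0 (min 1 x)"

lemma clamp01_bounds [simp]: "0 \<le> clamp01 x" "clamp01 x \<le> 1"
  by (auto simp: clamp01_def)

lemma clamp01_measurable [measurable]: "clamp01 \<in> borel_measurable borel"
  unfolding clamp01_def[abs_def] by measurable

lemma integral_lower_power:
  "(\<integral>x. of_bool (x < z) * clamp01 x ^ m \<partial>unif01) = clamp01 z ^ Suc m / real (Suc m)"
proof -
  have "(\<integral>x. of_bool (x < z) * clamp01 x ^ m \<partial>unif01)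
      = (\<integral>x. indicator {0..1} x *\<^sub>R (of_bool (x < z) * clamp01 x ^ m) \<partial>lborel)"
    by (rule integral_unif01) measurable
  also have "\<dots> = (\<integral>x. x ^ m * indicator {0..clamp01 z} x \<partial>lborel)"
  proof (rule integral_cong_AE)
    \<comment> \<open>The integrands may differ at \<open>z\<close>, where the inequality is strict,
      and at 0, which remains in the degenerate interval when \<open>z\<close> is negative.\<close>
    have "AE x in lborel. x \<noteq> z" "AE x in lborel. x \<noteq> (0::real)" by (rule AE_lborel_singleton)+
    then show "AE x in lborel. indicator {0..1} x *\<^sub>R (of_bool (x < z) * clamp01 x ^ m)
        = x ^ m * indicator {0..clamp01 z} x"
      by eventually_elim (auto simp: indicator_def clamp01_def max_def min_def)
  qed measurable
  also have "\<dots> = clamp01 z ^ Suc m / real (Suc m)"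
    using integral_power[of 0 "clamp01 z" m] by simp
  finally show ?thesis .
qed

lemma integral_upper_power:
  "(\<integral>x. of_bool (z < x) * (1 - clamp01 x) ^ m \<partial>unif01) = (1 - clamp01 z) ^ Suc m / real (Suc m)"
proof -
  have "(\<integral>x. of_bool (z < x) * (1 - clamp01 x) ^ m \<partial>unif01)
      = (\<integral>x. indicator {0..1} x *\<^sub>R (of_bool (z < x) * (1 - clamp01 x) ^ m) \<partial>lborel)"
    by (rule integral_unif01) measurable
  also have "\<dots> = (\<integral>x. indicator {0..1} x *\<^sub>R (of_bool (x < 1 - z) * clamp01 x ^ m) \<partial>lborel)"
  proof -
    define F where "F x = indicator {0..1} x *\<^sub>R (of_bool (z < x) * (1 - clamp01 x) ^ m)" for x
    have "F (1 + -1 * x) = indicator {0..1} x *\<^sub>R (of_bool (x < 1 - z) * clamp01 x ^ m)" for x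
    proof -
      have "1 - clamp01 (1 + -1 * x) = clamp01 x" by (auto simp: clamp01_def)
      moreover have "(z < 1 + -1 * x) = (x < 1 - z)" by auto
      moreover have "indicator {0..1} (1 + -1 * x) = (indicator {0..1} x :: real)" by (auto simp: indicator_def)
      ultimately show ?thesis by (simp only: F_def)
    qed
    moreover have "(\<integral>x. F x \<partial>lborel) = \<bar>-1\<bar> *\<^sub>R (\<integral>x. F (1 + -1 * x) \<partial>lborel)"
      by (rule lborel_integral_real_affine) simp
    ultimately show ?thesis unfolding F_def by simp
  qed
  also have "\<dots> = (\<integral>x. of_bool (x < 1 - z) * clamp01 x ^ m \<partial>unif01)"
    by (rule integral_unif01[symmetric]) measurable
  also have "\<dots> = (1 - clamp01 z) ^ Suc m / real (Suc m)"
  proof -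
    have "clamp01 (1 - z) = 1 - clamp01 z" by (auto simp: clamp01_def)
    then show ?thesis by (simp add: integral_lower_power)
  qed
  finally show ?thesis .
qed

subsection \<open>Integrating out increasing chains\<close>

lemma of_bool_Ball:
  "finite S \<Longrightarrow> (of_bool (\<forall>x\<in>S. P x) :: 'b::linordered_idom) = (\<Prod>x\<in>S. of_bool (P x))"
  by (induction S rule: finite_induct) auto

lemma bmeas_less [intro]:
  fixes f g :: "('i \<Rightarrow> real) \<Rightarrow> real"
  assumes [measurable]: "f \<in> borel_measurable (PiM V (\<lambda>_. borel))" "g \<in> borel_measurable (PiM V (\<lambda>_. borel))"
  shows "bmeas V (\<lambda>w. of_bool (f w < g w) :: real)"
  unfolding bmeas_def by (auto intro!: exI[of _ 1])

lemma measurable_coordinate [intro]: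
  "i \<in> V \<Longrightarrow> (\<lambda>w. w i :: real) \<in> borel_measurable (PiM V (\<lambda>_. borel))"
  by (rule measurable_component_singleton)

text \<open>The indicator is a finite product of indicators of single comparisons.\<close>

lemma bmeas_strict_mono:
  fixes a :: "nat \<Rightarrow> 'i"
  assumes "a ` S \<subseteq> V" "finite (S :: nat set)"
  shows "bmeas V (\<lambda>w. of_bool (strict_mono_on S (w \<circ> a)) :: real)"
proof -
  have "bmeas V (\<lambda>w. (\<Prod>x\<in>S. \<Prod>y\<in>S. (if x < y then of_bool (w (a x) < w (a y)) else 1)) :: real)"
  proof (intro bmeas_prod)
    fix x y assume "x \<in> S" "y \<in> S"
    with assms have "a x \<in> V" "a y \<in> V" by auto
    then show "bmeas V (\<lambda>w. (if x < y then of_bool (w (a x) < w (a y)) else 1) :: real)"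
      by (cases "x < y") auto
  qed
  also have "(\<lambda>w :: 'i \<Rightarrow> real. (\<Prod>x\<in>S. \<Prod>y\<in>S. (if x < y then of_bool (w (a x) < w (a y)) else 1)) :: real)
      = (\<lambda>w. of_bool (strict_mono_on S (w \<circ> a)))"
  proof
    fix w :: "'i \<Rightarrow> real"
    have "(\<Prod>y\<in>S. (if x < y then of_bool (w (a x) < w (a y)) else 1)) =
        (of_bool (\<forall>y\<in>S. x < y \<longrightarrow> w (a x) < w (a y)) :: real)" for x
      by (subst of_bool_Ball[OF assms(2)]) (auto intro!: prod.cong)
    then show "(\<Prod>x\<in>S. \<Prod>y\<in>S. (if x < y then of_bool (w (a x) < w (a y)) else 1))
        = (of_bool (strict_mono_on S (w \<circ> a)) :: real)"
      by (simp add: of_bool_Ball[OF assms(2), symmetric])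
         (auto simp: strict_mono_on_def simp flip: of_bool_def)
  qed
  finally show ?thesis .
qed

lemma bmeas_clamp [intro]:
  assumes [measurable]: "f \<in> borel_measurable (PiM V (\<lambda>_. borel))"
  shows "bmeas V (\<lambda>w. clamp01 (f w))"
  by (rule bmeas_compose[of _ _ clamp01 1]) auto

text \<open>The conditional probability that \<open>r\<close> i.i.d. uniform points are in increasing order,
  given that the \<open>k\<close>-th one is at \<open>u\<close>.  Clamping makes it meaningful for all real \<open>u\<close>.\<close>

definition q :: "nat \<Rightarrow> nat \<Rightarrow> real \<Rightarrow> real"
  where "q r k u = clamp01 u ^ (k - 1) / fact (k - 1) * ((1 - clamp01 u) ^ (r - k) / fact (r - k))"

lemma q_measurable [measurable]: "q r k \<in> borel_measurable borel"
  unfolding q_def[abs_def] by measurable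

lemma q_bounds: "0 \<le> q r k u" "q r k u \<le> 1"
proof -
  have le: "x ^ m / fact m \<le> 1" if "0 \<le> x" "x \<le> 1" for x :: real and m
    using that power_le_one[of x m] by (auto simp: divide_le_eq intro: order_trans[OF _ fact_ge_1])
  have ge: "0 \<le> x ^ m / fact m" if "0 \<le> x" for x :: real and m
    using that by auto
  have c: "0 \<le> 1 - clamp01 u" "1 - clamp01 u \<le> 1" using clamp01_bounds[of u] by linarith+
  show "0 \<le> q r k u"
    unfolding q_def by (rule mult_nonneg_nonneg; rule ge) (use c in simp_all)
  show "q r k u \<le> 1"
    unfolding q_def by (rule mult_le_one[OF le ge le]) (use c in simp_all)
qed

lemma bmeas_q [intro]:
  assumes [measurable]: "f \<in> borel_measurable (PiM V (\<lambda>_. borel))"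
  shows "bmeas V (\<lambda>w. q r k (f w))"
  by (rule bmeas_compose[of _ _ "q r k" 1]) (use q_bounds in \<open>auto simp: abs_le_iff intro: order_trans[of _ 0]\<close>)

lemma strict_mono_on_atLeastAtMost_low:
  assumes "l < (m::nat)"
  shows "strict_mono_on {l..m} f \<longleftrightarrow> f l < f (Suc l) \<and> strict_mono_on {Suc l..m} (f :: nat \<Rightarrow> real)"
proof safe
  assume "strict_mono_on {l..m} f"
  then show "f l < f (Suc l)" "strict_mono_on {Suc l..m} f"
    using assms by (auto simp: strict_mono_on_def)
next
  assume *: "f l < f (Suc l)" "strict_mono_on {Suc l..m} f"
  show "strict_mono_on {l..m} f"
  proof (rule strict_mono_onI)
    fix x y assume xy: "x \<in> {l..m}" "y \<in> {l..m}" "x < y"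
    show "f x < f y"
    proof (cases "x = l")
      case True
      have "f (Suc l) \<le> f y"
        using xy True * assms by (cases "y = Suc l") (auto simp: strict_mono_on_def intro!: less_imp_le)
      with * True show ?thesis by simp
    next
      case False
      with xy * show ?thesis by (auto simp: strict_mono_on_def)
    qed
  qed
qed

lemma strict_mono_on_atLeastAtMost_high:
  assumes "l \<le> (m::nat)"
  shows "strict_mono_on {l..Suc m} f \<longleftrightarrow> f m < f (Suc m) \<and> strict_mono_on {l..m} (f :: nat \<Rightarrow> real)"
proof safe
  assume "strict_mono_on {l..Suc m} f"
  then show "f m < f (Suc m)" "strict_mono_on {l..m} f"
    using assms by (auto simp: strict_mono_on_def)
next
  assume *: "f m < f (Suc m)" "strict_mono_on {l..m} f"
  show "strict_mono_on {l..Suc m} f"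
  proof (rule strict_mono_onI)
    fix x y assume xy: "x \<in> {l..Suc m}" "y \<in> {l..Suc m}" "x < y"
    show "f x < f y"
    proof (cases "y = Suc m")
      case True
      have "f x \<le> f m"
        using xy True * assms by (cases "x = m") (auto simp: strict_mono_on_def intro!: less_imp_le)
      with * True show ?thesis by simp
    next
      case False
      with xy * show ?thesis by (auto simp: strict_mono_on_def)
    qed
  qed
qed

context real_product
begin

text \<open>The coordinates below \<open>k\<close> are integrated out from the bottom upwards, those
  above \<open>k\<close> from the top downwards, each step being a one-dimensional power integral
  through which \<open>H\<close> passes as a constant. The law of the coordinate at position
  \<open>k\<close> is arbitrary, which later allows a Dirac mass there.\<close>

lemma integrate_out_chain:
  fixes a :: "nat \<Rightarrow> 'i"
  assumes inj: "inj_on a {1..r}" and aV: "a ` {1..r} \<subseteq> V" and k: "k \<in> {1..r}"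
    and unif: "\<And>j. j \<in> {1..r} - {k} \<Longrightarrow> M (a j) = unif01"
    and H: "bmeas V H" and free: "\<And>j. j \<in> {1..r} - {k} \<Longrightarrow> free_of (a j) H"
  shows "(\<integral>w. of_bool (strict_mono_on {1..r} (w \<circ> a)) * H w \<partial>PiM V M)
      = (\<integral>w. q r k (w (a k)) * H w \<partial>PiM V M)"
proof -
  \<comment> \<open>\<open>lo l x\<close> is the volume of the increasing tuples of length
    \<open>l - 1\<close> below \<open>x\<close>, and \<open>up m x\<close> that of the tuples of
    length \<open>r - m\<close> above it; \<open>K l m\<close> is the integrand left once the
    positions below \<open>l\<close> and above \<open>m\<close> are gone.\<close>
  define lo where "lo l x = clamp01 x ^ (l - 1) / fact (l - 1)" for l x
  define up where "up m x = (1 - clamp01 x) ^ (r - m) / fact (r - m)" for m x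
  define K where "K l m w = lo l (w (a l)) * (of_bool (strict_mono_on {l..m} (w \<circ> a)) * up m (w (a m)))"
    for l m w
  have ne: "a i \<noteq> a j" if "i \<in> {1..r}" "j \<in> {1..r}" "i \<noteq> j" for i j
    using inj_onD[OF inj _ that(1,2)] that(3) by blast
  have bm: "bmeas V (\<lambda>w. K l m w * H w)" if "l \<in> {1..r}" "m \<in> {1..r}" for l m
  proof -
    have lm: "a l \<in> V" "a m \<in> V" using aV that by blast+
    have [measurable]: "(\<lambda>w. w (a l)) \<in> borel_measurable (PiM V (\<lambda>_. borel :: real measure))"
       "(\<lambda>w. w (a m)) \<in> borel_measurable (PiM V (\<lambda>_. borel :: real measure))"
      by (rule measurable_coordinate[OF lm(1)] measurable_coordinate[OF lm(2)])+
    have sub: "a ` {l..m} \<subseteq> V" using aV that by auto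
    show ?thesis
      unfolding K_def lo_def up_def divide_inverse
      by (intro bmeas_mult bmeas_power bmeas_diff bmeas_const bmeas_clamp bmeas_strict_mono sub H measurable_coordinate lm) auto
  qed
  have low: "(\<integral>w. K l r w * H w \<partial>PiM V M) = (\<integral>w. K (Suc l) r w * H w \<partial>PiM V M)" if l: "1 \<le> l" "l < k" for l
  proof (rule integral_one_coordinate[where x = "a l"])
    fix w
    have r: "l < r" "l \<in> {1..r} - {k}" "l \<in> {1..r}" using l k by auto
    have Hw: "H (w(a l := y)) = H w" for y
      using free[OF r(2)] by (auto simp: free_of_def)
    have s: "strict_mono_on {l..r} (w(a l := y) \<circ> a) \<longleftrightarrow> y < w (a (Suc l)) \<and> strict_mono_on {Suc l..r} (w \<circ> a)" for y
    proof -
      have "strict_mono_on {Suc l..r} (w(a l := y) \<circ> a) = strict_mono_on {Suc l..r} (w \<circ> a)"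
        using ne[of _ l] r by (auto simp: strict_mono_on_def)
      then show ?thesis
        unfolding strict_mono_on_atLeastAtMost_low[OF r(1)] using ne[of "Suc l" l] r by auto
    qed
    have "K l r (w(a l := y)) * H (w(a l := y))
        = (of_bool (strict_mono_on {Suc l..r} (w \<circ> a)) * up r (w (a r)) * H w / fact (l - 1)) * (of_bool (y < w (a (Suc l))) * clamp01 y ^ (l - 1))" for y
      unfolding K_def Hw s lo_def using ne[of r l] r by (simp add: mult_ac)
    then have "(\<integral>y. K l r (w(a l := y)) * H (w(a l := y)) \<partial>M (a l))
      = (of_bool (strict_mono_on {Suc l..r} (w \<circ> a)) * up r (w (a r)) * H w / fact (l - 1)) * (clamp01 (w (a (Suc l))) ^ Suc (l - 1) / real (Suc (l - 1)))"
      unfolding unif[OF r(2)] by (simp only: integral_mult_right_zero integral_lower_power)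
    also have "\<dots> = K (Suc l) r w * H w"
    proof -
      obtain l' where "l = Suc l'" using l by (cases l) auto
      then show ?thesis unfolding K_def lo_def by (simp add: field_simps)
    qed
    finally show "(\<integral>y. K l r (w(a l := y)) * H (w(a l := y)) \<partial>M (a l)) = K (Suc l) r w * H w" .
  qed (use l k aV bm in auto)
  have high: "(\<integral>w. K k (Suc m) w * H w \<partial>PiM V M) = (\<integral>w. K k m w * H w \<partial>PiM V M)" if m: "k \<le> m" "m < r" for m
  proof (rule integral_one_coordinate[where x = "a (Suc m)"])
    fix w
    have r: "k \<le> m" "Suc m \<in> {1..r} - {k}" "Suc m \<in> {1..r}" using m k by auto
    have Hw: "H (w(a (Suc m) := y)) = H w" for y
      using free[OF r(2)] by (auto simp: free_of_def)
    have s: "strict_mono_on {k..Suc m} (w(a (Suc m) := y) \<circ> a) \<longleftrightarrow> w (a m) < y \<and> strict_mono_on {k..m} (w \<circ> a)" for y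
    proof -
      have "a j \<noteq> a (Suc m)" if "j \<in> {k..m}" for j using that m k by (intro ne) auto
      then have "strict_mono_on {k..m} (w(a (Suc m) := y) \<circ> a) = strict_mono_on {k..m} (w \<circ> a)"
        by (auto simp: strict_mono_on_def)
      then show ?thesis
        unfolding strict_mono_on_atLeastAtMost_high[OF r(1)] using ne[of "Suc m" m] r m k by auto
    qed
    have "K k (Suc m) (w(a (Suc m) := y)) * H (w(a (Suc m) := y))
        = (of_bool (strict_mono_on {k..m} (w \<circ> a)) * lo k (w (a k)) * H w / fact (r - Suc m)) * (of_bool (w (a m) < y) * (1 - clamp01 y) ^ (r - Suc m))" for y
      unfolding K_def Hw s up_def using ne[of k "Suc m"] r m k by (simp add: mult_ac)
    then have "(\<integral>y. K k (Suc m) (w(a (Suc m) := y)) * H (w(a (Suc m) := y)) \<partial>M (a (Suc m)))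
      = (of_bool (strict_mono_on {k..m} (w \<circ> a)) * lo k (w (a k)) * H w / fact (r - Suc m)) * ((1 - clamp01 (w (a m))) ^ Suc (r - Suc m) / real (Suc (r - Suc m)))"
      unfolding unif[OF r(2)] by (simp only: integral_mult_right_zero integral_upper_power)
    also have "\<dots> = K k m w * H w"
    proof -
      define d where "d = r - Suc m"
      have d: "r - m = Suc d" using m by (auto simp: d_def)
      show ?thesis unfolding K_def up_def d d_def[symmetric] by (simp add: field_simps)
    qed
    finally show "(\<integral>y. K k (Suc m) (w(a (Suc m) := y)) * H (w(a (Suc m) := y)) \<partial>M (a (Suc m))) = K k m w * H w" .
  qed (use m k aV bm in auto)
  have "(\<integral>w. of_bool (strict_mono_on {1..r} (w \<circ> a)) * H w \<partial>PiM V M) = (\<integral>w. K 1 r w * H w \<partial>PiM V M)"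
    by (simp add: K_def lo_def up_def)
  also have "\<dots> = (\<integral>w. K l r w * H w \<partial>PiM V M)" if "1 \<le> l" "l \<le> k" for l
    using that by (induction l rule: dec_induct) (auto simp: low)
  from this[of k] k have "(\<integral>w. K 1 r w * H w \<partial>PiM V M) = (\<integral>w. K k r w * H w \<partial>PiM V M)" by auto
  also have "\<dots> = (\<integral>w. K k m w * H w \<partial>PiM V M)" if "k \<le> m" "m \<le> r" for m
    using that(2,1) by (induction m rule: inc_induct) (auto simp: high)
  from this[of k] k have "(\<integral>w. K k r w * H w \<partial>PiM V M) = (\<integral>w. K k k w * H w \<partial>PiM V M)" by auto
  also have "\<dots> = (\<integral>w. q r k (w (a k)) * H w \<partial>PiM V M)"
    by (simp add: K_def lo_def up_def q_def strict_mono_on_def)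
  finally show ?thesis by (simp add: K_def lo_def up_def)
qed

end

subsection \<open>Patterns of point configurations\<close>

definition bijs :: "nat \<Rightarrow> 'i set \<Rightarrow> (nat \<Rightarrow> 'i) set"
  where "bijs r I = {a \<in> {1..r} \<rightarrow>\<^sub>E I. bij_betw a {1..r} I}"

text \<open>At most one enumeration puts the points in increasing order of \<open>X\<close>, so this
  is an indicator. The sum over enumerations turns it into products of two chain events, one for
  each axis, to which \<open>integrate_out_chain\<close> applies. \<open>a \<circ> inv \<pi>\<close>
  lists the points by their prescribed height.\<close>

definition patt :: "nat \<Rightarrow> 'i set \<Rightarrow> (nat \<Rightarrow> nat) \<Rightarrow> ('i \<Rightarrow> real) \<Rightarrow> ('i \<Rightarrow> real) \<Rightarrow> real"
  where "patt r I \<pi> X Y =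
    (\<Sum>a\<in>bijs r I. of_bool (strict_mono_on {1..r} (X \<circ> a)) * of_bool (strict_mono_on {1..r} (Y \<circ> (a \<circ> inv \<pi>))))"

lemma finite_bijs [simp, intro]: "finite I \<Longrightarrow> finite (bijs r I)"
  unfolding bijs_def by (rule finite_subset[of _ "{1..r} \<rightarrow>\<^sub>E I"]) (auto intro: finite_PiE)

lemma rank_enumeration:
  assumes a: "bij_betw a {1..r} I" and m: "strict_mono_on {1..r} (X \<circ> a)" and j: "j \<in> {1..r}"
  shows "card {i \<in> I. X i \<le> (X (a j) :: real)} = j"
proof -
  have "{i \<in> I. X i \<le> X (a j)} = a ` {1..j}"
  proof safe
    fix i assume i: "i \<in> I" "X i \<le> X (a j)"
    then obtain k where k: "k \<in> {1..r}" "i = a k" using a by (auto simp: bij_betw_def)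
    have "k \<le> j"
      using strict_mono_onD[OF m j k(1)] i k by (force simp: not_le)
    then show "i \<in> a ` {1..j}" using k by auto
  next
    fix k assume k: "k \<in> {1..j}"
    then have kr: "k \<in> {1..r}" using j by auto
    then show "a k \<in> I" using a by (auto simp: bij_betw_def)
    show "X (a k) \<le> X (a j)"
      using strict_mono_onD[OF m kr j] k by (cases "k = j") auto
  qed
  moreover have "inj_on a {1..j}"
    using a j by (auto simp: bij_betw_def intro: inj_on_subset)
  ultimately show ?thesis by (simp add: card_image)
qed

lemma enumeration_unique:
  assumes "a \<in> bijs r I" "b \<in> bijs r I" "strict_mono_on {1..r} (X \<circ> a)" "strict_mono_on {1..r} (X \<circ> b :: nat \<Rightarrow> real)"
  shows "a = b"
proof (rule PiE_ext[of _ "{1..r}" "\<lambda>_. I"])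
  show "a \<in> {1..r} \<rightarrow>\<^sub>E I" "b \<in> {1..r} \<rightarrow>\<^sub>E I" using assms by (auto simp: bijs_def)
  have bij: "bij_betw a {1..r} I" "bij_betw b {1..r} I" using assms by (auto simp: bijs_def)
  fix j assume j: "j \<in> {1..r}"
  then have "b j \<in> I" using bij by (auto simp: bij_betw_def)
  then obtain k where k: "k \<in> {1..r}" "b j = a k" using bij by (auto simp: bij_betw_def)
  then have "k = j"
    using rank_enumeration[OF bij(1) assms(3) k(1)] rank_enumeration[OF bij(2) assms(4) j] by simp
  with k show "a j = b j" by simp
qed

lemma patt_eq:
  assumes "finite I" "a \<in> bijs r I" "strict_mono_on {1..r} (X \<circ> a)"
  shows "patt r I \<pi> X Y = of_bool (strict_mono_on {1..r} (Y \<circ> (a \<circ> inv \<pi>)))"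
proof -
  have "patt r I \<pi> X Y = (\<Sum>b\<in>bijs r I. if b = a then of_bool (strict_mono_on {1..r} (Y \<circ> (a \<circ> inv \<pi>))) else 0)"
    unfolding patt_def
  proof (rule sum.cong[OF refl])
    fix b assume b: "b \<in> bijs r I"
    show "of_bool (strict_mono_on {1..r} (X \<circ> b)) * of_bool (strict_mono_on {1..r} (Y \<circ> (b \<circ> inv \<pi>)))
      = (if b = a then of_bool (strict_mono_on {1..r} (Y \<circ> (a \<circ> inv \<pi>))) else 0 :: real)"
    proof (cases "b = a")
      case True
      then show ?thesis using assms(3) by simp
    next
      case False
      then have "\<not> strict_mono_on {1..r} (X \<circ> b)"
        using enumeration_unique[OF assms(2) b assms(3)] by blast
      with False show ?thesis by simp
    qed
  qed
  then show ?thesis using assms by (simp add: sum.delta')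
qed

lemma patt_bounds:
  assumes "finite I" shows "0 \<le> patt r I \<pi> X Y" "patt r I \<pi> X Y \<le> 1"
proof -
  show "0 \<le> patt r I \<pi> X Y" unfolding patt_def by (intro sum_nonneg) auto
  show "patt r I \<pi> X Y \<le> 1"
  proof (cases "\<exists>a\<in>bijs r I. strict_mono_on {1..r} (X \<circ> a)")
    case True
    then show ?thesis using patt_eq[OF assms, of _ r X \<pi> Y] by auto
  next
    case False
    then have "patt r I \<pi> X Y = 0" unfolding patt_def by (intro sum.neutral) auto
    then show ?thesis by simp
  qed
qed

lemma sorted_enumeration:
  assumes "finite (J :: 'a::linorder set)" "card J = r"
  shows "bij_betw (\<lambda>j. sorted_list_of_set J ! (j - 1)) {1..r} J"
    "strict_mono_on {1..r} (\<lambda>j. sorted_list_of_set J ! (j - 1))"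
proof -
  let ?xs = "sorted_list_of_set J"
  have len: "length ?xs = r" using assms by simp
  have "bij_betw (\<lambda>j. j - 1) {1..r} {..<r}"
    by (rule bij_betwI[where g = Suc]) auto
  moreover have "bij_betw ((!) ?xs) {..<r} J"
    using bij_betw_nth[of ?xs "{..<r}" J] assms len by auto
  ultimately have "bij_betw ((!) ?xs \<circ> (\<lambda>j. j - 1)) {1..r} J" by (rule bij_betw_trans)
  then show "bij_betw (\<lambda>j. ?xs ! (j - 1)) {1..r} J"
    by (simp add: comp_def)
  show "strict_mono_on {1..r} (\<lambda>j. ?xs ! (j - 1))"
  proof (rule strict_mono_onI)
    fix x y assume "x \<in> {1..r}" "y \<in> {1..r}" "x < y"
    then show "?xs ! (x - 1) < ?xs ! (y - 1)"
      using len sorted_wrt_nth_less[of "(<)" ?xs "x - 1" "y - 1"] by auto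
  qed
qed

lemma ex_enumeration:
  assumes fin: "finite I" and card: "card I = r" and inj: "inj_on X I"
  obtains a where "a \<in> bijs r I" "strict_mono_on {1..r} (X \<circ> a :: nat \<Rightarrow> real)"
proof -
  obtain h where h: "bij_betw h {1..card (X ` I)} (X ` I)" "strict_mono_on {1..card (X ` I)} h"
    using sorted_enumeration[of "X ` I"] fin by blast
  have c: "card (X ` I) = r" using card_image[OF inj] card by simp
  define a where "a = restrict (the_inv_into I X \<circ> h) {1..r}"
  have "bij_betw (the_inv_into I X) (X ` I) I"
    by (intro bij_betw_the_inv_into bij_betw_imageI inj refl)
  then have "bij_betw (the_inv_into I X \<circ> h) {1..r} I"
    using h c by (auto intro: bij_betw_trans)
  then have bij: "bij_betw a {1..r} I"
    unfolding a_def by (subst bij_betw_restrict_eq) auto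
  have Xa: "X (a j) = h j" if "j \<in> {1..r}" for j
  proof -
    have "h j \<in> X ` I" using h(1) that c by (auto simp: bij_betw_def)
    then show ?thesis using that f_the_inv_into_f[OF inj] by (simp add: a_def)
  qed
  have "a \<in> bijs r I" using bij by (auto simp: bijs_def a_def bij_betw_def)
  moreover have "strict_mono_on {1..r} (X \<circ> a)"
    using h(2) c by (auto simp: strict_mono_on_def Xa)
  ultimately show ?thesis by (rule that)
qed

text \<open>Matches the comparison condition of \<open>pattern_count\<close> with monotonicity along
  the prescribed heights; ties \<open>\<pi> j = \<pi> k\<close> are excluded by injectivity.\<close>

lemma strict_mono_on_comp_inv_iff:
  fixes Y :: "'i \<Rightarrow> real"
  assumes pi: "\<pi> \<in> perms r"
  shows "strict_mono_on {1..r} (Y \<circ> (a \<circ> inv \<pi>)) \<longleftrightarrow>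
    (\<forall>j\<in>{1..r}. \<forall>k\<in>{1..r}. \<pi> j > \<pi> k \<longleftrightarrow> Y (a j) > Y (a k))"
proof
  have p: "\<pi> permutes {1..r}" using pi by simp
  have in_r: "\<pi> j \<in> {1..r}" if "j \<in> {1..r}" for j using permutes_in_image[OF p] that by blast
  assume m: "strict_mono_on {1..r} (Y \<circ> (a \<circ> inv \<pi>))"
  have *: "Y (a j) < Y (a k)" if "j \<in> {1..r}" "k \<in> {1..r}" "\<pi> j < \<pi> k" for j k
    using strict_mono_onD[OF m in_r[OF that(1)] in_r[OF that(2)] that(3)]
    by (simp add: permutes_inverses(2)[OF p])
  show "\<forall>j\<in>{1..r}. \<forall>k\<in>{1..r}. \<pi> j > \<pi> k \<longleftrightarrow> Y (a j) > Y (a k)"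
  proof (intro ballI iffI)
    fix j k assume jk: "j \<in> {1..r}" "k \<in> {1..r}" "Y (a j) > Y (a k)"
    show "\<pi> j > \<pi> k"
    proof (rule ccontr)
      assume "\<not> \<pi> j > \<pi> k"
      then consider "\<pi> j = \<pi> k" | "\<pi> j < \<pi> k" by linarith
      then show False
      proof cases
        case 1
        then have "j = k" using permutes_inj[OF p] by (auto dest: injD)
        with jk show False by simp
      qed (use *[of j k] jk in auto)
    qed
  qed (use * in blast)
next
  have p: "\<pi> permutes {1..r}" using pi by simp
  have in_r: "inv \<pi> j \<in> {1..r}" if "j \<in> {1..r}" for j
    using permutes_in_image[OF permutes_inv[OF p]] that by blast
  assume *: "\<forall>j\<in>{1..r}. \<forall>k\<in>{1..r}. \<pi> j > \<pi> k \<longleftrightarrow> Y (a j) > Y (a k)"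
  show "strict_mono_on {1..r} (Y \<circ> (a \<circ> inv \<pi>))"
  proof (rule strict_mono_onI)
    fix x y assume "x \<in> {1..r}" "y \<in> {1..r}" "x < y"
    then show "(Y \<circ> (a \<circ> inv \<pi>)) x < (Y \<circ> (a \<circ> inv \<pi>)) y"
      using *[rule_format, of "inv \<pi> y" "inv \<pi> x"] in_r by (auto simp: permutes_inverses(1)[OF p])
  qed
qed

text \<open>Enumerate the points by abscissa. The value of \<open>Perm\<close> at \<open>j\<close>
  is then the height rank of the j-th point, and prescribing these ranks by \<open>\<pi>\<close>
  means that \<open>a \<circ> inv \<pi>\<close> enumerates the points by height.\<close>

lemma Perm_eq_iff_patt:
  fixes X Y :: "'i \<Rightarrow> real"
  assumes fin: "finite I" and card: "card I = r" and X: "inj_on X I" and Y: "inj_on Y I" and pi: "\<pi> \<in> perms r"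
  shows "Perm ((\<lambda>i. (X i, Y i)) ` I) = \<pi> \<longleftrightarrow> patt r I \<pi> X Y = 1"
proof -
  obtain a where a: "a \<in> bijs r I" "strict_mono_on {1..r} (X \<circ> a)"
    using ex_enumeration[OF fin card X] .
  obtain b where b: "b \<in> bijs r I" "strict_mono_on {1..r} (Y \<circ> b)"
    using ex_enumeration[OF fin card Y] .
  have ba: "bij_betw a {1..r} I" and bb: "bij_betw b {1..r} I" using a b by (auto simp: bijs_def)
  have p: "\<pi> permutes {1..r}" using pi by simp
  let ?A = "(\<lambda>i. (X i, Y i)) ` I"
  let ?ry = "\<lambda>i. card {k \<in> I. Y k \<le> Y i}"
  have injA: "inj_on (\<lambda>i. (X i, Y i)) I" using X by (auto simp: inj_on_def)
  have cardA: "card ?A = r" using card_image[OF injA] card by simp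
  have xr: "x_rank ?A (X i, Y i) = card {k \<in> I. X k \<le> X i}" for i
    unfolding x_rank_def
    by (subst card_image[OF inj_on_subset[OF injA], of "{k \<in> I. X k \<le> X i}", symmetric])
       (auto intro!: arg_cong[of _ _ card])
  have yr: "y_rank ?A (X i, Y i) = ?ry i" for i
    unfolding y_rank_def
    by (subst card_image[OF inj_on_subset[OF injA], of "{k \<in> I. Y k \<le> Y i}", symmetric])
       (auto intro!: arg_cong[of _ _ card])
  have aI: "a j \<in> I" if "j \<in> {1..r}" for j using ba that by (auto simp: bij_betw_def)
  have PermA: "Perm ?A j = ?ry (a j)" if j: "j \<in> {1..r}" for j
  proof -
    have "(THE y. \<exists>z\<in>?A. x_rank ?A z = j \<and> y_rank ?A z = y) = ?ry (a j)"
    proof (rule the_equality)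
      show "\<exists>z\<in>?A. x_rank ?A z = j \<and> y_rank ?A z = ?ry (a j)"
        using aI[OF j] rank_enumeration[OF ba a(2) j] by (intro bexI[of _ "(X (a j), Y (a j))"]) (auto simp: xr yr)
    next
      fix y assume "\<exists>z\<in>?A. x_rank ?A z = j \<and> y_rank ?A z = y"
      then obtain i where i: "i \<in> I" "card {k \<in> I. X k \<le> X i} = j" "?ry i = y" by (auto simp: xr yr)
      then obtain k where k: "k \<in> {1..r}" "i = a k" using ba by (auto simp: bij_betw_def)
      then have "k = j" using i rank_enumeration[OF ba a(2) k(1)] by simp
      then show "y = ?ry (a j)" using i k by simp
    qed
    then show ?thesis using j cardA by (simp add: Perm_def)
  qed
  have rank_less: "?ry i < ?ry k \<longleftrightarrow> Y i < Y k" if "i \<in> I" "k \<in> I" for i k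
  proof
    assume "Y i < Y k"
    then have "{l \<in> I. Y l \<le> Y i} \<subset> {l \<in> I. Y l \<le> Y k}" using that by force
    then show "?ry i < ?ry k" using fin by (intro psubset_card_mono) auto
  next
    assume *: "?ry i < ?ry k"
    show "Y i < Y k"
    proof (rule ccontr)
      assume "\<not> Y i < Y k"
      then have "?ry k \<le> ?ry i" using fin by (intro card_mono) auto
      with * show False by simp
    qed
  qed
  have "Perm ?A = \<pi> \<longleftrightarrow> (\<forall>j\<in>{1..r}. ?ry (a j) = \<pi> j)"
  proof
    assume "Perm ?A = \<pi>" then show "\<forall>j\<in>{1..r}. ?ry (a j) = \<pi> j" using PermA by auto
  next
    assume *: "\<forall>j\<in>{1..r}. ?ry (a j) = \<pi> j"
    show "Perm ?A = \<pi>"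
    proof
      fix j show "Perm ?A j = \<pi> j"
        using * PermA cardA permutes_not_in[OF p, of j] by (cases "j \<in> {1..r}") (auto simp: Perm_def)
    qed
  qed
  also have "\<dots> \<longleftrightarrow> strict_mono_on {1..r} (Y \<circ> (a \<circ> inv \<pi>))"
  proof
    assume *: "\<forall>j\<in>{1..r}. ?ry (a j) = \<pi> j"
    show "strict_mono_on {1..r} (Y \<circ> (a \<circ> inv \<pi>))"
      unfolding strict_mono_on_comp_inv_iff[OF pi]
    proof (intro ballI)
      fix j k assume jk: "j \<in> {1..r}" "k \<in> {1..r}"
      show "\<pi> k < \<pi> j \<longleftrightarrow> Y (a k) < Y (a j)"
        using rank_less[OF aI[OF jk(2)] aI[OF jk(1)]] unfolding *[rule_format, OF jk(1)] *[rule_format, OF jk(2)] .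
    qed
  next
    assume m: "strict_mono_on {1..r} (Y \<circ> (a \<circ> inv \<pi>))"
    have "bij_betw (a \<circ> inv \<pi>) {1..r} I"
      using permutes_imp_bij[OF permutes_inv[OF p]] ba by (rule bij_betw_trans)
    from rank_enumeration[OF this m, of "\<pi> _"] show "\<forall>j\<in>{1..r}. ?ry (a j) = \<pi> j"
      using permutes_in_image[OF p] by (simp add: permutes_inverses(2)[OF p])
  qed
  also have "\<dots> \<longleftrightarrow> patt r I \<pi> X Y = 1"
    unfolding patt_eq[OF fin a] by simp
  finally show ?thesis .
qed

section \<open>Conjugation by the ranks of real labels\<close>

lemma nth_elem_bij:
  assumes "finite J" "card J = r"
  shows "bij_betw (nth_elem J) {1..r} J" "strict_mono_on {1..r} (nth_elem J)"
  using sorted_enumeration[OF assms] by (simp_all add: nth_elem_def[abs_def])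

text \<open>Equal to the identity off \<open>{1..n}\<close>, as \<open>permutes\<close> demands; it
  is a permutation once the labels are distinct.\<close>

definition rank_perm :: "nat \<Rightarrow> (nat \<Rightarrow> real) \<Rightarrow> nat \<Rightarrow> nat"
  where "rank_perm n U i = (if i \<in> {1..n} then card {j \<in> {1..n}. U j \<le> U i} else i)"

lemma rank_perm_less_iff:
  assumes "i \<in> {1..n}" "k \<in> {1..n}"
  shows "rank_perm n U i < rank_perm n U k \<longleftrightarrow> U i < U k"
proof
  assume "U i < U k"
  then have "{l \<in> {1..n}. U l \<le> U i} \<subseteq> {l \<in> {1..n}. U l \<le> U k}"
    "k \<notin> {l \<in> {1..n}. U l \<le> U i}" "k \<in> {l \<in> {1..n}. U l \<le> U k}"
    using assms by auto
  then have "{l \<in> {1..n}. U l \<le> U i} \<subset> {l \<in> {1..n}. U l \<le> U k}" by blast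
  then have "card {l \<in> {1..n}. U l \<le> U i} < card {l \<in> {1..n}. U l \<le> U k}"
    by (intro psubset_card_mono) auto
  then show "rank_perm n U i < rank_perm n U k"
    unfolding rank_perm_def using assms by presburger
next
  assume *: "rank_perm n U i < rank_perm n U k"
  show "U i < U k"
  proof (rule ccontr)
    assume "\<not> U i < U k"
    then have "card {l \<in> {1..n}. U l \<le> U k} \<le> card {l \<in> {1..n}. U l \<le> U i}" by (intro card_mono) auto
    with * assms show False by (simp add: rank_perm_def)
  qed
qed

lemma rank_perm_permutes:
  assumes "inj_on U {1..n}" shows "rank_perm n U permutes {1..n}"
proof (rule bij_imp_permutes)
  have "inj_on (rank_perm n U) {1..n}"
  proof (rule inj_onI)
    fix i k assume *: "i \<in> {1..n}" "k \<in> {1..n}" "rank_perm n U i = rank_perm n U k"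
    then have "\<not> U i < U k" "\<not> U k < U i"
      using rank_perm_less_iff[of i n k U] rank_perm_less_iff[of k n i U] by auto
    then have "U i = U k" by linarith
    then show "i = k" using inj_onD[OF assms _ *(1,2)] by blast
  qed
  moreover have "rank_perm n U ` {1..n} \<subseteq> {1..n}"
  proof safe
    fix i assume i: "i \<in> {1..n}"
    have "card {j \<in> {1..n}. U j \<le> U i} \<le> card {1..n}" by (intro card_mono) auto
    moreover have "card {j \<in> {1..n}. U j \<le> U i} > 0" using i by (subst card_gt_0_iff) auto
    ultimately show "rank_perm n U i \<in> {1..n}" using i by (simp add: rank_perm_def)
  qed
  ultimately show "bij_betw (rank_perm n U) {1..n} {1..n}"
    unfolding bij_betw_def using endo_inj_surj[of "{1..n}" "rank_perm n U"] by blast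
qed (auto simp: rank_perm_def)

text \<open>The conjugate sends the rank of \<open>U i\<close> to the rank of
  \<open>U (\<tau> i)\<close>, so its diagram is the set of points with coordinates
  \<open>U i\<close> and \<open>U (\<tau> i)\<close>, up to increasing changes of both axes. Pattern
  counts only see the two orders.\<close>

lemma pattern_count_conj:
  assumes tau: "\<tau> permutes {1..n}" and U: "inj_on U {1..n}" and pi: "\<pi> \<in> perms r"
  shows "real (pattern_count n r \<pi> (rank_perm n U \<circ> \<tau> \<circ> inv (rank_perm n U)))
    = (\<Sum>I | I \<subseteq> {1..n} \<and> card I = r. patt r I \<pi> U (U \<circ> \<tau>))"
proof -
  let ?R = "rank_perm n U"
  let ?V = "{1..n}"
  let ?S = "{I. I \<subseteq> ?V \<and> card I = r}"
  define cond where "cond J = (\<forall>j\<in>{1..r}. \<forall>k\<in>{1..r}. \<pi> j > \<pi> k \<longleftrightarrow>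
    (?R \<circ> \<tau> \<circ> inv ?R) (nth_elem J j) > (?R \<circ> \<tau> \<circ> inv ?R) (nth_elem J k))" for J
  have R: "?R permutes ?V" by (rule rank_perm_permutes[OF U])
  have Rinj: "inj ?R" using permutes_inj[OF R] .
  have finS: "finite ?S" by simp
  have "real (pattern_count n r \<pi> (?R \<circ> \<tau> \<circ> inv ?R)) = (\<Sum>J\<in>?S. of_bool (cond J))"
  proof -
    have "{I. I \<subseteq> ?V \<and> card I = r \<and> cond I} = {I \<in> ?S. cond I}" by auto
    then show ?thesis
      unfolding pattern_count_def cond_def[symmetric] using finS by (simp add: of_bool_def sum.If_cases Int_def)
  qed
  also have "\<dots> = (\<Sum>I\<in>?S. of_bool (cond (?R ` I)))"
  proof (rule sum.reindex_bij_witness[of _ "(`) ?R" "(`) (inv ?R)"])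
    fix J assume J: "J \<in> ?S"
    show "?R ` (inv ?R ` J) = J" by (simp add: image_comp permutes_surj[OF R] comp_def permutes_inverses(1)[OF R])
    show "inv ?R ` J \<in> ?S"
      using J permutes_image[OF permutes_inv[OF R]] permutes_inj[OF permutes_inv[OF R]]
      by (auto simp: card_image inj_on_subset dest!: subsetD[of _ ?V] )
    show "of_bool (cond (?R ` (inv ?R ` J))) = (of_bool (cond J) :: real)"
      by (simp add: image_comp permutes_surj[OF R] comp_def permutes_inverses(1)[OF R])
  next
    fix I assume I: "I \<in> ?S"
    show "inv ?R ` (?R ` I) = I" by (simp add: image_comp comp_def permutes_inverses(2)[OF R])
    show "?R ` I \<in> ?S"
      using I permutes_image[OF R] Rinj by (auto simp: card_image inj_on_subset)
  qed
  also have "\<dots> = (\<Sum>I\<in>?S. patt r I \<pi> U (U \<circ> \<tau>))"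
  proof (rule sum.cong[OF refl])
    fix I assume I: "I \<in> ?S"
    then have finI: "finite I" using finite_subset by auto
    let ?J = "?R ` I"
    have J: "finite ?J" "card ?J = r" using I finI Rinj by (auto simp: card_image inj_on_subset)
    note nth = nth_elem_bij[OF J]
    define a where "a = restrict (inv ?R \<circ> nth_elem ?J) {1..r}"
    have inv_bij: "bij_betw (inv ?R) ?J I"
      by (rule bij_betwI[where g = ?R]) (auto simp: permutes_inverses[OF R])
    then have "bij_betw (inv ?R \<circ> nth_elem ?J) {1..r} I"
      using nth(1) by (auto intro: bij_betw_trans)
    then have ba: "bij_betw a {1..r} I" unfolding a_def by (subst bij_betw_restrict_eq) auto
    have Ra: "?R (a j) = nth_elem ?J j" if "j \<in> {1..r}" for j
      using that by (simp add: a_def permutes_inverses(1)[OF R])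
    have ia: "inv ?R (nth_elem ?J j) = a j" if "j \<in> {1..r}" for j
      using that by (simp add: a_def)
    have aI: "a j \<in> ?V" if "j \<in> {1..r}" for j using bij_betwE[OF ba] that I by blast
    have taI: "\<tau> (a j) \<in> ?V" if "j \<in> {1..r}" for j
      using permutes_in_image[OF tau] aI[OF that] by blast
    have abijs: "a \<in> bijs r I" using ba by (auto simp: bijs_def a_def bij_betw_def)
    have "strict_mono_on {1..r} (U \<circ> a)"
    proof (rule strict_mono_onI)
      fix x y assume xy: "x \<in> {1..r}" "y \<in> {1..r}" "x < y"
      then have "?R (a x) < ?R (a y)" using strict_mono_onD[OF nth(2)] by (simp add: Ra)
      then show "(U \<circ> a) x < (U \<circ> a) y" using rank_perm_less_iff[OF aI[OF xy(1)] aI[OF xy(2)]] by simp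
    qed
    from patt_eq[OF finI abijs this]
    have "patt r I \<pi> U (U \<circ> \<tau>) = of_bool (strict_mono_on {1..r} ((U \<circ> \<tau>) \<circ> (a \<circ> inv \<pi>)))" .
    also have "\<dots> = of_bool (cond ?J)"
      unfolding strict_mono_on_comp_inv_iff[OF pi] cond_def
      by (intro arg_cong[of _ _ of_bool] ball_cong refl) (simp add: ia rank_perm_less_iff[OF taI taI])
    finally show "of_bool (cond ?J) = patt r I \<pi> U (U \<circ> \<tau>)" by simp
  qed
  finally show ?thesis .
qed

subsection \<open>The expected pattern indicator given one point\<close>

text \<open>Dropping position \<open>k\<close> leaves an injection between two sets of size
  \<open>r - 1\<close>, and every such injection arises once.\<close>

lemma card_bijs_at:
  assumes "finite I" "card I = r" "i \<in> I" "k \<in> {1..r}"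
  shows "card {a \<in> bijs r I. a k = i} = fact (r - 1)"
proof -
  let ?D = "{1..r} - {k}" and ?E = "I - {i}"
  let ?B = "{b \<in> ?D \<rightarrow>\<^sub>E ?E. inj_on b ?D}"
  have card: "card ?D = r - 1" "card ?E = r - 1" using assms by auto
  have kD: "insert k ?D = {1..r}" "insert i ?E = I" using assms by auto
  have "bij_betw (\<lambda>a. restrict a ?D) {a \<in> bijs r I. a k = i} ?B"
  proof (rule bij_betwI[where g = "\<lambda>b. b(k := i)"])
    show "(\<lambda>a. restrict a ?D) \<in> {a \<in> bijs r I. a k = i} \<rightarrow> ?B"
    proof
      fix a assume a: "a \<in> {a \<in> bijs r I. a k = i}"
      then have b: "bij_betw a {1..r} I" and ak: "a k = i" by (auto simp: bijs_def)
      then have inj: "inj_on a {1..r}" by (auto simp: bij_betw_def)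
      have "inj_on (restrict a ?D) ?D"
        unfolding inj_on_restrict_eq by (rule inj_on_subset[OF inj]) blast
      moreover have "restrict a ?D \<in> ?D \<rightarrow>\<^sub>E ?E"
      proof (rule PiE_I)
        fix x assume x: "x \<in> ?D"
        then have "a x \<in> I" using bij_betwE[OF b] by blast
        moreover have "a x \<noteq> a k" using inj_onD[OF inj _ _ assms(4), of x] x by blast
        ultimately show "restrict a ?D x \<in> ?E" using x ak by simp
      next
        fix x assume "x \<notin> ?D"
        then show "restrict a ?D x = undefined" by (simp only: restrict_apply if_False)
      qed
      ultimately show "restrict a ?D \<in> ?B" by blast
    qed
    show "(\<lambda>b. b(k := i)) \<in> ?B \<rightarrow> {a \<in> bijs r I. a k = i}"
    proof
      fix b assume b: "b \<in> ?B"
      have "b ` ?D = ?E"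
        using b card assms(1) by (intro card_subset_eq) (auto simp: card_image)
      then have "bij_betw b ?D ?E" using b by (auto simp: bij_betw_def)
      then have "bij_betw (b(k := i)) ?D ?E" by (rule bij_betw_cong[THEN iffD1, rotated]) auto
      then have "bij_betw (b(k := i)) (insert k ?D) (insert i ?E)"
        using notIn_Un_bij_betw[of k ?D "b(k := i)" ?E] by simp
      then have bij: "bij_betw (b(k := i)) {1..r} I" unfolding kD .
      moreover have "b(k := i) \<in> extensional {1..r}" using b assms(4) by (auto simp: PiE_iff extensional_def)
      ultimately show "b(k := i) \<in> {a \<in> bijs r I. a k = i}"
        using bij_betwE[OF bij] unfolding bijs_def PiE_iff by simp
    qed
    fix a assume "a \<in> {a \<in> bijs r I. a k = i}"
    then show "(restrict a ?D)(k := i) = a"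
      by (auto simp: bijs_def fun_eq_iff PiE_iff extensional_def)
  next
    fix b assume "b \<in> ?B"
    then show "restrict (b(k := i)) ?D = b"
      by (auto simp: fun_eq_iff PiE_iff extensional_def)
  qed
  then have "card {a \<in> bijs r I. a k = i} = card ?B" by (rule bij_betw_same_card)
  also have "\<dots> = fact (r - 1)"
    using card_inj_on_subset_funcset[of ?D ?E ?D] card assms(1) by (simp add: fact_prod_rev)
  finally show ?thesis .
qed

lemma sum_bijs_at:
  assumes "finite I" "i \<in> I"
  shows "(\<Sum>a\<in>bijs r I. f a) = (\<Sum>k=1..r. \<Sum>a | a \<in> bijs r I \<and> a k = i. (f a :: real))"
proof -
  have "(\<Sum>k=1..r. \<Sum>a | a \<in> bijs r I \<and> a k = i. f a) = (\<Sum>a\<in>(\<Union>k\<in>{1..r}. {a. a \<in> bijs r I \<and> a k = i}). f a)"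
  proof (rule sum.UNION_disjoint[symmetric])
    show "\<forall>x\<in>{1..r}. \<forall>y\<in>{1..r}. x \<noteq> y \<longrightarrow> {a. a \<in> bijs r I \<and> a x = i} \<inter> {a. a \<in> bijs r I \<and> a y = i} = {}"
    proof (intro ballI impI equals0I)
      fix x y a assume xy: "x \<in> {1..r}" "y \<in> {1..r}" "x \<noteq> y" "a \<in> {a. a \<in> bijs r I \<and> a x = i} \<inter> {a. a \<in> bijs r I \<and> a y = i}"
      then have "inj_on a {1..r}" by (auto simp: bijs_def bij_betw_def)
      from inj_onD[OF this _ xy(1,2)] xy show False by auto
    qed
  qed (use assms in auto)
  moreover have "(\<Union>k\<in>{1..r}. {a. a \<in> bijs r I \<and> a k = i}) = bijs r I"
  proof safe
    fix a assume a: "a \<in> bijs r I"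
    then have "i \<in> a ` {1..r}" using assms by (auto simp: bijs_def bij_betw_def)
    then show "a \<in> (\<Union>k\<in>{1..r}. {a. a \<in> bijs r I \<and> a k = i})" using a by auto
  qed
  ultimately show ?thesis by simp
qed

text \<open>Conditional probability of the pattern given that one of the \<open>r\<close> points is
  at (u, v): \<open>k\<close> is the rank of that point from the left, hence \<open>\<pi> k\<close>
  its rank from below, and the factorial counts the labelings of the other points.\<close>

definition pkernel :: "nat \<Rightarrow> (nat \<Rightarrow> nat) \<Rightarrow> real \<Rightarrow> real \<Rightarrow> real"
  where "pkernel r \<pi> u v = fact (r - 1) * (\<Sum>k=1..r. q r k u * q r (\<pi> k) v)"

lemma pkernel_measurable [measurable]: "(\<lambda>(u, v). pkernel r \<pi> u v) \<in> borel_measurable borel"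
proof -
  have "(\<lambda>z. pkernel r \<pi> (fst z) (snd z)) \<in> borel_measurable (borel \<Otimes>\<^sub>M borel)"
    unfolding pkernel_def by measurable
  then show ?thesis by (simp add: borel_prod case_prod_beta)
qed

lemma pkernel_nonneg: "0 \<le> pkernel r \<pi> u v"
  unfolding pkernel_def by (intro mult_nonneg_nonneg sum_nonneg q_bounds) auto

lemma bmeas_pkernel:
  assumes "(\<lambda>w. f w) \<in> borel_measurable (PiM V (\<lambda>_. borel))" "(\<lambda>w. g w) \<in> borel_measurable (PiM V (\<lambda>_. borel))"
  shows "bmeas V (\<lambda>w. pkernel r \<pi> (f w) (g w))"
  unfolding pkernel_def by (intro bmeas_mult bmeas_sum bmeas_const bmeas_q assms)

lemma dep_strict_mono: "dep (a ` S) (\<lambda>w. of_bool (strict_mono_on S (w \<circ> a)) :: real)"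
  unfolding dep_def strict_mono_on_def by auto

lemma bmeas_patt:
  assumes "finite I" "I \<subseteq> V" "\<sigma> ` I \<subseteq> V" and pi: "\<pi> \<in> perms r"
  shows "bmeas V (\<lambda>w. patt r I \<pi> w (w \<circ> \<sigma>))"
  unfolding patt_def
proof (intro bmeas_sum bmeas_mult)
  fix a assume a: "a \<in> bijs r I"
  then have im: "a ` {1..r} = I" by (auto simp: bijs_def bij_betw_def)
  show "bmeas V (\<lambda>w. of_bool (strict_mono_on {1..r} (w \<circ> a)) :: real)"
    by (rule bmeas_strict_mono) (use im assms in auto)
  have "(\<sigma> \<circ> (a \<circ> inv \<pi>)) ` {1..r} = \<sigma> ` I"
    using permutes_image[OF permutes_inv, of \<pi> "{1..r}"] pi unfolding image_comp[symmetric] by (simp only: im mem_Collect_eq)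
  then have "bmeas V (\<lambda>w. of_bool (strict_mono_on {1..r} (w \<circ> (\<sigma> \<circ> (a \<circ> inv \<pi>)))) :: real)"
    by (intro bmeas_strict_mono) (use assms in auto)
  then show "bmeas V (\<lambda>w. of_bool (strict_mono_on {1..r} (w \<circ> \<sigma> \<circ> (a \<circ> inv \<pi>))) :: real)"
    by (simp add: comp_assoc)
qed

context real_product
begin

text \<open>For each enumeration the horizontal chain is integrated out first and the vertical one
  second; the disjointness of \<open>I\<close> and its image keeps the second chain constant during
  the first integration. The test function \<open>H\<close> makes this a statement about conditional
  expectations, and the laws of the two coordinates of \<open>i0\<close> stay arbitrary.\<close>

lemma integral_patt:
  assumes I: "I \<subseteq> V" "card I = r" and \<sigma>: "inj_on \<sigma> I" "\<sigma> ` I \<subseteq> V" "I \<inter> \<sigma> ` I = {}"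
    and i0: "i0 \<in> I" and pi: "\<pi> \<in> perms r"
    and unif: "\<And>j. j \<in> I - {i0} \<Longrightarrow> M j = unif01 \<and> M (\<sigma> j) = unif01"
    and H: "bmeas V H" and free: "\<And>j. j \<in> I - {i0} \<Longrightarrow> free_of j H \<and> free_of (\<sigma> j) H"
  shows "(\<integral>w. patt r I \<pi> w (w \<circ> \<sigma>) * H w \<partial>PiM V M) = (\<integral>w. pkernel r \<pi> (w i0) (w (\<sigma> i0)) * H w \<partial>PiM V M)"
proof -
  have fin: "finite I" using I finite_V finite_subset by auto
  have p: "\<pi> permutes {1..r}" using pi by simp
  define b where "b a = \<sigma> \<circ> (a \<circ> inv \<pi>)" for a :: "nat \<Rightarrow> 'i"
  let ?O = "\<lambda>a w. of_bool (strict_mono_on {1..r} (w \<circ> a)) :: real"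
  have im: "a ` {1..r} = I" "inj_on a {1..r}" "b a ` {1..r} = \<sigma> ` I" "inj_on (b a) {1..r}" if "a \<in> bijs r I" for a
  proof -
    show a: "a ` {1..r} = I" "inj_on a {1..r}" using that by (auto simp: bijs_def bij_betw_def)
    have ip: "inv \<pi> ` {1..r} = {1..r}" by (rule permutes_image[OF permutes_inv[OF p]])
    show "b a ` {1..r} = \<sigma> ` I" unfolding b_def image_comp[symmetric] ip a ..
    show "inj_on (b a) {1..r}"
      unfolding b_def
      by (intro comp_inj_on permutes_inj_on[OF permutes_inv[OF p]]; simp only: ip a \<sigma> image_comp[symmetric])
  qed
  have bmO: "bmeas V (\<lambda>w. ?O a w)" "bmeas V (\<lambda>w. ?O (b a) w)" if "a \<in> bijs r I" for a
    by (rule bmeas_strict_mono; simp only: im[OF that] I \<sigma> finite_atLeastAtMost)+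
  have V: "i0 \<in> V" "\<sigma> i0 \<in> V" using I \<sigma> i0 by auto
  have i0ne: "j \<noteq> i0 \<and> j \<noteq> \<sigma> i0 \<and> \<sigma> j \<noteq> i0 \<and> \<sigma> j \<noteq> \<sigma> i0" if "j \<in> I - {i0}" for j
    using that \<sigma> i0 by (auto dest: inj_onD)
  have chain: "(\<integral>w. ?O a w * (?O (b a) w * H w) \<partial>PiM V M) = (\<integral>w. q r k (w i0) * (q r (\<pi> k) (w (\<sigma> i0)) * H w) \<partial>PiM V M)"
    if a: "a \<in> bijs r I" and k: "k \<in> {1..r}" "a k = i0" for a k
  proof -
    have bq: "bmeas V (\<lambda>w. q r k (w i0) * H w)" by (intro bmeas_mult bmeas_q measurable_coordinate V H)
    have aj: "a j \<in> I - {i0}" if "j \<in> {1..r} - {k}" for j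
      using that im[OF a] k by (auto dest: inj_onD)
    have "(\<integral>w. ?O a w * (?O (b a) w * H w) \<partial>PiM V M) = (\<integral>w. q r k (w (a k)) * (?O (b a) w * H w) \<partial>PiM V M)"
    proof (rule integrate_out_chain)
      fix j assume j: "j \<in> {1..r} - {k}"
      have "free_of (a j) (?O (b a))"
        by (rule dep_free_of[OF dep_strict_mono]) (use aj[OF j] \<sigma> im[OF a] in auto)
      then show "free_of (a j) (\<lambda>w. ?O (b a) w * H w)" using free[OF aj[OF j]] unfolding free_of_def by simp
      show "M (a j) = unif01" using unif[OF aj[OF j]] by simp
    qed (use im[OF a] I k bmO[OF a] H in auto)
    \<comment> \<open>Now the vertical indicator takes the role of the chain, and the factor just
      produced joins \<open>H\<close>.\<close>
    also have "\<dots> = (\<integral>w. ?O (b a) w * (q r k (w i0) * H w) \<partial>PiM V M)" by (simp add: k mult_ac)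
    also have "\<dots> = (\<integral>w. q r (\<pi> k) (w (b a (\<pi> k))) * (q r k (w i0) * H w) \<partial>PiM V M)"
    proof (rule integrate_out_chain)
      show pk: "\<pi> k \<in> {1..r}" using permutes_in_image[OF p] k by blast
      fix j assume j: "j \<in> {1..r} - {\<pi> k}"
      have "inv \<pi> j \<in> {1..r}" using permutes_in_image[OF permutes_inv[OF p]] j by blast
      moreover have "inv \<pi> j \<noteq> k" using j permutes_inverses(1)[OF p, of j] by auto
      ultimately have aI: "a (inv \<pi> j) \<in> I - {i0}" by (intro aj) simp
      then have bj: "b a j = \<sigma> (a (inv \<pi> j))" by (simp add: b_def)
      have "i0 \<noteq> \<sigma> (a (inv \<pi> j))" using i0ne[OF aI] by metis
      then show "free_of (b a j) (\<lambda>w. q r k (w i0) * H w)"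
        using free[OF aI] unfolding free_of_def bj by simp
      show "M (b a j) = unif01" using unif[OF aI] by (simp add: bj)
    qed (use im[OF a] \<sigma> bq in auto)
    finally show ?thesis by (simp add: b_def permutes_inverses(2)[OF p] k mult_ac)
  qed
  have bmq: "bmeas V (\<lambda>w. q r k (w i0) * (q r (\<pi> k) (w (\<sigma> i0)) * H w))" for k
    by (intro bmeas_mult bmeas_q measurable_coordinate V H)
  have "(\<integral>w. patt r I \<pi> w (w \<circ> \<sigma>) * H w \<partial>PiM V M) = (\<integral>w. (\<Sum>a\<in>bijs r I. ?O a w * (?O (b a) w * H w)) \<partial>PiM V M)"
    unfolding patt_def b_def by (simp add: sum_distrib_right mult.assoc comp_assoc)
  also have "\<dots> = (\<Sum>a\<in>bijs r I. \<integral>w. ?O a w * (?O (b a) w * H w) \<partial>PiM V M)"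
    by (intro Bochner_Integration.integral_sum bmeas_integrable bmeas_mult bmO H)
  also have "\<dots> = (\<Sum>k=1..r. \<Sum>a | a \<in> bijs r I \<and> a k = i0. \<integral>w. ?O a w * (?O (b a) w * H w) \<partial>PiM V M)"
    by (rule sum_bijs_at[OF fin i0])
  also have "\<dots> = (\<Sum>k=1..r. \<Sum>a | a \<in> bijs r I \<and> a k = i0. \<integral>w. q r k (w i0) * (q r (\<pi> k) (w (\<sigma> i0)) * H w) \<partial>PiM V M)"
    by (intro sum.cong refl chain) auto
  also have "\<dots> = (\<Sum>k=1..r. fact (r - 1) * (\<integral>w. q r k (w i0) * (q r (\<pi> k) (w (\<sigma> i0)) * H w) \<partial>PiM V M))"
    using card_bijs_at[OF fin I(2) i0] by (intro sum.cong refl) simp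
  also have "\<dots> = (\<integral>w. (\<Sum>k=1..r. fact (r - 1) * (q r k (w i0) * (q r (\<pi> k) (w (\<sigma> i0)) * H w))) \<partial>PiM V M)"
    by (subst Bochner_Integration.integral_sum, intro bmeas_integrable bmeas_mult bmq bmeas_const) simp
  also have "\<dots> = (\<integral>w. pkernel r \<pi> (w i0) (w (\<sigma> i0)) * H w \<partial>PiM V M)"
    by (simp add: pkernel_def sum_distrib_left sum_distrib_right mult.assoc)
  finally show ?thesis .
qed

lemma integral_two_coordinates:
  fixes f :: "real \<times> real \<Rightarrow> real"
  assumes [measurable]: "f \<in> borel_measurable borel" and B: "\<And>z. \<bar>f z\<bar> \<le> B" and jk: "j \<in> V" "k \<in> V" "j \<noteq> k"
  shows "(\<integral>w. f (w j, w k) \<partial>PiM V M) = (\<integral>z. f z \<partial>(M j \<Otimes>\<^sub>M M k))"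
proof -
  interpret jk: pair_prob_space "M j" "M k" ..
  have [measurable_cong]: "sets (M j) = sets borel" "sets (M k) = sets borel" by (simp_all add: sets_M)
  have fm: "f \<in> borel_measurable (borel \<Otimes>\<^sub>M borel)" by (simp add: borel_prod)
  note [measurable] = measurable_coordinate[OF jk(1)] measurable_coordinate[OF jk(2)] fm
  have fjk: "f \<in> borel_measurable (M j \<Otimes>\<^sub>M M k)" by measurable
  have bm: "bmeas V (\<lambda>w. f (w j, w k))" using B unfolding bmeas_def by (auto intro!: exI[of _ B])
  have gB: "norm (\<integral>y. f (y, z) \<partial>M j) \<le> B" for z
  proof -
    have i: "integrable (M j) (\<lambda>y. f (y, z))"
      using B measurable_Pair1[OF fjk, of z] space_M by (intro M.integrable_const_bound[where B = B]) auto
    have "norm (\<integral>y. f (y, z) \<partial>M j) \<le> (\<integral>y. norm (f (y, z)) \<partial>M j)" by (rule integral_norm_bound)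
    also have "\<dots> \<le> (\<integral>y. B \<partial>M j)" using i B by (intro integral_mono) auto
    finally show ?thesis by (simp add: M.prob_space)
  qed
  have "(\<integral>w. f (w j, w k) \<partial>PiM V M) = (\<integral>w. (\<integral>y. f (y, w k) \<partial>M j) \<partial>PiM V M)"
    by (rule integral_one_coordinate[OF bm jk(1)]) (use jk in simp)
  also have "\<dots> = (\<integral>w. (\<integral>z. (\<integral>y. f (y, z) \<partial>M j) \<partial>M k) \<partial>PiM V M)"
  proof (rule integral_one_coordinate[OF _ jk(2)])
    have "(\<lambda>w. \<integral>y. f (y, w k) \<partial>M j) \<in> borel_measurable (PiM V (\<lambda>_. borel))" by measurable
    then show "bmeas V (\<lambda>w. \<integral>y. f (y, w k) \<partial>M j)" using gB unfolding bmeas_def by blast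
  qed simp
  also have "\<dots> = (\<integral>z. (\<integral>y. f (y, z) \<partial>M j) \<partial>M k)" by (simp add: P.prob_space)
  also have "\<dots> = (\<integral>z. f z \<partial>(M j \<Otimes>\<^sub>M M k))"
  proof -
    have "integrable (M j \<Otimes>\<^sub>M M k) (\<lambda>(x, y). f (x, y))"
      using fjk B by (intro jk.P.integrable_const_bound[where B = B]) auto
    from jk.integral_snd[OF this] show ?thesis by simp
  qed
  finally show ?thesis .
qed

text \<open>Integrating the uniform coordinate first gives 0 for every value of \<open>w j\<close>,
  whose law may therefore be a Dirac mass.\<close>

lemma AE_coordinates_ne:
  assumes ij: "i \<in> V" "j \<in> V" "i \<noteq> j" and unif: "M i = unif01"
  shows "AE w in PiM V M. w i \<noteq> w j"
proof -
  have ji: "j \<noteq> i" using ij by simp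
  have "(\<lambda>w :: 'i \<Rightarrow> real. of_bool (w i = w j) :: real) = (\<lambda>w. 1 - of_bool (w i < w j) - of_bool (w j < w i))"
    by (auto simp: fun_eq_iff)
  then have bm: "bmeas V (\<lambda>w. of_bool (w i = w j) :: real)"
    using ij by (simp only:) (intro bmeas_diff bmeas_const bmeas_less measurable_coordinate)
  have "(\<integral>y. of_bool (y = z) \<partial>unif01) = (0 :: real)" for z
  proof -
    have "AE y in unif01. y \<noteq> z"
      unfolding unif01_def by (rule AE_uniform_measureI) (use AE_lborel_singleton[of z] in auto)
    then show ?thesis by (intro integral_eq_zero_AE) (auto elim: eventually_mono)
  qed
  then have "(\<integral>w. of_bool (w i = w j) \<partial>PiM V M) = (\<integral>w. (0::real) \<partial>PiM V M)"
    by (intro integral_one_coordinate[OF bm ij(1)]) (use ji unif in simp)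
  then have "(\<integral>w. of_bool (w i = w j) \<partial>PiM V M) = (0::real)" by simp
  then have "AE w in PiM V M. of_bool (w i = w j) = (0::real)"
    using integral_nonneg_eq_0_iff_AE[OF bmeas_integrable[OF bm]] by simp
  then show ?thesis by eventually_elim (auto split: if_splits)
qed

end

section \<open>Measurability of the permutation event and the law of planar samples\<close>

lemma Perm_cong_bij:
  assumes h: "bij_betw h A A'"
    and x: "\<And>w z. w \<in> A \<Longrightarrow> z \<in> A \<Longrightarrow> fst (h w) \<le> fst (h z) \<longleftrightarrow> fst w \<le> fst z"
    and y: "\<And>w z. w \<in> A \<Longrightarrow> z \<in> A \<Longrightarrow> snd (h w) \<le> snd (h z) \<longleftrightarrow> snd w \<le> snd z"
  shows "Perm A = Perm A'"
proof -
  have A': "A' = h ` A" and inj: "inj_on h A" using h by (auto simp: bij_betw_def)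
  have xr: "x_rank A' (h z) = x_rank A z" if "z \<in> A" for z
  proof -
    have "{w \<in> A'. fst w \<le> fst (h z)} = h ` {w \<in> A. fst w \<le> fst z}"
      using x[OF _ that] unfolding A' by auto
    then show ?thesis unfolding x_rank_def using inj by (simp add: card_image inj_on_subset)
  qed
  have yr: "y_rank A' (h z) = y_rank A z" if "z \<in> A" for z
  proof -
    have "{w \<in> A'. snd w \<le> snd (h z)} = h ` {w \<in> A. snd w \<le> snd z}"
      using y[OF _ that] unfolding A' by auto
    then show ?thesis unfolding y_rank_def using inj by (simp add: card_image inj_on_subset)
  qed
  have "(\<exists>z\<in>A'. x_rank A' z = i \<and> y_rank A' z = j) \<longleftrightarrow> (\<exists>z\<in>A. x_rank A z = i \<and> y_rank A z = j)" for i j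
    unfolding A' by (simp add: xr[unfolded A'] yr[unfolded A'] cong: bex_cong)
  then show ?thesis
    using bij_betw_same_card[OF h] by (simp add: Perm_def fun_eq_iff)
qed

text \<open>The permutation depends only on the outcomes of finitely many comparisons.\<close>

lemma Perm_event_measurable:
  fixes Z :: "'a \<Rightarrow> nat \<Rightarrow> real \<times> real"
  assumes J: "finite J" and X: "\<And>i. i \<in> J \<Longrightarrow> (\<lambda>\<omega>'. fst (Z \<omega>' i)) \<in> borel_measurable M"
    and Y: "\<And>i. i \<in> J \<Longrightarrow> (\<lambda>\<omega>'. snd (Z \<omega>' i)) \<in> borel_measurable M"
  shows "{x \<in> space M. Perm (Z x ` J) = \<pi>} \<in> sets M"
proof -
  define c where "c x = ({(i, j) \<in> J \<times> J. fst (Z x i) \<le> fst (Z x j)}, {(i, j) \<in> J \<times> J. snd (Z x i) \<le> snd (Z x j)})" for x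
  have cong: "Perm (Z x ` J) = Perm (Z x' ` J)" if "c x = c x'" for x x'
  proof -
    have le: "fst (Z x i) \<le> fst (Z x j) \<longleftrightarrow> fst (Z x' i) \<le> fst (Z x' j)"
      "snd (Z x i) \<le> snd (Z x j) \<longleftrightarrow> snd (Z x' i) \<le> snd (Z x' j)" if "i \<in> J" "j \<in> J" for i j
      using \<open>c x = c x'\<close> that unfolding c_def by blast+
    \<comment> \<open>Coincidence of two points amounts to comparisons in both directions on each
      axis, so \<open>c\<close> decides it too; this makes \<open>g\<close> below well
      defined.\<close>
    have eq: "Z x i = Z x j \<longleftrightarrow> Z x' i = Z x' j" if "i \<in> J" "j \<in> J" for i j
      using le[OF that] le[OF that(2,1)] by (metis order_antisym prod_eqI order_refl)
    define g where "g z = Z x' (SOME i. i \<in> J \<and> Z x i = z)" for z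
    have g: "g (Z x i) = Z x' i" if i: "i \<in> J" for i
    proof -
      let ?k = "SOME k. k \<in> J \<and> Z x k = Z x i"
      have "?k \<in> J \<and> Z x ?k = Z x i" by (rule someI[of "\<lambda>k. k \<in> J \<and> Z x k = Z x i" i]) (simp add: i)
      then show ?thesis using eq[of ?k i] i unfolding g_def by blast
    qed
    have im: "g ` (Z x ` J) = Z x' ` J" unfolding image_image by (rule image_cong) (simp_all add: g)
    have "inj_on g (Z x ` J)"
    proof (rule inj_onI)
      fix y z assume yz: "y \<in> Z x ` J" "z \<in> Z x ` J" "g y = g z"
      then obtain i j where "i \<in> J" "j \<in> J" "y = Z x i" "z = Z x j" by blast
      then show "y = z" using eq g yz(3) by simp
    qed
    then have "bij_betw g (Z x ` J) (Z x' ` J)" using im by (simp add: bij_betw_def)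
    then show ?thesis
      by (rule Perm_cong_bij) (auto simp: g le)
  qed
  let ?S = "{x \<in> space M. Perm (Z x ` J) = \<pi>}"
  have "?S = (\<Union>d\<in>c ` ?S. {x \<in> space M. c x = d})"
    using cong by blast
  moreover have "finite (c ` ?S)"
    by (rule finite_subset[of _ "Pow (J \<times> J) \<times> Pow (J \<times> J)"]) (auto simp: c_def J)
  moreover have "{x \<in> space M. c x = d} \<in> sets M" if "d \<in> c ` ?S" for d
  proof -
    from that obtain y where d: "d = c y" by blast
    have "{x \<in> space M. c x = d} = {x \<in> space M. \<forall>i\<in>J. \<forall>j\<in>J. (fst (Z x i) \<le> fst (Z x j) \<longleftrightarrow> fst (Z y i) \<le> fst (Z y j))
        \<and> (snd (Z x i) \<le> snd (Z x j) \<longleftrightarrow> snd (Z y i) \<le> snd (Z y j))}"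
      unfolding d c_def by (auto simp: set_eq_iff)
    also have "\<dots> \<in> sets M"
    proof (intro sets.sets_Collect_finite_All[OF _ J] sets.sets_Collect_conj)
      fix i j assume ij: "i \<in> J" "j \<in> J"
      note [measurable] = X[OF ij(1)] X[OF ij(2)] Y[OF ij(1)] Y[OF ij(2)]
      show "{x \<in> space M. (fst (Z x i) \<le> fst (Z x j)) = (fst (Z y i) \<le> fst (Z y j))} \<in> sets M"
        by (cases "fst (Z y i) \<le> fst (Z y j)") (simp_all, measurable)
      show "{x \<in> space M. (snd (Z x i) \<le> snd (Z x j)) = (snd (Z y i) \<le> snd (Z y j))} \<in> sets M"
        by (cases "snd (Z y i) \<le> snd (Z y j)") (simp_all, measurable)
    qed
    finally show ?thesis .
  qed
  ultimately show ?thesis by (metis (no_types, lifting) sets.finite_UN)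
qed

lemma prob_space_unif_square: "prob_space unif_square"
proof -
  interpret prob_space unif01 by (rule prob_space_unif01)
  interpret pair_prob_space unif01 unif01 ..
  show ?thesis unfolding unif_square_def by (rule prob_space_axioms)
qed

lemma sets_unif_square: "sets unif_square = sets borel"
proof -
  have "sets unif_square = sets (borel \<Otimes>\<^sub>M borel :: (real \<times> real) measure)"
    unfolding unif_square_def by (rule sets_pair_measure_cong) auto
  then show ?thesis unfolding borel_prod .
qed

lemma space_unif_square: "space unif_square = UNIV"
  using sets_eq_imp_space_eq[OF sets_unif_square] by simp

lemma AE_return_eq: "AE x in return borel (u :: real). x = u"
  by (subst AE_return) (auto simp: pred_def)

text \<open>A product measure is determined on rectangles. There the integrand is a product of
  functions of disjoint pairs of coordinates, which \<open>integral_mult_dep\<close> splits off one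
  at a time.\<close>

lemma (in real_product) distr_pairs:
  fixes f g :: "nat \<Rightarrow> 'i"
  assumes J: "finite J" and inj: "inj_on f J" "inj_on g J" "f ` J \<inter> g ` J = {}" and V: "f ` J \<subseteq> V" "g ` J \<subseteq> V"
    and unif: "\<And>j. j \<in> J \<Longrightarrow> M (f j) = unif01 \<and> M (g j) = unif01"
  shows "distr (PiM V M) (PiM J (\<lambda>_. unif_square)) (\<lambda>w. \<lambda>j\<in>J. (w (f j), w (g j))) = PiM J (\<lambda>_. unif_square)"
proof -
  interpret sq: prob_space unif_square by (rule prob_space_unif_square)
  interpret PS: product_prob_space "\<lambda>_. unif_square" J ..
  have meas: "(\<lambda>w. (w (f j), w (g j))) \<in> PiM V M \<rightarrow>\<^sub>M unif_square" if "j \<in> J" for j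
  proof -
    have fV: "f j \<in> V" "g j \<in> V" using V that by auto
    have "(\<lambda>w. (w (f j), w (g j))) \<in> PiM V M \<rightarrow>\<^sub>M unif01 \<Otimes>\<^sub>M unif01"
      using measurable_component_singleton[OF fV(1), of M] measurable_component_singleton[OF fV(2), of M] unif[OF that]
      by (intro measurable_Pair) auto
    then show ?thesis by (simp add: unif_square_def)
  qed
  let ?T = "\<lambda>w. \<lambda>j\<in>J. (w (f j), w (g j))"
  have T: "?T \<in> PiM V M \<rightarrow>\<^sub>M PiM J (\<lambda>_. unif_square)" by (intro measurable_restrict meas)
  show ?thesis
  proof (rule PS.PiM_eqI)
    show "finite J" by fact
    show "sets (distr (PiM V M) (PiM J (\<lambda>_. unif_square)) ?T) = sets (PiM J (\<lambda>_. unif_square))" by simp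
    fix A assume A: "\<And>i. i \<in> J \<Longrightarrow> A i \<in> sets unif_square"
    have ind: "bmeas V (\<lambda>w. indicator (A j) (w (f j), w (g j)) :: real)"
      and E1: "(\<integral>w. indicator (A j) (w (f j), w (g j)) \<partial>PiM V M) = measure unif_square (A j)" if j: "j \<in> J" for j
    proof -
      have Aj [measurable]: "A j \<in> sets borel" using A[OF j] by (simp add: sets_unif_square)
      have fV: "f j \<in> V" "g j \<in> V" "f j \<noteq> g j" using V j inj by auto
      have "indicator (A j) \<in> borel_measurable (borel \<Otimes>\<^sub>M borel :: (real \<times> real) measure)" using Aj by (simp add: borel_prod)
      moreover have "(\<lambda>w. (w (f j), w (g j))) \<in> PiM V (\<lambda>_. borel) \<rightarrow>\<^sub>M borel \<Otimes>\<^sub>M (borel :: real measure)"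
        by (intro measurable_Pair measurable_coordinate fV)
      ultimately have "(\<lambda>w. indicator (A j) (w (f j), w (g j)) :: real) \<in> borel_measurable (PiM V (\<lambda>_. borel))"
        by (rule measurable_compose[rotated])
      then show "bmeas V (\<lambda>w. indicator (A j) (w (f j), w (g j)) :: real)"
        unfolding bmeas_def by (auto intro!: exI[of _ 1] simp: indicator_def)
      have "(\<integral>w. indicator (A j) (w (f j), w (g j)) \<partial>PiM V M) = (\<integral>z. (indicator (A j) z :: real) \<partial>(M (f j) \<Otimes>\<^sub>M M (g j)))"
        by (rule integral_two_coordinates[where f = "indicator (A j)" and B = 1, OF _ _ fV]) (auto simp: indicator_def)
      also have "\<dots> = measure unif_square (A j)"
        using unif[OF j] by (simp add: unif_square_def[symmetric] space_unif_square)
      finally show "(\<integral>w. indicator (A j) (w (f j), w (g j)) \<partial>PiM V M) = measure unif_square (A j)" .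
    qed
    have prod: "(\<integral>w. (\<Prod>j\<in>K. indicator (A j) (w (f j), w (g j))) \<partial>PiM V M) = (\<Prod>j\<in>K. measure unif_square (A j))"
      if "finite K" "K \<subseteq> J" for K
      using that
    proof (induction K rule: finite_induct)
      case (insert k K)
      let ?F = "\<lambda>w. indicator (A k) (w (f k), w (g k)) :: real"
      let ?G = "\<lambda>w. \<Prod>j\<in>K. indicator (A j) (w (f j), w (g j)) :: real"
      have "(\<integral>w. ?F w * ?G w \<partial>PiM V M) = (\<integral>w. ?F w \<partial>PiM V M) * (\<integral>w. ?G w \<partial>PiM V M)"
      proof (rule integral_mult_dep)
        show "dep {f k, g k} ?F" by (simp add: dep_def)
        show "dep (f ` K \<union> g ` K) ?G" unfolding dep_def by (auto intro!: prod.cong)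
        have "f k \<noteq> f j \<and> f k \<noteq> g j \<and> g k \<noteq> f j \<and> g k \<noteq> g j" if "j \<in> K" for j
        proof -
          have jk: "j \<in> J" "k \<in> J" "k \<noteq> j" using insert that by auto
          then have "f k \<noteq> g j" "g k \<noteq> f j" using inj(3) by (metis IntI empty_iff imageI)+
          then show ?thesis using jk inj_onD[OF inj(1), of k j] inj_onD[OF inj(2), of k j] by blast
        qed
        then show "{f k, g k} \<inter> (f ` K \<union> g ` K) = {}" by auto
        show "bmeas V ?F" "bmeas V ?G" using insert.prems by (auto intro!: ind bmeas_prod)
      qed
      then show ?case using insert E1 by simp
    qed (simp add: P.prob_space)
    have "emeasure (distr (PiM V M) (PiM J (\<lambda>_. unif_square)) ?T) (Pi\<^sub>E J A) = emeasure (PiM V M) (?T -` Pi\<^sub>E J A \<inter> space (PiM V M))"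
      using A J by (intro emeasure_distr T sets_PiM_I_finite)
    also have "\<dots> = ennreal (measure (PiM V M) (?T -` Pi\<^sub>E J A \<inter> space (PiM V M)))" by (rule P.emeasure_eq_measure)
    also have "measure (PiM V M) (?T -` Pi\<^sub>E J A \<inter> space (PiM V M)) = (\<integral>w. indicator (?T -` Pi\<^sub>E J A \<inter> space (PiM V M)) w \<partial>PiM V M)"
      by (simp add: Int_absorb2)
    also have "\<dots> = (\<integral>w. (\<Prod>j\<in>J. indicator (A j) (w (f j), w (g j))) \<partial>PiM V M)"
    proof (rule Bochner_Integration.integral_cong[OF refl])
      fix w assume "w \<in> space (PiM V M)"
      then have "indicator (?T -` Pi\<^sub>E J A \<inter> space (PiM V M)) w = (of_bool (\<forall>j\<in>J. (w (f j), w (g j)) \<in> A j) :: real)"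
        by (auto simp: indicator_def PiE_iff)
      also have "\<dots> = (\<Prod>j\<in>J. indicator (A j) (w (f j), w (g j)))"
        by (subst of_bool_Ball[OF J]) (simp add: indicator_def of_bool_def)
      finally show "indicator (?T -` Pi\<^sub>E J A \<inter> space (PiM V M)) w = (\<Prod>j\<in>J. indicator (A j) (w (f j), w (g j)) :: real)" .
    qed
    also have "\<dots> = (\<Prod>j\<in>J. measure unif_square (A j))" by (rule prod[OF J subset_refl])
    finally show "emeasure (distr (PiM V M) (PiM J (\<lambda>_. unif_square)) ?T) (Pi\<^sub>E J A) = (\<Prod>j\<in>J. emeasure unif_square (A j))"
      by (simp only: sq.emeasure_eq_measure prod_ennreal measure_nonneg)
  qed
qed

text \<open>The fixed point \<open>(u, v)\<close> is treated as the \<open>r\<close>-th sample, with Dirac coordinates.\<close>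

theorem psi_eq_pkernel:
  assumes r: "r \<ge> 1" and pi: "\<pi> \<in> perms r"
  shows "psi r \<pi> (u, v) = pkernel r \<pi> u v"
proof -
  \<comment> \<open>Abscissas occupy the indices 1 to \<open>r\<close>, ordinates
    \<open>r + 1\<close> to \<open>2 * r\<close>; the Dirac pair sits at \<open>r\<close> and
    \<open>2 * r\<close>.\<close>
  define M where "M i = (if i = r then return borel u else if i = 2 * r then return borel v else unif01)" for i :: nat
  have M_r: "M r = return borel u" and M_2r: "M (2 * r) = return borel v"
    and M_unif: "i \<noteq> r \<Longrightarrow> i \<noteq> 2 * r \<Longrightarrow> M i = unif01" for i
    using r by (simp_all add: M_def)
  let ?V = "{1..2 * r}"
  have psM: "prob_space (M i)" for i
    unfolding M_def using prob_space_unif01 by (auto intro: prob_space_return)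
  interpret real_product M ?V
  proof -
    interpret M: prob_space "M i" for i by (rule psM)
    show "real_product M ?V" by unfold_locales (auto simp: M_def)
  qed
  let ?\<sigma> = "\<lambda>i. i + r"
  let ?J = "{1..<r}" and ?I = "{1..r}"
  let ?T = "\<lambda>w. \<lambda>j\<in>?J. (w j, w (j + r))"
  let ?P = "PiM ?J (\<lambda>_. unif_square)"
  have D: "distr (PiM ?V M) ?P ?T = ?P"
    by (rule distr_pairs[of ?J "\<lambda>j. j" ?\<sigma>]) (auto simp: M_def inj_on_def)
  have T: "?T \<in> PiM ?V M \<rightarrow>\<^sub>M ?P"
  proof (rule measurable_restrict)
    fix j assume j: "j \<in> ?J"
    then have "(\<lambda>w. (w j, w (j + r))) \<in> PiM ?V M \<rightarrow>\<^sub>M M j \<Otimes>\<^sub>M M (j + r)"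
      by (intro measurable_Pair measurable_component_singleton) auto
    then show "(\<lambda>w. (w j, w (j + r))) \<in> PiM ?V M \<rightarrow>\<^sub>M unif_square"
      using j by (simp add: M_def unif_square_def)
  qed
  let ?S = "{Z \<in> space ?P. Perm (insert (u, v) (Z ` ?J)) = \<pi>}"
  have S: "?S \<in> sets ?P"
  proof -
    \<comment> \<open>The fixed point is adjoined as sample number \<open>r\<close>, so that
      \<open>Perm_event_measurable\<close> applies to one index set.\<close>
    define Z' where "Z' Z i = (if i = r then (u, v) else Z i)" for Z :: "nat \<Rightarrow> real \<times> real" and i
    have "Z' Z ` ?I = insert (u, v) (Z ` ?J)" for Z
    proof -
      have "?I = insert r ?J" using r by auto
      then show ?thesis by (auto simp: Z'_def image_iff)
    qed
    moreover have "{Z \<in> space ?P. Perm (Z' Z ` ?I) = \<pi>} \<in> sets ?P"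
    proof (rule Perm_event_measurable)
      have comp: "(\<lambda>Z. Z i) \<in> ?P \<rightarrow>\<^sub>M borel \<Otimes>\<^sub>M borel" if "i \<in> ?J" for i
      proof -
        have "(\<lambda>Z. Z i) \<in> ?P \<rightarrow>\<^sub>M unif_square" by (rule measurable_component_singleton[OF that])
        moreover have "?P \<rightarrow>\<^sub>M unif_square = ?P \<rightarrow>\<^sub>M borel"
          by (rule measurable_cong_sets[OF refl sets_unif_square])
        ultimately show ?thesis unfolding borel_prod by blast
      qed
      fix i assume i: "i \<in> ?I"
      have iJ: "i \<in> ?J" if "i \<noteq> r" using i that by auto
      show "(\<lambda>Z. fst (Z' Z i)) \<in> borel_measurable ?P"
      proof (cases "i = r")
        case False
        from measurable_compose[OF comp[OF iJ[OF False]] measurable_fst] False show ?thesis by (simp add: Z'_def)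
      qed (simp add: Z'_def)
      show "(\<lambda>Z. snd (Z' Z i)) \<in> borel_measurable ?P"
      proof (cases "i = r")
        case False
        from measurable_compose[OF comp[OF iJ[OF False]] measurable_snd] False show ?thesis by (simp add: Z'_def)
      qed (simp add: Z'_def)
    qed simp
    ultimately show ?thesis by simp
  qed
  have "psi r \<pi> (u, v) = measure (distr (PiM ?V M) ?P ?T) ?S" unfolding psi_def Let_def D ..
  also have "\<dots> = measure (PiM ?V M) (?T -` ?S \<inter> space (PiM ?V M))" by (rule measure_distr[OF T S])
  also have "\<dots> = (\<integral>w. indicator (?T -` ?S \<inter> space (PiM ?V M)) w \<partial>PiM ?V M)" by (simp add: Int_absorb2)
  \<comment> \<open>Almost surely the abscissas are pairwise distinct, and so are the ordinates;
    \<open>Perm_eq_iff_patt\<close> then identifies the two integrands.\<close>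
  also have "\<dots> = (\<integral>w. patt r ?I \<pi> w (w \<circ> ?\<sigma>) \<partial>PiM ?V M)"
  proof (rule integral_cong_AE)
    show "indicator (?T -` ?S \<inter> space (PiM ?V M)) \<in> borel_measurable (PiM ?V M)"
      using measurable_sets[OF T S] by simp
    show "(\<lambda>w. patt r ?I \<pi> w (w \<circ> ?\<sigma>)) \<in> borel_measurable (PiM ?V M)"
      by (intro bmeas_borel bmeas_patt pi) auto
    have AEr: "AE w in PiM ?V M. w r = u" "AE w in PiM ?V M. w (2 * r) = v"
    proof -
      have "AE x in M r. x = u" unfolding M_r by (rule AE_return_eq)
      then show "AE w in PiM ?V M. w r = u" using r by (intro AE_component) auto
      have "AE x in M (2 * r). x = v" unfolding M_2r by (rule AE_return_eq)
      then show "AE w in PiM ?V M. w (2 * r) = v" using r by (intro AE_component) auto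
    qed
    \<comment> \<open>The two Dirac coordinates may coincide, but one is an abscissa and the other
      an ordinate, and these are never compared.\<close>
    have ne: "AE w in PiM ?V M. w i \<noteq> w j" if "i \<in> ?V" "j \<in> ?V" "i \<noteq> j" "\<not> (i \<in> {r, 2 * r} \<and> j \<in> {r, 2 * r})" for i j
    proof (cases "i \<in> {r, 2 * r}")
      case True
      then have "M j = unif01" using that by (auto simp: M_def)
      then have "AE w in PiM ?V M. w j \<noteq> w i" using that by (intro AE_coordinates_ne) auto
      then show ?thesis by eventually_elim auto
    next
      case False
      then show ?thesis using that by (intro AE_coordinates_ne) (auto simp: M_def)
    qed
    have "AE w in PiM ?V M. \<forall>i\<in>?I. \<forall>j\<in>?I. i \<noteq> j \<longrightarrow> w i \<noteq> w j \<and> w (i + r) \<noteq> w (j + r)"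
    proof (intro AE_finite_allI)
      fix i j assume ij: "i \<in> ?I" "j \<in> ?I"
      show "AE w in PiM ?V M. i \<noteq> j \<longrightarrow> w i \<noteq> w j \<and> w (i + r) \<noteq> w (j + r)"
      proof (cases "i = j")
        case False
        have "AE w in PiM ?V M. w i \<noteq> w j" "AE w in PiM ?V M. w (i + r) \<noteq> w (j + r)"
          using ij False r by (intro ne; auto)+
        then show ?thesis by eventually_elim auto
      qed simp
    qed auto
    then show "AE w in PiM ?V M. indicator (?T -` ?S \<inter> space (PiM ?V M)) w = patt r ?I \<pi> w (w \<circ> ?\<sigma>)"
      using AEr AE_space
    proof eventually_elim
      case (elim w)
      have "?I = insert r ?J" using r by auto
      then have "(\<lambda>i. (w i, (w \<circ> ?\<sigma>) i)) ` ?I = insert (u, v) (?T w ` ?J)"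
        using elim by (auto simp: mult_2 image_iff)
      moreover have "Perm ((\<lambda>i. (w i, (w \<circ> ?\<sigma>) i)) ` ?I) = \<pi> \<longleftrightarrow> patt r ?I \<pi> w (w \<circ> ?\<sigma>) = 1"
        using elim(1) by (intro Perm_eq_iff_patt pi) (auto simp: inj_on_def)
      moreover have "patt r ?I \<pi> w (w \<circ> ?\<sigma>) = 0 \<or> patt r ?I \<pi> w (w \<circ> ?\<sigma>) = 1"
      proof -
        have "inj_on w ?I" using elim(1) by (auto simp: inj_on_def)
        then obtain a where "a \<in> bijs r ?I" "strict_mono_on {1..r} (w \<circ> a)"
          using ex_enumeration[of ?I r w] by auto
        from patt_eq[OF _ this, of \<pi> "w \<circ> ?\<sigma>"] show ?thesis by auto
      qed
      moreover have "?T w \<in> space ?P" using measurable_space[OF T] elim(4) by blast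
      ultimately show ?case using elim(4) by (auto simp: indicator_def)
    qed
  qed
  also have "\<dots> = (\<integral>w. pkernel r \<pi> (w r) (w (2 * r)) \<partial>PiM ?V M)"
    using integral_patt[of ?I r ?\<sigma> r \<pi> "\<lambda>_. 1"] r pi by (auto simp: M_def inj_on_def free_of_def mult_2)
  also have "\<dots> = (\<integral>w. pkernel r \<pi> u v \<partial>PiM ?V M)"
  proof (rule integral_cong_AE)
    have V: "r \<in> ?V" "2 * r \<in> ?V" using r by auto
    show "(\<lambda>w. pkernel r \<pi> (w r) (w (2 * r))) \<in> borel_measurable (PiM ?V M)"
      by (intro bmeas_borel bmeas_pkernel measurable_coordinate V)
    have "AE x in M r. x = u" "AE x in M (2 * r). x = v" unfolding M_r M_2r by (rule AE_return_eq)+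
    then have "AE w in PiM ?V M. w r = u" "AE w in PiM ?V M. w (2 * r) = v" using V by (intro AE_component; simp)+
    then show "AE w in PiM ?V M. pkernel r \<pi> (w r) (w (2 * r)) = pkernel r \<pi> u v"
      by eventually_elim simp
  qed simp
  also have "\<dots> = pkernel r \<pi> u v" by (simp only: lebesgue_integral_const P.prob_space scaleR_one)
  finally show ?thesis .
qed

subsection \<open>Bernstein polynomials and the degenerate kernels\<close>

text \<open>Bernstein polynomial of degree \<open>r - 1\<close> and index \<open>k - 1\<close> in
  the clamped variable, see \<open>bern_Suc\<close>.\<close>

definition bern :: "nat \<Rightarrow> nat \<Rightarrow> real \<Rightarrow> real"
  where "bern r k u = fact (r - 1) * q r k u"

definition cbern :: "nat \<Rightarrow> nat \<Rightarrow> real \<Rightarrow> real"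
  where "cbern r k u = bern r k u - 1 / real r"

definition gker :: "nat \<Rightarrow> (nat \<Rightarrow> nat) \<Rightarrow> real \<Rightarrow> real \<Rightarrow> real"
  where "gker r \<pi> u v = pkernel r \<pi> u v - 1 / fact r"

lemma bern_Suc:
  assumes "j \<le> m"
  shows "bern (Suc m) (Suc j) u = real (m choose j) * clamp01 u ^ j * (1 - clamp01 u) ^ (m - j)"
proof -
  have "real (m choose j) = fact m / (fact j * fact (m - j))" by (rule binomial_fact[OF assms])
  then show ?thesis unfolding bern_def q_def using assms by (simp add: field_simps)
qed

lemma sum_bern:
  assumes "r \<ge> 1" shows "(\<Sum>k=1..r. bern r k u) = 1"
proof -
  obtain m where m: "r = Suc m" using assms by (cases r) auto
  have "(\<Sum>k=1..r. bern r k u) = (\<Sum>j\<le>m. bern r (Suc j) u)"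
    unfolding m One_nat_def sum.atLeast_Suc_atMost_Suc_shift by (simp add: atMost_atLeast0)
  also have "\<dots> = (\<Sum>j\<le>m. real (m choose j) * clamp01 u ^ j * (1 - clamp01 u) ^ (m - j))"
    unfolding m by (intro sum.cong refl bern_Suc) auto
  also have "\<dots> = (clamp01 u + (1 - clamp01 u)) ^ m" by (rule binomial_ring[symmetric])
  finally show ?thesis by simp
qed

lemma sum_cbern: "r \<ge> 1 \<Longrightarrow> (\<Sum>k=1..r. cbern r k u) = 0"
  unfolding cbern_def by (simp add: sum_subtractf sum_bern[unfolded One_nat_def])

lemma bern_measurable [measurable]: "bern r k \<in> borel_measurable borel"
  unfolding bern_def[abs_def] by measurable

lemma cbern_measurable [measurable]: "cbern r k \<in> borel_measurable borel"
  unfolding cbern_def[abs_def] by measurable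

lemma cbern_bounded: "\<exists>B. \<forall>u. \<bar>cbern r k u\<bar> \<le> B"
proof -
  have "\<bar>cbern r k u\<bar> \<le> fact (r - 1) + 1 / real r" for u
  proof -
    have "\<bar>bern r k u\<bar> \<le> fact (r - 1)"
      unfolding bern_def using q_bounds[of r k u] by (simp add: abs_mult mult_left_le)
    then show ?thesis unfolding cbern_def by (intro order_trans[OF abs_triangle_ineq4]) simp
  qed
  then show ?thesis by blast
qed

lemma integrable_unif01:
  assumes "f \<in> borel_measurable borel" "\<And>u. \<bar>f u\<bar> \<le> (B::real)"
  shows "integrable unif01 f"
proof -
  interpret prob_space unif01 by (rule prob_space_unif01)
  have "f \<in> borel_measurable unif01" using assms(1) measurable_cong_sets[OF sets_unif01 refl] by blast
  then show ?thesis using assms(2) by (intro integrable_const_bound[where B = B]) auto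
qed

text \<open>The integral of \<open>q r j\<close> is the probability that \<open>r\<close> uniform
  points come in a given order, whatever \<open>j\<close> is: integrating out the chain may stop at
  any position. So all Bernstein polynomials have the same integral, and as a partition of unity
  they share the total mass 1 equally.\<close>

lemma integral_bern:
  assumes k: "k \<in> {1..r}" shows "(\<integral>u. bern r k u \<partial>unif01) = 1 / real r"
proof -
  interpret U: prob_space unif01 by (rule prob_space_unif01)
  interpret real_product "\<lambda>_. unif01" "{1..r}" by unfold_locales auto
  define e :: real where "e = (\<integral>w. of_bool (strict_mono_on {1..r} (w \<circ> (\<lambda>j. j))) * 1 \<partial>PiM {1..r} (\<lambda>_. unif01))"
  have q: "(\<integral>u. q r j u \<partial>unif01) = e" if j: "j \<in> {1..r}" for j
  proof -
    have "e = (\<integral>w. q r j (w j) * 1 \<partial>PiM {1..r} (\<lambda>_. unif01))"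
      unfolding e_def by (rule integrate_out_chain) (use j in \<open>auto simp: free_of_def\<close>)
    also have "\<dots> = (\<integral>w. (\<integral>u. q r j u \<partial>unif01) \<partial>PiM {1..r} (\<lambda>_. unif01))"
      by (rule integral_one_coordinate[where x = j]) (use j in auto)
    also have "\<dots> = (\<integral>u. q r j u \<partial>unif01)" by (simp only: lebesgue_integral_const P.prob_space scaleR_one)
    finally show ?thesis ..
  qed
  have i: "integrable unif01 (bern r j)" for j
    unfolding bern_def[abs_def] using q_bounds[of r j]
    by (intro integrable_mult_right integrable_unif01[where B = 1]) (auto simp: abs_le_iff intro: order_trans[of _ 0])
  have b: "(\<integral>u. bern r j u \<partial>unif01) = fact (r - 1) * e" if "j \<in> {1..r}" for j
    unfolding bern_def using q[OF that] by simp
  have r: "r \<ge> 1" using k by auto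
  have "1 = (\<integral>u. (\<Sum>j=1..r. bern r j u) \<partial>unif01)" using r by (simp add: sum_bern[unfolded One_nat_def] U.prob_space[simplified])
  also have "\<dots> = (\<Sum>j=1..r. \<integral>u. bern r j u \<partial>unif01)" by (rule Bochner_Integration.integral_sum) (rule i)
  also have "\<dots> = (\<Sum>j=1..r. fact (r - 1) * e)" by (intro sum.cong refl b)
  also have "\<dots> = real r * (\<integral>u. bern r k u \<partial>unif01)" unfolding b[OF k] by simp
  finally show ?thesis using r by (simp add: field_simps)
qed

lemma integral_cbern:
  assumes k: "k \<in> {1..r}" shows "(\<integral>u. cbern r k u \<partial>unif01) = 0"
proof -
  interpret U: prob_space unif01 by (rule prob_space_unif01)
  have "integrable unif01 (bern r k)"
    unfolding bern_def[abs_def] using q_bounds[of r k]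
    by (intro integrable_mult_right integrable_unif01[where B = 1]) (auto simp: abs_le_iff intro: order_trans[of _ 0])
  then show ?thesis
    unfolding cbern_def using U.prob_space by (simp add: integral_bern[OF k])
qed

text \<open>Both families of centred Bernstein polynomials sum to 0, so the cross terms vanish; the
  constant that remains is the \<open>1 / fact r\<close> subtracted in \<open>gker\<close>.\<close>

lemma gker_eq:
  assumes r: "r \<ge> 1" and pi: "\<pi> \<in> perms r"
  shows "gker r \<pi> u v = (\<Sum>k=1..r. cbern r k u * cbern r (\<pi> k) v) / fact (r - 1)"
proof -
  have p: "\<pi> permutes {1..r}" using pi by simp
  have s: "(\<Sum>k=1..r. cbern r (\<pi> k) v) = 0"
    using sum.permute[OF p, of "\<lambda>k. cbern r k v"] sum_cbern[OF r, of v] by (simp add: comp_def)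
  have "(\<Sum>k=1..r. bern r k u * bern r (\<pi> k) v)
    = (\<Sum>k=1..r. cbern r k u * cbern r (\<pi> k) v + (1 / real r) * cbern r k u + (1 / real r) * cbern r (\<pi> k) v + 1 / real r * (1 / real r))"
    by (intro sum.cong refl) (simp add: cbern_def algebra_simps)
  also have "\<dots> = (\<Sum>k=1..r. cbern r k u * cbern r (\<pi> k) v) + 1 / real r"
    using r by (simp only: sum.distrib sum_distrib_left[symmetric] s sum_cbern[OF r]) simp
  finally have *: "(\<Sum>k=1..r. bern r k u * bern r (\<pi> k) v) = (\<Sum>k=1..r. cbern r k u * cbern r (\<pi> k) v) + 1 / real r" .
  have "pkernel r \<pi> u v = (\<Sum>k=1..r. bern r k u * bern r (\<pi> k) v) / fact (r - 1)"
    unfolding pkernel_def bern_def sum_divide_distrib sum_distrib_left by (intro sum.cong refl) simp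
  moreover have "fact r = real r * fact (r - 1)" using r by (simp add: fact_reduce)
  ultimately show ?thesis
    unfolding gker_def * by (simp add: add_divide_distrib)
qed

lemma gker_measurable: "(\<lambda>z. gker r \<pi> (fst z) (snd z)) \<in> borel_measurable borel"
  using pkernel_measurable[of r \<pi>] unfolding gker_def by (simp add: split_beta' borel_measurable_diff)

lemma gker_bounded: "\<exists>B. \<forall>u v. \<bar>gker r \<pi> u v\<bar> \<le> B"
proof -
  have "\<bar>gker r \<pi> u v\<bar> \<le> fact (r - 1) * real r + 1" for u v
  proof -
    have "(\<Sum>k=1..r. q r k u * q r (\<pi> k) v) \<le> real r"
    proof -
      have "q r k u * q r (\<pi> k) v \<le> 1" for k by (intro mult_le_one q_bounds)
      from sum_bounded_above[of "{1..r}", OF this] show ?thesis by simp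
    qed
    then have "pkernel r \<pi> u v \<le> fact (r - 1) * real r" unfolding pkernel_def by (intro mult_left_mono) auto
    moreover have "0 \<le> 1 / (fact r :: real)" "1 / (fact r :: real) \<le> 1" by (simp_all add: fact_ge_1)
    ultimately show ?thesis unfolding gker_def using pkernel_nonneg[of r \<pi> u v] by linarith
  qed
  then show ?thesis by blast
qed

lemma integral_gker_left:
  assumes r: "r \<ge> 1" and pi: "\<pi> \<in> perms r"
  shows "(\<integral>u. gker r \<pi> u v \<partial>unif01) = 0"
proof -
  have i: "integrable unif01 (cbern r k)" for k
    using cbern_bounded[of r k] integrable_unif01[OF cbern_measurable] by blast
  have "(\<integral>u. gker r \<pi> u v \<partial>unif01) = (\<integral>u. (\<Sum>k=1..r. cbern r k u * (cbern r (\<pi> k) v / fact (r - 1))) \<partial>unif01)"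
    unfolding gker_eq[OF r pi] sum_divide_distrib by simp
  also have "\<dots> = (\<Sum>k=1..r. \<integral>u. cbern r k u * (cbern r (\<pi> k) v / fact (r - 1)) \<partial>unif01)"
    by (intro Bochner_Integration.integral_sum integrable_mult_left i)
  also have "\<dots> = 0" by (intro sum.neutral ballI) (simp add: integral_cbern)
  finally show ?thesis .
qed

lemma integral_gker_right:
  assumes r: "r \<ge> 1" and pi: "\<pi> \<in> perms r"
  shows "(\<integral>v. gker r \<pi> u v \<partial>unif01) = 0"
proof -
  have i: "integrable unif01 (cbern r k)" for k
    using cbern_bounded[of r k] integrable_unif01[OF cbern_measurable] by blast
  have pk: "\<pi> k \<in> {1..r}" if "k \<in> {1..r}" for k using permutes_in_image[of \<pi> "{1..r}"] pi that by blast
  have "(\<integral>v. gker r \<pi> u v \<partial>unif01) = (\<integral>v. (\<Sum>k=1..r. (cbern r k u / fact (r - 1)) * cbern r (\<pi> k) v) \<partial>unif01)"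
    unfolding gker_eq[OF r pi] sum_divide_distrib by simp
  also have "\<dots> = (\<Sum>k=1..r. \<integral>v. (cbern r k u / fact (r - 1)) * cbern r (\<pi> k) v \<partial>unif01)"
    by (intro Bochner_Integration.integral_sum integrable_mult_right i)
  also have "\<dots> = 0" using pk by (intro sum.neutral ballI) (simp add: integral_cbern)
  finally show ?thesis .
qed

section \<open>Bounded kernels on the unit square\<close>

definition sqf :: "(real \<Rightarrow> real \<Rightarrow> real) \<Rightarrow> bool"
  where "sqf w \<longleftrightarrow> (\<lambda>z. w (fst z) (snd z)) \<in> borel_measurable borel \<and> (\<exists>B. \<forall>u v. \<bar>w u v\<bar> \<le> B)"

definition IS :: "(real \<Rightarrow> real \<Rightarrow> real) \<Rightarrow> real"
  where "IS w = (\<integral>z. w (fst z) (snd z) \<partial>unif_square)"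

lemma sqf_gker: "sqf (gker r \<pi>)"
  using gker_measurable gker_bounded by (simp add: sqf_def)

lemma sqf_const [intro, simp]: "sqf (\<lambda>_ _. c)"
  by (auto simp: sqf_def)

lemma sqf_add:
  assumes "sqf f" "sqf g" shows "sqf (\<lambda>u v. f u v + g u v)"
proof -
  obtain A B where "\<And>u v. \<bar>f u v\<bar> \<le> A" "\<And>u v. \<bar>g u v\<bar> \<le> B" using assms unfolding sqf_def by blast
  then have "\<bar>f u v + g u v\<bar> \<le> A + B" for u v by (meson abs_triangle_ineq add_mono order_trans)
  with assms show ?thesis unfolding sqf_def by auto
qed

lemma sqf_mult:
  assumes "sqf f" "sqf g" shows "sqf (\<lambda>u v. f u v * g u v)"
proof -
  obtain A B where *: "\<And>u v. \<bar>f u v\<bar> \<le> A" "\<And>u v. \<bar>g u v\<bar> \<le> B" using assms unfolding sqf_def by blast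
  then have "0 \<le> A" by (meson abs_ge_zero order_trans)
  with * have "\<bar>f u v * g u v\<bar> \<le> A * B" for u v by (auto simp: abs_mult intro!: mult_mono)
  with assms show ?thesis unfolding sqf_def by auto
qed

lemma sqf_sum:
  assumes "\<And>i. i \<in> I \<Longrightarrow> sqf (f i)" shows "sqf (\<lambda>u v. \<Sum>i\<in>I. f i u v)"
  using assms by (induction I rule: infinite_finite_induct) (auto intro: sqf_add)

lemma sqf_swap:
  assumes "sqf f" shows "sqf (\<lambda>u v. f v u)"
proof -
  have "(\<lambda>z. f (fst z) (snd z)) \<in> borel_measurable (borel \<Otimes>\<^sub>M borel)" using assms by (simp add: sqf_def borel_prod)
  from measurable_compose[OF measurable_pair_swap' this] assms
  show ?thesis by (auto simp: sqf_def borel_prod split_beta')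
qed

lemma sqf_fst: "f \<in> borel_measurable borel \<Longrightarrow> (\<And>u. \<bar>f u\<bar> \<le> B) \<Longrightarrow> sqf (\<lambda>u v. f u)"
  unfolding sqf_def by (auto simp: borel_prod[symmetric])

lemma sqf_integrable:
  assumes "sqf w" shows "integrable unif_square (\<lambda>z. w (fst z) (snd z))"
proof -
  interpret prob_space unif_square by (rule prob_space_unif_square)
  obtain B where "\<And>u v. \<bar>w u v\<bar> \<le> B" using assms unfolding sqf_def by blast
  moreover have "(\<lambda>z. w (fst z) (snd z)) \<in> borel_measurable unif_square"
    using assms measurable_cong_sets[OF sets_unif_square refl] unfolding sqf_def by blast
  ultimately show ?thesis by (intro integrable_const_bound[where B = B]) auto
qed

lemma IS_add: "sqf f \<Longrightarrow> sqf g \<Longrightarrow> IS (\<lambda>u v. f u v + g u v) = IS f + IS g"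
  unfolding IS_def by (intro Bochner_Integration.integral_add sqf_integrable)

lemma IS_cmult: "IS (\<lambda>u v. c * f u v) = c * IS f"
  unfolding IS_def by simp

lemma IS_sum: "(\<And>i. i \<in> I \<Longrightarrow> sqf (f i)) \<Longrightarrow> IS (\<lambda>u v. \<Sum>i\<in>I. f i u v) = (\<Sum>i\<in>I. IS (f i))"
  unfolding IS_def by (intro Bochner_Integration.integral_sum sqf_integrable)

lemma IS_swap:
  assumes "sqf f" shows "IS (\<lambda>u v. f v u) = IS f"
proof -
  interpret U: prob_space unif01 by (rule prob_space_unif01)
  interpret pair_prob_space unif01 unif01 ..
  have "(\<lambda>z. f (fst z) (snd z)) \<in> borel_measurable unif_square"
    using assms measurable_cong_sets[OF sets_unif_square refl] unfolding sqf_def by blast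
  then show ?thesis
    using integral_product_swap[of "\<lambda>z. f (fst z) (snd z)"]
    unfolding IS_def unif_square_def by (simp add: split_beta')
qed

lemma IS_iterated:
  assumes "sqf f" shows "IS f = (\<integral>u. (\<integral>v. f u v \<partial>unif01) \<partial>unif01)"
proof -
  interpret U: prob_space unif01 by (rule prob_space_unif01)
  interpret pair_prob_space unif01 unif01 ..
  have "integrable (unif01 \<Otimes>\<^sub>M unif01) (\<lambda>(u, v). f u v)"
    using sqf_integrable[OF assms] by (simp add: unif_square_def split_beta')
  from integral_fst'[OF this] show ?thesis unfolding IS_def unif_square_def by (simp add: split_beta')
qed

lemma IS_gker:
  assumes "r \<ge> 1" "\<pi> \<in> perms r" shows "IS (gker r \<pi>) = 0"
  unfolding IS_iterated[OF sqf_gker] integral_gker_right[OF assms] by simp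

text \<open>Both \<open>psi r \<pi>\<close> and its transpose have mean \<open>1 / fact r\<close>,
  because \<open>gker\<close> integrates to 0; the covariances thus become plain integrals of
  products of \<open>gker\<close>.\<close>

lemma cov_matrix_eq:
  assumes r: "r \<ge> 1" and pi: "\<pi> \<in> perms r" and rho: "\<rho> \<in> perms r"
  shows "cov_matrix r p2 \<pi> \<rho> = IS (\<lambda>u v. gker r \<pi> u v * (gker r \<rho> u v + p2 * gker r \<rho> v u)) / (fact (r - 1))\<^sup>2"
proof -
  interpret S: prob_space unif_square by (rule prob_space_unif_square)
  have psi: "psi r \<pi> (u, v) = gker r \<pi> u v + 1 / fact r" if "\<pi> \<in> perms r" for \<pi> u v
    using psi_eq_pkernel[OF r that] by (simp add: gker_def)
  have IS1: "(\<integral>z. 1 / fact r \<partial>unif_square) = (1 / fact r :: real)" by (simp add: S.prob_space[simplified])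
  have m1: "(\<integral>z. (case z of (u, v) \<Rightarrow> psi r \<pi> (u, v)) \<partial>unif_square) = 1 / fact r" if "\<pi> \<in> perms r" for \<pi>
    using IS_gker[OF r that] sqf_integrable[OF sqf_gker[of r \<pi>]] IS1
    unfolding IS_def psi[OF that] by (simp add: split_beta' S.prob_space[simplified])
  have m2: "(\<integral>z. (case z of (u, v) \<Rightarrow> psi r \<pi> (v, u)) \<partial>unif_square) = 1 / fact r" if "\<pi> \<in> perms r" for \<pi>
    using IS_gker[OF r that] IS_swap[OF sqf_gker[of r \<pi>]] sqf_integrable[OF sqf_swap[OF sqf_gker[of r \<pi>]]] IS1
    unfolding IS_def psi[OF that] by (simp add: split_beta' S.prob_space[simplified])
  have c1: "covariance unif_square (\<lambda>(u, v). psi r \<pi> (u, v)) (\<lambda>(u, v). psi r \<rho> (u, v)) = IS (\<lambda>u v. gker r \<pi> u v * gker r \<rho> u v)"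
    unfolding covariance_def m1[OF pi] m1[OF rho] unfolding IS_def psi[OF pi] psi[OF rho] by (simp add: split_beta')
  have c2: "covariance unif_square (\<lambda>(u, v). psi r \<pi> (u, v)) (\<lambda>(u, v). psi r \<rho> (v, u)) = IS (\<lambda>u v. gker r \<pi> u v * gker r \<rho> v u)"
    unfolding covariance_def m1[OF pi] m2[OF rho] unfolding IS_def psi[OF pi] psi[OF rho] by (simp add: split_beta')
  have "IS (\<lambda>u v. gker r \<pi> u v * (gker r \<rho> u v + p2 * gker r \<rho> v u))
     = IS (\<lambda>u v. gker r \<pi> u v * gker r \<rho> u v + p2 * (gker r \<pi> u v * gker r \<rho> v u))"
    by (simp add: distrib_left mult.left_commute)
  also have "\<dots> = IS (\<lambda>u v. gker r \<pi> u v * gker r \<rho> u v) + p2 * IS (\<lambda>u v. gker r \<pi> u v * gker r \<rho> v u)"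
    by (subst IS_add) (auto intro!: sqf_mult sqf_gker sqf_const sqf_swap[OF sqf_gker] simp: IS_cmult)
  finally show ?thesis unfolding cov_matrix_def c1 c2 by simp
qed

subsection \<open>The rank of the covariance matrix\<close>

interpretation fv: vector_space "\<lambda>(c::real) (v :: 'i \<Rightarrow> real) i. c * v i"
  by unfold_locales (auto simp: fun_eq_iff algebra_simps)

lemma sum_fun_apply: "(\<Sum>i\<in>I. f i) x = (\<Sum>i\<in>I. f i x :: real)"
  by (induction I rule: infinite_finite_induct) auto

text \<open>Rank through a family that spans the column space. Independence is stated for
  coefficients indexed by \<open>K\<close>, which also forces \<open>w\<close> to be injective and
  makes the dimension the cardinality of \<open>K\<close>.\<close>

lemma matrix_rank_eqI:
  fixes w :: "'e \<Rightarrow> 'i \<Rightarrow> real"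
  assumes fin: "finite K"
    and cols: "\<And>j. j \<in> I \<Longrightarrow> (\<lambda>i. if i \<in> I then A i j else 0) \<in> fv.span (w ` K)"
    and span: "\<And>e. e \<in> K \<Longrightarrow> w e \<in> fv.span ((\<lambda>j i. if i \<in> I then A i j else 0) ` I)"
    and indep: "\<And>c. (\<And>i. (\<Sum>e\<in>K. c e * w e i) = 0) \<Longrightarrow> (\<And>e. e \<in> K \<Longrightarrow> c e = 0)"
  shows "matrix_rank I A = card K"
proof -
  have inj: "inj_on w K"
  proof (rule inj_onI, rule ccontr)
    fix e f assume ef: "e \<in> K" "f \<in> K" "w e = w f" "e \<noteq> f"
    define c where "c x = (if x = e then 1 else 0) - (if x = f then 1 else 0 :: real)" for x
    have "(\<Sum>x\<in>K. c x * w x i) = 0" for i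
      using fin ef by (simp add: c_def left_diff_distrib sum_subtractf if_distrib[of "\<lambda>t. t * _"] cong: if_cong)
    then have "c e = 0" by (rule indep) (rule ef(1))
    then show False using ef by (simp add: c_def)
  qed
  have "\<not> fv.dependent (w ` K)"
  proof
    assume "fv.dependent (w ` K)"
    then obtain u v where uv: "v \<in> w ` K" "u v \<noteq> 0" "(\<Sum>v\<in>w ` K. (\<lambda>i. u v * v i)) = 0"
      using fv.dependent_finite[OF finite_imageI[OF fin]] by blast
    have "(\<Sum>e\<in>K. u (w e) * w e i) = 0" for i
      using fun_cong[OF uv(3), of i] by (simp add: sum_fun_apply sum.reindex[OF inj])
    from indep[of "\<lambda>e. u (w e)", OF this] uv show False by blast
  qed
  moreover have "fv.span (w ` K) = fv.span ((\<lambda>j i. if i \<in> I then A i j else 0) ` I)"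
    unfolding fv.span_eq using cols span by auto
  ultimately have "fv.dim ((\<lambda>j i. if i \<in> I then A i j else 0) ` I) = card (w ` K)"
    by (intro fv.dim_eq_card) auto
  then show ?thesis by (simp add: matrix_rank_def card_image[OF inj])
qed

text \<open>These span the same functions as the centred Bernstein polynomials but drop their one
  linear relation, as \<open>dbern r r\<close> is 0.\<close>

definition dbern :: "nat \<Rightarrow> nat \<Rightarrow> real \<Rightarrow> real"
  where "dbern r i u = cbern r i u - cbern r r u"

text \<open>In the Bernstein basis, dividing by the power of 1 - x and substituting y = x / (1 - x)
  gives an ordinary polynomial in y. It has infinitely many roots, because a function that vanishes
  almost everywhere vanishes at infinitely many points of the unit interval.\<close>

lemma dbern_independent:
  assumes ae: "AE x in unif01. (\<Sum>i\<in>{1..<r}. a i * dbern r i x) = 0" and i: "i \<in> {1..<r}"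
  shows "a i = 0"
proof -
  interpret U: prob_space unif01 by (rule prob_space_unif01)
  obtain m where m: "r = Suc m" using i by (cases r) auto
  \<comment> \<open>Differences rewritten in the full basis: the last polynomial collects minus the
    sum of the coefficients.\<close>
  define a' where "a' j = (if j = r then - (\<Sum>i\<in>{1..<r}. a i) else a j)" for j
  have rI: "{1..r} = insert r {1..<r}" using m by auto
  have eq: "(\<Sum>i\<in>{1..<r}. a i * dbern r i x) = (\<Sum>j\<le>m. (a' (Suc j) * real (m choose j)) * clamp01 x ^ j * (1 - clamp01 x) ^ (m - j))" for x
  proof -
    have "(\<Sum>i\<in>{1..<r}. a i * dbern r i x) = (\<Sum>i\<in>{1..<r}. a i * bern r i x) - (\<Sum>i\<in>{1..<r}. a i) * bern r r x"
      by (simp add: dbern_def cbern_def right_diff_distrib sum_subtractf sum_distrib_right)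
    also have "(\<Sum>i\<in>{1..<r}. a i * bern r i x) = (\<Sum>i\<in>{1..<r}. a' i * bern r i x)"
      by (intro sum.cong refl) (auto simp: a'_def)
    also have "\<dots> - (\<Sum>i\<in>{1..<r}. a i) * bern r r x = (\<Sum>j=1..r. a' j * bern r j x)"
      unfolding rI by (simp add: a'_def)
    also have "\<dots> = (\<Sum>j\<le>m. a' (Suc j) * bern r (Suc j) x)"
      unfolding m One_nat_def sum.atLeast_Suc_atMost_Suc_shift by (simp add: atMost_atLeast0)
    also have "\<dots> = (\<Sum>j\<le>m. (a' (Suc j) * real (m choose j)) * clamp01 x ^ j * (1 - clamp01 x) ^ (m - j))"
      unfolding m by (intro sum.cong refl) (simp add: bern_Suc mult.assoc)
    finally show ?thesis .
  qed
  define c where "c j = a' (Suc j) * real (m choose j)" for j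
  let ?Z = "{x \<in> {0<..<1}. (\<Sum>j\<le>m. c j * (x / (1 - x)) ^ j) = 0}"
  have inf: "infinite ?Z"
  proof
    assume fin: "finite ?Z"
    then have "AE x in lborel. x \<notin> ?Z" by (intro AE_not_in finite_imp_null_set_lborel)
    moreover have "AE x in lborel. x \<noteq> (0 :: real)" "AE x in lborel. x \<noteq> (1 :: real)" by (rule AE_lborel_singleton)+
    ultimately have "AE x in lborel. x \<in> {0..1} \<longrightarrow> x \<notin> ?Z \<and> 0 < x \<and> x < 1"
      by eventually_elim auto
    then have "AE x in unif01. x \<notin> ?Z \<and> 0 < x \<and> x < 1"
      unfolding unif01_def by (intro AE_uniform_measureI) auto
    with ae have "AE x in unif01. False"
    proof eventually_elim
      case (elim x)
      then have cl: "clamp01 x = x" by (simp add: clamp01_def)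
      have "0 = (\<Sum>j\<le>m. c j * x ^ j * (1 - x) ^ (m - j))"
        using elim(1) unfolding eq cl c_def by simp
      also have "\<dots> = (\<Sum>j\<le>m. (1 - x) ^ m * (c j * (x / (1 - x)) ^ j))"
      proof (rule sum.cong[OF refl])
        fix j assume "j \<in> {..m}"
        then have "(1 - x) ^ m = (1 - x) ^ j * (1 - x) ^ (m - j)" by (simp flip: power_add)
        then show "c j * x ^ j * (1 - x) ^ (m - j) = (1 - x) ^ m * (c j * (x / (1 - x)) ^ j)"
          using elim(2) by (simp add: power_divide)
      qed
      also have "\<dots> = (1 - x) ^ m * (\<Sum>j\<le>m. c j * (x / (1 - x)) ^ j)" by (rule sum_distrib_left[symmetric])
      finally have "(\<Sum>j\<le>m. c j * (x / (1 - x)) ^ j) = 0" using elim(2) by simp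
      then show False using elim(2) by auto
    qed
    then show False by simp
  qed
  have "inj_on (\<lambda>x. x / (1 - x)) ?Z"
  proof (rule inj_onI)
    fix x y :: real assume "x \<in> ?Z" "y \<in> ?Z" "x / (1 - x) = y / (1 - y)"
    then have "x * (1 - y) = y * (1 - x)" by (subst (asm) frac_eq_eq) auto
    then show "x = y" by (simp add: right_diff_distrib mult.commute)
  qed
  with inf have "infinite ((\<lambda>x. x / (1 - x)) ` ?Z)" by (simp add: finite_image_iff)
  moreover have "(\<lambda>x. x / (1 - x)) ` ?Z \<subseteq> {y. (\<Sum>j\<le>m. c j * y ^ j) = 0}" by auto
  ultimately have "infinite {y. (\<Sum>j\<le>m. c j * y ^ j) = 0}" using finite_subset by blast
  then have c0: "\<forall>j\<le>m. c j = 0" using polyfun_finite_roots[of c m] by blast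
  obtain j where j: "i = Suc j" "j \<le> m" using i m by (cases i) auto
  then have "c j = 0" using c0 by blast
  then show "a i = 0" using j i by (simp add: c_def a'_def)
qed

lemma dbern_measurable [measurable]: "dbern r i \<in> borel_measurable borel"
  unfolding dbern_def[abs_def] by measurable

definition tens :: "nat \<Rightarrow> nat \<times> nat \<Rightarrow> real \<Rightarrow> real \<Rightarrow> real"
  where "tens r e u v = dbern r (fst e) u * dbern r (snd e) v"

lemma sqf_tens: "sqf (tens r e)"
proof -
  have b: "sqf (\<lambda>u v. dbern r i u)" for i
  proof -
    obtain A B where "\<And>u. \<bar>cbern r i u\<bar> \<le> A" "\<And>u. \<bar>cbern r r u\<bar> \<le> B" using cbern_bounded by meson
    then have "\<bar>dbern r i u\<bar> \<le> A + B" for u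
      unfolding dbern_def by (meson abs_triangle_ineq4 add_mono order_trans)
    then show ?thesis by (intro sqf_fst) auto
  qed
  have "sqf (\<lambda>u v. dbern r (fst e) u * dbern r (snd e) v)"
    by (intro sqf_mult b sqf_swap[OF b])
  then show ?thesis by (simp add: tens_def[abs_def])
qed

lemma sqf_lincomb: "(\<And>e. e \<in> K \<Longrightarrow> sqf (f e)) \<Longrightarrow> sqf (\<lambda>u v. \<Sum>e\<in>K. c e * f e u v)"
  by (intro sqf_sum sqf_mult sqf_const) auto

text \<open>Fubini reduces to one variable twice: for almost every \<open>u\<close> the section in
  \<open>v\<close> has vanishing coefficients, and these coefficients are again combinations of the
  functions \<open>dbern\<close> in \<open>u\<close>.\<close>

lemma tens_independent:
  assumes IS0: "IS (\<lambda>u v. (\<Sum>e\<in>{1..<r} \<times> {1..<r}. C e * tens r e u v)\<^sup>2) = 0"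
    and e: "e \<in> {1..<r} \<times> {1..<r}"
  shows "C e = 0"
proof -
  interpret U: prob_space unif01 by (rule prob_space_unif01)
  interpret pair_prob_space unif01 unif01 ..
  let ?w = "\<lambda>u v. \<Sum>e\<in>{1..<r} \<times> {1..<r}. C e * tens r e u v"
  have w: "sqf ?w" by (intro sqf_lincomb sqf_tens)
  have "integrable unif_square (\<lambda>z. (?w (fst z) (snd z))\<^sup>2)"
    using sqf_integrable[OF sqf_mult[OF w w]] by (simp add: power2_eq_square)
  then have "AE z in unif_square. (?w (fst z) (snd z))\<^sup>2 = 0"
    using integral_nonneg_eq_0_iff_AE[of unif_square "\<lambda>z. (?w (fst z) (snd z))\<^sup>2"] IS0 unfolding IS_def by simp
  then have "AE z in unif01 \<Otimes>\<^sub>M unif01. ?w (fst z) (snd z) = 0"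
    unfolding unif_square_def by simp
  from AE_pair[OF this] have "AE u in unif01. AE v in unif01. ?w u v = 0" by simp
  moreover have wE: "?w u v = (\<Sum>j\<in>{1..<r}. (\<Sum>i\<in>{1..<r}. C (i, j) * dbern r i u) * dbern r j v)" for u v
    unfolding sum.cartesian_product' tens_def
    by (subst sum.swap) (simp add: sum_distrib_left sum_distrib_right mult.assoc)
  ultimately have "AE u in unif01. \<forall>j\<in>{1..<r}. (\<Sum>i\<in>{1..<r}. C (i, j) * dbern r i u) = 0"
  proof (elim eventually_mono, intro ballI)
    fix u j assume ae: "AE v in unif01. ?w u v = 0" and j: "j \<in> {1..<r}"
    show "(\<Sum>i\<in>{1..<r}. C (i, j) * dbern r i u) = 0"
      using dbern_independent[OF ae[unfolded wE] j] .
  qed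
  then have "AE u in unif01. (\<Sum>i\<in>{1..<r}. C (i, snd e) * dbern r i u) = 0"
    using e by (auto elim!: eventually_mono)
  from dbern_independent[OF this, of "fst e"] e show "C e = 0" by auto
qed

text \<open>Change of basis from \<open>gker_eq\<close>. The sums may run up to \<open>r\<close>
  since \<open>dbern r r\<close> is 0, and the term \<open>- 1 / real r\<close> cancels the rank-one
  remainder that arises because the sum of all \<open>dbern r i\<close> is
  \<open>- real r * cbern r r\<close>.\<close>

lemma gker_expand:
  assumes r: "r \<ge> 1" and pi: "\<pi> \<in> perms r"
  shows "gker r \<pi> u v = (\<Sum>e\<in>{1..<r} \<times> {1..<r}. ((of_bool (\<pi> (fst e) = snd e) - 1 / real r) / fact (r - 1)) * tens r e u v)"
proof -
  have p: "\<pi> permutes {1..r}" using pi by simp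
  have pk: "\<pi> k \<in> {1..r}" if "k \<in> {1..r}" for k using permutes_in_image[OF p] that by blast
  have rI: "{1..r} = insert r {1..<r}" using r by auto
  have dr: "dbern r r x = 0" for x by (simp add: dbern_def)
  have sub: "(\<Sum>i\<in>{1..<r}. f i) = (\<Sum>i\<in>{1..r}. f i)" if "f r = 0" for f :: "nat \<Rightarrow> real"
    unfolding rI using that by simp
  have sd: "(\<Sum>i=1..r. dbern r i x) = - real r * cbern r r x" for x
    unfolding dbern_def by (simp only: sum_subtractf sum_cbern[OF r]) simp
  have sp: "(\<Sum>k=1..r. cbern r (\<pi> k) v) = 0"
    using sum.permute[OF p, of "\<lambda>k. cbern r k v"] sum_cbern[OF r, of v] by (simp add: comp_def)
  let ?c = "\<lambda>i j. of_bool (\<pi> i = j) - 1 / real r"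
  have "(\<Sum>e\<in>{1..<r} \<times> {1..<r}. ?c (fst e) (snd e) * tens r e u v)
     = (\<Sum>i=1..<r. \<Sum>j=1..<r. ?c i j * (dbern r i u * dbern r j v))"
    unfolding sum.cartesian_product' tens_def by simp
  also have "\<dots> = (\<Sum>i=1..r. \<Sum>j=1..r. ?c i j * (dbern r i u * dbern r j v))"
    by (subst sub, simp add: dr) (intro sum.cong refl sub, simp add: dr)
  also have "\<dots> = (\<Sum>i=1..r. dbern r i u * dbern r (\<pi> i) v - dbern r i u * (1 / real r * (\<Sum>j=1..r. dbern r j v)))"
  proof (rule sum.cong[OF refl])
    fix i assume i: "i \<in> {1..r}"
    have "(\<Sum>j=1..r. ?c i j * (dbern r i u * dbern r j v))
      = (\<Sum>j=1..r. if \<pi> i = j then dbern r i u * dbern r j v else 0) - (\<Sum>j=1..r. dbern r i u * (1 / real r * dbern r j v))"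
      unfolding sum_subtractf[symmetric] by (intro sum.cong refl) (simp add: left_diff_distrib)
    also have "(\<Sum>j=1..r. if \<pi> i = j then dbern r i u * dbern r j v else 0) = dbern r i u * dbern r (\<pi> i) v"
      using pk[OF i] by (simp add: sum.delta)
    finally show "(\<Sum>j=1..r. ?c i j * (dbern r i u * dbern r j v)) = dbern r i u * dbern r (\<pi> i) v - dbern r i u * (1 / real r * (\<Sum>j=1..r. dbern r j v))"
      by (simp only: sum_distrib_left)
  qed
  also have "\<dots> = (\<Sum>i=1..r. dbern r i u * dbern r (\<pi> i) v) - (\<Sum>i=1..r. dbern r i u) * (1 / real r * (\<Sum>j=1..r. dbern r j v))"
    by (simp only: sum_subtractf sum_distrib_right)
  also have "(\<Sum>i=1..r. dbern r i u) * (1 / real r * (\<Sum>j=1..r. dbern r j v)) = real r * (cbern r r u * cbern r r v)"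
    unfolding sd using r by simp
  also have "(\<Sum>i=1..r. dbern r i u * dbern r (\<pi> i) v)
    = (\<Sum>i=1..r. cbern r i u * cbern r (\<pi> i) v - cbern r r v * cbern r i u - cbern r r u * cbern r (\<pi> i) v + cbern r r u * cbern r r v)"
    by (intro sum.cong refl) (simp add: dbern_def algebra_simps)
  also have "\<dots> = (\<Sum>i=1..r. cbern r i u * cbern r (\<pi> i) v) + real r * (cbern r r u * cbern r r v)"
    by (simp only: sum.distrib sum_subtractf sum_distrib_left[symmetric] sp sum_cbern[OF r]) simp
  finally have "(\<Sum>e\<in>{1..<r} \<times> {1..<r}. ?c (fst e) (snd e) * tens r e u v) = (\<Sum>i=1..r. cbern r i u * cbern r (\<pi> i) v)"
    by simp
  moreover have "(\<Sum>e\<in>{1..<r} \<times> {1..<r}. (?c (fst e) (snd e) / fact (r - 1)) * tens r e u v)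
      = (\<Sum>e\<in>{1..<r} \<times> {1..<r}. ?c (fst e) (snd e) * tens r e u v) / fact (r - 1)"
    by (simp only: sum_divide_distrib times_divide_eq_left)
  ultimately show ?thesis unfolding gker_eq[OF r pi] by simp
qed

text \<open>Take two permutations that agree except that their values at \<open>i\<close> and
  \<open>r\<close> are exchanged: j and r against r and j. In the difference of their kernels all
  other terms cancel, and the remaining ones factor. So the kernels generate the whole tensor
  square.\<close>

lemma tens_eq_gker:
  assumes e: "e \<in> {1..<r} \<times> {1..<r}"
  obtains \<rho> \<rho>' where "\<rho> \<in> perms r" "\<rho>' \<in> perms r" "\<And>u v. tens r e u v = fact (r - 1) * (gker r \<rho> u v - gker r \<rho>' u v)"
proof -
  obtain i j where ij: "e = (i, j)" "i \<in> {1..<r}" "j \<in> {1..<r}" using e by blast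
  have r: "r \<ge> 1" using ij by auto
  define \<rho> where "\<rho> = Transposition.transpose i j"
  define \<rho>' where "\<rho>' = Transposition.transpose i j \<circ> Transposition.transpose i r"
  have p: "\<rho> permutes {1..r}" unfolding \<rho>_def using ij by (intro permutes_swap_id) auto
  have p': "\<rho>' permutes {1..r}" unfolding \<rho>'_def using ij by (intro permutes_compose permutes_swap_id) auto
  have vals: "\<rho> i = j" "\<rho> r = r" "\<rho>' i = r" "\<rho>' r = j" "\<And>k. k \<noteq> i \<Longrightarrow> k \<noteq> r \<Longrightarrow> \<rho>' k = \<rho> k"
    using ij by (auto simp: \<rho>_def \<rho>'_def Transposition.transpose_def)
  have "tens r e u v = fact (r - 1) * (gker r \<rho> u v - gker r \<rho>' u v)" for u v
  proof -
    have "(\<Sum>k=1..r. cbern r k u * cbern r (\<rho> k) v) - (\<Sum>k=1..r. cbern r k u * cbern r (\<rho>' k) v)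
      = (\<Sum>k=1..r. cbern r k u * cbern r (\<rho> k) v - cbern r k u * cbern r (\<rho>' k) v)" by (rule sum_subtractf[symmetric])
    also have "\<dots> = (\<Sum>k\<in>{i, r}. cbern r k u * cbern r (\<rho> k) v - cbern r k u * cbern r (\<rho>' k) v)"
      by (rule sum.mono_neutral_right) (use ij vals in auto)
    also have "\<dots> = dbern r i u * dbern r j v"
      using ij vals by (simp add: dbern_def algebra_simps)
    finally show ?thesis
      unfolding gker_eq[OF r, of \<rho>, simplified, OF p[simplified]] gker_eq[OF r, of \<rho>', simplified, OF p'[simplified]]
      by (simp add: tens_def ij diff_divide_distrib[symmetric])
  qed
  then show thesis using that[of \<rho> \<rho>'] p p' by auto
qed

text \<open>The bilinear form whose Gram matrix on the kernels \<open>gker r \<pi>\<close> is the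
  covariance matrix, up to the squared factorial.\<close>

definition pair_form :: "real \<Rightarrow> (real \<Rightarrow> real \<Rightarrow> real) \<Rightarrow> (real \<Rightarrow> real \<Rightarrow> real) \<Rightarrow> real"
  where "pair_form p f w = IS (\<lambda>u v. f u v * (w u v + p * w v u))"

lemma sqf_pair_form:
  assumes "sqf f" "sqf w" shows "sqf (\<lambda>u v. f u v * (w u v + p * w v u))"
  by (rule sqf_mult[OF assms(1) sqf_add[OF assms(2) sqf_mult[OF sqf_const sqf_swap[OF assms(2)]]]])

lemma pair_form_sum_left:
  assumes "\<And>e. e \<in> K \<Longrightarrow> sqf (f e)" "sqf w"
  shows "pair_form p (\<lambda>u v. \<Sum>e\<in>K. c e * f e u v) w = (\<Sum>e\<in>K. c e * pair_form p (f e) w)"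
proof -
  have "pair_form p (\<lambda>u v. \<Sum>e\<in>K. c e * f e u v) w = IS (\<lambda>u v. \<Sum>e\<in>K. c e * (f e u v * (w u v + p * w v u)))"
    unfolding pair_form_def by (simp add: sum_distrib_right mult.assoc)
  also have "\<dots> = (\<Sum>e\<in>K. IS (\<lambda>u v. c e * (f e u v * (w u v + p * w v u))))"
    by (intro IS_sum) (intro sqf_mult[OF sqf_const] sqf_pair_form assms)
  finally show ?thesis by (simp add: IS_cmult pair_form_def)
qed

lemma pair_form_sum_right:
  assumes "\<And>e. e \<in> K \<Longrightarrow> sqf (f e)" "sqf w"
  shows "pair_form p w (\<lambda>u v. \<Sum>e\<in>K. c e * f e u v) = (\<Sum>e\<in>K. c e * pair_form p w (f e))"
proof -
  have "pair_form p w (\<lambda>u v. \<Sum>e\<in>K. c e * f e u v) = IS (\<lambda>u v. \<Sum>e\<in>K. c e * (w u v * (f e u v + p * f e v u)))"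
    unfolding pair_form_def
    by (simp add: sum_distrib_left sum.distrib[symmetric] distrib_left mult.left_commute mult.assoc)
  also have "\<dots> = (\<Sum>e\<in>K. IS (\<lambda>u v. c e * (w u v * (f e u v + p * f e v u))))"
    by (intro IS_sum) (intro sqf_mult[OF sqf_const] sqf_pair_form assms)
  finally show ?thesis by (simp add: IS_cmult pair_form_def)
qed

text \<open>Separates the square of \<open>w\<close>, with weight \<open>1 - p\<close>, from the
  square of its symmetrization. Up to null sets, the form is definite for p in [0, 1), while for
  \<open>p = 1\<close> it vanishes exactly on antisymmetric kernels; this explains the two
  ranks.\<close>

lemma pair_form_self:
  assumes w: "sqf w"
  shows "pair_form p w w = (1 - p) * IS (\<lambda>u v. (w u v)\<^sup>2) + p / 2 * IS (\<lambda>u v. (w u v + w v u)\<^sup>2)"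
proof -
  note s = sqf_mult[OF w w] sqf_mult[OF w sqf_swap[OF w]] sqf_mult[OF sqf_swap[OF w] sqf_swap[OF w]]
  have swap: "IS (\<lambda>u v. w v u * w v u) = IS (\<lambda>u v. w u v * w u v)" by (rule IS_swap[OF s(1)])
  have "IS (\<lambda>u v. (w u v + w v u)\<^sup>2) = IS (\<lambda>u v. (w u v * w u v + w v u * w v u) + 2 * (w u v * w v u))"
    by (simp add: power2_eq_square algebra_simps)
  also have "\<dots> = 2 * IS (\<lambda>u v. w u v * w u v) + 2 * IS (\<lambda>u v. w u v * w v u)"
    unfolding IS_add[OF sqf_add[OF s(1) s(3)] sqf_mult[OF sqf_const s(2)]] IS_add[OF s(1) s(3)] IS_cmult swap by simp
  finally have 1: "IS (\<lambda>u v. (w u v + w v u)\<^sup>2) = 2 * IS (\<lambda>u v. w u v * w u v) + 2 * IS (\<lambda>u v. w u v * w v u)" .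
  have "pair_form p w w = IS (\<lambda>u v. w u v * w u v + p * (w u v * w v u))"
    unfolding pair_form_def by (simp add: distrib_left mult.left_commute)
  also have "\<dots> = IS (\<lambda>u v. w u v * w u v) + p * IS (\<lambda>u v. w u v * w v u)"
    unfolding IS_add[OF s(1) sqf_mult[OF sqf_const s(2)]] IS_cmult ..
  finally show ?thesis unfolding 1 by (simp add: power2_eq_square algebra_simps)
qed

lemma IS_nonneg: "(\<And>u v. 0 \<le> f u v) \<Longrightarrow> 0 \<le> IS f"
  unfolding IS_def by (rule Bochner_Integration.integral_nonneg) auto

lemma symmetrized_tens:
  "(\<Sum>e\<in>{1..<r} \<times> {1..<r}. C e * tens r e u v) + (\<Sum>e\<in>{1..<r} \<times> {1..<r}. C e * tens r e v u)
   = (\<Sum>e\<in>{1..<r} \<times> {1..<r}. (C e + C (prod.swap e)) * tens r e u v)"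
proof -
  have "(\<Sum>e\<in>{1..<r} \<times> {1..<r}. C e * tens r e v u) = (\<Sum>e\<in>{1..<r} \<times> {1..<r}. C (prod.swap e) * tens r e u v)"
    by (rule sum.reindex_bij_witness[of _ prod.swap prod.swap]) (auto simp: tens_def)
  then show ?thesis by (simp add: sum.distrib distrib_right)
qed

text \<open>Both squares in \<open>pair_form_self\<close> have to contribute 0. For
  \<open>p < 1\<close> the first one determines all coefficients; at \<open>p = 1\<close> only the
  second is left, and it sees the symmetrized coefficients.\<close>

lemma pair_form_zero:
  assumes p: "0 \<le> p" "p \<le> 1" and e: "e \<in> {1..<r} \<times> {1..<r}"
    and w: "w = (\<lambda>u v. \<Sum>e\<in>{1..<r} \<times> {1..<r}. C e * tens r e u v)" and zero: "pair_form p w w \<le> 0"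
  shows "if p < 1 then C e = 0 else C e + C (prod.swap e) = 0"
proof -
  have ws: "sqf w" unfolding w by (intro sqf_lincomb sqf_tens)
  let ?a = "IS (\<lambda>u v. (w u v)\<^sup>2)" and ?b = "IS (\<lambda>u v. (w u v + w v u)\<^sup>2)"
  have nn: "0 \<le> ?a" "0 \<le> ?b" by (intro IS_nonneg; simp)+
  have le: "(1 - p) * ?a + p / 2 * ?b \<le> 0" using zero unfolding pair_form_self[OF ws] .
  show ?thesis
  proof (cases "p < 1")
    case True
    have "0 \<le> p / 2 * ?b" using nn p by simp
    with le have "(1 - p) * ?a \<le> 0" by linarith
    with True nn have "?a = 0" by (simp add: mult_le_0_iff)
    then have "C e = 0" unfolding w by (rule tens_independent[OF _ e])
    with True show ?thesis by simp
  next
    case False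
    with p have "p = 1" by simp
    with le nn have "?b = 0" by simp
    then have "IS (\<lambda>u v. (\<Sum>e\<in>{1..<r} \<times> {1..<r}. (C e + C (prod.swap e)) * tens r e u v)\<^sup>2) = 0"
      unfolding w symmetrized_tens .
    from tens_independent[OF this e] False show ?thesis by simp
  qed
qed

text \<open>The coefficient of \<open>tens r (1, 1)\<close> in \<open>gker r \<pi>\<close> is a
  positive multiple of \<open>1 - 1 / real r\<close> or of \<open>- 1 / real r\<close>, hence not 0
  for \<open>r\<close> at least 2. Being on the diagonal, it is its own mirror image and survives
  the symmetrization at \<open>p = 1\<close>.\<close>

theorem cov_matrix_pos:
  assumes r: "r \<ge> 2" and p: "0 \<le> p" "p \<le> 1" and pi: "\<pi> \<in> perms r"
  shows "cov_matrix r p \<pi> \<pi> > 0"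
proof (rule ccontr)
  assume "\<not> cov_matrix r p \<pi> \<pi> > 0"
  then have "pair_form p (gker r \<pi>) (gker r \<pi>) / (fact (r - 1))\<^sup>2 \<le> 0"
    using cov_matrix_eq[of r \<pi> \<pi> p] r pi by (simp add: pair_form_def)
  then have le: "pair_form p (gker r \<pi>) (gker r \<pi>) \<le> 0" by (simp add: divide_le_0_iff)
  define C where "C e = (of_bool (\<pi> (fst e) = snd e) - 1 / real r) / fact (r - 1)" for e :: "nat \<times> nat"
  have g: "gker r \<pi> = (\<lambda>u v. \<Sum>e\<in>{1..<r} \<times> {1..<r}. C e * tens r e u v)"
    unfolding C_def using gker_expand[of r \<pi>] r pi by (simp add: fun_eq_iff)
  have "(1, 1) \<in> {1..<r} \<times> {1..<r}" using r by auto
  from pair_form_zero[OF p this g le] have "C (1, 1) = 0" by (auto split: if_splits)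
  then show False using r by (auto simp: C_def of_bool_def split: if_splits)
qed

text \<open>The columns are multiples of the vectors \<open>L (gker r \<rho>)\<close>. The kernels
  \<open>gker\<close> and the tensors \<open>tens\<close> generate each other, so the
  \<open>L (tens r e)\<close> span the column space, up to mirror images when \<open>p = 1\<close>.
  A vanishing combination yields a kernel \<open>w\<close> orthogonal to all \<open>gker\<close>,
  hence to all tensors, hence to itself, and \<open>pair_form_zero\<close> applies.\<close>

theorem rank_cov_matrix:
  assumes r: "r \<ge> 1" and p: "0 \<le> p" "p \<le> 1"
    and K: "K = (if p < 1 then {1..<r} \<times> {1..<r} else {(i, j) \<in> {1..<r} \<times> {1..<r}. i \<le> j})"
  shows "matrix_rank (perms r) (cov_matrix r p) = card K"
proof -
  let ?E = "{1..<r} \<times> {1..<r}"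
  define L where "L w = (\<lambda>\<pi>. if \<pi> \<in> perms r then pair_form p (gker r \<pi>) w else 0)" for w
  let ?F = "fact (r - 1) :: real"
  have KE: "K \<subseteq> ?E" using K by auto
  then have finK: "finite K" by (rule finite_subset) auto
  have col: "(\<lambda>\<pi>. if \<pi> \<in> perms r then cov_matrix r p \<pi> \<rho> else 0) = (\<lambda>\<pi>. 1 / ?F\<^sup>2 * L (gker r \<rho>) \<pi>)"
    if "\<rho> \<in> perms r" for \<rho>
    using cov_matrix_eq[OF r _ that, of _ p] by (auto simp: L_def pair_form_def fun_eq_iff)
  have L_sum: "L (\<lambda>u v. \<Sum>e\<in>A. c e * f e u v) = (\<Sum>e\<in>A. (\<lambda>\<pi>. c e * L (f e) \<pi>))" if "\<And>e. e \<in> A \<Longrightarrow> sqf (f e)" for A :: "(nat \<times> nat) set" and c f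
    by (auto simp: fun_eq_iff sum_fun_apply L_def pair_form_sum_right[OF that sqf_gker])
  have L_swap: "L (tens r e) = L (tens r (prod.swap e))" if "\<not> p < 1" for e
  proof -
    have "p = 1" using p that by simp
    moreover have "tens r e u v + tens r e v u = tens r (prod.swap e) u v + tens r (prod.swap e) v u" for u v
      by (simp add: tens_def mult.commute add.commute)
    ultimately show ?thesis unfolding L_def pair_form_def by (simp only: mult_1)
  qed
  have in_span: "L (tens r e) \<in> fv.span ((\<lambda>e. L (tens r e)) ` K)" if e: "e \<in> ?E" for e
  proof (cases "e \<in> K")
    case True then show ?thesis by (intro fv.span_base) auto
  next
    case False
    \<comment> \<open>Off the triangle, the mirror image of \<open>e\<close> lies in it and has the
      same vector by \<open>L_swap\<close>.\<close>
    with e K have "prod.swap e \<in> K" "\<not> p < 1" by (auto split: if_splits)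
    then show ?thesis unfolding L_swap[OF \<open>\<not> p < 1\<close>, of e] by (intro fv.span_base) auto
  qed
  show ?thesis
  proof (rule matrix_rank_eqI[where w = "\<lambda>e. L (tens r e)", OF finK])
    fix \<rho> assume rho: "\<rho> \<in> perms r"
    define C where "C e = (of_bool (\<rho> (fst e) = snd e) - 1 / real r) / fact (r - 1)" for e :: "nat \<times> nat"
    have g: "gker r \<rho> = (\<lambda>u v. \<Sum>e\<in>?E. C e * tens r e u v)"
      unfolding C_def using gker_expand[of r \<rho>] r rho by (simp add: fun_eq_iff)
    have "L (gker r \<rho>) \<in> fv.span ((\<lambda>e. L (tens r e)) ` K)"
      unfolding g by (subst L_sum, rule sqf_tens) (intro fv.span_sum fv.span_scale in_span)
    then show "(\<lambda>\<pi>. if \<pi> \<in> perms r then cov_matrix r p \<pi> \<rho> else 0) \<in> fv.span ((\<lambda>e. L (tens r e)) ` K)"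
      unfolding col[OF rho] by (rule fv.span_scale)
  next
    fix e assume "e \<in> K"
    then have "e \<in> ?E" using KE by blast
    then obtain \<rho> \<rho>' where rho: "\<rho> \<in> perms r" "\<rho>' \<in> perms r" "\<And>u v. tens r e u v = ?F * (gker r \<rho> u v - gker r \<rho>' u v)"
      by (rule tens_eq_gker) auto
    let ?C = "\<lambda>\<rho> \<pi>. if \<pi> \<in> perms r then cov_matrix r p \<pi> \<rho> else 0"
    have inC: "(\<lambda>\<pi>. 1 / ?F\<^sup>2 * L (gker r \<rho>) \<pi>) \<in> fv.span (?C ` perms r)" if "\<rho> \<in> perms r" for \<rho>
      unfolding col[OF that, symmetric] using that by (intro fv.span_base) auto
    have inL: "L (gker r \<rho>) \<in> fv.span (?C ` perms r)" if "\<rho> \<in> perms r" for \<rho>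
      using fv.span_scale[OF inC[OF that], of "?F\<^sup>2"] by simp
    have "L (tens r e) = (\<lambda>\<pi>. ?F * (L (gker r \<rho>) \<pi>)) + (\<lambda>\<pi>. - ?F * (L (gker r \<rho>') \<pi>))"
    proof -
      \<comment> \<open>A difference written as a sum over two truth values, to reuse the linearity
        lemma for sums.\<close>
      define f where "f b = (if b then gker r \<rho> else gker r \<rho>')" for b
      have t: "tens r e = (\<lambda>u v. \<Sum>b\<in>UNIV. (if b then ?F else - ?F) * f b u v)"
        by (simp add: fun_eq_iff rho(3) UNIV_bool f_def right_diff_distrib)
      have "pair_form p (gker r \<pi>) (tens r e) = (\<Sum>b\<in>UNIV. (if b then ?F else - ?F) * pair_form p (gker r \<pi>) (f b))" for \<pi>
        unfolding t by (rule pair_form_sum_right) (auto simp: f_def sqf_gker)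
      then show ?thesis by (auto simp: fun_eq_iff L_def UNIV_bool f_def)
    qed
    then show "L (tens r e) \<in> fv.span (?C ` perms r)"
      using fv.span_add[OF fv.span_scale[OF inL[OF rho(1)]] fv.span_scale[OF inL[OF rho(2)]], of ?F "- ?F"] by simp
  next
    fix c e assume zero: "\<And>\<pi>. (\<Sum>e\<in>K. c e * L (tens r e) \<pi>) = 0" and e: "e \<in> K"
    \<comment> \<open>Coefficients are 0 off \<open>K\<close>; at \<open>p = 1\<close> the mirror
      image of an off-diagonal index therefore adds nothing.\<close>
    define C where "C e = (if e \<in> K then c e else 0)" for e
    define w where "w = (\<lambda>u v. \<Sum>e\<in>?E. C e * tens r e u v)"
    have wK: "w = (\<lambda>u v. \<Sum>e\<in>K. c e * tens r e u v)"
      unfolding w_def C_def using KE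
      by (intro ext sum.mono_neutral_cong_right) (auto simp: finK)
    have ws: "sqf w" unfolding w_def by (intro sqf_lincomb sqf_tens)
    have orth: "pair_form p (gker r \<pi>) w = 0" if "\<pi> \<in> perms r" for \<pi>
      using zero[of \<pi>] that unfolding wK by (subst pair_form_sum_right) (auto simp: L_def sqf_tens sqf_gker)
    have orth_t: "pair_form p (tens r e) w = 0" if "e \<in> ?E" for e
    proof -
      from that obtain \<rho> \<rho>' where rho: "\<rho> \<in> perms r" "\<rho>' \<in> perms r" "\<And>u v. tens r e u v = ?F * (gker r \<rho> u v - gker r \<rho>' u v)"
        by (rule tens_eq_gker) auto
      define f where "f b = (if b then gker r \<rho> else gker r \<rho>')" for b
      have t: "tens r e = (\<lambda>u v. \<Sum>b\<in>UNIV. (if b then ?F else - ?F) * f b u v)"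
        by (simp add: fun_eq_iff rho(3) UNIV_bool f_def right_diff_distrib)
      have "pair_form p (tens r e) w = (\<Sum>b\<in>UNIV. (if b then ?F else - ?F) * pair_form p (f b) w)"
        unfolding t by (rule pair_form_sum_left) (auto simp: f_def sqf_gker ws)
      then show ?thesis using orth rho by (simp add: UNIV_bool f_def)
    qed
    have "pair_form p w w = 0"
    proof -
      have "pair_form p (\<lambda>u v. \<Sum>e\<in>?E. C e * tens r e u v) w = (\<Sum>e\<in>?E. C e * pair_form p (tens r e) w)"
        by (rule pair_form_sum_left[OF sqf_tens ws])
      also have "\<dots> = 0" by (intro sum.neutral ballI) (simp only: orth_t mult_zero_right)
      finally show ?thesis unfolding w_def .
    qed
    then have z: "if p < 1 then C e = 0 else C e + C (prod.swap e) = 0"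
      using e KE by (intro pair_form_zero[OF p _ w_def]) auto
    show "c e = 0"
    proof (cases "p < 1 \<or> prod.swap e \<in> K")
      case True
      then show ?thesis
      proof
        assume "p < 1" then show ?thesis using z e by (simp add: C_def)
      next
        assume s: "prod.swap e \<in> K"
        show ?thesis
        proof (cases "p < 1")
          case True then show ?thesis using z e by (simp add: C_def)
        next
          case False
          \<comment> \<open>With both \<open>e\<close> and its mirror image in the triangle,
            \<open>e\<close> is diagonal and its coefficient is counted twice.\<close>
          then have "prod.swap e = e" using s e K by auto
          then show ?thesis using z e False by (simp add: C_def)
        qed
      qed
    next
      case False
      then show ?thesis using z e by (simp add: C_def)
    qed
  qed
qed

lemma card_triangle: "card {(i, j) \<in> {1..<r} \<times> {1..<r}. i \<le> j} = r * (r - 1) div 2"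
proof -
  have "{(i, j) \<in> {1..<r} \<times> {1..<r}. i \<le> j} = prod.swap ` (SIGMA j:{1..<r}. {1..j})"
    by (auto simp: image_iff)
  then have "card {(i, j) \<in> {1..<r} \<times> {1..<r}. i \<le> j} = card (SIGMA j:{1..<r}. {1..j})"
    by (simp add: card_image)
  also have "\<dots> = (\<Sum>j\<in>{1..<r}. j)" by simp
  also have "\<dots> = r * (r - 1) div 2" by (subst Sum_Ico_nat) simp
  finally show ?thesis .
qed

subsection \<open>Sums of a degenerate kernel along a permutation\<close>

abbreviation UP :: "nat \<Rightarrow> (nat \<Rightarrow> real) measure"
  where "UP n \<equiv> PiM {1..n} (\<lambda>_. unif01)"

lemma real_product_unif: "real_product (\<lambda>_ :: nat. unif01) {1..n}"
proof -
  interpret U: prob_space unif01 by (rule prob_space_unif01)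
  show ?thesis by unfold_locales auto
qed

text \<open>Fixed points are left out because \<open>G\<close> need not be centred on the diagonal;
  their contribution is bounded separately.\<close>

definition perm_term :: "nat \<Rightarrow> (nat \<Rightarrow> nat) \<Rightarrow> (real \<Rightarrow> real \<Rightarrow> real) \<Rightarrow> nat \<Rightarrow> (nat \<Rightarrow> real) \<Rightarrow> real"
  where "perm_term n \<tau> G i w = (if i \<in> {1..n} \<and> \<tau> i \<noteq> i then G (w i) (w (\<tau> i)) else 0)"

definition fixed_points :: "nat \<Rightarrow> (nat \<Rightarrow> nat) \<Rightarrow> nat set"
  where "fixed_points n \<tau> = {i \<in> {1..n}. \<tau> i = i}"

definition two_cycle_points :: "nat \<Rightarrow> (nat \<Rightarrow> nat) \<Rightarrow> nat set"
  where "two_cycle_points n \<tau> = {i \<in> {1..n}. \<tau> i \<noteq> i \<and> \<tau> (\<tau> i) = i}"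

text \<open>Variance of the sum of all \<open>perm_term\<close> divided by
  \<open>sqrt (real n)\<close>, see \<open>second_moment\<close>. A 2-cycle pairs the terms G (u, v)
  and G (v, u); all other distinct terms are uncorrelated.\<close>

definition perm_var :: "nat \<Rightarrow> (nat \<Rightarrow> nat) \<Rightarrow> (real \<Rightarrow> real \<Rightarrow> real) \<Rightarrow> real"
  where "perm_var n \<tau> G =
    ((real n - real (card (fixed_points n \<tau>))) * IS (\<lambda>u v. G u v * G u v)
      + real (card (two_cycle_points n \<tau>)) * IS (\<lambda>u v. G u v * G v u)) / real n"

lemma sqf_compose:
  assumes G: "sqf G" and f: "f \<in> borel_measurable (PiM V (\<lambda>_. borel))" "g \<in> borel_measurable (PiM V (\<lambda>_. borel))"
  shows "bmeas V (\<lambda>w. G (f w) (g w))"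
proof -
  have G': "(\<lambda>z. G (fst z) (snd z)) \<in> borel_measurable (borel \<Otimes>\<^sub>M borel)"
    using G by (simp add: sqf_def borel_prod)
  have "(\<lambda>w. (f w, g w)) \<in> PiM V (\<lambda>_. borel) \<rightarrow>\<^sub>M borel \<Otimes>\<^sub>M borel" using f by (rule measurable_Pair)
  from measurable_compose[OF this G'] have "(\<lambda>w. G (f w) (g w)) \<in> borel_measurable (PiM V (\<lambda>_. borel))" by simp
  moreover obtain B where "\<And>u v. \<bar>G u v\<bar> \<le> B" using G unfolding sqf_def by blast
  ultimately show ?thesis unfolding bmeas_def by auto
qed

lemma sqf_section:
  assumes "sqf G" shows "(\<lambda>u. G u v) \<in> borel_measurable borel"
proof -
  have 1: "(\<lambda>z. G (fst z) (snd z)) \<in> borel_measurable (borel \<Otimes>\<^sub>M borel)"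
    using assms by (simp add: sqf_def borel_prod)
  have 2: "(\<lambda>u. (u, v)) \<in> borel \<rightarrow>\<^sub>M borel \<Otimes>\<^sub>M (borel :: real measure)"
    by (intro measurable_Pair) auto
  from measurable_compose[OF 2 1] show ?thesis by simp
qed

lemma dep_comp: "dep A f \<Longrightarrow> dep A (\<lambda>w. h (f w))"
  unfolding dep_def by (intro allI impI arg_cong[of _ _ h]) blast

lemma dep_comp2: "dep A f \<Longrightarrow> dep A g \<Longrightarrow> dep A (\<lambda>w. h (f w) (g w))"
  unfolding dep_def by (intro allI impI arg_cong2[of _ _ _ _ h]) blast+

locale perm_sum =
  fixes n :: nat and \<tau> :: "nat \<Rightarrow> nat" and G :: "real \<Rightarrow> real \<Rightarrow> real" and C :: real
  assumes n: "n \<ge> 1" and tau: "\<tau> permutes {1..n}" and G: "sqf G" and C: "\<And>u v. \<bar>G u v\<bar> \<le> C"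
    and G_left: "\<And>v. (\<integral>u. G u v \<partial>unif01) = 0" and G_right: "\<And>u. (\<integral>v. G u v \<partial>unif01) = 0"
begin

sublocale real_product "\<lambda>_ :: nat. unif01" "{1..n}" by (rule real_product_unif)

abbreviation "X \<equiv> perm_term n \<tau> G"
text \<open>\<open>N1 i\<close> lists the terms that involve the label of \<open>i\<close>:
  integrating this label out kills \<open>X i\<close> whatever the other terms are.
  \<open>N2 i\<close> lists the terms sharing a label with \<open>X i\<close> or with a term of
  \<open>N1 i\<close>.\<close>

abbreviation "N1 i \<equiv> {i, inv \<tau> i}"
abbreviation "N2 i \<equiv> {i, \<tau> i, inv \<tau> i, inv \<tau> (inv \<tau> i)}"

lemma tau_in: "i \<in> {1..n} \<Longrightarrow> \<tau> i \<in> {1..n}" "i \<in> {1..n} \<Longrightarrow> inv \<tau> i \<in> {1..n}"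
  using permutes_in_image[OF tau] permutes_in_image[OF permutes_inv[OF tau]] by blast+

lemma tau_inv: "\<tau> (inv \<tau> i) = i" "inv \<tau> (\<tau> i) = i"
  using permutes_inverses[OF tau] by auto

lemma C_nonneg: "C \<ge> 0" using C abs_ge_zero order_trans by blast

lemma bmeas_X: "bmeas {1..n} (X i)"
proof (cases "i \<in> {1..n} \<and> \<tau> i \<noteq> i")
  case True
  have "bmeas {1..n} (\<lambda>w. G (w i) (w (\<tau> i)))"
    by (intro sqf_compose[OF G] measurable_coordinate) (use True tau_in in blast)+
  then show ?thesis using True by (simp add: perm_term_def[abs_def])
next
  case False
  then show ?thesis by (simp only: perm_term_def[abs_def] if_False bmeas_const)
qed

lemma X_bound: "\<bar>X i w\<bar> \<le> C"
  using C C_nonneg by (simp add: perm_term_def)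

lemma dep_X: "dep {i, \<tau> i} (X i)"
  unfolding dep_def
proof (intro allI impI)
  fix w w' :: "nat \<Rightarrow> real" assume "\<forall>k\<in>{i, \<tau> i}. w k = w' k"
  then have "w i = w' i" "w (\<tau> i) = w' (\<tau> i)" by simp_all
  then show "X i w = X i w'" by (simp only: perm_term_def)
qed

lemma dep_sum: "(\<And>j. j \<in> A \<Longrightarrow> dep B (f j)) \<Longrightarrow> dep B (\<lambda>w. \<Sum>j\<in>A. f j w :: real)"
  unfolding dep_def by (intro allI impI sum.cong refl) blast

text \<open>Integrate out the label of \<open>i\<close>, on which \<open>H\<close> does not depend,
  and use that \<open>G\<close> is centred in its first argument. The embedding
  \<open>of_real\<close> serves real and complex test functions alike.\<close>

lemma X_zero_mean:
  fixes H :: "(nat \<Rightarrow> real) \<Rightarrow> 'b::{real_normed_field, banach, second_countable_topology}"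
  assumes i: "i \<in> {1..n}" and H: "bmeas {1..n} H" "free_of i H"
  shows "(\<integral>w. of_real (X i w) * H w \<partial>UP n) = 0"
proof (cases "\<tau> i = i")
  case True
  then show ?thesis by (simp add: perm_term_def)
next
  case False
  have bm: "bmeas {1..n} (\<lambda>w. of_real (X i w) * H w)"
  proof (rule bmeas_mult[OF _ H(1)])
    show "bmeas {1..n} (\<lambda>w. of_real (X i w) :: 'b)" using bmeas_X[of i] unfolding bmeas_def by auto
  qed
  have "(\<integral>w. of_real (X i w) * H w \<partial>UP n) = (\<integral>w. 0 \<partial>UP n :: 'b)"
  proof (rule integral_one_coordinate[OF bm i])
    fix w
    have "of_real (X i (w(i := y))) * H (w(i := y)) = of_real (G y (w (\<tau> i))) * H w" for y
      using H(2) i False by (simp add: perm_term_def free_of_def)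
    moreover have "(\<integral>y. of_real (G y (w (\<tau> i))) \<partial>unif01) = (of_real (\<integral>y. G y (w (\<tau> i)) \<partial>unif01) :: 'b)"
      by (rule integral_bounded_linear[OF bounded_linear_of_real integrable_unif01[OF sqf_section[OF G] C]])
    ultimately show "(\<integral>y. of_real (X i (w(i := y))) * H (w(i := y)) \<partial>unif01) = 0"
      by (simp only: integral_mult_left_zero G_left of_real_0 mult_zero_left)
  qed
  then show ?thesis by simp
qed

lemma rest_free: "free_of i (\<lambda>w. \<Sum>j\<in>{1..n} - N1 i. X j w)"
proof -
  have "dep (- {i}) (\<lambda>w. \<Sum>j\<in>{1..n} - N1 i. X j w)"
  proof (rule dep_sum)
    fix j assume "j \<in> {1..n} - N1 i"
    then have "j \<noteq> i" "\<tau> j \<noteq> i" using tau_inv(2)[of j] by auto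
    then show "dep (- {i}) (X j)" by (intro dep_mono[OF dep_X]) auto
  qed
  then show ?thesis by (rule dep_free_of) simp
qed

lemma bmeas_sumX: "bmeas {1..n} (\<lambda>w. \<Sum>j\<in>A. X j w)"
  by (intro bmeas_sum bmeas_X)

text \<open>Besides itself, \<open>X i\<close> meets only the term of the preimage of
  \<open>i\<close>. Unless the two form a 2-cycle, the label of the preimage occurs in that term
  alone and integrates to 0.\<close>

lemma expectation_XR:
  assumes i: "i \<in> {1..n}"
  shows "(\<integral>w. X i w * (\<Sum>j\<in>N1 i. X j w) \<partial>UP n)
    = (if \<tau> i = i then 0 else IS (\<lambda>u v. G u v * G u v)) + (if \<tau> i \<noteq> i \<and> \<tau> (\<tau> i) = i then IS (\<lambda>u v. G u v * G v u) else 0)"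
proof (cases "\<tau> i = i")
  case True
  then show ?thesis by (simp add: perm_term_def)
next
  case False
  let ?k = "inv \<tau> i"
  have k: "?k \<noteq> i" "\<tau> ?k = i" "?k \<in> {1..n}" using False tau_inv tau_in(2)[OF i] by metis+
  have ti: "\<tau> i \<in> {1..n}" "i \<noteq> \<tau> i" using tau_in(1)[OF i] False by auto
  have two: "(\<integral>w. F (w i) (w (\<tau> i)) \<partial>UP n) = IS F" if F: "sqf F" for F
  proof -
    obtain B where B: "\<And>u v. \<bar>F u v\<bar> \<le> B" using F unfolding sqf_def by blast
    have m: "(\<lambda>z. F (fst z) (snd z)) \<in> borel_measurable borel" using F by (simp add: sqf_def)
    show ?thesis
      using integral_two_coordinates[of "\<lambda>z. F (fst z) (snd z)" B i "\<tau> i", OF m _ i ti] B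
      by (simp add: IS_def unif_square_def)
  qed
  have "(\<integral>w. X i w * (\<Sum>j\<in>N1 i. X j w) \<partial>UP n) = (\<integral>w. X i w * X i w + X i w * X ?k w \<partial>UP n)"
    using k(1) by (simp add: distrib_left)
  also have "\<dots> = (\<integral>w. X i w * X i w \<partial>UP n) + (\<integral>w. X i w * X ?k w \<partial>UP n)"
    by (intro Bochner_Integration.integral_add bmeas_integrable bmeas_mult bmeas_X)
  also have "(\<integral>w. X i w * X i w \<partial>UP n) = IS (\<lambda>u v. G u v * G u v)"
    using two[OF sqf_mult[OF G G]] i False by (simp add: perm_term_def)
  also have "(\<integral>w. X i w * X ?k w \<partial>UP n) = (if \<tau> (\<tau> i) = i then IS (\<lambda>u v. G u v * G v u) else 0)"
  proof (cases "\<tau> (\<tau> i) = i")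
    case True
    then have "?k = \<tau> i" by (metis tau_inv(2))
    then show ?thesis
      using two[OF sqf_mult[OF G sqf_swap[OF G]]] i ti True by (simp add: perm_term_def)
  next
    case ne: False
    have "(\<integral>w. of_real (X ?k w) * X i w \<partial>UP n) = 0"
    proof (rule X_zero_mean[OF k(3) bmeas_X])
      have "?k \<noteq> \<tau> i" using ne k(2) by metis
      then show "free_of ?k (X i)" using k(1) by (intro dep_free_of[OF dep_X]) auto
    qed
    then show ?thesis using ne by (simp add: mult.commute)
  qed
  finally show ?thesis using False by simp
qed

lemma sum_expectation_XR:
  "(\<Sum>i\<in>{1..n}. (\<integral>w. X i w * (\<Sum>j\<in>N1 i. X j w) \<partial>UP n)) / real n = perm_var n \<tau> G"
proof -
  have "(\<Sum>i\<in>{1..n}. if \<tau> i = i then 0 else a) = (real n - real (card (fixed_points n \<tau>))) * a" for a :: real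
  proof -
    have "(\<Sum>i\<in>{1..n}. if \<tau> i = i then 0 else a) = (\<Sum>i\<in>{1..n}. a) - (\<Sum>i\<in>{1..n}. if \<tau> i = i then a else 0)"
      unfolding sum_subtractf[symmetric] by (intro sum.cong refl) auto
    also have "(\<Sum>i\<in>{1..n}. if \<tau> i = i then a else 0) = real (card (fixed_points n \<tau>)) * a"
      unfolding fixed_points_def by (subst sum.inter_filter[symmetric]) auto
    finally show ?thesis by (simp add: left_diff_distrib)
  qed
  moreover have "(\<Sum>i\<in>{1..n}. if \<tau> i \<noteq> i \<and> \<tau> (\<tau> i) = i then b else 0) = real (card (two_cycle_points n \<tau>)) * b" for b :: real
    unfolding two_cycle_points_def by (subst sum.inter_filter[symmetric]) auto
  moreover have "(\<Sum>i\<in>{1..n}. (\<integral>w. X i w * (\<Sum>j\<in>N1 i. X j w) \<partial>UP n))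
     = (\<Sum>i\<in>{1..n}. (if \<tau> i = i then 0 else IS (\<lambda>u v. G u v * G u v)) + (if \<tau> i \<noteq> i \<and> \<tau> (\<tau> i) = i then IS (\<lambda>u v. G u v * G v u) else 0))"
    by (intro sum.cong refl expectation_XR)
  ultimately show ?thesis unfolding perm_var_def by (simp only: sum.distrib)
qed

text \<open>Terms outside \<open>N1 i\<close> do not involve the label of \<open>i\<close>, hence
  are uncorrelated with \<open>X i\<close>.\<close>

lemma second_moment: "(\<integral>w. ((\<Sum>i\<in>{1..n}. X i w) / sqrt (real n))\<^sup>2 \<partial>UP n) = perm_var n \<tau> G"
proof -
  have "(\<integral>w. ((\<Sum>i\<in>{1..n}. X i w) / sqrt (real n))\<^sup>2 \<partial>UP n) = (\<integral>w. (\<Sum>i\<in>{1..n}. X i w * (\<Sum>j\<in>{1..n}. X j w)) / real n \<partial>UP n)"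
    by (simp add: power_divide power2_eq_square sum_distrib_right)
  also have "\<dots> = (\<integral>w. (\<Sum>i\<in>{1..n}. X i w * (\<Sum>j\<in>{1..n}. X j w)) \<partial>UP n) / real n" by simp
  also have "(\<integral>w. (\<Sum>i\<in>{1..n}. X i w * (\<Sum>j\<in>{1..n}. X j w)) \<partial>UP n) = (\<Sum>i\<in>{1..n}. (\<integral>w. X i w * (\<Sum>j\<in>{1..n}. X j w) \<partial>UP n))"
    by (intro Bochner_Integration.integral_sum bmeas_integrable bmeas_mult bmeas_X bmeas_sumX)
  also have "\<dots> = (\<Sum>i\<in>{1..n}. (\<integral>w. X i w * (\<Sum>j\<in>N1 i. X j w) \<partial>UP n))"
  proof (rule sum.cong[OF refl])
    fix i assume i: "i \<in> {1..n}"
    have N: "N1 i \<subseteq> {1..n}" using i tau_in(2)[OF i] by auto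
    have "X i w * (\<Sum>j\<in>{1..n}. X j w) = X i w * (\<Sum>j\<in>N1 i. X j w) + X i w * (\<Sum>j\<in>{1..n} - N1 i. X j w)" for w
      unfolding sum.subset_diff[OF N finite_V] by (simp add: distrib_left)
    then have "(\<integral>w. X i w * (\<Sum>j\<in>{1..n}. X j w) \<partial>UP n)
      = (\<integral>w. X i w * (\<Sum>j\<in>N1 i. X j w) \<partial>UP n) + (\<integral>w. X i w * (\<Sum>j\<in>{1..n} - N1 i. X j w) \<partial>UP n)"
      by (simp only:) (intro Bochner_Integration.integral_add bmeas_integrable bmeas_mult bmeas_X bmeas_sumX)
    also have "(\<integral>w. X i w * (\<Sum>j\<in>{1..n} - N1 i. X j w) \<partial>UP n) = 0"
      using X_zero_mean[OF i bmeas_sumX rest_free] by simp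
    finally show "(\<integral>w. X i w * (\<Sum>j\<in>{1..n}. X j w) \<partial>UP n) = (\<integral>w. X i w * (\<Sum>j\<in>N1 i. X j w) \<partial>UP n)" by simp
  qed
  finally show ?thesis unfolding sum_expectation_XR .
qed

lemma perm_char_bound:
  "cmod ((\<integral>w. iexp ((\<Sum>i\<in>{1..n}. X i w) / sqrt (real n)) \<partial>UP n) - complex_of_real (exp (- (perm_var n \<tau> G / 2))))
    \<le> 64 * C ^ 3 * exp \<bar>perm_var n \<tau> G\<bar> / sqrt (real n)"
proof -
  \<comment> \<open>Frequency 1 suffices, since the coefficients of a linear form are absorbed in
    the kernel. Both neighbourhoods have at most 4 elements, whence 64 as 4 times 4 squared.\<close>
  have "cmod ((\<integral>w. iexp (1 * ((\<Sum>i\<in>{1..n}. X i w) / sqrt (real n))) \<partial>UP n) - complex_of_real (exp (- (1\<^sup>2 * perm_var n \<tau> G / 2))))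
    \<le> 4 * 4\<^sup>2 * C ^ 3 * exp (1\<^sup>2 * \<bar>perm_var n \<tau> G\<bar>) * \<bar>1\<bar> ^ 3 / sqrt (real n)"
  proof (rule P.local_dependence_char_bound[where ?N1.0 = "\<lambda>i. N1 i" and ?N2.0 = "\<lambda>i. N2 i"])
    show "finite {1..n}" "real n = real (card {1..n})" "real n > 0" using n by auto
    show "X i \<in> borel_measurable (UP n)" for i by (rule bmeas_borel[OF bmeas_X])
    show "\<bar>X i w\<bar> \<le> C" for i w by (rule X_bound)
    fix i assume i: "i \<in> {1..n}"
    show "N1 i \<subseteq> {1..n} \<and> real (card (N1 i)) \<le> 4"
      using i tau_in(2)[OF i] by (auto simp: card_insert_if)
    show "N2 i \<subseteq> {1..n} \<and> real (card (N2 i)) \<le> 4"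
      using i tau_in(1)[OF i] tau_in(2)[OF i] tau_in(2)[OF tau_in(2)[OF i]] by (auto simp: card_insert_if)
    show "(\<integral>w. X i w * iexp (s * (\<Sum>j\<in>{1..n} - N1 i. X j w)) \<partial>UP n) = 0" for s
    proof (rule X_zero_mean[OF i])
      have "bmeas {1..n} (\<lambda>w. s * (\<Sum>j\<in>{1..n} - N1 i. X j w))"
        by (rule bmeas_mult[OF bmeas_const bmeas_sumX])
      then show "bmeas {1..n} (\<lambda>w. iexp (s * (\<Sum>j\<in>{1..n} - N1 i. X j w)))" by (rule bmeas_iexp)
      show "free_of i (\<lambda>w. iexp (s * (\<Sum>j\<in>{1..n} - N1 i. X j w)))"
        using rest_free[of i] unfolding free_of_def by simp
    qed
    show "(\<integral>w. complex_of_real (X i w * (\<Sum>j\<in>N1 i. X j w)) * iexp (s * (\<Sum>j\<in>{1..n} - N2 i. X j w)) \<partial>UP n)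
      = (\<integral>w. complex_of_real (X i w * (\<Sum>j\<in>N1 i. X j w)) \<partial>UP n) * (\<integral>w. iexp (s * (\<Sum>j\<in>{1..n} - N2 i. X j w)) \<partial>UP n)" for s
    proof (rule integral_mult_dep)
      show "bmeas {1..n} (\<lambda>w. complex_of_real (X i w * (\<Sum>j\<in>N1 i. X j w)))"
        by (intro bmeas_of_real bmeas_mult bmeas_X bmeas_sumX)
      have "bmeas {1..n} (\<lambda>w. s * (\<Sum>j\<in>{1..n} - N2 i. X j w))"
        by (rule bmeas_mult[OF bmeas_const bmeas_sumX])
      then show "bmeas {1..n} (\<lambda>w. iexp (s * (\<Sum>j\<in>{1..n} - N2 i. X j w)))" by (rule bmeas_iexp)
      let ?A = "{i, \<tau> i, inv \<tau> i}"
      have "dep ?A (\<lambda>w. \<Sum>j\<in>N1 i. X j w)"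
      proof (rule dep_sum)
        fix j assume "j \<in> N1 i"
        then show "dep ?A (X j)" by (intro dep_mono[OF dep_X]) (auto simp: tau_inv)
      qed
      moreover have "dep ?A (X i)" by (intro dep_mono[OF dep_X]) auto
      ultimately show "dep ?A (\<lambda>w. complex_of_real (X i w * (\<Sum>j\<in>N1 i. X j w)))"
        by (rule dep_comp2[where h = "\<lambda>x y. complex_of_real (x * y)", rotated])
      have "dep (- ?A) (\<lambda>w. \<Sum>j\<in>{1..n} - N2 i. X j w)"
      proof (rule dep_sum)
        fix j assume "j \<in> {1..n} - N2 i"
        then have "j \<notin> ?A" "\<tau> j \<notin> ?A" using tau_inv(2)[of j] tau_inv(2)[of i] by auto
        then show "dep (- ?A) (X j)" by (intro dep_mono[OF dep_X]) auto
      qed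
      then show "dep (- ?A) (\<lambda>w. iexp (s * (\<Sum>j\<in>{1..n} - N2 i. X j w)))"
        by (rule dep_comp)
    qed auto
  qed (rule sum_expectation_XR[symmetric])
  then show ?thesis by simp
qed

end

subsection \<open>Projection of the pattern counts\<close>

definition rsets :: "nat \<Rightarrow> nat \<Rightarrow> nat set set"
  where "rsets n r = {I. I \<subseteq> {1..n} \<and> card I = r}"

lemma finite_rsets [simp]: "finite (rsets n r)"
  unfolding rsets_def by (rule finite_subset[of _ "Pow {1..n}"]) auto

lemma card_rsets: "card (rsets n r) = n choose r"
  unfolding rsets_def using n_subsets[of "{1..n}" r] by simp

lemma rsets_finite: "I \<in> rsets n r \<Longrightarrow> finite I"
  unfolding rsets_def using finite_subset by auto

lemma binomial_le_power: "n choose k \<le> n ^ k"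
  by (cases "k \<le> n") (simp_all add: binomial_le_pow binomial_eq_0)

lemma card_rsets_containing:
  assumes A: "A \<subseteq> {1..n}"
  shows "card {I \<in> rsets n r. A \<subseteq> I} \<le> n ^ (r - card A)"
proof (cases "card A \<le> r")
  case False
  have "{I \<in> rsets n r. A \<subseteq> I} = {}"
  proof (rule equals0I)
    fix I assume "I \<in> {I \<in> rsets n r. A \<subseteq> I}"
    then have I: "A \<subseteq> I" "I \<in> rsets n r" by simp_all
    have "card A \<le> card I" by (rule card_mono[OF rsets_finite[OF I(2)] I(1)])
    then have "card A \<le> r" using I(2) by (simp add: rsets_def)
    with False show False by simp
  qed
  then show ?thesis by (simp only: card.empty le0)
next
  case True
  have finA: "finite A" using A finite_subset by auto
  have "inj_on (\<lambda>I. I - A) {I \<in> rsets n r. A \<subseteq> I}"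
    by (rule inj_onI) blast
  moreover have "(\<lambda>I. I - A) ` {I \<in> rsets n r. A \<subseteq> I} \<subseteq> rsets n (r - card A)"
    using finA by (auto simp: rsets_def card_Diff_subset)
  ultimately have "card {I \<in> rsets n r. A \<subseteq> I} \<le> card (rsets n (r - card A))"
    by (rule card_inj_on_le) simp
  also have "\<dots> \<le> n ^ (r - card A)"
    unfolding card_rsets by (rule binomial_le_power)
  finally show ?thesis .
qed

text \<open>There are at most \<open>(card N)\<^sup>2\<close> pairs to contain, each in at most
  \<open>n ^ (r - 2)\<close> sets. Multiplying by \<open>n ^ r\<close> gives an exponent that is
  also harmless for \<open>r = 1\<close>, where \<open>r - 2\<close> would be truncated.\<close>

lemma card_rsets_meeting_twice:
  assumes N: "N \<subseteq> {1..n}" and n: "n \<ge> 1" and r: "r \<ge> 1"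
  shows "card {I \<in> rsets n r. card (I \<inter> N) \<ge> 2} * n ^ r \<le> (card N)\<^sup>2 * n ^ (2 * r - 2)"
proof (cases "r \<ge> 2")
  case False
  have "{I \<in> rsets n r. card (I \<inter> N) \<ge> 2} = {}"
  proof (rule equals0I)
    fix I assume I: "I \<in> {I \<in> rsets n r. card (I \<inter> N) \<ge> 2}"
    then have I': "I \<in> rsets n r" "card (I \<inter> N) \<ge> 2" by simp_all
    have "card (I \<inter> N) \<le> card I" by (rule card_mono[OF rsets_finite[OF I'(1)]]) blast
    then have "2 \<le> card I" using I'(2) by linarith
    then show False using I'(1) False by (simp add: rsets_def)
  qed
  then show ?thesis by (simp only: card.empty mult_0 le0)
next
  case True
  let ?P = "{e \<in> N \<times> N. fst e \<noteq> snd e}"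
  have finN: "finite N" using N finite_subset by auto
  have "{I \<in> rsets n r. card (I \<inter> N) \<ge> 2} \<subseteq> (\<Union>e\<in>?P. {I \<in> rsets n r. {fst e, snd e} \<subseteq> I})"
  proof
    fix I assume I: "I \<in> {I \<in> rsets n r. card (I \<inter> N) \<ge> 2}"
    then have "2 \<le> card (I \<inter> N)" by simp
    then obtain B where B: "B \<subseteq> I \<inter> N" "card B = 2" using obtain_subset_with_card_n by metis
    then obtain a b where ab: "B = {a, b}" "a \<noteq> b" unfolding card_2_iff by blast
    show "I \<in> (\<Union>e\<in>?P. {I \<in> rsets n r. {fst e, snd e} \<subseteq> I})"
    proof (rule UN_I[of "(a, b)"])
      show "(a, b) \<in> ?P" using B ab by simp
      show "I \<in> {I \<in> rsets n r. {fst (a, b), snd (a, b)} \<subseteq> I}" using I B ab by simp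
    qed
  qed
  then have "card {I \<in> rsets n r. card (I \<inter> N) \<ge> 2} \<le> card (\<Union>e\<in>?P. {I \<in> rsets n r. {fst e, snd e} \<subseteq> I})"
    using finN by (intro card_mono) auto
  also have "\<dots> \<le> (\<Sum>e\<in>?P. card {I \<in> rsets n r. {fst e, snd e} \<subseteq> I})"
    using finN by (intro card_UN_le) auto
  also have "\<dots> \<le> (\<Sum>e\<in>?P. n ^ (r - 2))"
  proof (rule sum_mono)
    fix e assume e: "e \<in> ?P"
    then have "{fst e, snd e} \<subseteq> {1..n}" "card {fst e, snd e} = 2" using N by auto
    then show "card {I \<in> rsets n r. {fst e, snd e} \<subseteq> I} \<le> n ^ (r - 2)"
      using card_rsets_containing[of "{fst e, snd e}" n r] by simp
  qed
  also have "\<dots> = card ?P * n ^ (r - 2)" by simp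
  also have "\<dots> \<le> (card N)\<^sup>2 * n ^ (r - 2)"
  proof (rule mult_right_mono)
    have "card ?P \<le> card (N \<times> N)" using finN by (intro card_mono) auto
    then show "card ?P \<le> (card N)\<^sup>2" by (simp add: card_cartesian_product power2_eq_square)
  qed simp
  finally have "card {I \<in> rsets n r. card (I \<inter> N) \<ge> 2} * n ^ r \<le> (card N)\<^sup>2 * n ^ (r - 2) * n ^ r"
    by (rule mult_right_mono) simp
  also have "\<dots> = (card N)\<^sup>2 * n ^ (2 * r - 2)"
  proof -
    have "2 * r - 2 = (r - 2) + r" using True by simp
    then show ?thesis by (simp only: power_add mult.assoc)
  qed
  finally show ?thesis .
qed

text \<open>Such a set contains a fixed point, or some \<open>i\<close> together with a different
  \<open>\<tau> i\<close>: at most \<open>n ^ (r - 1)\<close> sets for each fixed point, and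
  \<open>n ^ (r - 2)\<close> for each of at most \<open>n\<close> other points.\<close>

lemma card_bad_rsets:
  assumes tau: "\<tau> permutes {1..n}" and n: "n \<ge> 1" and r: "r \<ge> 1"
  shows "card {I \<in> rsets n r. I \<inter> \<tau> ` I \<noteq> {}} \<le> (card (fixed_points n \<tau>) + 1) * n ^ (r - 1)"
proof -
  have fin: "finite (fixed_points n \<tau>)" by (simp add: fixed_points_def)
  let ?A = "\<Union>i\<in>fixed_points n \<tau>. {I \<in> rsets n r. {i} \<subseteq> I}"
  let ?B = "\<Union>i\<in>{i \<in> {1..n}. \<tau> i \<noteq> i}. {I \<in> rsets n r. {i, \<tau> i} \<subseteq> I}"
  have tin: "\<tau> i \<in> {1..n}" if "i \<in> {1..n}" for i using permutes_in_image[OF tau] that by blast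
  have "{I \<in> rsets n r. I \<inter> \<tau> ` I \<noteq> {}} \<subseteq> ?A \<union> ?B"
  proof
    fix I assume I: "I \<in> {I \<in> rsets n r. I \<inter> \<tau> ` I \<noteq> {}}"
    then obtain i where i: "i \<in> I" "\<tau> i \<in> I" by blast
    then have "i \<in> {1..n}" using I by (auto simp: rsets_def)
    then show "I \<in> ?A \<union> ?B" using i I by (cases "\<tau> i = i") (auto simp: fixed_points_def)
  qed
  then have "card {I \<in> rsets n r. I \<inter> \<tau> ` I \<noteq> {}} \<le> card (?A \<union> ?B)"
    using fin by (intro card_mono) auto
  also have "\<dots> \<le> card ?A + card ?B" by (rule card_Un_le)
  also have "\<dots> \<le> card (fixed_points n \<tau>) * n ^ (r - 1) + n ^ (r - 1)"
  proof (rule add_mono)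
    have "card ?A \<le> (\<Sum>i\<in>fixed_points n \<tau>. card {I \<in> rsets n r. {i} \<subseteq> I})" using fin by (rule card_UN_le)
    also have "\<dots> \<le> (\<Sum>i\<in>fixed_points n \<tau>. n ^ (r - 1))"
    proof (rule sum_mono)
      fix i assume "i \<in> fixed_points n \<tau>"
      then have "{i} \<subseteq> {1..n}" by (auto simp: fixed_points_def)
      then show "card {I \<in> rsets n r. {i} \<subseteq> I} \<le> n ^ (r - 1)" using card_rsets_containing[of "{i}" n r] by simp
    qed
    finally show "card ?A \<le> card (fixed_points n \<tau>) * n ^ (r - 1)" by simp
    show "card ?B \<le> n ^ (r - 1)"
    proof (cases "r \<ge> 2")
      case False
      have "{I \<in> rsets n r. {i, \<tau> i} \<subseteq> I} = {}" if "\<tau> i \<noteq> i" for i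
      proof (rule equals0I)
        fix I assume I: "I \<in> {I \<in> rsets n r. {i, \<tau> i} \<subseteq> I}"
        then have I': "I \<in> rsets n r" "{i, \<tau> i} \<subseteq> I" by simp_all
        have "card {i, \<tau> i} \<le> card I" by (rule card_mono[OF rsets_finite[OF I'(1)] I'(2)])
        moreover have "card {i, \<tau> i} = 2" using that by auto
        ultimately show False using I'(1) False by (simp add: rsets_def)
      qed
      then have "?B = {}" by blast
      then show ?thesis by (simp only: card.empty le0)
    next
      case True
      have "card ?B \<le> (\<Sum>i\<in>{i \<in> {1..n}. \<tau> i \<noteq> i}. card {I \<in> rsets n r. {i, \<tau> i} \<subseteq> I})" by (rule card_UN_le) simp
      also have "\<dots> \<le> (\<Sum>i\<in>{i \<in> {1..n}. \<tau> i \<noteq> i}. n ^ (r - 2))"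
      proof (rule sum_mono)
        fix i assume i: "i \<in> {i \<in> {1..n}. \<tau> i \<noteq> i}"
        then have "{i, \<tau> i} \<subseteq> {1..n}" "card {i, \<tau> i} = 2" using tin[of i] by auto
        then show "card {I \<in> rsets n r. {i, \<tau> i} \<subseteq> I} \<le> n ^ (r - 2)" using card_rsets_containing[of "{i, \<tau> i}" n r] by simp
      qed
      also have "\<dots> = card {i \<in> {1..n}. \<tau> i \<noteq> i} * n ^ (r - 2)" by simp
      also have "\<dots> \<le> n * n ^ (r - 2)"
      proof (rule mult_right_mono)
        have "{i \<in> {1..n}. \<tau> i \<noteq> i} \<subseteq> {1..n}" by auto
        from card_mono[OF finite_atLeastAtMost this] show "card {i \<in> {1..n}. \<tau> i \<noteq> i} \<le> n" by simp
      qed simp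
      also have "\<dots> = n ^ (r - 1)"
      proof -
        have "r - 1 = Suc (r - 2)" using True by simp
        then show ?thesis by simp
      qed
      finally show ?thesis .
    qed
  qed
  finally show ?thesis by (simp add: algebra_simps)
qed

text \<open>Cauchy-Schwarz through the inequality of arithmetic and geometric means; working with
  \<open>A + e\<close> avoids dividing by 0.\<close>

lemma (in prob_space) expectation_abs_le:
  assumes i: "integrable M f" "integrable M (\<lambda>x. (f x)\<^sup>2)" and E: "expectation (\<lambda>x. (f x)\<^sup>2) \<le> A\<^sup>2" and A: "A \<ge> (0 :: real)"
  shows "expectation (\<lambda>x. \<bar>f x\<bar>) \<le> A"
proof (rule field_le_epsilon)
  fix e :: real assume e: "e > 0"
  define a where "a = A + e"
  have a: "a > 0" using A e by (simp add: a_def)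
  have "\<bar>f x\<bar> \<le> (f x)\<^sup>2 / (2 * a) + a / 2" for x
  proof -
    have "0 \<le> (\<bar>f x\<bar> - a)\<^sup>2" by simp
    then have "2 * (a * \<bar>f x\<bar>) \<le> (f x)\<^sup>2 + a\<^sup>2" by (simp add: power2_diff algebra_simps)
    then show ?thesis using a by (simp add: field_simps power2_eq_square)
  qed
  then have "expectation (\<lambda>x. \<bar>f x\<bar>) \<le> expectation (\<lambda>x. (f x)\<^sup>2 / (2 * a) + a / 2)"
    using i by (intro integral_mono) auto
  also have "\<dots> = expectation (\<lambda>x. (f x)\<^sup>2) / (2 * a) + a / 2"
    using i by (simp add: prob_space)
  also have "\<dots> \<le> a\<^sup>2 / (2 * a) + a / 2"
  proof -
    have "A\<^sup>2 \<le> a\<^sup>2" using A e by (intro power_mono) (auto simp: a_def)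
    then show ?thesis using E a by (intro add_right_mono divide_right_mono) auto
  qed
  also have "\<dots> = a" using a by (simp add: power2_eq_square)
  finally show "expectation (\<lambda>x. \<bar>f x\<bar>) \<le> A + e" unfolding a_def .
qed

text \<open>The normalized count as a function of the labels, defined even if labels coincide; for
  distinct labels it is that of the conjugate of \<open>\<tau>\<close>, see
  \<open>stat_vector\<close>.\<close>

definition pstat :: "nat \<Rightarrow> nat \<Rightarrow> (nat \<Rightarrow> nat) \<Rightarrow> (nat \<Rightarrow> nat) \<Rightarrow> (nat \<Rightarrow> real) \<Rightarrow> real"
  where "pstat n r \<tau> \<pi> w =
    ((\<Sum>I\<in>rsets n r. patt r I \<pi> w (w \<circ> \<tau>)) - real (n choose r) * (1 / fact r)) / real n powr (real r - 1 / 2)"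

text \<open>Hajek projection of \<open>pstat\<close>, with fixed points removed and the binomial
  coefficient replaced by its leading order.\<close>

definition pproj :: "nat \<Rightarrow> nat \<Rightarrow> (nat \<Rightarrow> nat) \<Rightarrow> (nat \<Rightarrow> nat) \<Rightarrow> (nat \<Rightarrow> real) \<Rightarrow> real"
  where "pproj n r \<tau> \<pi> w =
    (\<Sum>i\<in>{1..n}. perm_term n \<tau> (gker r \<pi>) i w) / sqrt (real n) / fact (r - 1)"

locale pattern_sum =
  fixes n r :: nat and \<tau> \<pi> :: "nat \<Rightarrow> nat" and B :: real
  assumes n: "n \<ge> 1" and r: "r \<ge> 1" and tau: "\<tau> permutes {1..n}" and pi: "\<pi> \<in> perms r"
    and B: "\<And>u v. \<bar>gker r \<pi> u v\<bar> \<le> B"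
begin

sublocale ps: perm_sum n \<tau> "gker r \<pi>" B
  by (rule perm_sum.intro[OF n tau sqf_gker B integral_gker_left[OF r pi] integral_gker_right[OF r pi]])

abbreviation "V \<equiv> {1..n}"
abbreviation "g i w \<equiv> gker r \<pi> (w i) (w (\<tau> i))"

text \<open>Contribution of a single set to the remainder after the first-order projection.\<close>

definition dev :: "nat set \<Rightarrow> (nat \<Rightarrow> real) \<Rightarrow> real"
  where "dev I w = patt r I \<pi> w (w \<circ> \<tau>) - 1 / fact r - (\<Sum>i\<in>I. g i w)"

text \<open>The indicator and its mean are at most 1 each, and each of the \<open>r\<close> kernel
  values is at most \<open>B\<close>.\<close>

definition K0 :: real where "K0 = 2 + real r * B"

lemma B_nonneg: "B \<ge> 0" using B abs_ge_zero order_trans by blast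

lemma tau_inj: "inj_on \<tau> A" using permutes_inj_on[OF tau] .

lemma bmeas_g: "i \<in> V \<Longrightarrow> bmeas V (g i)"
  by (intro sqf_compose[OF sqf_gker] measurable_coordinate ps.tau_in)

lemma bmeas_dev:
  assumes I: "I \<in> rsets n r" shows "bmeas V (dev I)"
proof -
  have IV: "I \<subseteq> V" "finite I" "\<tau> ` I \<subseteq> V" using I rsets_finite[OF I] ps.tau_in(1) by (auto simp: rsets_def)
  have "bmeas V (\<lambda>w. patt r I \<pi> w (w \<circ> \<tau>) - 1 / fact r - (\<Sum>i\<in>I. g i w))"
    by (intro bmeas_diff bmeas_patt bmeas_const bmeas_sum bmeas_g) (use IV pi in auto)
  then show ?thesis by (simp add: dev_def[abs_def])
qed

lemma dev_bound:
  assumes I: "I \<in> rsets n r" shows "\<bar>dev I w\<bar> \<le> K0"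
proof -
  have "\<bar>\<Sum>i\<in>I. g i w\<bar> \<le> real (card I) * B"
    using sum_norm_bound[of I "\<lambda>i. g i w" B] B by simp
  then have "\<bar>\<Sum>i\<in>I. g i w\<bar> \<le> real r * B" using I by (simp add: rsets_def)
  moreover have "0 \<le> patt r I \<pi> w (w \<circ> \<tau>)" "patt r I \<pi> w (w \<circ> \<tau>) \<le> 1" by (rule patt_bounds[OF rsets_finite[OF I]])+
  moreover have "0 \<le> 1 / (fact r :: real)" "1 / (fact r :: real) \<le> 1" by (simp_all add: fact_ge_1)
  ultimately show ?thesis unfolding dev_def K0_def by linarith
qed

lemma K0_nonneg: "K0 \<ge> 0" unfolding K0_def using B_nonneg by simp

lemma dep_dev:
  assumes I: "I \<in> rsets n r" shows "dep (I \<union> \<tau> ` I) (dev I)"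
  unfolding dep_def
proof (intro allI impI)
  fix w w' :: "nat \<Rightarrow> real" assume eq: "\<forall>i\<in>I \<union> \<tau> ` I. w i = w' i"
  have "(\<Sum>i\<in>I. g i w) = (\<Sum>i\<in>I. g i w')" by (intro sum.cong refl) (use eq in simp)
  moreover have "patt r I \<pi> w (w \<circ> \<tau>) = patt r I \<pi> w' (w' \<circ> \<tau>)"
    unfolding patt_def
  proof (rule sum.cong[OF refl])
    fix a assume a: "a \<in> bijs r I"
    have aI: "a j \<in> I" if "j \<in> {1..r}" for j using a that by (auto simp: bijs_def)
    have bI: "a (inv \<pi> j) \<in> I" if "j \<in> {1..r}" for j
      using aI permutes_in_image[OF permutes_inv, of \<pi> "{1..r}" j] pi that by blast
    have "strict_mono_on {1..r} (w \<circ> a) = strict_mono_on {1..r} (w' \<circ> a)"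
      unfolding strict_mono_on_def using aI eq by (metis UnI1 comp_apply)
    moreover have "strict_mono_on {1..r} (w \<circ> \<tau> \<circ> (a \<circ> inv \<pi>)) = strict_mono_on {1..r} (w' \<circ> \<tau> \<circ> (a \<circ> inv \<pi>))"
      unfolding strict_mono_on_def using bI eq by (metis UnI2 comp_apply imageI)
    ultimately show "of_bool (strict_mono_on {1..r} (w \<circ> a)) * of_bool (strict_mono_on {1..r} (w \<circ> \<tau> \<circ> (a \<circ> inv \<pi>)))
      = (of_bool (strict_mono_on {1..r} (w' \<circ> a)) * of_bool (strict_mono_on {1..r} (w' \<circ> \<tau> \<circ> (a \<circ> inv \<pi>))) :: real)" by simp
  qed
  ultimately show "dev I w = dev I w'" by (simp add: dev_def)
qed

text \<open>By \<open>integral_patt\<close> the indicator may be replaced by \<open>pkernel\<close>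
  at \<open>i0\<close>, which is \<open>g i0\<close> plus the mean, and every other
  \<open>g j\<close> integrates to 0 against \<open>H\<close>. So the remainder is orthogonal to
  functions that see at most one point of the configuration.\<close>

lemma dev_orthogonal:
  assumes I: "I \<in> rsets n r" "I \<inter> \<tau> ` I = {}" and i0: "i0 \<in> I" and H: "bmeas V H"
    and free: "\<And>j. j \<in> I - {i0} \<Longrightarrow> free_of j H \<and> free_of (\<tau> j) H"
  shows "(\<integral>w. dev I w * H w \<partial>UP n) = 0"
proof -
  have IV: "I \<subseteq> V" "card I = r" "finite I" "\<tau> ` I \<subseteq> V" using I rsets_finite[OF I(1)] ps.tau_in(1) by (auto simp: rsets_def)
  have bp: "bmeas V (\<lambda>w. patt r I \<pi> w (w \<circ> \<tau>))" by (rule bmeas_patt[OF IV(3,1,4) pi])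
  have bg: "bmeas V (\<lambda>w. g i w * H w)" if "i \<in> I" for i
    using that IV by (intro bmeas_mult bmeas_g H) auto
  have i0V: "i0 \<in> V" "\<tau> i0 \<in> V" using i0 IV by auto
  have patt: "(\<integral>w. patt r I \<pi> w (w \<circ> \<tau>) * H w \<partial>UP n) = (\<integral>w. pkernel r \<pi> (w i0) (w (\<tau> i0)) * H w \<partial>UP n)"
    by (rule ps.integral_patt[OF IV(1,2) tau_inj IV(4) I(2) i0 pi _ H free]) auto
  have others: "(\<integral>w. g j w * H w \<partial>UP n) = 0" if j: "j \<in> I - {i0}" for j
  proof -
    have jV: "j \<in> V" using j IV by auto
    have jne: "\<tau> j \<noteq> j"
    proof
      assume "\<tau> j = j"
      then have "j \<in> I \<inter> \<tau> ` I" using j imageI[of j I \<tau>] by simp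
      then show False using I(2) by simp
    qed
    then have "(\<integral>w. of_real (perm_term n \<tau> (gker r \<pi>) j w) * H w \<partial>UP n) = 0"
      using free[OF j] by (intro ps.X_zero_mean[OF jV] H) blast
    then show ?thesis using jV jne by (simp add: perm_term_def)
  qed
  have "(\<integral>w. dev I w * H w \<partial>UP n) = (\<integral>w. patt r I \<pi> w (w \<circ> \<tau>) * H w - 1 / fact r * H w - (\<Sum>i\<in>I. g i w * H w) \<partial>UP n)"
    by (simp add: dev_def left_diff_distrib sum_distrib_right)
  also have "\<dots> = (\<integral>w. patt r I \<pi> w (w \<circ> \<tau>) * H w \<partial>UP n) - (\<integral>w. 1 / fact r * H w \<partial>UP n) - (\<Sum>i\<in>I. \<integral>w. g i w * H w \<partial>UP n)"
  proof -
    have 1: "integrable (UP n) (\<lambda>w. patt r I \<pi> w (w \<circ> \<tau>) * H w)" by (intro ps.bmeas_integrable bmeas_mult bp H)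
    have 2: "integrable (UP n) (\<lambda>w. 1 / fact r * H w)" by (intro ps.bmeas_integrable bmeas_mult bmeas_const H)
    have 3: "integrable (UP n) (\<lambda>w. g i w * H w)" if "i \<in> I" for i by (intro ps.bmeas_integrable bg that)
    have 4: "integrable (UP n) (\<lambda>w. \<Sum>i\<in>I. g i w * H w)" by (rule Bochner_Integration.integrable_sum[OF 3])
    have 5: "(\<integral>w. (\<Sum>i\<in>I. g i w * H w) \<partial>UP n) = (\<Sum>i\<in>I. \<integral>w. g i w * H w \<partial>UP n)"
      by (rule Bochner_Integration.integral_sum[OF 3])
    show ?thesis
      unfolding Bochner_Integration.integral_diff[OF Bochner_Integration.integrable_diff[OF 1 2] 4]
        Bochner_Integration.integral_diff[OF 1 2] 5 ..
  qed
  also have "(\<Sum>i\<in>I. \<integral>w. g i w * H w \<partial>UP n) = (\<integral>w. g i0 w * H w \<partial>UP n)"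
    using i0 IV(3) others by (simp add: sum.remove)
  also have "(\<integral>w. g i0 w * H w \<partial>UP n) = (\<integral>w. pkernel r \<pi> (w i0) (w (\<tau> i0)) * H w \<partial>UP n) - (\<integral>w. 1 / fact r * H w \<partial>UP n)"
    unfolding gker_def left_diff_distrib
    by (intro Bochner_Integration.integral_diff ps.bmeas_integrable bmeas_mult bmeas_const bmeas_pkernel measurable_coordinate i0V H)
  finally show ?thesis unfolding patt by simp
qed

abbreviation "good \<equiv> {I \<in> rsets n r. I \<inter> \<tau> ` I = {}}"
text \<open>The indices whose point shares a label with \<open>dev J\<close>: the latter sees the
  labels of \<open>J\<close> and of its image, and the point of \<open>i\<close> carries the labels
  of \<open>i\<close> and \<open>\<tau> i\<close>.\<close>

abbreviation "nbhd J \<equiv> J \<union> \<tau> ` J \<union> inv \<tau> ` J"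

text \<open>Let \<open>i0\<close> be the common index if there is one, and any element of
  \<open>I\<close> otherwise; then \<open>dev J\<close> is an admissible test function for
  \<open>dev I\<close>.\<close>

lemma dev_uncorrelated:
  assumes I: "I \<in> good" and J: "J \<in> rsets n r" and c: "\<not> card (I \<inter> nbhd J) \<ge> 2"
  shows "(\<integral>w. dev I w * dev J w \<partial>UP n) = 0"
proof -
  have finI: "finite I" using I rsets_finite[of I n r] by blast
  have "I \<noteq> {}" using I r by (auto simp: rsets_def)
  obtain i0 where i0: "i0 \<in> I" "I \<inter> nbhd J \<subseteq> {i0}"
  proof (cases "I \<inter> nbhd J = {}")
    case True
    then show ?thesis using \<open>I \<noteq> {}\<close> that by blast
  next
    case False
    then have "card (I \<inter> nbhd J) \<noteq> 0" using finI by simp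
    then have "card (I \<inter> nbhd J) = 1" using c by linarith
    then obtain x where "I \<inter> nbhd J = {x}" by (rule card_1_singletonE)
    then show ?thesis using that[of x] by blast
  qed
  show ?thesis
  proof (rule dev_orthogonal[of I i0])
    fix j assume j: "j \<in> I - {i0}"
    then have jN: "j \<notin> nbhd J" using i0(2) by blast
    have "\<tau> j \<notin> J \<union> \<tau> ` J"
    proof
      assume "\<tau> j \<in> J \<union> \<tau> ` J"
      then have "inv \<tau> (\<tau> j) \<in> inv \<tau> ` J \<or> inv \<tau> (\<tau> j) \<in> inv \<tau> ` \<tau> ` J" by blast
      then have "j \<in> inv \<tau> ` J \<or> j \<in> J" by (simp add: image_image ps.tau_inv)
      with jN show False by blast
    qed
    with jN show "free_of j (dev J) \<and> free_of (\<tau> j) (dev J)"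
      using dep_free_of[OF dep_dev[OF J]] by blast
  qed (use I J i0 bmeas_dev in auto)
qed

text \<open>Only pairs of sets with two or more interactions count, of the order n^(2r-2). In mean
  square the sum therefore has order n^(r-1), below the normalization n^(r-1/2). The factor 3 comes
  from the three parts of \<open>nbhd J\<close>.\<close>

lemma dev_good_second_moment:
  "(\<integral>w. (\<Sum>I\<in>good. dev I w)\<^sup>2 \<partial>UP n) \<le> (3 * real r * K0)\<^sup>2 * real n ^ (2 * r - 2)"
proof -
  have fin: "finite good" by simp
  have "(\<integral>w. (\<Sum>I\<in>good. dev I w)\<^sup>2 \<partial>UP n) = (\<integral>w. (\<Sum>J\<in>good. \<Sum>I\<in>good. dev I w * dev J w) \<partial>UP n)"
    unfolding power2_eq_square sum_product by (subst sum.swap) simp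
  also have "\<dots> = (\<Sum>J\<in>good. \<Sum>I\<in>good. \<integral>w. dev I w * dev J w \<partial>UP n)"
  proof -
    have i: "integrable (UP n) (\<lambda>w. dev I w * dev J w)" if "I \<in> good" "J \<in> good" for I J
      using that by (intro ps.bmeas_integrable bmeas_mult bmeas_dev) auto
    have "(\<integral>w. (\<Sum>J\<in>good. \<Sum>I\<in>good. dev I w * dev J w) \<partial>UP n) = (\<Sum>J\<in>good. \<integral>w. (\<Sum>I\<in>good. dev I w * dev J w) \<partial>UP n)"
      by (intro Bochner_Integration.integral_sum Bochner_Integration.integrable_sum i)
    also have "\<dots> = (\<Sum>J\<in>good. \<Sum>I\<in>good. \<integral>w. dev I w * dev J w \<partial>UP n)"
      by (intro sum.cong[OF refl] Bochner_Integration.integral_sum i)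
    finally show ?thesis .
  qed
  also have "\<dots> \<le> (\<Sum>J\<in>good. K0\<^sup>2 * real (card {I \<in> rsets n r. card (I \<inter> nbhd J) \<ge> 2}))"
  proof (rule sum_mono)
    fix J assume J: "J \<in> good"
    let ?S = "{I \<in> rsets n r. card (I \<inter> nbhd J) \<ge> 2}"
    have "(\<Sum>I\<in>good. \<integral>w. dev I w * dev J w \<partial>UP n) = (\<Sum>I\<in>good \<inter> ?S. \<integral>w. dev I w * dev J w \<partial>UP n)"
      using J dev_uncorrelated by (intro sum.mono_neutral_right fin) auto
    also have "\<dots> \<le> (\<Sum>I\<in>good \<inter> ?S. K0\<^sup>2)"
    proof (rule sum_mono)
      fix I assume I: "I \<in> good \<inter> ?S"
      have "(\<integral>w. dev I w * dev J w \<partial>UP n) \<le> (\<integral>w. K0\<^sup>2 \<partial>UP n)"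
      proof (rule integral_mono)
        show "integrable (UP n) (\<lambda>w. dev I w * dev J w)"
          using I J by (intro ps.bmeas_integrable bmeas_mult bmeas_dev) auto
        fix w
        have "\<bar>dev I w\<bar> \<le> K0" "\<bar>dev J w\<bar> \<le> K0" using I J by (auto intro: dev_bound)
        then have "\<bar>dev I w * dev J w\<bar> \<le> K0 * K0" unfolding abs_mult using K0_nonneg by (intro mult_mono) auto
        then show "dev I w * dev J w \<le> K0\<^sup>2" by (simp add: power2_eq_square)
      qed (rule ps.bmeas_integrable[OF bmeas_const])
      then show "(\<integral>w. dev I w * dev J w \<partial>UP n) \<le> K0\<^sup>2" using ps.P.prob_space by simp
    qed
    also have "\<dots> = K0\<^sup>2 * real (card (good \<inter> ?S))" by simp
    also have "\<dots> \<le> K0\<^sup>2 * real (card ?S)"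
      by (intro mult_left_mono of_nat_mono card_mono) auto
    finally show "(\<Sum>I\<in>good. \<integral>w. dev I w * dev J w \<partial>UP n) \<le> K0\<^sup>2 * real (card ?S)" .
  qed
  also have "\<dots> \<le> (\<Sum>J\<in>rsets n r. K0\<^sup>2 * real (card {I \<in> rsets n r. card (I \<inter> nbhd J) \<ge> 2}))"
    by (intro sum_mono2) auto
  also have "\<dots> \<le> (\<Sum>J\<in>rsets n r. K0\<^sup>2 * ((3 * real r)\<^sup>2 * real n ^ (2 * r - 2) / real n ^ r))"
  proof (intro sum_mono mult_left_mono)
    fix J assume J: "J \<in> rsets n r"
    have "nbhd J \<subseteq> V" using J ps.tau_in by (auto simp: rsets_def)
    from card_rsets_meeting_twice[OF this n r]
    have "real (card {I \<in> rsets n r. card (I \<inter> nbhd J) \<ge> 2} * n ^ r) \<le> real ((card (nbhd J))\<^sup>2 * n ^ (2 * r - 2))"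
      by (rule of_nat_mono)
    also have "\<dots> \<le> (3 * real r)\<^sup>2 * real n ^ (2 * r - 2)"
    proof -
      have "card (nbhd J) \<le> card J + card (\<tau> ` J) + card (inv \<tau> ` J)"
        using card_Un_le[of "J \<union> \<tau> ` J" "inv \<tau> ` J"] card_Un_le[of J "\<tau> ` J"] by linarith
      also have "\<dots> \<le> 3 * card J"
        using card_image_le[OF rsets_finite[OF J], of \<tau>] card_image_le[OF rsets_finite[OF J], of "inv \<tau>"] by linarith
      finally have "card (nbhd J) \<le> 3 * r" using J by (simp add: rsets_def)
      then have "real (card (nbhd J)) \<le> 3 * real r" by linarith
      then have "(real (card (nbhd J)))\<^sup>2 \<le> (3 * real r)\<^sup>2" by (intro power_mono) auto
      then show ?thesis by (simp add: mult_right_mono)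
    qed
    finally show "real (card {I \<in> rsets n r. card (I \<inter> nbhd J) \<ge> 2}) \<le> (3 * real r)\<^sup>2 * real n ^ (2 * r - 2) / real n ^ r"
      using n by (simp add: pos_le_divide_eq)
  qed simp
  also have "\<dots> = real (card (rsets n r)) * (K0\<^sup>2 * ((3 * real r)\<^sup>2 * real n ^ (2 * r - 2) / real n ^ r))" by simp
  also have "\<dots> \<le> real n ^ r * (K0\<^sup>2 * ((3 * real r)\<^sup>2 * real n ^ (2 * r - 2) / real n ^ r))"
  proof (rule mult_right_mono)
    have "card (rsets n r) \<le> n ^ r"
      unfolding card_rsets by (rule binomial_le_power)
    then show "real (card (rsets n r)) \<le> real n ^ r" by (simp flip: of_nat_power)
  qed simp
  also have "\<dots> = (3 * real r * K0)\<^sup>2 * real n ^ (2 * r - 2)" using n by (simp add: power_mult_distrib)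
  finally show ?thesis .
qed

text \<open>For the sets that meet their image no orthogonality is available; they are few enough to
  be bounded termwise, at a cost proportional to the number of fixed points plus 1.\<close>

lemma expectation_dev:
  "(\<integral>w. \<bar>\<Sum>I\<in>rsets n r. dev I w\<bar> \<partial>UP n) \<le> (3 * real r * K0 + K0 * (real (card (fixed_points n \<tau>)) + 1)) * real n ^ (r - 1)"
proof -
  let ?bad = "{I \<in> rsets n r. I \<inter> \<tau> ` I \<noteq> {}}"
  have split: "(\<Sum>I\<in>rsets n r. dev I w) = (\<Sum>I\<in>good. dev I w) + (\<Sum>I\<in>?bad. dev I w)" for w
    by (subst sum.union_disjoint[symmetric]) (auto intro!: sum.cong)
  have bm: "bmeas V (\<lambda>w. \<Sum>I\<in>good. dev I w)" by (intro bmeas_sum bmeas_dev) auto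
  have Eg: "(\<integral>w. \<bar>\<Sum>I\<in>good. dev I w\<bar> \<partial>UP n) \<le> 3 * real r * K0 * real n ^ (r - 1)"
  proof (rule ps.P.expectation_abs_le)
    show "integrable (UP n) (\<lambda>w. \<Sum>I\<in>good. dev I w)" "integrable (UP n) (\<lambda>w. (\<Sum>I\<in>good. dev I w)\<^sup>2)"
      by (intro ps.bmeas_integrable bmeas_power bm)+
    have "(3 * real r * K0)\<^sup>2 * real n ^ (2 * r - 2) = (3 * real r * K0 * real n ^ (r - 1))\<^sup>2"
    proof -
      have "2 * r - 2 = (r - 1) * 2" by simp
      then show ?thesis by (simp only: power_mult power_mult_distrib)
    qed
    with dev_good_second_moment show "(\<integral>w. (\<Sum>I\<in>good. dev I w)\<^sup>2 \<partial>UP n) \<le> (3 * real r * K0 * real n ^ (r - 1))\<^sup>2" by simp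
    show "0 \<le> 3 * real r * K0 * real n ^ (r - 1)" using K0_nonneg by simp
  qed
  have bad: "\<bar>\<Sum>I\<in>?bad. dev I w\<bar> \<le> K0 * (real (card (fixed_points n \<tau>)) + 1) * real n ^ (r - 1)" for w
  proof -
    have "\<bar>\<Sum>I\<in>?bad. dev I w\<bar> \<le> real (card ?bad) * K0"
      using sum_norm_bound[of ?bad "\<lambda>I. dev I w" K0] dev_bound by auto
    also have "\<dots> \<le> real ((card (fixed_points n \<tau>) + 1) * n ^ (r - 1)) * K0"
      using K0_nonneg card_bad_rsets[OF tau n r] by (intro mult_right_mono of_nat_mono)
    finally show ?thesis by (simp add: algebra_simps)
  qed
  have "(\<integral>w. \<bar>\<Sum>I\<in>rsets n r. dev I w\<bar> \<partial>UP n) \<le> (\<integral>w. \<bar>\<Sum>I\<in>good. dev I w\<bar> + K0 * (real (card (fixed_points n \<tau>)) + 1) * real n ^ (r - 1) \<partial>UP n)"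
  proof (rule integral_mono)
    show "integrable (UP n) (\<lambda>w. \<bar>\<Sum>I\<in>rsets n r. dev I w\<bar>)"
      by (intro ps.bmeas_integrable bmeas_abs bmeas_sum bmeas_dev)
    show "integrable (UP n) (\<lambda>w. \<bar>\<Sum>I\<in>good. dev I w\<bar> + K0 * (real (card (fixed_points n \<tau>)) + 1) * real n ^ (r - 1))"
      by (intro ps.bmeas_integrable bmeas_add bmeas_abs bmeas_const bm)
    show "\<bar>\<Sum>I\<in>rsets n r. dev I w\<bar> \<le> \<bar>\<Sum>I\<in>good. dev I w\<bar> + K0 * (real (card (fixed_points n \<tau>)) + 1) * real n ^ (r - 1)" for w
      unfolding split using bad[of w] by linarith
  qed
  also have "\<dots> = (\<integral>w. \<bar>\<Sum>I\<in>good. dev I w\<bar> \<partial>UP n) + K0 * (real (card (fixed_points n \<tau>)) + 1) * real n ^ (r - 1)"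
    unfolding Bochner_Integration.integral_add[OF ps.bmeas_integrable[OF bmeas_abs[OF bm]] ps.bmeas_integrable[OF bmeas_const]]
    by (simp only: lebesgue_integral_const ps.P.prob_space scaleR_one)
  finally show ?thesis using Eg by (simp add: algebra_simps)
qed

abbreviation "stat \<equiv> pstat n r \<tau> \<pi>"

abbreviation "proj \<equiv> pproj n r \<tau> \<pi>"

lemma bmeas_stat: "bmeas V stat"
proof -
  have "bmeas V (\<lambda>w. ((\<Sum>I\<in>rsets n r. patt r I \<pi> w (w \<circ> \<tau>)) - real (n choose r) * (1 / fact r)) * (1 / real n powr (real r - 1 / 2)))"
  proof (intro bmeas_mult bmeas_diff bmeas_const bmeas_sum)
    fix I assume I: "I \<in> rsets n r"
    then show "bmeas V (\<lambda>w. patt r I \<pi> w (w \<circ> \<tau>))"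
      using rsets_finite[OF I] ps.tau_in(1) pi by (intro bmeas_patt) (auto simp: rsets_def)
  qed
  then show ?thesis by (simp add: pstat_def[abs_def])
qed

lemma bmeas_proj: "bmeas V proj"
proof -
  have "bmeas V (\<lambda>w. (\<Sum>i\<in>V. perm_term n \<tau> (gker r \<pi>) i w) * (1 / sqrt (real n) / fact (r - 1)))"
    by (intro bmeas_mult bmeas_const ps.bmeas_sumX)
  then show ?thesis by (simp add: pproj_def[abs_def])
qed

lemma expectation_proj:
  "(\<integral>w. \<bar>(\<Sum>i\<in>V. perm_term n \<tau> (gker r \<pi>) i w) / sqrt (real n)\<bar> \<partial>UP n) \<le> sqrt \<bar>perm_var n \<tau> (gker r \<pi>)\<bar>"
proof (rule ps.P.expectation_abs_le)
  have bm: "bmeas V (\<lambda>w. (\<Sum>i\<in>V. perm_term n \<tau> (gker r \<pi>) i w) / sqrt (real n))"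
    using bmeas_mult[OF ps.bmeas_sumX[of V] bmeas_const[of _ "1 / sqrt (real n)"]] by simp
  show "integrable (UP n) (\<lambda>w. (\<Sum>i\<in>V. perm_term n \<tau> (gker r \<pi>) i w) / sqrt (real n))"
    by (rule ps.bmeas_integrable[OF bm])
  show "integrable (UP n) (\<lambda>w. ((\<Sum>i\<in>V. perm_term n \<tau> (gker r \<pi>) i w) / sqrt (real n))\<^sup>2)"
    by (rule ps.bmeas_integrable[OF bmeas_power[OF bm]])
  show "(\<integral>w. ((\<Sum>i\<in>V. perm_term n \<tau> (gker r \<pi>) i w) / sqrt (real n))\<^sup>2 \<partial>UP n) \<le> (sqrt \<bar>perm_var n \<tau> (gker r \<pi>)\<bar>)\<^sup>2"
    unfolding ps.second_moment by simp
qed simp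

text \<open>Three errors: the remainder \<open>dev\<close>, the terms at fixed points, and the
  replacement of \<open>(n - 1) choose (r - 1)\<close> by its leading order. The last one multiplies
  the normalized sum, whose first absolute moment is controlled by its variance.\<close>

theorem stat_proj_distance:
  "(\<integral>w. \<bar>stat w - proj w\<bar> \<partial>UP n)
    \<le> ((3 * real r * K0 + K0 * (real (card (fixed_points n \<tau>)) + 1)) + real (card (fixed_points n \<tau>)) * B) / sqrt (real n)
      + \<bar>real ((n - 1) choose (r - 1)) / real n ^ (r - 1) - 1 / fact (r - 1)\<bar> * sqrt \<bar>perm_var n \<tau> (gker r \<pi>)\<bar>"
proof -
  let ?N = "real n powr (real r - 1 / 2)"
  let ?f = "real (card (fixed_points n \<tau>))"
  let ?c = "real ((n - 1) choose (r - 1))"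
  let ?X = "\<lambda>w. \<Sum>i\<in>V. perm_term n \<tau> (gker r \<pi>) i w"
  have N: "?N = real n ^ (r - 1) * sqrt (real n)"
  proof -
    have "?N = real n powr (real (r - 1) + 1 / 2)" using r by (simp add: of_nat_diff)
    also have "\<dots> = real n powr real (r - 1) * real n powr (1 / 2)" by (rule powr_add)
    finally show ?thesis using n by (simp add: powr_realpow powr_half_sqrt)
  qed
  have pos: "real n ^ (r - 1) > 0" "sqrt (real n) > 0" using n by auto
  have cle: "?c \<le> real n ^ (r - 1)"
  proof -
    have "(n - 1) choose (r - 1) \<le> (n - 1) ^ (r - 1)"
      by (rule binomial_le_power)
    also have "\<dots> \<le> n ^ (r - 1)" by (intro power_mono) auto
    finally show ?thesis by (simp flip: of_nat_power)
  qed
  have count: "card {I \<in> rsets n r. i \<in> I} = (n - 1) choose (r - 1)" if i: "i \<in> V" for i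
  proof -
    have "bij_betw (\<lambda>I. I - {i}) {I \<in> rsets n r. i \<in> I} {K. K \<subseteq> V - {i} \<and> card K = r - 1}"
    proof (rule bij_betwI[where g = "insert i"])
      show "(\<lambda>I. I - {i}) \<in> {I \<in> rsets n r. i \<in> I} \<rightarrow> {K. K \<subseteq> V - {i} \<and> card K = r - 1}"
      proof
        fix I assume I: "I \<in> {I \<in> rsets n r. i \<in> I}"
        then have "finite I" using rsets_finite[of I n r] by blast
        then show "I - {i} \<in> {K. K \<subseteq> V - {i} \<and> card K = r - 1}" using I by (auto simp: rsets_def)
      qed
      show "insert i \<in> {K. K \<subseteq> V - {i} \<and> card K = r - 1} \<rightarrow> {I \<in> rsets n r. i \<in> I}"
      proof
        fix K assume K: "K \<in> {K. K \<subseteq> V - {i} \<and> card K = r - 1}"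
        then have "finite K" using finite_subset by auto
        then show "insert i K \<in> {I \<in> rsets n r. i \<in> I}" using K i r by (auto simp: rsets_def card_insert_if)
      qed
    qed auto
    then have "card {I \<in> rsets n r. i \<in> I} = card {K. K \<subseteq> V - {i} \<and> card K = r - 1}" by (rule bij_betw_same_card)
    also have "\<dots> = (n - 1) choose (r - 1)" using n_subsets[of "V - {i}" "r - 1"] i by simp
    finally show ?thesis .
  qed
  \<comment> \<open>Each index lies in \<open>(n - 1) choose (r - 1)\<close> of the sets.\<close>
  have double: "(\<Sum>I\<in>rsets n r. \<Sum>i\<in>I. g i w) = ?c * (\<Sum>i\<in>V. g i w)" for w
  proof -
    have "(\<Sum>I\<in>rsets n r. \<Sum>i\<in>I. g i w) = (\<Sum>I\<in>rsets n r. \<Sum>i\<in>V. if i \<in> I then g i w else 0)"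
    proof (rule sum.cong[OF refl])
      fix I assume "I \<in> rsets n r"
      then have "V \<inter> I = I" by (auto simp: rsets_def)
      then show "(\<Sum>i\<in>I. g i w) = (\<Sum>i\<in>V. if i \<in> I then g i w else 0)"
        by (simp add: sum.inter_restrict[symmetric])
    qed
    also have "\<dots> = (\<Sum>i\<in>V. \<Sum>I\<in>rsets n r. if i \<in> I then g i w else 0)" by (rule sum.swap)
    also have "\<dots> = (\<Sum>i\<in>V. ?c * g i w)"
    proof (rule sum.cong[OF refl])
      fix i assume i: "i \<in> V"
      have "(\<Sum>I\<in>rsets n r. if i \<in> I then g i w else 0) = (\<Sum>I\<in>{I \<in> rsets n r. i \<in> I}. g i w)"
        by (rule sum.inter_filter[OF finite_rsets, symmetric])
      then show "(\<Sum>I\<in>rsets n r. if i \<in> I then g i w else 0) = ?c * g i w" by (simp add: count[OF i, simplified])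
    qed
    finally show ?thesis by (simp add: sum_distrib_left)
  qed
  have fixed: "\<bar>(\<Sum>i\<in>V. g i w) - ?X w\<bar> \<le> ?f * B" for w
  proof -
    have "(\<Sum>i\<in>V. g i w) - ?X w = (\<Sum>i\<in>V. if i \<in> fixed_points n \<tau> then g i w else 0)"
      unfolding sum_subtractf[symmetric] by (intro sum.cong refl) (auto simp: perm_term_def fixed_points_def)
    also have "\<dots> = (\<Sum>i\<in>fixed_points n \<tau>. g i w)"
      by (rule sum.mono_neutral_cong_right) (auto simp: fixed_points_def)
    also have "\<bar>\<dots>\<bar> \<le> ?f * B" using sum_norm_bound[of "fixed_points n \<tau>" "\<lambda>i. g i w" B] B by simp
    finally show ?thesis .
  qed
  have stat: "stat w = ((\<Sum>I\<in>rsets n r. dev I w) + ?c * (\<Sum>i\<in>V. g i w)) / ?N" for w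
  proof -
    have "(\<Sum>I\<in>rsets n r. dev I w) = (\<Sum>I\<in>rsets n r. patt r I \<pi> w (w \<circ> \<tau>)) - real (n choose r) * (1 / fact r) - ?c * (\<Sum>i\<in>V. g i w)"
      unfolding dev_def sum_subtractf double by (simp add: card_rsets)
    then show ?thesis unfolding pstat_def by simp
  qed
  let ?d = "\<bar>?c / real n ^ (r - 1) - 1 / fact (r - 1)\<bar>"
  have absN: "\<bar>1 / ?N\<bar> = 1 / ?N" by (rule abs_of_nonneg) simp
  have pw: "\<bar>stat w - proj w\<bar> \<le> \<bar>\<Sum>I\<in>rsets n r. dev I w\<bar> * (1 / ?N) + ?f * B / sqrt (real n) + ?d * \<bar>?X w / sqrt (real n)\<bar>" for w
  proof -
    \<comment> \<open>Here \<open>a\<close> is the power of \<open>n\<close>, \<open>s\<close> its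
      square root and \<open>F\<close> the factorial; the three summands are the three
      errors.\<close>
    have split: "(D + c * G) / (a * s) - x / s / F = D * (1 / (a * s)) + c / a * ((G - x) / s) + (c / a - 1 / F) * (x / s)"
      if "a > 0" "s > 0" "F > 0" for D c G a s x F :: real
      using that by (simp add: field_simps)
    have eq: "stat w - proj w = (\<Sum>I\<in>rsets n r. dev I w) * (1 / ?N) + ?c / real n ^ (r - 1) * (((\<Sum>i\<in>V. g i w) - ?X w) / sqrt (real n))
        + (?c / real n ^ (r - 1) - 1 / fact (r - 1)) * (?X w / sqrt (real n))"
      unfolding stat pproj_def N by (rule split[OF pos]) simp
    have "\<bar>stat w - proj w\<bar> \<le> \<bar>(\<Sum>I\<in>rsets n r. dev I w) * (1 / ?N)\<bar> + \<bar>?c / real n ^ (r - 1) * (((\<Sum>i\<in>V. g i w) - ?X w) / sqrt (real n))\<bar>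
        + \<bar>(?c / real n ^ (r - 1) - 1 / fact (r - 1)) * (?X w / sqrt (real n))\<bar>"
      unfolding eq by (rule order_trans[OF abs_triangle_ineq add_right_mono[OF abs_triangle_ineq]])
    also have "\<dots> \<le> \<bar>\<Sum>I\<in>rsets n r. dev I w\<bar> * (1 / ?N) + 1 * (?f * B / sqrt (real n)) + ?d * \<bar>?X w / sqrt (real n)\<bar>"
    proof (rule add_mono[OF add_mono])
      show "\<bar>(\<Sum>I\<in>rsets n r. dev I w) * (1 / ?N)\<bar> \<le> \<bar>\<Sum>I\<in>rsets n r. dev I w\<bar> * (1 / ?N)"
        unfolding abs_mult absN by (rule order_refl)
      show "\<bar>?c / real n ^ (r - 1) * (((\<Sum>i\<in>V. g i w) - ?X w) / sqrt (real n))\<bar> \<le> 1 * (?f * B / sqrt (real n))"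
        unfolding abs_mult
      proof (intro mult_mono)
        have "?c / real n ^ (r - 1) \<le> 1" using cle pos(1) by (subst pos_divide_le_eq) simp_all
        then show "\<bar>?c / real n ^ (r - 1)\<bar> \<le> 1" by (subst abs_of_nonneg) simp_all
        show "\<bar>((\<Sum>i\<in>V. g i w) - ?X w) / sqrt (real n)\<bar> \<le> ?f * B / sqrt (real n)"
          using fixed[of w] pos by (simp add: abs_divide divide_right_mono)
      qed auto
      show "\<bar>(?c / real n ^ (r - 1) - 1 / fact (r - 1)) * (?X w / sqrt (real n))\<bar> \<le> ?d * \<bar>?X w / sqrt (real n)\<bar>"
        by (simp only: abs_mult order_refl)
    qed
    finally show ?thesis unfolding mult_1 .
  qed
  have bmD: "bmeas V (\<lambda>w. \<bar>\<Sum>I\<in>rsets n r. dev I w\<bar> * (1 / ?N))"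
    by (intro bmeas_mult bmeas_abs bmeas_sum bmeas_dev bmeas_const)
  have bmX: "bmeas V (\<lambda>w. ?d * \<bar>?X w / sqrt (real n)\<bar>)"
    using bmeas_mult[OF bmeas_const bmeas_abs[OF bmeas_mult[OF ps.bmeas_sumX[of V] bmeas_const[of _ "1 / sqrt (real n)"]]], of ?d] by simp
  have "(\<integral>w. \<bar>stat w - proj w\<bar> \<partial>UP n) \<le> (\<integral>w. \<bar>\<Sum>I\<in>rsets n r. dev I w\<bar> * (1 / ?N) + ?f * B / sqrt (real n) + ?d * \<bar>?X w / sqrt (real n)\<bar> \<partial>UP n)"
    by (intro integral_mono ps.bmeas_integrable bmeas_add bmD bmX bmeas_const bmeas_abs bmeas_diff bmeas_stat bmeas_proj pw)
  also have "\<dots> = (\<integral>w. \<bar>\<Sum>I\<in>rsets n r. dev I w\<bar> \<partial>UP n) * (1 / ?N) + ?f * B / sqrt (real n) + ?d * (\<integral>w. \<bar>?X w / sqrt (real n)\<bar> \<partial>UP n)"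
  proof -
    have i1: "integrable (UP n) (\<lambda>w. \<bar>\<Sum>I\<in>rsets n r. dev I w\<bar> * (1 / ?N))" by (rule ps.bmeas_integrable[OF bmD])
    have i2: "integrable (UP n) (\<lambda>w. ?f * B / sqrt (real n))" by (rule ps.bmeas_integrable[OF bmeas_const])
    have i3: "integrable (UP n) (\<lambda>w. ?d * \<bar>?X w / sqrt (real n)\<bar>)" by (rule ps.bmeas_integrable[OF bmX])
    show ?thesis
      unfolding Bochner_Integration.integral_add[OF Bochner_Integration.integrable_add[OF i1 i2] i3]
        Bochner_Integration.integral_add[OF i1 i2]
      by (simp only: lebesgue_integral_const ps.P.prob_space scaleR_one integral_mult_left_zero integral_mult_right_zero)
  qed
  also have "\<dots> \<le> ((3 * real r * K0 + K0 * (?f + 1)) * real n ^ (r - 1)) * (1 / ?N) + ?f * B / sqrt (real n) + ?d * sqrt \<bar>perm_var n \<tau> (gker r \<pi>)\<bar>"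
    by (intro add_mono mult_right_mono mult_left_mono expectation_dev expectation_proj) auto
  also have "((3 * real r * K0 + K0 * (?f + 1)) * real n ^ (r - 1)) * (1 / ?N) = (3 * real r * K0 + K0 * (?f + 1)) / sqrt (real n)"
    unfolding N using pos by simp
  finally show ?thesis by (simp add: add_divide_distrib)
qed

end

subsection \<open>Convergence of the normalized pattern counts\<close>

text \<open>The kernel of a linear form in the projections; it reduces the vector statement to
  \<open>perm_sum\<close> for a single kernel.\<close>

definition lin_kernel :: "nat \<Rightarrow> ((nat \<Rightarrow> nat) \<Rightarrow> real) \<Rightarrow> real \<Rightarrow> real \<Rightarrow> real"
  where "lin_kernel r s u v = (\<Sum>\<pi>\<in>perms r. (s \<pi> / fact (r - 1)) * gker r \<pi> u v)"

lemma finite_perms [simp]: "finite (perms r)"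
  by (simp add: finite_permutations)

lemma sqf_lin_kernel: "sqf (lin_kernel r s)"
proof -
  have "sqf (\<lambda>u v. \<Sum>\<pi>\<in>perms r. (s \<pi> / fact (r - 1)) * gker r \<pi> u v)"
    by (rule sqf_lincomb[OF sqf_gker])
  then show ?thesis by (simp add: lin_kernel_def[abs_def])
qed

lemma integrable_gker:
  "integrable unif01 (\<lambda>u. gker r \<pi> u v)" "integrable unif01 (\<lambda>v. gker r \<pi> u v)"
proof -
  obtain B where B: "\<And>u v. \<bar>gker r \<pi> u v\<bar> \<le> B" using gker_bounded by blast
  show "integrable unif01 (\<lambda>u. gker r \<pi> u v)"
    by (rule integrable_unif01[OF sqf_section[OF sqf_gker] B])
  show "integrable unif01 (\<lambda>v. gker r \<pi> u v)"
    by (rule integrable_unif01[OF sqf_section[OF sqf_swap[OF sqf_gker]] B])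
qed

lemma integral_lin_kernel:
  assumes r: "r \<ge> 1"
  shows "(\<integral>u. lin_kernel r s u v \<partial>unif01) = 0" "(\<integral>v. lin_kernel r s u v \<partial>unif01) = 0"
proof -
  have "(\<integral>u. lin_kernel r s u v \<partial>unif01) = (\<Sum>\<pi>\<in>perms r. \<integral>u. (s \<pi> / fact (r - 1)) * gker r \<pi> u v \<partial>unif01)"
    unfolding lin_kernel_def by (intro Bochner_Integration.integral_sum integrable_mult_right integrable_gker)
  also have "\<dots> = 0" using integral_gker_left[OF r] by (intro sum.neutral ballI) (simp only: integral_mult_right_zero mult_zero_right)
  finally show "(\<integral>u. lin_kernel r s u v \<partial>unif01) = 0" .
  have "(\<integral>v. lin_kernel r s u v \<partial>unif01) = (\<Sum>\<pi>\<in>perms r. \<integral>v. (s \<pi> / fact (r - 1)) * gker r \<pi> u v \<partial>unif01)"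
    unfolding lin_kernel_def by (intro Bochner_Integration.integral_sum integrable_mult_right integrable_gker)
  also have "\<dots> = 0" using integral_gker_right[OF r] by (intro sum.neutral ballI) (simp only: integral_mult_right_zero mult_zero_right)
  finally show "(\<integral>v. lin_kernel r s u v \<partial>unif01) = 0" .
qed

text \<open>Links the limiting variance of a linear form, which appears as \<open>pair_form\<close>,
  with the quadratic form of the covariance matrix; positive semidefiniteness is then read off
  \<open>pair_form_self\<close>.\<close>

lemma cov_form_eq:
  assumes r: "r \<ge> 1"
  shows "(\<Sum>\<pi>\<in>perms r. \<Sum>\<rho>\<in>perms r. s \<pi> * s \<rho> * cov_matrix r p \<pi> \<rho>) = pair_form p (lin_kernel r s) (lin_kernel r s)"
proof -
  let ?F = "fact (r - 1) :: real"
  have "pair_form p (lin_kernel r s) (lin_kernel r s) = (\<Sum>\<pi>\<in>perms r. (s \<pi> / ?F) * pair_form p (gker r \<pi>) (lin_kernel r s))"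
    unfolding lin_kernel_def[of r s, abs_def] by (rule pair_form_sum_left[OF sqf_gker sqf_lincomb[OF sqf_gker]])
  also have "\<dots> = (\<Sum>\<pi>\<in>perms r. (s \<pi> / ?F) * (\<Sum>\<rho>\<in>perms r. (s \<rho> / ?F) * pair_form p (gker r \<pi>) (gker r \<rho>)))"
    unfolding lin_kernel_def[of r s, abs_def] by (intro sum.cong refl arg_cong2[of _ _ _ _ "(*)"] pair_form_sum_right sqf_gker)
  also have "\<dots> = (\<Sum>\<pi>\<in>perms r. \<Sum>\<rho>\<in>perms r. s \<pi> * s \<rho> * cov_matrix r p \<pi> \<rho>)"
    unfolding sum_distrib_left
    by (intro sum.cong refl) (simp add: cov_matrix_eq[OF r] pair_form_def power2_eq_square)
  finally show ?thesis ..
qed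

lemma pair_form_commute:
  assumes "sqf f" "sqf w" shows "pair_form p f w = pair_form p w f"
proof -
  have e: "pair_form p f w = IS (\<lambda>u v. f u v * w u v) + p * IS (\<lambda>u v. f u v * w v u)" if "sqf f" "sqf w" for f w
  proof -
    have "pair_form p f w = IS (\<lambda>u v. f u v * w u v + p * (f u v * w v u))"
      unfolding pair_form_def by (simp add: distrib_left mult.left_commute)
    also have "\<dots> = IS (\<lambda>u v. f u v * w u v) + p * IS (\<lambda>u v. f u v * w v u)"
      unfolding IS_add[OF sqf_mult[OF that] sqf_mult[OF sqf_const sqf_mult[OF that(1) sqf_swap[OF that(2)]]]] IS_cmult ..
    finally show ?thesis .
  qed
  have "IS (\<lambda>u v. f u v * w v u) = IS (\<lambda>u v. w u v * f v u)"
    using IS_swap[OF sqf_mult[OF assms(1) sqf_swap[OF assms(2)]]] by (simp add: mult.commute)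
  then show ?thesis unfolding e[OF assms] e[OF assms(2,1)] by (simp add: mult.commute)
qed

lemma psd_cov_matrix:
  assumes r: "r \<ge> 1" and p: "0 \<le> p" "p \<le> 1"
  shows "psd (perms r) (cov_matrix r p)"
  unfolding psd_def
proof (intro conjI ballI allI)
  fix \<pi> \<rho> assume "\<pi> \<in> perms r" "\<rho> \<in> perms r"
  then show "cov_matrix r p \<pi> \<rho> = cov_matrix r p \<rho> \<pi>"
    using pair_form_commute[OF sqf_gker sqf_gker, of p r \<pi> r \<rho>] by (simp add: cov_matrix_eq[OF r] pair_form_def)
next
  fix s :: "(nat \<Rightarrow> nat) \<Rightarrow> real"
  have nn: "0 \<le> IS (\<lambda>u v. (lin_kernel r s u v)\<^sup>2)" "0 \<le> IS (\<lambda>u v. (lin_kernel r s u v + lin_kernel r s v u)\<^sup>2)"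
    by (intro IS_nonneg; simp)+
  show "0 \<le> (\<Sum>\<pi>\<in>perms r. \<Sum>\<rho>\<in>perms r. s \<pi> * s \<rho> * cov_matrix r p \<pi> \<rho>)"
    unfolding cov_form_eq[OF r] pair_form_self[OF sqf_lin_kernel] using nn p by simp
qed

lemma binomial_ratio_tendsto:
  "(\<lambda>n. real ((n - 1) choose k) / real n ^ k) \<longlonglongrightarrow> 1 / fact k"
proof -
  have one: "(\<lambda>n. (real (n - 1) - real i) / real n) \<longlonglongrightarrow> 1" for i
  proof (rule Lim_transform_eventually)
    have "(\<lambda>n. 1 - (1 + real i) * (1 / real n)) \<longlonglongrightarrow> 1 - (1 + real i) * 0"
      by (intro tendsto_intros lim_1_over_n)
    then show "(\<lambda>n. 1 - (1 + real i) * (1 / real n)) \<longlonglongrightarrow> 1" by simp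
    show "\<forall>\<^sub>F n in sequentially. 1 - (1 + real i) * (1 / real n) = (real (n - 1) - real i) / real n"
      using eventually_ge_at_top[of 1] by eventually_elim (simp add: of_nat_diff field_simps)
  qed
  have "(\<lambda>n. (\<Prod>i<k. (real (n - 1) - real i) / real n) / fact k) \<longlonglongrightarrow> (\<Prod>i<k. 1) / fact k"
    by (intro tendsto_divide tendsto_prod one tendsto_const) simp
  moreover have "(\<Prod>i<k. (real (n - 1) - real i) / real n) / fact k = real ((n - 1) choose k) / real n ^ k" for n
    by (simp add: binomial_gbinomial gbinomial_prod_rev prod_dividef atLeast0LessThan)
  ultimately show ?thesis by simp
qed

section \<open>Transfer from i.i.d. labels to the law of the counts\<close>

lemma stat_vector:
  assumes r: "r \<ge> 1" and tau: "\<tau> permutes {1..n}" and w: "inj_on w {1..n}"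
  shows "normalized_counts r n (rank_perm n w \<circ> \<tau> \<circ> inv (rank_perm n w)) = (\<lambda>\<pi>\<in>perms r. pstat n r \<tau> \<pi> w)"
proof -
  have "real (pattern_count n r \<pi> (rank_perm n w \<circ> \<tau> \<circ> inv (rank_perm n w))) = (\<Sum>I\<in>rsets n r. patt r I \<pi> w (w \<circ> \<tau>))"
    if "\<pi> \<in> perms r" for \<pi>
    unfolding rsets_def by (rule pattern_count_conj[OF tau w that])
  then show ?thesis
    unfolding normalized_counts_def by (intro restrict_ext) (simp only: pstat_def)
qed

lemma AE_inj_on: "AE w in UP n. inj_on w {1..n}"
proof -
  interpret real_product "\<lambda>_ :: nat. unif01" "{1..n}" by (rule real_product_unif)
  have "AE w in UP n. \<forall>i\<in>{1..n}. \<forall>j\<in>{1..n}. i \<noteq> j \<longrightarrow> w i \<noteq> w j"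
  proof (intro AE_finite_allI)
    fix i j assume ij: "i \<in> {1..n}" "j \<in> {1..n}"
    show "AE w in UP n. i \<noteq> j \<longrightarrow> w i \<noteq> w j"
    proof (cases "i = j")
      case False
      from AE_coordinates_ne[OF ij False refl] show ?thesis by eventually_elim simp
    qed simp
  qed auto
  then show ?thesis by eventually_elim (auto simp: inj_on_def)
qed

text \<open>Conjugating by the ranks of i.i.d. uniform points preserves the uniform distribution on
  the permutations of cycle type \<open>t\<close>.\<close>

lemma sum_t_cyclic_expectation:
  fixes h :: "((nat \<Rightarrow> nat) \<Rightarrow> real) \<Rightarrow> real"
  assumes r: "r \<ge> 1" and h: "\<And>\<tau>. \<tau> \<in> t_cyclic n t \<Longrightarrow> bmeas {1..n} (\<lambda>w. h (\<lambda>\<pi>\<in>perms r. pstat n r \<tau> \<pi> w))"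
  shows "(\<Sum>\<tau>\<in>t_cyclic n t. h (normalized_counts r n \<tau>)) = (\<Sum>\<tau>\<in>t_cyclic n t. \<integral>w. h (\<lambda>\<pi>\<in>perms r. pstat n r \<tau> \<pi> w) \<partial>UP n)"
proof -
  interpret real_product "\<lambda>_ :: nat. unif01" "{1..n}" by (rule real_product_unif)
  let ?c = "\<Sum>\<tau>\<in>t_cyclic n t. h (normalized_counts r n \<tau>)"
  have "?c = (\<integral>w. ?c \<partial>UP n)" by (simp only: lebesgue_integral_const P.prob_space scaleR_one)
  also have "\<dots> = (\<integral>w. (\<Sum>\<tau>\<in>t_cyclic n t. h (\<lambda>\<pi>\<in>perms r. pstat n r \<tau> \<pi> w)) \<partial>UP n)"
  proof (rule integral_cong_AE)
    show "(\<lambda>w. \<Sum>\<tau>\<in>t_cyclic n t. h (\<lambda>\<pi>\<in>perms r. pstat n r \<tau> \<pi> w)) \<in> borel_measurable (UP n)"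
      by (intro bmeas_borel bmeas_sum h)
    show "AE w in UP n. ?c = (\<Sum>\<tau>\<in>t_cyclic n t. h (\<lambda>\<pi>\<in>perms r. pstat n r \<tau> \<pi> w))"
      using AE_inj_on
    proof eventually_elim
      case (elim w)
      \<comment> \<open>For fixed labels, the sum over the whole class is unchanged by conjugation
        with their ranks; the labels are integrated only afterwards.\<close>
      have "?c = (\<Sum>\<tau>\<in>t_cyclic n t. h (normalized_counts r n (rank_perm n w \<circ> \<tau> \<circ> inv (rank_perm n w))))"
        by (rule sum_t_cyclic_conj[OF rank_perm_permutes[OF elim], symmetric])
      also have "\<dots> = (\<Sum>\<tau>\<in>t_cyclic n t. h (\<lambda>\<pi>\<in>perms r. pstat n r \<tau> \<pi> w))"
      proof (rule sum.cong[OF refl])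
        fix \<tau> assume "\<tau> \<in> t_cyclic n t"
        then have "\<tau> permutes {1..n}" by (simp add: t_cyclic_def)
        from stat_vector[OF r this elim]
        show "h (normalized_counts r n (rank_perm n w \<circ> \<tau> \<circ> inv (rank_perm n w))) = h (\<lambda>\<pi>\<in>perms r. pstat n r \<tau> \<pi> w)"
          by (simp only:)
      qed
      finally show ?case .
    qed
  qed simp
  also have "\<dots> = (\<Sum>\<tau>\<in>t_cyclic n t. \<integral>w. h (\<lambda>\<pi>\<in>perms r. pstat n r \<tau> \<pi> w) \<partial>UP n)"
    by (intro Bochner_Integration.integral_sum bmeas_integrable h)
  finally show ?thesis .
qed

lemma measurable_normalized_counts:
  "normalized_counts r n \<in> measure_pmf P \<rightarrow>\<^sub>M PiM (perms r) (\<lambda>_. borel)"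
  by (auto simp: measurable_pmf_measure1 normalized_counts_def space_PiM)

lemma prob_space_counts_law: "prob_space (counts_law r n t)"
  unfolding counts_law_def
  by (rule prob_space.prob_space_distr[OF measure_pmf.prob_space_axioms measurable_normalized_counts])

lemma sets_counts_law: "sets (counts_law r n t) = sets (PiM (perms r) (\<lambda>_. borel))"
  by (simp add: counts_law_def)

lemma integrable_counts_law:
  fixes h :: "((nat \<Rightarrow> nat) \<Rightarrow> real) \<Rightarrow> real"
  assumes "t_cyclic n t \<noteq> {}" and h: "h \<in> borel_measurable (PiM (perms r) (\<lambda>_. borel))"
  shows "integrable (counts_law r n t) h"
  unfolding counts_law_def integrable_distr_eq[OF measurable_normalized_counts h]
  by (rule integrable_measure_pmf_finite) (simp add: set_pmf_of_set[OF assms(1) finite_t_cyclic] finite_t_cyclic)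

text \<open>An estimate uniform over the class passes to its average, so each \<open>\<tau>\<close>
  can be treated separately.\<close>

lemma counts_law_deviation:
  fixes h :: "((nat \<Rightarrow> nat) \<Rightarrow> real) \<Rightarrow> real"
  assumes r: "r \<ge> 1" and ne: "t_cyclic n t \<noteq> {}" and hm: "h \<in> borel_measurable (PiM (perms r) (\<lambda>_. borel))"
    and h: "\<And>\<tau>. \<tau> \<in> t_cyclic n t \<Longrightarrow> bmeas {1..n} (\<lambda>w. h (\<lambda>\<pi>\<in>perms r. pstat n r \<tau> \<pi> w))"
    and b: "\<And>\<tau>. \<tau> \<in> t_cyclic n t \<Longrightarrow> \<bar>(\<integral>w. h (\<lambda>\<pi>\<in>perms r. pstat n r \<tau> \<pi> w) \<partial>UP n) - L\<bar> \<le> e"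
  shows "\<bar>(\<integral>x. h x \<partial>counts_law r n t) - L\<bar> \<le> e"
proof -
  let ?T = "t_cyclic n t"
  have c: "real (card ?T) > 0" using ne finite_t_cyclic[of n t] by (simp add: card_gt_0_iff)
  have "(\<integral>x. h x \<partial>counts_law r n t) = (\<Sum>\<tau>\<in>?T. h (normalized_counts r n \<tau>)) / real (card ?T)"
    unfolding counts_law_def integral_distr[OF measurable_normalized_counts hm]
    by (rule integral_pmf_of_set[OF ne finite_t_cyclic])
  also have "\<dots> = (\<Sum>\<tau>\<in>?T. \<integral>w. h (\<lambda>\<pi>\<in>perms r. pstat n r \<tau> \<pi> w) \<partial>UP n) / real (card ?T)"
  proof -
    have "(\<Sum>\<tau>\<in>?T. h (normalized_counts r n \<tau>)) = (\<Sum>\<tau>\<in>?T. \<integral>w. h (\<lambda>\<pi>\<in>perms r. pstat n r \<tau> \<pi> w) \<partial>UP n)"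
      by (rule sum_t_cyclic_expectation[OF r h])
    then show ?thesis by (simp only:)
  qed
  finally have "(\<integral>x. h x \<partial>counts_law r n t) - L = (\<Sum>\<tau>\<in>?T. (\<integral>w. h (\<lambda>\<pi>\<in>perms r. pstat n r \<tau> \<pi> w) \<partial>UP n) - L) / real (card ?T)"
    using c by (simp add: sum_subtractf diff_divide_distrib)
  moreover have "\<bar>\<Sum>\<tau>\<in>?T. (\<integral>w. h (\<lambda>\<pi>\<in>perms r. pstat n r \<tau> \<pi> w) \<partial>UP n) - L\<bar> \<le> real (card ?T) * e"
    using sum_norm_bound[of ?T "\<lambda>\<tau>. (\<integral>w. h (\<lambda>\<pi>\<in>perms r. pstat n r \<tau> \<pi> w) \<partial>UP n) - L" e] b by simp
  ultimately show ?thesis using c by (simp add: abs_divide divide_le_eq mult.commute)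
qed

lemma tail_bound:
  fixes Q :: "('i \<Rightarrow> real) measure"
  assumes "prob_space Q" and sets: "sets Q = sets (PiM I (\<lambda>_. borel))" and fin: "finite I" and L: "L > 0"
    and int: "\<And>i. i \<in> I \<Longrightarrow> integrable Q (\<lambda>x. \<bar>x i\<bar>)"
  shows "measure Q {x \<in> space Q. \<exists>i\<in>I. L < \<bar>x i\<bar>} \<le> (\<Sum>i\<in>I. \<integral>x. \<bar>x i\<bar> \<partial>Q) / L"
proof -
  interpret prob_space Q by fact
  have sets_i: "{x \<in> space Q. L \<le> \<bar>x i\<bar>} \<in> events" if "i \<in> I" for i
    using borel_measurable_integrable[OF int[OF that]] by measurable
  have "measure Q {x \<in> space Q. \<exists>i\<in>I. L < \<bar>x i\<bar>} \<le> measure Q (\<Union>i\<in>I. {x \<in> space Q. L \<le> \<bar>x i\<bar>})"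
    using sets_i fin by (intro finite_measure_mono sets.finite_UN) auto
  also have "\<dots> \<le> (\<Sum>i\<in>I. measure Q {x \<in> space Q. L \<le> \<bar>x i\<bar>})"
    using sets_i fin by (intro finite_measure_subadditive_finite) auto
  also have "\<dots> \<le> (\<Sum>i\<in>I. (\<integral>x. \<bar>x i\<bar> \<partial>Q) / L)"
    by (intro sum_mono integral_Markov_inequality_measure[where A = "{}"] int) (use L in auto)
  finally show ?thesis by (simp add: sum_divide_distrib)
qed

section \<open>The limit theorem along a sequence of cycle types\<close>

locale cycle_type_sequence =
  fixes r :: nat and p :: real and t :: "nat \<Rightarrow> nat \<Rightarrow> nat"
  assumes r: "r \<ge> 1" and p: "0 \<le> p" "p \<le> 1" and type: "\<And>n. n \<ge> 1 \<Longrightarrow> is_cycle_type n (t n)"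
    and t1: "(\<lambda>n. real (t n 1)) \<in> o(\<lambda>n. sqrt (real n))"
    and t2: "(\<lambda>n. 2 * real (t n 2) - real n * p) \<in> o(\<lambda>n. real n)"
begin

abbreviation "T n \<equiv> t_cyclic n (t n)"

text \<open>The common value of \<open>perm_var\<close> on the class \<open>T n\<close>, for
  \<open>n\<close> at least 2.\<close>

definition var_seq :: "(real \<Rightarrow> real \<Rightarrow> real) \<Rightarrow> nat \<Rightarrow> real"
  where "var_seq G n = ((real n - real (t n 1)) * IS (\<lambda>u v. G u v * G u v) + 2 * real (t n 2) * IS (\<lambda>u v. G u v * G v u)) / real n"

lemma T_permutes: "\<tau> \<in> T n \<Longrightarrow> \<tau> permutes {1..n}"
  by (simp add: t_cyclic_def)

lemma perm_var_eq:
  assumes n: "n \<ge> 2" and tau: "\<tau> \<in> T n"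
  shows "perm_var n \<tau> G = var_seq G n" "card (fixed_points n \<tau>) = t n 1"
  using card_fixed_points[OF tau] card_two_cycle_points[OF tau n] n
  by (simp_all add: perm_var_def var_seq_def fixed_points_def two_cycle_points_def)

lemma t1_ratio: "(\<lambda>n. real (t n 1) / sqrt (real n)) \<longlonglongrightarrow> 0"
  using smalloD_tendsto[OF t1] .

lemma inverse_sqrt: "(\<lambda>n. 1 / sqrt (real n)) \<longlonglongrightarrow> 0"
proof -
  have "(\<lambda>n. sqrt (1 / real n)) \<longlonglongrightarrow> sqrt 0" by (intro tendsto_real_sqrt lim_1_over_n)
  then show ?thesis by (simp add: real_sqrt_divide)
qed

lemma var_seq_tendsto:
  assumes G: "sqf G" shows "var_seq G \<longlonglongrightarrow> pair_form p G G"
proof -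
  let ?a = "IS (\<lambda>u v. G u v * G u v)" and ?b = "IS (\<lambda>u v. G u v * G v u)"
  \<comment> \<open>Here t_1 / n is written as a product of two null sequences, so that
    \<open>t1_ratio\<close> can be reused.\<close>
  have "(\<lambda>n. (1 - real (t n 1) / sqrt (real n) * (1 / sqrt (real n))) * ?a + (p + (2 * real (t n 2) - real n * p) / real n) * ?b) \<longlonglongrightarrow> (1 - 0 * 0) * ?a + (p + 0) * ?b"
    by (intro tendsto_intros t1_ratio inverse_sqrt smalloD_tendsto[OF t2])
  moreover have "\<forall>\<^sub>F n in sequentially. (1 - real (t n 1) / sqrt (real n) * (1 / sqrt (real n))) * ?a + (p + (2 * real (t n 2) - real n * p) / real n) * ?b = var_seq G n"
    using eventually_ge_at_top[of 1]
  proof eventually_elim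
    case (elim n)
    have "real (t n 1) / sqrt (real n) * (1 / sqrt (real n)) = real (t n 1) / real n" by simp
    then show ?case unfolding var_seq_def using elim by (simp add: field_simps)
  qed
  ultimately have "var_seq G \<longlonglongrightarrow> ?a + p * ?b"
    using Lim_transform_eventually by (simp add: tendsto_cong)
  moreover have "pair_form p G G = IS (\<lambda>u v. G u v * G u v + p * (G u v * G v u))"
    unfolding pair_form_def by (simp add: distrib_left mult.left_commute)
  then have "pair_form p G G = ?a + p * ?b"
    unfolding IS_add[OF sqf_mult[OF G G] sqf_mult[OF sqf_const sqf_mult[OF G sqf_swap[OF G]]]] IS_cmult .
  ultimately show ?thesis by simp
qed

text \<open>The bound of \<open>stat_proj_distance\<close> depends on \<open>\<tau>\<close> only
  through quantities fixed by the cycle type, so one null sequence serves the whole class. It tends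
  to 0 by t_1 = o(sqrt n), the limit of the binomial ratio and the boundedness of the variances. The
  bound on the projection itself is for tightness.\<close>

lemma approximation:
  assumes pi: "\<pi> \<in> perms r"
  obtains \<delta> where "\<delta> \<longlonglongrightarrow> 0" "\<And>n \<tau>. n \<ge> 2 \<Longrightarrow> \<tau> \<in> T n \<Longrightarrow> (\<integral>w. \<bar>pstat n r \<tau> \<pi> w - pproj n r \<tau> \<pi> w\<bar> \<partial>UP n) \<le> \<delta> n"
    "\<And>n \<tau>. n \<ge> 2 \<Longrightarrow> \<tau> \<in> T n \<Longrightarrow> bmeas {1..n} (pstat n r \<tau> \<pi>) \<and> bmeas {1..n} (pproj n r \<tau> \<pi>)
      \<and> (\<integral>w. \<bar>pproj n r \<tau> \<pi> w\<bar> \<partial>UP n) \<le> sqrt \<bar>var_seq (gker r \<pi>) n\<bar>"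
proof -
  obtain B where B: "\<And>u v. \<bar>gker r \<pi> u v\<bar> \<le> B" using gker_bounded by blast
  define K where "K = 2 + real r * B"
  define \<delta> where "\<delta> n = ((3 * real r * K + K * (real (t n 1) + 1)) + real (t n 1) * B) / sqrt (real n)
      + \<bar>real ((n - 1) choose (r - 1)) / real n ^ (r - 1) - 1 / fact (r - 1)\<bar> * sqrt \<bar>var_seq (gker r \<pi>) n\<bar>" for n
  have loc: "pattern_sum n r \<tau> \<pi> B" if "n \<ge> 2" "\<tau> \<in> T n" for n \<tau>
    by (rule pattern_sum.intro[OF _ r T_permutes[OF that(2)] pi B]) (use that in simp)
  show thesis
  proof (rule that[of \<delta>])
    have "(\<lambda>n. (3 * real r * K + K) * (1 / sqrt (real n)) + (K + B) * (real (t n 1) / sqrt (real n))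
      + \<bar>real ((n - 1) choose (r - 1)) / real n ^ (r - 1) - 1 / fact (r - 1)\<bar> * sqrt \<bar>var_seq (gker r \<pi>) n\<bar>)
      \<longlonglongrightarrow> (3 * real r * K + K) * 0 + (K + B) * 0 + \<bar>1 / fact (r - 1) - 1 / fact (r - 1)\<bar> * sqrt \<bar>pair_form p (gker r \<pi>) (gker r \<pi>)\<bar>"
      by (intro tendsto_add tendsto_mult tendsto_const t1_ratio inverse_sqrt tendsto_rabs tendsto_diff
        binomial_ratio_tendsto tendsto_real_sqrt var_seq_tendsto sqf_gker)
    moreover have "\<delta> = (\<lambda>n. (3 * real r * K + K) * (1 / sqrt (real n)) + (K + B) * (real (t n 1) / sqrt (real n))
      + \<bar>real ((n - 1) choose (r - 1)) / real n ^ (r - 1) - 1 / fact (r - 1)\<bar> * sqrt \<bar>var_seq (gker r \<pi>) n\<bar>)"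
    proof
      fix n
      have "((3 * real r * K + K * (real (t n 1) + 1)) + real (t n 1) * B) / sqrt (real n)
        = (3 * real r * K + K) * (1 / sqrt (real n)) + (K + B) * (real (t n 1) / sqrt (real n))"
        by (simp add: add_divide_distrib algebra_simps)
      then show "\<delta> n = (3 * real r * K + K) * (1 / sqrt (real n)) + (K + B) * (real (t n 1) / sqrt (real n))
      + \<bar>real ((n - 1) choose (r - 1)) / real n ^ (r - 1) - 1 / fact (r - 1)\<bar> * sqrt \<bar>var_seq (gker r \<pi>) n\<bar>"
        by (simp only: \<delta>_def)
    qed
    ultimately show "\<delta> \<longlonglongrightarrow> 0" by simp
    fix n \<tau> assume n: "n \<ge> 2" and tau: "\<tau> \<in> T n"
    have shrink: "\<bar>x / fact (r - 1)\<bar> \<le> \<bar>x\<bar>" for x :: real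
      using mult_left_mono[OF fact_ge_1[of "r - 1"] abs_ge_zero[of x]] by (simp add: abs_divide pos_divide_le_eq)
    interpret pp: pattern_sum n r \<tau> \<pi> B by (rule loc[OF n tau])
    show "(\<integral>w. \<bar>pstat n r \<tau> \<pi> w - pproj n r \<tau> \<pi> w\<bar> \<partial>UP n) \<le> \<delta> n"
      using pp.stat_proj_distance unfolding perm_var_eq[OF n tau] pp.K0_def \<delta>_def K_def .
    have "(\<integral>w. \<bar>pproj n r \<tau> \<pi> w\<bar> \<partial>UP n) \<le> (\<integral>w. \<bar>(\<Sum>i\<in>{1..n}. perm_term n \<tau> (gker r \<pi>) i w) / sqrt (real n)\<bar> \<partial>UP n)"
    proof (rule integral_mono)
      show "integrable (UP n) (\<lambda>w. \<bar>pproj n r \<tau> \<pi> w\<bar>)" by (intro pp.ps.bmeas_integrable bmeas_abs pp.bmeas_proj)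
      show "integrable (UP n) (\<lambda>w. \<bar>(\<Sum>i\<in>{1..n}. perm_term n \<tau> (gker r \<pi>) i w) / sqrt (real n)\<bar>)"
        using pp.ps.bmeas_integrable[OF bmeas_abs[OF bmeas_mult[OF pp.ps.bmeas_sumX[of "{1..n}"] bmeas_const[of _ "1 / sqrt (real n)"]]]] by simp
      fix w
      show "\<bar>pproj n r \<tau> \<pi> w\<bar> \<le> \<bar>(\<Sum>i\<in>{1..n}. perm_term n \<tau> (gker r \<pi>) i w) / sqrt (real n)\<bar>"
        unfolding pproj_def by (rule shrink)
    qed
    also have "\<dots> \<le> sqrt \<bar>var_seq (gker r \<pi>) n\<bar>" using pp.expectation_proj unfolding perm_var_eq[OF n tau] .
    finally show "bmeas {1..n} (pstat n r \<tau> \<pi>) \<and> bmeas {1..n} (pproj n r \<tau> \<pi>)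
      \<and> (\<integral>w. \<bar>pproj n r \<tau> \<pi> w\<bar> \<partial>UP n) \<le> sqrt \<bar>var_seq (gker r \<pi>) n\<bar>"
      using pp.bmeas_stat pp.bmeas_proj by blast
  qed
qed

lemma lin_proj:
  "(\<Sum>\<pi>\<in>perms r. s \<pi> * pproj n r \<tau> \<pi> w) = (\<Sum>i\<in>{1..n}. perm_term n \<tau> (lin_kernel r s) i w) / sqrt (real n)"
proof -
  have "(\<Sum>\<pi>\<in>perms r. s \<pi> * pproj n r \<tau> \<pi> w) = (\<Sum>\<pi>\<in>perms r. \<Sum>i\<in>{1..n}. s \<pi> / fact (r - 1) * perm_term n \<tau> (gker r \<pi>) i w / sqrt (real n))"
    unfolding pproj_def sum_divide_distrib sum_distrib_left by (intro sum.cong refl) simp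
  also have "\<dots> = (\<Sum>i\<in>{1..n}. \<Sum>\<pi>\<in>perms r. s \<pi> / fact (r - 1) * perm_term n \<tau> (gker r \<pi>) i w / sqrt (real n))" by (rule sum.swap)
  also have "\<dots> = (\<Sum>i\<in>{1..n}. perm_term n \<tau> (lin_kernel r s) i w / sqrt (real n))"
    unfolding sum_divide_distrib[symmetric] by (intro sum.cong refl arg_cong2[of _ _ _ _ "(/)"]) (simp add: perm_term_def lin_kernel_def)
  finally show ?thesis unfolding sum_divide_distrib .
qed

text \<open>The function \<open>iexp\<close> is 1-Lipschitz, so \<open>pstat\<close> may be
  exchanged for \<open>pproj\<close> at the price of the mean distances; the linear form in the
  projections is then a \<open>perm_sum\<close> for \<open>lin_kernel r s\<close>.\<close>

lemma characteristic_function: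
  obtains \<epsilon> where "\<epsilon> \<longlonglongrightarrow> 0" "\<And>n \<tau>. n \<ge> 2 \<Longrightarrow> \<tau> \<in> T n \<Longrightarrow>
    cmod ((\<integral>w. iexp (\<Sum>\<pi>\<in>perms r. s \<pi> * pstat n r \<tau> \<pi> w) \<partial>UP n) - complex_of_real (exp (- (var_seq (lin_kernel r s) n / 2)))) \<le> \<epsilon> n"
proof -
  have "\<forall>\<pi>\<in>perms r. \<exists>\<delta>. \<delta> \<longlonglongrightarrow> 0 \<and> (\<forall>n \<tau>. n \<ge> 2 \<longrightarrow> \<tau> \<in> T n \<longrightarrow>
    (\<integral>w. \<bar>pstat n r \<tau> \<pi> w - pproj n r \<tau> \<pi> w\<bar> \<partial>UP n) \<le> \<delta> n \<and> bmeas {1..n} (pstat n r \<tau> \<pi>) \<and> bmeas {1..n} (pproj n r \<tau> \<pi>))"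
  proof
    fix \<pi> assume "\<pi> \<in> perms r"
    then show "\<exists>\<delta>. \<delta> \<longlonglongrightarrow> 0 \<and> (\<forall>n \<tau>. n \<ge> 2 \<longrightarrow> \<tau> \<in> T n \<longrightarrow>
      (\<integral>w. \<bar>pstat n r \<tau> \<pi> w - pproj n r \<tau> \<pi> w\<bar> \<partial>UP n) \<le> \<delta> n \<and> bmeas {1..n} (pstat n r \<tau> \<pi>) \<and> bmeas {1..n} (pproj n r \<tau> \<pi>))"
    proof (rule approximation, goal_cases)
      case (1 \<delta>)
      show ?case
      proof (intro exI[of _ \<delta>] conjI allI impI)
        show "\<delta> \<longlonglongrightarrow> 0" by (rule 1(1))
        fix n \<tau> assume n: "2 \<le> n" and tau: "\<tau> \<in> T n"
        show "(\<integral>w. \<bar>pstat n r \<tau> \<pi> w - pproj n r \<tau> \<pi> w\<bar> \<partial>UP n) \<le> \<delta> n" by (rule 1(2)[OF n tau])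
        show "bmeas {1..n} (pstat n r \<tau> \<pi>)" by (rule conjunct1[OF 1(3)[OF n tau]])
        show "bmeas {1..n} (pproj n r \<tau> \<pi>)" by (rule conjunct1[OF conjunct2[OF 1(3)[OF n tau]]])
      qed
    qed
  qed
  from bchoice[OF this] obtain \<delta> where d: "\<forall>\<pi>\<in>perms r. \<delta> \<pi> \<longlonglongrightarrow> 0 \<and> (\<forall>n \<tau>. n \<ge> 2 \<longrightarrow> \<tau> \<in> T n \<longrightarrow>
    (\<integral>w. \<bar>pstat n r \<tau> \<pi> w - pproj n r \<tau> \<pi> w\<bar> \<partial>UP n) \<le> \<delta> \<pi> n \<and> bmeas {1..n} (pstat n r \<tau> \<pi>) \<and> bmeas {1..n} (pproj n r \<tau> \<pi>))" ..
  note d' = conjunct2[OF bspec[OF d], rule_format]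
  note \<delta> = conjunct1[OF bspec[OF d]] conjunct1[OF d'] conjunct1[OF conjunct2[OF d']] conjunct2[OF conjunct2[OF d']]
  let ?G = "lin_kernel r s"
  obtain C where C: "\<And>u v. \<bar>?G u v\<bar> \<le> C" using sqf_lin_kernel[of r s] unfolding sqf_def by blast
  define \<epsilon> where "\<epsilon> n = (\<Sum>\<pi>\<in>perms r. \<bar>s \<pi>\<bar> * \<delta> \<pi> n) + 64 * C ^ 3 * exp \<bar>var_seq ?G n\<bar> * (1 / sqrt (real n))" for n
  show thesis
  proof (rule that[of \<epsilon>])
    have "(\<lambda>n. (\<Sum>\<pi>\<in>perms r. \<bar>s \<pi>\<bar> * \<delta> \<pi> n) + 64 * C ^ 3 * exp \<bar>var_seq ?G n\<bar> * (1 / sqrt (real n)))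
      \<longlonglongrightarrow> (\<Sum>\<pi>\<in>perms r. \<bar>s \<pi>\<bar> * 0) + 64 * C ^ 3 * exp \<bar>pair_form p ?G ?G\<bar> * 0"
      by (intro tendsto_add tendsto_sum tendsto_mult tendsto_const \<delta>(1) tendsto_exp tendsto_rabs var_seq_tendsto sqf_lin_kernel inverse_sqrt)
    then show "\<epsilon> \<longlonglongrightarrow> 0" by (simp add: \<epsilon>_def[abs_def])
    fix n \<tau> assume n: "n \<ge> 2" and tau: "\<tau> \<in> T n"
    have n1: "n \<ge> 1" using n by simp
    interpret ps: perm_sum n \<tau> ?G C
      by (rule perm_sum.intro[OF n1 T_permutes[OF tau] sqf_lin_kernel C integral_lin_kernel[OF r]])
    let ?S = "\<lambda>w. \<Sum>\<pi>\<in>perms r. s \<pi> * pstat n r \<tau> \<pi> w" and ?P = "\<lambda>w. \<Sum>\<pi>\<in>perms r. s \<pi> * pproj n r \<tau> \<pi> w"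
    have bS: "bmeas {1..n} ?S" and bP: "bmeas {1..n} ?P"
      by (intro bmeas_sum bmeas_mult bmeas_const \<delta>(3,4) n tau; assumption)+
    have i: "integrable (UP n) (\<lambda>w. iexp (?S w))" "integrable (UP n) (\<lambda>w. iexp (?P w))"
      by (intro ps.bmeas_integrable bmeas_iexp bS bP)+
    have "cmod ((\<integral>w. iexp (?S w) \<partial>UP n) - (\<integral>w. iexp (?P w) \<partial>UP n)) = cmod (\<integral>w. iexp (?S w) - iexp (?P w) \<partial>UP n)"
      using i by simp
    also have "\<dots> \<le> (\<integral>w. cmod (iexp (?S w) - iexp (?P w)) \<partial>UP n)" by (rule integral_norm_bound)
    also have "\<dots> \<le> (\<integral>w. (\<Sum>\<pi>\<in>perms r. \<bar>s \<pi>\<bar> * \<bar>pstat n r \<tau> \<pi> w - pproj n r \<tau> \<pi> w\<bar>) \<partial>UP n)"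
    proof (rule integral_mono)
      show "integrable (UP n) (\<lambda>w. cmod (iexp (?S w) - iexp (?P w)))" using i by (intro integrable_norm Bochner_Integration.integrable_diff)
      show "integrable (UP n) (\<lambda>w. \<Sum>\<pi>\<in>perms r. \<bar>s \<pi>\<bar> * \<bar>pstat n r \<tau> \<pi> w - pproj n r \<tau> \<pi> w\<bar>)"
        by (intro ps.bmeas_integrable bmeas_sum bmeas_mult bmeas_const bmeas_abs bmeas_diff \<delta>(3,4) n tau)
      fix w
      have "cmod (iexp (?S w) - iexp (?P w)) \<le> \<bar>?S w - ?P w\<bar>" by (rule iexp_diff_bound)
      also have "?S w - ?P w = (\<Sum>\<pi>\<in>perms r. s \<pi> * (pstat n r \<tau> \<pi> w - pproj n r \<tau> \<pi> w))"
        by (simp add: sum_subtractf right_diff_distrib)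
      also have "\<bar>\<dots>\<bar> \<le> (\<Sum>\<pi>\<in>perms r. \<bar>s \<pi> * (pstat n r \<tau> \<pi> w - pproj n r \<tau> \<pi> w)\<bar>)" by (rule sum_abs)
      finally show "cmod (iexp (?S w) - iexp (?P w)) \<le> (\<Sum>\<pi>\<in>perms r. \<bar>s \<pi>\<bar> * \<bar>pstat n r \<tau> \<pi> w - pproj n r \<tau> \<pi> w\<bar>)"
        by (simp only: abs_mult)
    qed
    also have "\<dots> = (\<Sum>\<pi>\<in>perms r. \<bar>s \<pi>\<bar> * (\<integral>w. \<bar>pstat n r \<tau> \<pi> w - pproj n r \<tau> \<pi> w\<bar> \<partial>UP n))"
    proof -
      have "integrable (UP n) (\<lambda>w. \<bar>s \<pi>\<bar> * \<bar>pstat n r \<tau> \<pi> w - pproj n r \<tau> \<pi> w\<bar>)" if "\<pi> \<in> perms r" for \<pi>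
        by (intro ps.bmeas_integrable bmeas_mult bmeas_const bmeas_abs bmeas_diff \<delta>(3,4) n tau that)
      from Bochner_Integration.integral_sum[OF this] show ?thesis by (simp only: integral_mult_right_zero)
    qed
    also have "\<dots> \<le> (\<Sum>\<pi>\<in>perms r. \<bar>s \<pi>\<bar> * \<delta> \<pi> n)" by (intro sum_mono mult_left_mono \<delta>(2) n tau) auto
    finally have 1: "cmod ((\<integral>w. iexp (?S w) \<partial>UP n) - (\<integral>w. iexp (?P w) \<partial>UP n)) \<le> (\<Sum>\<pi>\<in>perms r. \<bar>s \<pi>\<bar> * \<delta> \<pi> n)" .
    have 2: "cmod ((\<integral>w. iexp (?P w) \<partial>UP n) - complex_of_real (exp (- (var_seq ?G n / 2)))) \<le> 64 * C ^ 3 * exp \<bar>var_seq ?G n\<bar> * (1 / sqrt (real n))"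
      using ps.perm_char_bound unfolding perm_var_eq[OF n tau] lin_proj by simp
    from norm_triangle_mono[OF 1 2]
    show "cmod ((\<integral>w. iexp (?S w) \<partial>UP n) - complex_of_real (exp (- (var_seq ?G n / 2)))) \<le> \<epsilon> n"
      by (simp add: \<epsilon>_def)
  qed
qed

lemma lin_measurable:
  "(\<lambda>x. \<Sum>\<pi>\<in>perms r. s \<pi> * x \<pi>) \<in> borel_measurable (PiM (perms r) (\<lambda>_. borel :: real measure))"
  by (intro borel_measurable_sum borel_measurable_times borel_measurable_const measurable_component_singleton)

lemma bmeas_pstat:
  assumes "n \<ge> 2" "\<tau> \<in> T n" "\<pi> \<in> perms r" shows "bmeas {1..n} (pstat n r \<tau> \<pi>)"
proof (rule approximation[OF assms(3)], goal_cases)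
  case (1 \<delta>)
  show ?case by (rule conjunct1[OF 1(3)[OF assms(1,2)]])
qed

lemma bmeas_cos_sin:
  assumes "bmeas V (f :: _ \<Rightarrow> real)" shows "bmeas V (\<lambda>w. cos (f w))" "bmeas V (\<lambda>w. sin (f w))"
  by (rule bmeas_compose[OF bmeas_measurable[OF assms], of _ 1]; simp)+

text \<open>Real and imaginary parts of \<open>characteristic_function\<close>, averaged over the
  class. The Gaussian limit is real, hence the sine integrals tend to 0.\<close>

lemma fourier_limits:
  shows "(\<lambda>n. \<integral>x. cos (\<Sum>\<pi>\<in>perms r. s \<pi> * x \<pi>) \<partial>counts_law r n (t n))
      \<longlonglongrightarrow> exp (- ((\<Sum>\<pi>\<in>perms r. \<Sum>\<rho>\<in>perms r. s \<pi> * s \<rho> * cov_matrix r p \<pi> \<rho>) / 2))" (is "?cos \<longlonglongrightarrow> ?L")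
    and "(\<lambda>n. \<integral>x. sin (\<Sum>\<pi>\<in>perms r. s \<pi> * x \<pi>) \<partial>counts_law r n (t n)) \<longlonglongrightarrow> 0" (is "?sin \<longlonglongrightarrow> 0")
proof -
  obtain \<epsilon> where \<epsilon>: "\<epsilon> \<longlonglongrightarrow> 0" "\<And>n \<tau>. n \<ge> 2 \<Longrightarrow> \<tau> \<in> T n \<Longrightarrow>
    cmod ((\<integral>w. iexp (\<Sum>\<pi>\<in>perms r. s \<pi> * pstat n r \<tau> \<pi> w) \<partial>UP n) - complex_of_real (exp (- (var_seq (lin_kernel r s) n / 2)))) \<le> \<epsilon> n"
  proof (rule characteristic_function[of s], goal_cases)
    case (1 \<epsilon>)
    show ?case by (rule 1(1)) (fact 1)+
  qed
  let ?e = "\<lambda>n. exp (- (var_seq (lin_kernel r s) n / 2))"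
  have "?e \<longlonglongrightarrow> exp (- (pair_form p (lin_kernel r s) (lin_kernel r s) / 2))"
    by (intro tendsto_intros var_seq_tendsto sqf_lin_kernel) simp
  then have e: "?e \<longlonglongrightarrow> ?L" unfolding cov_form_eq[OF r] .
  have both: "\<bar>?cos n - ?e n\<bar> \<le> \<epsilon> n \<and> \<bar>?sin n - 0\<bar> \<le> \<epsilon> n" if n: "n \<ge> 2" for n
  proof -
    have ne: "T n \<noteq> {}" using n by (intro t_cyclic_nonempty type) simp
    interpret U: real_product "\<lambda>_ :: nat. unif01" "{1..n}" by (rule real_product_unif)
    have bS: "bmeas {1..n} (\<lambda>w. \<Sum>\<pi>\<in>perms r. s \<pi> * pstat n r \<tau> \<pi> w)" if "\<tau> \<in> T n" for \<tau>
      by (intro bmeas_sum bmeas_mult bmeas_const bmeas_pstat n that)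
    have restr: "(\<Sum>\<pi>\<in>perms r. s \<pi> * (\<lambda>\<pi>\<in>perms r. pstat n r \<tau> \<pi> w) \<pi>) = (\<Sum>\<pi>\<in>perms r. s \<pi> * pstat n r \<tau> \<pi> w)" for \<tau> w
      by (intro sum.cong refl) simp
    have ie: "iexp y = Complex (cos y) (sin y)" for y by (simp add: cis_conv_exp[symmetric] complex_eq_iff)
    have parts: "\<bar>(\<integral>w. cos (\<Sum>\<pi>\<in>perms r. s \<pi> * pstat n r \<tau> \<pi> w) \<partial>UP n) - ?e n\<bar> \<le> \<epsilon> n"
      "\<bar>(\<integral>w. sin (\<Sum>\<pi>\<in>perms r. s \<pi> * pstat n r \<tau> \<pi> w) \<partial>UP n) - 0\<bar> \<le> \<epsilon> n" if tau: "\<tau> \<in> T n" for \<tau>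
    proof -
      let ?z = "(\<integral>w. iexp (\<Sum>\<pi>\<in>perms r. s \<pi> * pstat n r \<tau> \<pi> w) \<partial>UP n)"
      have i: "integrable (UP n) (\<lambda>w. iexp (\<Sum>\<pi>\<in>perms r. s \<pi> * pstat n r \<tau> \<pi> w))"
        by (intro U.bmeas_integrable bmeas_iexp bS tau)
      have re: "Re ?z = (\<integral>w. cos (\<Sum>\<pi>\<in>perms r. s \<pi> * pstat n r \<tau> \<pi> w) \<partial>UP n)"
        using integral_Re[OF i] by (simp only: ie complex.sel)
      have im: "Im ?z = (\<integral>w. sin (\<Sum>\<pi>\<in>perms r. s \<pi> * pstat n r \<tau> \<pi> w) \<partial>UP n)"
        using integral_Im[OF i] by (simp only: ie complex.sel)
      show "\<bar>(\<integral>w. cos (\<Sum>\<pi>\<in>perms r. s \<pi> * pstat n r \<tau> \<pi> w) \<partial>UP n) - ?e n\<bar> \<le> \<epsilon> n"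
        using order_trans[OF abs_Re_le_cmod \<epsilon>(2)[OF n tau]] by (simp only: minus_complex.sel Re_complex_of_real re)
      show "\<bar>(\<integral>w. sin (\<Sum>\<pi>\<in>perms r. s \<pi> * pstat n r \<tau> \<pi> w) \<partial>UP n) - 0\<bar> \<le> \<epsilon> n"
        using order_trans[OF abs_Im_le_cmod \<epsilon>(2)[OF n tau]] by (simp only: minus_complex.sel Im_complex_of_real im)
    qed
    have hm: "(\<lambda>x. cos (\<Sum>\<pi>\<in>perms r. s \<pi> * x \<pi>)) \<in> borel_measurable (PiM (perms r) (\<lambda>_. borel))"
      "(\<lambda>x. sin (\<Sum>\<pi>\<in>perms r. s \<pi> * x \<pi>)) \<in> borel_measurable (PiM (perms r) (\<lambda>_. borel))"
      by (intro measurable_compose[OF lin_measurable]; simp)+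
    have "\<bar>?cos n - ?e n\<bar> \<le> \<epsilon> n"
      by (rule counts_law_deviation[OF r ne hm(1)]; simp only: restr; intro bmeas_cos_sin bS parts; assumption)
    moreover have "\<bar>?sin n - 0\<bar> \<le> \<epsilon> n"
      by (rule counts_law_deviation[OF r ne hm(2)]; simp only: restr; intro bmeas_cos_sin bS parts; assumption)
    ultimately show ?thesis by blast
  qed
  have "(\<lambda>n. ?cos n - ?e n) \<longlonglongrightarrow> 0"
    by (rule Lim_null_comparison[OF _ \<epsilon>(1)]) (use both in \<open>auto simp: eventually_sequentially\<close>)
  from tendsto_add[OF this e] show "?cos \<longlonglongrightarrow> ?L" by simp
  show "?sin \<longlonglongrightarrow> 0"
    by (rule Lim_null_comparison[OF _ \<epsilon>(1)]) (use both in \<open>auto simp: eventually_sequentially\<close>)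
qed

text \<open>Convergence of \<open>var_seq\<close> bounds the projection in mean, and the
  approximation error tends to 0. With Markov's inequality this gives tightness.\<close>

lemma first_moment_bound:
  assumes pi: "\<pi> \<in> perms r"
  obtains C where "C \<ge> 0" "\<forall>\<^sub>F n in sequentially. integrable (counts_law r n (t n)) (\<lambda>x. \<bar>x \<pi>\<bar>) \<and> (\<integral>x. \<bar>x \<pi>\<bar> \<partial>counts_law r n (t n)) \<le> C"
proof -
  obtain \<delta> where \<delta>: "\<delta> \<longlonglongrightarrow> 0" "\<And>n \<tau>. n \<ge> 2 \<Longrightarrow> \<tau> \<in> T n \<Longrightarrow> (\<integral>w. \<bar>pstat n r \<tau> \<pi> w - pproj n r \<tau> \<pi> w\<bar> \<partial>UP n) \<le> \<delta> n"
    "\<And>n \<tau>. n \<ge> 2 \<Longrightarrow> \<tau> \<in> T n \<Longrightarrow> bmeas {1..n} (pstat n r \<tau> \<pi>) \<and> bmeas {1..n} (pproj n r \<tau> \<pi>)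
      \<and> (\<integral>w. \<bar>pproj n r \<tau> \<pi> w\<bar> \<partial>UP n) \<le> sqrt \<bar>var_seq (gker r \<pi>) n\<bar>"
  proof (rule approximation[OF pi], goal_cases)
    case (1 \<delta>)
    show ?case by (rule 1(1)) (fact 1)+
  qed
  let ?b = "\<lambda>n. \<delta> n + sqrt \<bar>var_seq (gker r \<pi>) n\<bar>"
  have "convergent ?b"
    using tendsto_add[OF \<delta>(1) tendsto_real_sqrt[OF tendsto_rabs[OF var_seq_tendsto[OF sqf_gker]]]] by (rule convergentI)
  then obtain C where C: "C > 0" "\<And>n. norm (?b n) \<le> C" using convergent_imp_Bseq[OF \<open>convergent ?b\<close>] unfolding Bseq_def by blast
  have m: "(\<lambda>x. \<bar>x \<pi>\<bar>) \<in> borel_measurable (PiM (perms r) (\<lambda>_. borel :: real measure))"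
    using measurable_component_singleton[OF pi, of "\<lambda>_. borel :: real measure"] by measurable
  have "integrable (counts_law r n (t n)) (\<lambda>x. \<bar>x \<pi>\<bar>) \<and> (\<integral>x. \<bar>x \<pi>\<bar> \<partial>counts_law r n (t n)) \<le> C" if n: "n \<ge> 2" for n
  proof
    have ne: "T n \<noteq> {}" using n by (intro t_cyclic_nonempty type) simp
    show "integrable (counts_law r n (t n)) (\<lambda>x. \<bar>x \<pi>\<bar>)" by (rule integrable_counts_law[OF ne m])
    interpret U: real_product "\<lambda>_ :: nat. unif01" "{1..n}" by (rule real_product_unif)
    have "\<bar>(\<integral>x. \<bar>x \<pi>\<bar> \<partial>counts_law r n (t n)) - 0\<bar> \<le> C"
    proof (rule counts_law_deviation[OF r ne m])
      fix \<tau> assume tau: "\<tau> \<in> T n"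
      have restr: "(\<lambda>\<pi>\<in>perms r. pstat n r \<tau> \<pi> w) \<pi> = pstat n r \<tau> \<pi> w" for w using pi by simp
      have bs: "bmeas {1..n} (pstat n r \<tau> \<pi>)" and bp: "bmeas {1..n} (pproj n r \<tau> \<pi>)" using \<delta>(3)[OF n tau] by auto
      show "bmeas {1..n} (\<lambda>w. \<bar>(\<lambda>\<pi>\<in>perms r. pstat n r \<tau> \<pi> w) \<pi>\<bar>)" unfolding restr by (intro bmeas_abs bs)
      have "(\<integral>w. \<bar>pstat n r \<tau> \<pi> w\<bar> \<partial>UP n) \<le> (\<integral>w. \<bar>pstat n r \<tau> \<pi> w - pproj n r \<tau> \<pi> w\<bar> + \<bar>pproj n r \<tau> \<pi> w\<bar> \<partial>UP n)"
        by (intro integral_mono U.bmeas_integrable bmeas_add bmeas_abs bmeas_diff bs bp) linarith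
      also have "\<dots> = (\<integral>w. \<bar>pstat n r \<tau> \<pi> w - pproj n r \<tau> \<pi> w\<bar> \<partial>UP n) + (\<integral>w. \<bar>pproj n r \<tau> \<pi> w\<bar> \<partial>UP n)"
        by (intro Bochner_Integration.integral_add U.bmeas_integrable bmeas_abs bmeas_diff bs bp)
      also have "\<dots> \<le> ?b n" using \<delta>(2)[OF n tau] \<delta>(3)[OF n tau] by linarith
      also have "\<dots> \<le> C" using C(2)[of n] by simp
      finally have "(\<integral>w. \<bar>pstat n r \<tau> \<pi> w\<bar> \<partial>UP n) \<le> C" .
      moreover have "0 \<le> (\<integral>w. \<bar>pstat n r \<tau> \<pi> w\<bar> \<partial>UP n)" by (rule Bochner_Integration.integral_nonneg) simp
      ultimately show "\<bar>(\<integral>w. \<bar>(\<lambda>\<pi>\<in>perms r. pstat n r \<tau> \<pi> w) \<pi>\<bar> \<partial>UP n) - 0\<bar> \<le> C"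
        unfolding restr by linarith
    qed
    then show "(\<integral>x. \<bar>x \<pi>\<bar> \<partial>counts_law r n (t n)) \<le> C" by linarith
  qed
  then show thesis
    using C(1) eventually_mono[OF eventually_ge_at_top[of "2::nat"]] by (intro that[of C]) simp_all
qed

theorem pattern_counts_clt:
  "\<exists>N. is_multivariate_normal (perms r) (\<lambda>_. 0) (cov_matrix r p) N \<and>
       weak_conv_vec (perms r) (\<lambda>n. counts_law r n (t n)) N"
proof -
  obtain N where N: "is_multivariate_normal (perms r) (\<lambda>_. 0) (cov_matrix r p) N"
    "\<And>s. (\<integral>x. cos (\<Sum>\<pi>\<in>perms r. s \<pi> * x \<pi>) \<partial>N) = exp (- ((\<Sum>\<pi>\<in>perms r. \<Sum>\<rho>\<in>perms r. s \<pi> * s \<rho> * cov_matrix r p \<pi> \<rho>) / 2))"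
    "\<And>s. (\<integral>x. sin (\<Sum>\<pi>\<in>perms r. s \<pi> * x \<pi>) \<partial>N) = 0"
    "\<And>\<pi>. \<pi> \<in> perms r \<Longrightarrow> integrable N (\<lambda>x. (x \<pi>)\<^sup>2)"
    using multivariate_normal_exists[OF finite_perms psd_cov_matrix[OF r p]] by blast
  have psN: "prob_space N" and setsN: "sets N = sets (PiM (perms r) (\<lambda>_. borel))"
    using N(1) by (auto simp: is_multivariate_normal_def)
  have "weak_conv_vec (perms r) (\<lambda>n. counts_law r n (t n)) N"
  proof (rule weak_conv_vec_trig[OF finite_perms prob_space_counts_law sets_counts_law psN setsN])
    fix s
    show "(\<lambda>n. \<integral>x. cos (\<Sum>\<pi>\<in>perms r. s \<pi> * x \<pi>) \<partial>counts_law r n (t n)) \<longlonglongrightarrow> (\<integral>x. cos (\<Sum>\<pi>\<in>perms r. s \<pi> * x \<pi>) \<partial>N)"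
      unfolding N(2) by (rule fourier_limits)
    show "(\<lambda>n. \<integral>x. sin (\<Sum>\<pi>\<in>perms r. s \<pi> * x \<pi>) \<partial>counts_law r n (t n)) \<longlonglongrightarrow> (\<integral>x. sin (\<Sum>\<pi>\<in>perms r. s \<pi> * x \<pi>) \<partial>N)"
      unfolding N(3) by (rule fourier_limits)
  next
    fix e :: real assume e: "e > 0"
    have "\<forall>\<pi>\<in>perms r. \<exists>C. \<forall>\<^sub>F n in sequentially. integrable (counts_law r n (t n)) (\<lambda>x. \<bar>x \<pi>\<bar>) \<and> (\<integral>x. \<bar>x \<pi>\<bar> \<partial>counts_law r n (t n)) \<le> C"
    proof
      fix \<pi> assume "\<pi> \<in> perms r"
      then show "\<exists>C. \<forall>\<^sub>F n in sequentially. integrable (counts_law r n (t n)) (\<lambda>x. \<bar>x \<pi>\<bar>) \<and> (\<integral>x. \<bar>x \<pi>\<bar> \<partial>counts_law r n (t n)) \<le> C"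
        by (rule first_moment_bound) (rule exI)
    qed
    from bchoice[OF this] obtain C where C: "\<And>\<pi>. \<pi> \<in> perms r \<Longrightarrow> \<forall>\<^sub>F n in sequentially. integrable (counts_law r n (t n)) (\<lambda>x. \<bar>x \<pi>\<bar>) \<and> (\<integral>x. \<bar>x \<pi>\<bar> \<partial>counts_law r n (t n)) \<le> C \<pi>"
      unfolding bchoice_iff by blast
    \<comment> \<open>Markov's inequality bounds the tail by the sum of the first moments over
      \<open>L\<close>, which this choice makes at most \<open>e\<close>; the summand 1 keeps
      \<open>L\<close> positive.\<close>
    define L where "L = (\<bar>\<Sum>\<pi>\<in>perms r. C \<pi>\<bar> + 1) / e"
    have L: "L > 0" using e by (simp add: L_def add_nonneg_pos)
    have "\<forall>\<^sub>F n in sequentially. \<forall>\<pi>\<in>perms r. integrable (counts_law r n (t n)) (\<lambda>x. \<bar>x \<pi>\<bar>) \<and> (\<integral>x. \<bar>x \<pi>\<bar> \<partial>counts_law r n (t n)) \<le> C \<pi>"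
      by (rule eventually_ball_finite[OF finite_perms]) (use C in blast)
    then have "\<forall>\<^sub>F n in sequentially. measure (counts_law r n (t n)) {x \<in> space (counts_law r n (t n)). \<exists>\<pi>\<in>perms r. L < \<bar>x \<pi>\<bar>} \<le> e"
    proof eventually_elim
      case (elim n)
      have "measure (counts_law r n (t n)) {x \<in> space (counts_law r n (t n)). \<exists>\<pi>\<in>perms r. L < \<bar>x \<pi>\<bar>}
        \<le> (\<Sum>\<pi>\<in>perms r. \<integral>x. \<bar>x \<pi>\<bar> \<partial>counts_law r n (t n)) / L"
        using elim by (intro tail_bound[OF prob_space_counts_law sets_counts_law finite_perms L]) blast
      also have "\<dots> \<le> (\<Sum>\<pi>\<in>perms r. C \<pi>) / L"
        using elim L by (intro divide_right_mono sum_mono) auto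
      also have "\<dots> \<le> e" using e L unfolding pos_divide_le_eq[OF L] by (simp add: L_def)
      finally show ?case .
    qed
    then show "\<exists>L>0. \<forall>\<^sub>F n in sequentially. measure (counts_law r n (t n)) {x \<in> space (counts_law r n (t n)). \<exists>\<pi>\<in>perms r. L < \<bar>x \<pi>\<bar>} \<le> e"
      using L by blast
  next
    fix e :: real assume e: "e > 0"
    interpret N: prob_space N by (rule psN)
    have int: "integrable N (\<lambda>x. \<bar>x \<pi>\<bar>)" if "\<pi> \<in> perms r" for \<pi>
    proof (rule Bochner_Integration.integrable_bound)
      show "integrable N (\<lambda>x. 1 + (x \<pi>)\<^sup>2)" using N(4)[OF that] by simp
      have "(\<lambda>x. \<bar>x \<pi>\<bar>) \<in> borel_measurable (PiM (perms r) (\<lambda>_. borel :: real measure))"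
        using measurable_component_singleton[OF that, of "\<lambda>_. borel :: real measure"] by measurable
      then show "(\<lambda>x. \<bar>x \<pi>\<bar>) \<in> borel_measurable N" using measurable_cong_sets[OF setsN refl] by blast
      have "\<bar>y\<bar> \<le> 1 + y\<^sup>2" for y :: real
      proof (cases "\<bar>y\<bar> \<le> 1")
        case False
        then have "\<bar>y\<bar> * 1 \<le> \<bar>y\<bar> * \<bar>y\<bar>" by (intro mult_left_mono) auto
        then show ?thesis by (simp add: power2_eq_square)
      qed (simp add: add_increasing2)
      then show "AE x in N. norm \<bar>x \<pi>\<bar> \<le> norm (1 + (x \<pi>)\<^sup>2)" by (simp add: abs_of_nonneg add_nonneg_nonneg)
    qed
    let ?S = "\<Sum>\<pi>\<in>perms r. \<integral>x. \<bar>x \<pi>\<bar> \<partial>N"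
    define L where "L = (\<bar>?S\<bar> + 1) / e"
    have L: "L > 0" using e by (simp add: L_def add_nonneg_pos)
    have "measure N {x \<in> space N. \<exists>\<pi>\<in>perms r. L < \<bar>x \<pi>\<bar>} \<le> ?S / L"
      by (rule tail_bound[OF psN setsN finite_perms L int])
    also have "\<dots> \<le> e" using e L unfolding pos_divide_le_eq[OF L] by (simp add: L_def)
    finally show "\<exists>L>0. measure N {x \<in> space N. \<exists>\<pi>\<in>perms r. L < \<bar>x \<pi>\<bar>} \<le> e" using L by blast
  qed
  with N(1) show ?thesis by blast
qed

end

theorem theorem2p18:
  fixes r :: nat
  assumes "r \<ge> 1"
  shows
    "(\<forall>(p2::real) (t :: nat \<Rightarrow> nat \<Rightarrow> nat).
        p2 \<in> {0..1} \<longrightarrow>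
        (\<forall>n\<ge>1. is_cycle_type n (t n)) \<longrightarrow>
        (\<lambda>n. real (t n 1)) \<in> o(\<lambda>n. sqrt (real n)) \<longrightarrow>
        (\<lambda>n. 2 * real (t n 2) - real n * p2) \<in> o(\<lambda>n. real n) \<longrightarrow>
        (\<exists>N. is_multivariate_normal (perms r) (\<lambda>_. 0) (cov_matrix r p2) N \<and>
             weak_conv_vec (perms r) (\<lambda>n. counts_law r n (t n)) N)) \<and>
     (\<forall>p2::real. 0 \<le> p2 \<and> p2 < 1 \<longrightarrow> matrix_rank (perms r) (cov_matrix r p2) = (r - 1)\<^sup>2) \<and>
     matrix_rank (perms r) (cov_matrix r 1) = r * (r - 1) div 2 \<and>
     (r \<ge> 2 \<longrightarrow>
        (\<forall>p2::real. \<forall>\<pi>\<in>perms r. p2 \<in> {0..1} \<longrightarrow> cov_matrix r p2 \<pi> \<pi> > 0))"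
proof (intro conjI allI impI ballI)
  fix p2 :: real and t :: "nat \<Rightarrow> nat \<Rightarrow> nat"
  assume p2: "p2 \<in> {0..1}" and type: "\<forall>n\<ge>1. is_cycle_type n (t n)"
    and t1: "(\<lambda>n. real (t n 1)) \<in> o(\<lambda>n. sqrt (real n))"
    and t2: "(\<lambda>n. 2 * real (t n 2) - real n * p2) \<in> o(\<lambda>n. real n)"
  have "cycle_type_sequence r p2 t"
    by (rule cycle_type_sequence.intro) (use assms p2 type t1 t2 in auto)
  then show "\<exists>N. is_multivariate_normal (perms r) (\<lambda>_. 0) (cov_matrix r p2) N \<and>
      weak_conv_vec (perms r) (\<lambda>n. counts_law r n (t n)) N"
    by (rule cycle_type_sequence.pattern_counts_clt)
next
  fix p2 :: real assume p: "0 \<le> p2 \<and> p2 < 1"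
  have "matrix_rank (perms r) (cov_matrix r p2) = card ({1..<r} \<times> {1..<r})"
    using rank_cov_matrix[OF assms, of p2 "{1..<r} \<times> {1..<r}"] p by auto
  then show "matrix_rank (perms r) (cov_matrix r p2) = (r - 1)\<^sup>2"
    by (simp add: card_cartesian_product power2_eq_square)
next
  show "matrix_rank (perms r) (cov_matrix r 1) = r * (r - 1) div 2"
    using rank_cov_matrix[OF assms, of 1] card_triangle[of r] by simp
next
  fix p2 :: real and \<pi> assume "r \<ge> 2" "\<pi> \<in> perms r" "p2 \<in> {0..1}"
  then show "cov_matrix r p2 \<pi> \<pi> > 0" using cov_matrix_pos[of r p2 \<pi>] by simp
qed

end
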